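(* Let $d_1,d_2\neq 1$ be two different square-free positive integers, let $K=\mathbb{Q}(\sqrt{d_1},\sqrt{d_2})$ be the corresponding real biquadratic field, let $d_3$ be the square-free part of $d_1d_2$, and let $k_i=\mathbb{Q}(\sqrt{d_i})$ ($i=1,2,3$) be the three quadratic subfields of $K$. Let $t\in\{0,1,2,3\}$ be the number of indices $i$ for which the fundamental unit of $k_i$ has negative norm (i.e. norm $-1$ over $\mathbb{Q}$). Let $\operatorname{Po}(K)$ be the P\'olya group of $K$, let $[U_K:U_{k_1}U_{k_2}U_{k_3}]$ be the Hasse unit index, let $d_K$ be the discriminant of $K$ and, for a prime number $p$, let $e_p(K/\mathbb{Q})$ be the ramification index of $p$ in $K/\mathbb{Q}$. (i) If $2$ ramifies totally in $K/\mathbb{Q}$ and all the $k_i$ contain integers with the same norm, either $2$ or $-2$ (that is, either for every $i\in\{1,2,3\}$ there is $x_i\in\mathcal{O}_{k_i}$ with $N_{k_i/\mathbb{Q}}(x_i)=2$, or for every $i\in\{1,2,3\}$ there is $x_i\in\mathcal{O}_{k_i}$ with $N_{k_i/\mathbb{Q}}(x_i)=-2$), then $$\#\operatorname{Po}(K)=\begin{cases}\dfrac{[U_K:U_{k_1}U_{k_2}U_{k_3}]\cdot\prod_{p\mid d_K}e_p(K/\mathbb{Q})}{2^{6-t}} & \text{if } t=0,1,\\[2ex] \dfrac{[U_K:U_{k_1}U_{k_2}U_{k_3}]\cdot\prod_{p\mid d_K}e_p(K/\mathbb{Q})}{2^{4}} & \text{if } t=2,3.\end{cases}$$ (ii) Otherwise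 (if the hypothesis of (i) does not hold), $$\#\operatorname{Po}(K)=\begin{cases}\dfrac{[U_K:U_{k_1}U_{k_2}U_{k_3}]\cdot\prod_{p\mid d_K}e_p(K/\mathbb{Q})}{2^{5-t}} & \text{if } t=0,1,\\[2ex] \dfrac{[U_K:U_{k_1}U_{k_2}U_{k_3}]\cdot\prod_{p\mid d_K}e_p(K/\mathbb{Q})}{2^{3}} & \text{if } t=2,3.\end{cases}$$ In particular, in each of (i) and (ii), the order of the P\'olya group is given by the same formula for $t=2$ and for $t=3$.
   Context: For a number field $F$, $\mathcal{O}_F$ is its ring of integers, $U_F$ its group of units (units of $\mathcal{O}_F$), $d_F$ its discriminant, and $\operatorname{Cl}(F)$ its ideal class group. $U_{k_1}U_{k_2}U_{k_3}$ denotes the subgroup of $U_K$ generated by $U_{k_1},U_{k_2},U_{k_3}$, and its index in $U_K$ is called the Hasse unit index. For each positive integer $q$, the Ostrowski ideal $\Pi_q(K)$ is the product of all maximal ideals $\mathfrak{m}$ of $\mathcal{O}_K$ with norm $N_{K/\mathbb{Q}}(\mathfrak{m})=q$, with the convention $\Pi_q(K)=\mathcal{O}_K$ if there are no such ideals. The P\'olya group (or P\'olya-Ostrowski group) $\operatorname{Po}(K)$ is the subgroup of $\operatorname{Cl}(K)$ generated by the classes of all the ideals $\Pi_q(K)$. (For $K/\mathbb{Q}$ Galois this coincides with the subgroup of classes of strongly ambiguous ideals, i.e. ideals invariant under $\operatorname{Gal}(K/\mathbb{Q})$.) Products $\prod_{p\mid d_K}$ run over prime numbers $p$ dividing $d_K$.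 *)

theory Defs
  imports
    "HOL-Algebra.Algebra"
    "HOL-Algebra.Algebraic_Closure_Type"
    "HOL-Computational_Algebra.Computational_Algebra"
    "Jordan_Normal_Form.Determinant"
begin

text \<open>
  Number fields are represented by their carriers, as subfields of the complex numbers that
  are finite over the rationals. Rings and groups are those of HOL-Algebra; several of the
  general definitions below are meaningful only for such carriers.
\<close>

abbreviation complex_field :: "complex ring" where
  "complex_field \<equiv> ring_of_type_algebra"

abbreviation field_of :: "complex set \<Rightarrow> complex ring" where
  "field_of F \<equiv> complex_field\<lparr>carrier := F\<rparr>"

definition rat_adjoin :: "complex set \<Rightarrow> complex set" where
  "rat_adjoin S = generate_field complex_field S"

definition field_degree :: "complex set \<Rightarrow> nat" where
  "field_degree F = ring.dim complex_field \<rat> F"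

definition ring_of_integers :: "complex set \<Rightarrow> complex ring" where
  "ring_of_integers F = complex_field\<lparr>carrier := {x \<in> F. algebraic_int x}\<rparr>"

abbreviation unit_group :: "complex set \<Rightarrow> complex monoid" where
  "unit_group F \<equiv> units_of (ring_of_integers F)"

definition group_index :: "('a, 'b) monoid_scheme \<Rightarrow> 'a set \<Rightarrow> nat" where
  "group_index G H = card (rcosets\<^bsub>G\<^esub> H)"


text \<open>Extensionality makes each embedding a single function, so that sums and products over
  the embeddings of a number field are finite.\<close>

definition field_embeddings :: "complex set \<Rightarrow> (complex \<Rightarrow> complex) set" where
  "field_embeddings F = Ring.ring_hom (field_of F) complex_field \<inter> extensional F"

definition field_norm :: "complex set \<Rightarrow> complex \<Rightarrow> complex" where
  "field_norm F x = (\<Prod>\<sigma>\<in>field_embeddings F. \<sigma> x)"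

definition field_trace :: "complex set \<Rightarrow> complex \<Rightarrow> complex" where
  "field_trace F x = (\<Sum>\<sigma>\<in>field_embeddings F. \<sigma> x)"

definition integral_basis :: "complex set \<Rightarrow> complex list \<Rightarrow> bool" where
  "integral_basis F b \<longleftrightarrow>
     set b \<subseteq> carrier (ring_of_integers F) \<and>
     (\<forall>x \<in> carrier (ring_of_integers F).
        \<exists>!c :: int list. length c = length b \<and> x = (\<Sum>i<length b. of_int (c ! i) * b ! i))"

text \<open>The discriminant does not depend on the integral basis, which justifies the definite
  description.\<close>

definition field_discriminant :: "complex set \<Rightarrow> int" where
  "field_discriminant F = (THE d. \<exists>b. integral_basis F b \<and>
     of_int d = det (mat (length b) (length b) (\<lambda>(i, j). field_trace F (b ! i * b ! j))))"

text \<open>For a real quadratic field \<open>F\<close>: the generator greater than 1 of the unit group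
  modulo \<open>{1, -1}\<close>.\<close>

definition fundamental_unit :: "complex set \<Rightarrow> complex" where
  "fundamental_unit F = (THE u. u \<in> Units (ring_of_integers F) \<and>
     (\<exists>r>1. u = complex_of_real r) \<and>
     (\<forall>v \<in> Units (ring_of_integers F). \<exists>n :: int. v = u powi n \<or> v = - (u powi n)))"


definition primes_above :: "complex set \<Rightarrow> nat \<Rightarrow> complex set set" where
  "primes_above F p = {\<mm>. maximalideal \<mm> (ring_of_integers F) \<and> of_nat p \<in> \<mm>}"

text \<open>The exponent of the maximal ideal \<open>\<mm>\<close> in the factorisation of the ideal generated
  by \<open>p\<close>; divisibility is that of the multiplicative monoid of ideals.\<close>

definition ramification_index_at :: "complex set \<Rightarrow> nat \<Rightarrow> complex set \<Rightarrow> nat" where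
  "ramification_index_at F p \<mm> =
     (GREATEST e. (\<mm> [^]\<^bsub>ideals_set (ring_of_integers F)\<^esub> e)
        divides\<^bsub>ideals_set (ring_of_integers F)\<^esub>
        PIdl\<^bsub>ring_of_integers F\<^esub> (of_nat p))"

text \<open>For \<open>F\<close> Galois over the rationals all maximal ideals above \<open>p\<close> have the same
  ramification index.\<close>

definition ramification_index :: "complex set \<Rightarrow> nat \<Rightarrow> nat" where
  "ramification_index F p = (THE e. \<forall>\<mm> \<in> primes_above F p. ramification_index_at F p \<mm> = e)"

definition totally_ramified :: "complex set \<Rightarrow> nat \<Rightarrow> bool" where
  "totally_ramified F p \<longleftrightarrow>
     (\<exists>\<mm> \<in> primes_above F p. ramification_index_at F p \<mm> = field_degree F)"


text \<open>Since \<open>ideal_prod\<close> only forms finite sums of products, taken in the complex numbers it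
  also multiplies fractional ideals.\<close>

definition fractional_ideals :: "complex set \<Rightarrow> complex set monoid" where
  "fractional_ideals F =
     \<lparr>carrier = {I. \<exists>J a. ideal J (ring_of_integers F) \<and> J \<noteq> {0} \<and>
                     a \<in> carrier (ring_of_integers F) \<and> a \<noteq> 0 \<and> I = (\<lambda>x. x / a) ` J},
      monoid.mult = ideal_prod complex_field,
      monoid.one = carrier (ring_of_integers F)\<rparr>"

definition principal_fractional_ideals :: "complex set \<Rightarrow> complex set set" where
  "principal_fractional_ideals F =
     {(\<lambda>x. a * x) ` carrier (ring_of_integers F) | a. a \<in> F \<and> a \<noteq> 0}"

definition class_group :: "complex set \<Rightarrow> complex set set monoid" where
  "class_group F = fractional_ideals F Mod principal_fractional_ideals F"

definition ideal_class :: "complex set \<Rightarrow> complex set \<Rightarrow> complex set set" where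
  "ideal_class F I = principal_fractional_ideals F #>\<^bsub>fractional_ideals F\<^esub> I"

definition ideal_norm :: "complex set \<Rightarrow> complex set \<Rightarrow> nat" where
  "ideal_norm F I = card (carrier (ring_of_integers F Quot I))"

definition ostrowski_ideal :: "complex set \<Rightarrow> nat \<Rightarrow> complex set" where
  "ostrowski_ideal F q = finprod (ideals_set (ring_of_integers F)) (\<lambda>\<mm>. \<mm>)
     {\<mm>. maximalideal \<mm> (ring_of_integers F) \<and> ideal_norm F \<mm> = q}"

definition Polya_group :: "complex set \<Rightarrow> complex set set set" where
  "Polya_group F = generate (class_group F) {ideal_class F (ostrowski_ideal F q) | q. 0 < q}"

end

theory Submission
  imports Defs "Jordan_Normal_Form.Char_Poly"
begin

text \<open>
  Let \<open>U\<close> be the unit group of \<open>K\<close> and \<open>W\<close> the product of the unit groups of the quadratic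
  subfields. The classes generating the Polya group are those of the Galois invariant fractional
  ideals. Modulo the ideals generated by rational numbers, these form a group of order
  \<open>\<Prod> e\<^sub>p\<close>, so \<open>#Po(K) [A0 : \<rat>\<^sup>* U] = \<Prod> e\<^sub>p\<close>, where \<open>A0\<close> is the group of generators of invariant
  principal ideals. Let \<open>A2 \<subseteq> A0\<close> consist of the \<open>a\<close> with \<open>a\<^sup>2 \<in> \<rat>\<^sup>* U\<close>.

  Sending \<open>a \<in> A2\<close> to the unit \<open>u\<close> with \<open>a\<^sup>2 u\<close> rational and positive identifies \<open>A2\<close>, modulo the classes
  of \<open>1\<close> and the \<open>\<surd>d\<^sub>i\<close>, with \<open>V / U\<^sup>2\<close> for a group \<open>V\<close> of units all of whose conjugates are positive. This
  gives \<open>[A2 : \<rat>\<^sup>* U] [U : W] = 4 [V : W\<^sup>2]\<close>. Moreover \<open>V \<subseteq> W\<close>, and Hilbert's theorem 90 shows that a product of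
  powers of the fundamental units belongs to \<open>V\<close> as soon as its conjugates are positive, which is a
  condition on the norms of the fundamental units; hence \<open>[V : W\<^sup>2]\<close> depends on \<open>t\<close> only.

  Finally \<open>[A0 : A2] \<le> 2\<close>, and \<open>a \<in> A0\<close> lies outside \<open>A2\<close> only if 2 is totally ramified and the valuation
  of \<open>a\<close> above 2 is odd. Then, up to rational factors, the norms of \<open>a\<close> to the three quadratic subfields
  generate the square of the prime above 2 and have the same norm, 2 or -2. Conversely, elements of
  the quadratic subfields with that common norm yield such an \<open>a\<close> by Hilbert's theorem 90.
\<close>

text \<open>The ideal theory rests on one fact: the product of all conjugates of a nonzero ideal is
  generated by a rational integer. It comes from polynomials whose coefficients generate the ideal,
  together with Dedekind's Prague theorem. It makes every nonzero ideal divide an integer, and from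
  this follow cancellation, unique factorization, valuations and the transitive action on the primes
  above \<open>p\<close>. The ramification indices enter because an invariant ideal has a single
  valuation at each rational prime, and a rational factor changes it by a multiple of the
  ramification index. All indices are cardinalities of sets of cosets, with 0 for an infinite one.
  The identities between them are multiplicative with a nonzero side, so finiteness of the Polya
  group and of the unit index comes out of the counting itself. The special role of 2 in the
  comparison of \<open>A0\<close> with \<open>A2\<close> comes from a bound: an odd prime is
  unramified in one of the quadratic subfields, so its index is at most 2 and squaring removes every
  obstruction there, whereas the index of 2 can be 4.\<close>

section \<open>Algebraic integers form an integrally closed ring\<close>

inductive_set zspan :: "complex set \<Rightarrow> complex set" for B where
  zspan_0: "0 \<in> zspan B"
| zspan_base: "b \<in> B \<Longrightarrow> b \<in> zspan B"
| zspan_add: "x \<in> zspan B \<Longrightarrow> y \<in> zspan B \<Longrightarrow> x + y \<in> zspan B"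
| zspan_minus: "x \<in> zspan B \<Longrightarrow> - x \<in> zspan B"

lemma zspan_sum: "(\<And>i. i \<in> I \<Longrightarrow> f i \<in> zspan B) \<Longrightarrow> sum f I \<in> zspan B"
  by (induction I rule: infinite_finite_induct) (auto intro: zspan_0 zspan_add)

lemma zspan_coeffs:
  assumes "finite B" "x \<in> zspan B"
  obtains c :: "complex \<Rightarrow> int" where "x = (\<Sum>b\<in>B. of_int (c b) * b)"
proof -
  from assms(2) have "\<exists>c :: complex \<Rightarrow> int. x = (\<Sum>b\<in>B. of_int (c b) * b)"
  proof induction
    case zspan_0
    show ?case by (rule exI[of _ "\<lambda>_. 0"]) simp
  next
    case (zspan_base b)
    show ?case
      by (rule exI[of _ "\<lambda>b'. if b' = b then 1 else 0"])
         (use zspan_base assms(1) in \<open>simp add: if_distrib[of of_int] if_distrib[of "\<lambda>x. x * _"] cong: if_cong\<close>)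
  next
    case (zspan_add x y)
    then obtain c d :: "complex \<Rightarrow> int" where "x = (\<Sum>b\<in>B. of_int (c b) * b)"
      "y = (\<Sum>b\<in>B. of_int (d b) * b)" by blast
    thus ?case
      by (intro exI[of _ "\<lambda>b. c b + d b"]) (simp add: sum.distrib algebra_simps)
  next
    case (zspan_minus x)
    then obtain c :: "complex \<Rightarrow> int" where "x = (\<Sum>b\<in>B. of_int (c b) * b)" by blast
    thus ?case
      by (intro exI[of _ "\<lambda>b. - c b"]) (simp add: sum_negf)
  qed
  thus ?thesis using that by blast
qed

text \<open>Multiplication by \<open>z\<close> acts on the finite family \<open>B\<close> through an
  integer matrix, and the vector of the members of \<open>B\<close> is an eigenvector for the
  eigenvalue \<open>z\<close>. So \<open>z\<close> is a root of the characteristic polynomial, which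
  is monic with integer coefficients. The member \<open>b0\<close> keeps the eigenvector
  nonzero.\<close>

lemma algebraic_int_of_stable_zspan:
  assumes B: "finite B" "b0 \<in> B" "b0 \<noteq> 0"
    and stable: "\<And>b. b \<in> B \<Longrightarrow> z * b \<in> zspan B"
  shows "algebraic_int z"
proof -
  obtain bs where bs: "set bs = B" "distinct bs" using finite_distinct_list[OF B(1)] by blast
  define n where "n = length bs"
  have "\<exists>c :: complex \<Rightarrow> int. z * b = (\<Sum>b'\<in>B. of_int (c b') * b')" if "b \<in> B" for b
    using zspan_coeffs[OF B(1) stable[OF that]] by metis
  then obtain c :: "complex \<Rightarrow> complex \<Rightarrow> int"
    where c: "\<And>b. b \<in> B \<Longrightarrow> z * b = (\<Sum>b'\<in>B. of_int (c b b') * b')" by metis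
  define A where "A = mat n n (\<lambda>(i, j). c (bs ! i) (bs ! j))"
  define A' :: "complex mat" where "A' = map_mat of_int A"
  define v where "v = vec n (\<lambda>i. bs ! i)"
  have A: "A \<in> carrier_mat n n" and A': "A' \<in> carrier_mat n n"
    by (auto simp: A_def A'_def)
  have sum_bs: "(\<Sum>j<n. f (bs ! j)) = (\<Sum>b\<in>B. f b)" for f :: "complex \<Rightarrow> complex"
    using bs n_def by (metis bij_betw_nth sum.reindex_bij_betw)
  have "A' *\<^sub>v v = z \<cdot>\<^sub>v v"
  proof (rule eq_vecI)
    fix i assume "i < dim_vec (z \<cdot>\<^sub>v v)"
    hence i: "i < n" by (simp add: v_def)
    hence "bs ! i \<in> B" using bs n_def by auto
    have "(A' *\<^sub>v v) $ i = (\<Sum>j<n. of_int (c (bs ! i) (bs ! j)) * bs ! j)"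
      using i by (simp add: A'_def A_def v_def scalar_prod_def lessThan_atLeast0)
    also have "\<dots> = z * bs ! i" using sum_bs[of "\<lambda>b. of_int (c (bs ! i) b) * b"] c[OF \<open>bs ! i \<in> B\<close>] by simp
    finally show "(A' *\<^sub>v v) $ i = (z \<cdot>\<^sub>v v) $ i" using i by (simp add: v_def)
  qed (auto simp: A'_def A_def v_def)
  moreover have "v \<noteq> 0\<^sub>v n"
  proof -
    obtain i where "i < n" "bs ! i = b0" using B(2) bs n_def by (metis in_set_conv_nth)
    thus ?thesis using B(3) by (metis index_vec index_zero_vec(1) v_def)
  qed
  ultimately have "eigenvalue A' z"
    unfolding eigenvalue_def eigenvector_def using A' by (auto intro!: exI[of _ v] simp: v_def)
  hence "poly (char_poly A') z = 0" using eigenvalue_root_char_poly[OF A'] by simp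
  moreover have "char_poly A' = map_poly of_int (char_poly A)"
    unfolding A'_def using of_int_hom.char_poly_hom[OF A] by simp
  moreover have "lead_coeff (char_poly A) = 1" using degree_monic_char_poly[OF A] by simp
  ultimately show ?thesis unfolding algebraic_int_altdef_ipoly by auto
qed

text \<open>Rings that are finitely generated as additive groups. Every element of such a ring is
  integral, and any finite set of algebraic integers fits into one of them; this is the route to
  sums, products and integral closure.\<close>

definition int_order :: "complex set \<Rightarrow> bool" where
  "int_order R \<longleftrightarrow> (\<exists>B. finite B \<and> R = zspan B) \<and> 1 \<in> R \<and> (\<forall>x\<in>R. \<forall>y\<in>R. x * y \<in> R)"

lemma algebraic_int_of_int_order:
  assumes "int_order R" "z \<in> R"
  shows "algebraic_int z"
proof -
  obtain B where B: "finite B" "R = zspan B" and R: "1 \<in> R" "\<And>x y. x \<in> R \<Longrightarrow> y \<in> R \<Longrightarrow> x * y \<in> R"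
    using assms(1) unfolding int_order_def by blast
  have "\<exists>b\<in>B. b \<noteq> 0"
  proof (rule ccontr)
    assume "\<not> ?thesis"
    hence B0: "b = 0" if "b \<in> B" for b using that by blast
    have "x = 0" if "x \<in> zspan B" for x using that by induction (auto dest: B0)
    thus False using R(1) B(2) by fastforce
  qed
  thus ?thesis using algebraic_int_of_stable_zspan[of B _ z] B R(2) assms(2) by (metis zspan_base)
qed

lemma int_order_zspan_1: "int_order (zspan {1})"
proof -
  have "x \<in> zspan {1} \<Longrightarrow> y \<in> zspan {1} \<Longrightarrow> x * y \<in> zspan {1}" for x y
  proof (induction x rule: zspan.induct)
    case (zspan_minus x) thus ?case using zspan.zspan_minus[of "x * y"] by simp
  qed (auto simp: algebra_simps intro: zspan_0 zspan_add)
  thus ?thesis unfolding int_order_def by (auto intro: zspan_base)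
qed

text \<open>The ring \<open>R[z]\<close> is spanned over \<open>R\<close> by the powers of
  \<open>z\<close> below \<open>n\<close>, because the relation rewrites the \<open>n\<close>-th
  power. The products of these powers with the generators of \<open>R\<close> generate it
  additively.\<close>

lemma int_order_adjoin:
  assumes R: "int_order R" and n: "n > 0"
    and z: "z ^ n = (\<Sum>i<n. r i * z ^ i)" "\<And>i. i < n \<Longrightarrow> r i \<in> R"
  obtains R' where "int_order R'" "R \<subseteq> R'" "z \<in> R'"
proof -
  obtain B where B: "finite B" "R = zspan B" and R1: "1 \<in> R" and Rm: "\<And>x y. x \<in> R \<Longrightarrow> y \<in> R \<Longrightarrow> x * y \<in> R"
    using R unfolding int_order_def by blast
  have Ra: "x + y \<in> R" if "x \<in> R" "y \<in> R" for x y using that B(2) zspan_add by auto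
  have Rn: "- x \<in> R" if "x \<in> R" for x using that B(2) zspan_minus by auto
  have R0: "0 \<in> R" using B(2) zspan_0 by auto
  define R' where "R' = {\<Sum>i<n. s i * z ^ i | s. \<forall>i<n. s i \<in> R}"
  have add: "x + y \<in> R'" if xy: "x \<in> R'" "y \<in> R'" for x y
  proof -
    obtain s t where "x = (\<Sum>i<n. s i * z ^ i)" "y = (\<Sum>i<n. t i * z ^ i)" "\<forall>i<n. s i \<in> R" "\<forall>i<n. t i \<in> R"
      using xy unfolding R'_def by blast
    thus ?thesis unfolding R'_def
      by (intro CollectI exI[of _ "\<lambda>i. s i + t i"]) (auto simp: sum.distrib algebra_simps intro: Ra)
  qed
  have scale: "q * x \<in> R'" if xq: "x \<in> R'" "q \<in> R" for x q
  proof -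
    obtain s where "x = (\<Sum>i<n. s i * z ^ i)" "\<forall>i<n. s i \<in> R"
      using xq unfolding R'_def by blast
    thus ?thesis unfolding R'_def using xq(2)
      by (intro CollectI exI[of _ "\<lambda>i. q * s i"]) (auto simp: sum_distrib_left algebra_simps intro: Rm)
  qed
  have "- 1 \<in> R" using R1 Rn by auto
  hence neg: "- x \<in> R'" if "x \<in> R'" for x using scale[OF that, of "-1"] by simp
  have pow: "z ^ i \<in> R'" if "i < n" for i
    unfolding R'_def using that R0 R1
    by (intro CollectI exI[of _ "\<lambda>j. if j = i then 1 else 0"]) (auto simp: if_distrib[of "\<lambda>x. x * _"] cong: if_cong)
  have zero: "0 \<in> R'" unfolding R'_def using R0 by (intro CollectI exI[of _ "\<lambda>j. 0"]) auto
  have sum: "sum f I \<in> R'" if "\<And>i. i \<in> I \<Longrightarrow> f i \<in> R'" for f and I :: "nat set"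
    using that by (induction I rule: infinite_finite_induct) (auto intro: zero add)
  have zn: "z ^ n \<in> R'" unfolding R'_def using z by auto
  \<comment> \<open>Multiplication by \<open>z\<close> raises each power by one; only the top one
    leaves the range, and \<open>zn\<close> brings it back.\<close>
  have zmult: "z * x \<in> R'" if x: "x \<in> R'" for x
  proof -
    obtain s where s: "x = (\<Sum>i<n. s i * z ^ i)" "\<forall>i<n. s i \<in> R"
      using x unfolding R'_def by blast
    have "s i * z ^ Suc i \<in> R'" if "i < n" for i
      using scale[of "z ^ Suc i" "s i"] pow[of "Suc i"] zn that s by (cases "Suc i = n") auto
    hence "(\<Sum>i<n. s i * z ^ Suc i) \<in> R'" by (intro sum) auto
    also have "(\<Sum>i<n. s i * z ^ Suc i) = z * x" by (simp add: s sum_distrib_left algebra_simps)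
    finally show ?thesis .
  qed
  have zpow: "z ^ i * x \<in> R'" if x: "x \<in> R'" for x i
    by (induction i) (use x zmult in \<open>auto simp: mult.assoc\<close>)
  have mult: "x * y \<in> R'" if xR: "x \<in> R'" and yR: "y \<in> R'" for x y
  proof -
    obtain s where s: "x = (\<Sum>i<n. s i * z ^ i)" "\<forall>i<n. s i \<in> R"
      using xR unfolding R'_def by blast
    have "(\<Sum>i<n. s i * (z ^ i * y)) \<in> R'" by (intro sum scale zpow yR) (use s in auto)
    also have "(\<Sum>i<n. s i * (z ^ i * y)) = x * y" by (simp add: s sum_distrib_right mult.assoc)
    finally show ?thesis .
  qed
  define C where "C = (\<lambda>(b, i). b * z ^ i) ` (B \<times> {..<n})"
  have RC: "q * z ^ i \<in> zspan C" if "q \<in> zspan B" "i < n" for q i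
    using that
  proof (induction q rule: zspan.induct)
    case (zspan_base b)
    thus ?case by (intro zspan.zspan_base) (auto simp: C_def)
  next
    case (zspan_minus x)
    thus ?case using zspan.zspan_minus[of "x * z ^ i"] by simp
  qed (auto simp: algebra_simps intro: zspan_0 zspan_add)
  have "R' = zspan C"
  proof
    show "R' \<subseteq> zspan C" unfolding R'_def using RC B(2) by (auto intro!: zspan_sum)
    show "zspan C \<subseteq> R'"
    proof
      fix x assume "x \<in> zspan C"
      thus "x \<in> R'"
      proof induction
        case (zspan_base b)
        then obtain b' i where "b' \<in> B" "i < n" "b = b' * z ^ i" by (auto simp: C_def)
        thus ?case using scale[OF pow] B(2) zspan.zspan_base by auto
      qed (auto intro: zero add neg)
    qed
  qed
  moreover have "finite C" using B(1) by (auto simp: C_def)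
  moreover have one: "1 \<in> R'" using pow[OF n] by simp
  ultimately have "int_order R'" using mult unfolding int_order_def by blast
  moreover have "R \<subseteq> R'" using scale[OF one] by auto
  moreover have "z \<in> R'" using zmult[OF one] by simp
  ultimately show ?thesis using that by blast
qed

lemma int_order_adjoin_algebraic_int:
  assumes R: "int_order R" and z: "algebraic_int z"
  obtains R' where "int_order R'" "R \<subseteq> R'" "z \<in> R'"
proof -
  obtain p where p: "poly (map_poly of_int p) z = 0" "lead_coeff p = 1"
    using z unfolding algebraic_int_altdef_ipoly by blast
  define n where "n = degree p"
  have "degree (map_poly (of_int :: int \<Rightarrow> complex) p) = n" by (simp add: n_def)
  hence *: "(\<Sum>i\<le>n. of_int (coeff p i) * z ^ i) = 0" using p(1) by (simp add: poly_altdef)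
  have n: "n > 0"
  proof (rule ccontr)
    assume "\<not> n > 0" thus False using * p(2) n_def by simp
  qed
  from * have zn: "z ^ n = (\<Sum>i<n. of_int (- coeff p i) * z ^ i)"
    using p(2) n_def by (simp add: lessThan_Suc_atMost[symmetric] sum_negf add_eq_0_iff)
  have R1: "1 \<in> R" and "\<exists>B. R = zspan B" using R unfolding int_order_def by auto
  then obtain B where B: "R = zspan B" by blast
  have nat: "of_nat k \<in> R" for k by (induction k) (use R1 in \<open>auto simp: B intro: zspan_0 zspan_add\<close>)
  have "of_int k \<in> R" for k
    by (cases k rule: int_cases2) (use nat in \<open>auto simp: B intro: zspan_minus\<close>)
  thus ?thesis using int_order_adjoin[OF R n zn] that by blast
qed

lemma int_order_of_finite:
  assumes "finite S" "\<And>x. x \<in> S \<Longrightarrow> algebraic_int x"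
  obtains R where "int_order R" "S \<subseteq> R"
proof -
  have "\<exists>R. int_order R \<and> S \<subseteq> R" using assms
  proof (induction S rule: finite_induct)
    case empty thus ?case using int_order_zspan_1 by blast
  next
    case (insert x S)
    then obtain R where "int_order R" "S \<subseteq> R" by auto
    with insert.prems show ?case
      using int_order_adjoin_algebraic_int[of R x] by (metis insertCI insert_subset order_trans)
  qed
  thus ?thesis using that by blast
qed

lemma int_order_add: "int_order R \<Longrightarrow> x \<in> R \<Longrightarrow> y \<in> R \<Longrightarrow> x + y \<in> R"
  unfolding int_order_def using zspan_add by blast

lemma int_order_mult: "int_order R \<Longrightarrow> x \<in> R \<Longrightarrow> y \<in> R \<Longrightarrow> x * y \<in> R"
  unfolding int_order_def by blast

lemma algebraic_int_add:
  fixes x y :: complex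
  assumes "algebraic_int x" "algebraic_int y"
  shows "algebraic_int (x + y)"
proof -
  obtain R where R: "int_order R" "{x, y} \<subseteq> R"
    by (rule int_order_of_finite[of "{x, y}"]) (use assms in auto)
  thus ?thesis using algebraic_int_of_int_order[OF R(1) int_order_add[OF R(1)]] by simp
qed

lemma algebraic_int_mult:
  fixes x y :: complex
  assumes "algebraic_int x" "algebraic_int y"
  shows "algebraic_int (x * y)"
proof -
  obtain R where R: "int_order R" "{x, y} \<subseteq> R"
    by (rule int_order_of_finite[of "{x, y}"]) (use assms in auto)
  thus ?thesis using algebraic_int_of_int_order[OF R(1) int_order_mult[OF R(1)]] by simp
qed

lemma algebraic_int_diff:
  fixes x y :: complex
  assumes "algebraic_int x" "algebraic_int y"
  shows "algebraic_int (x - y)"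
  using algebraic_int_add[of x "- y"] assms by auto

lemma algebraic_int_power: "algebraic_int x \<Longrightarrow> algebraic_int (x ^ n)" for x :: complex
  by (induction n) (auto intro: algebraic_int_mult)

text \<open>Integral closure: the coefficients lie in one \<open>int_order\<close>, and adjoining
  \<open>z\<close> to it gives another. In this form it covers both square roots of units and scaled
  roots of polynomials.\<close>

lemma algebraic_int_of_monic_relation:
  fixes z :: complex
  assumes "n > 0" "z ^ n = (\<Sum>i<n. r i * z ^ i)" "\<And>i. i < n \<Longrightarrow> algebraic_int (r i)"
  shows "algebraic_int z"
proof -
  obtain R where R: "int_order R" "r ` {..<n} \<subseteq> R"
    using int_order_of_finite[of "r ` {..<n}"] assms(3) by blast
  hence "\<And>i. i < n \<Longrightarrow> r i \<in> R" by auto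
  from int_order_adjoin[OF R(1) assms(1,2) this] show ?thesis
    using algebraic_int_of_int_order by metis
qed

subsection \<open>Dedekind's Prague theorem\<close>

definition int_coeffs :: "complex poly \<Rightarrow> bool" where
  "int_coeffs p \<longleftrightarrow> (\<forall>i. algebraic_int (coeff p i))"

lemma int_coeffs_add: "int_coeffs p \<Longrightarrow> int_coeffs q \<Longrightarrow> int_coeffs (p + q)"
  by (auto simp: int_coeffs_def intro: algebraic_int_add)

lemma int_coeffs_diff: "int_coeffs p \<Longrightarrow> int_coeffs q \<Longrightarrow> int_coeffs (p - q)"
  by (auto simp: int_coeffs_def intro: algebraic_int_diff)

text \<open>Multiplying the equation of \<open>\<rho>\<close> by the power \<open>n - 1\<close> of
  the leading coefficient turns it into a monic equation of degree \<open>n\<close> for the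
  product.\<close>

lemma algebraic_int_lead_coeff_mult_root:
  assumes p: "int_coeffs p" and root: "poly p \<rho> = 0"
  shows "algebraic_int (lead_coeff p * \<rho>)"
proof (cases "degree p = 0")
  case True
  thus ?thesis using root by (auto elim!: degree_eq_zeroE)
next
  case False
  define n a where "n = degree p" and "a = lead_coeff p"
  have n: "n > 0" using False n_def by simp
  have "a * (\<Sum>i\<le>n. coeff p i * \<rho> ^ i) = 0" using root by (simp add: poly_altdef n_def)
  hence "a * \<rho> ^ n = - (\<Sum>i<n. coeff p i * \<rho> ^ i)" if "a \<noteq> 0"
    using that by (simp add: lessThan_Suc_atMost[symmetric] n_def a_def add_eq_0_iff)
  hence *: "a * \<rho> ^ n = - (\<Sum>i<n. coeff p i * \<rho> ^ i)"
    using False unfolding a_def by force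
  have "(a * \<rho>) ^ n = a ^ (n - 1) * (a * \<rho> ^ n)"
    using n by (cases n) (auto simp: power_mult_distrib algebra_simps)
  also have "\<dots> = (\<Sum>i<n. - (a ^ (n - 1) * coeff p i * \<rho> ^ i))"
    unfolding * by (simp add: sum_distrib_left sum_negf algebra_simps)
  also have "\<dots> = (\<Sum>i<n. - (a ^ (n - 1 - i) * coeff p i) * (a * \<rho>) ^ i)"
  proof (intro sum.cong refl)
    fix i assume "i \<in> {..<n}"
    hence "n - 1 = (n - 1 - i) + i" by auto
    hence "a ^ (n - 1) = a ^ (n - 1 - i) * a ^ i" by (metis power_add)
    thus "- (a ^ (n - 1) * coeff p i * \<rho> ^ i) = - (a ^ (n - 1 - i) * coeff p i) * (a * \<rho>) ^ i"
      by (simp add: power_mult_distrib algebra_simps)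
  qed
  finally have rel: "(a * \<rho>) ^ n = (\<Sum>i<n. - (a ^ (n - 1 - i) * coeff p i) * (a * \<rho>) ^ i)" .
  have "algebraic_int (- (a ^ (n - 1 - i) * coeff p i))" for i
    using p unfolding int_coeffs_def a_def
    by (auto intro!: algebraic_int_minus algebraic_int_mult algebraic_int_power)
  from algebraic_int_of_monic_relation[OF n rel this] show ?thesis by (simp add: a_def)
qed

text \<open>The leading coefficient \<open>a\<close> of \<open>q\<close> is also that of the
  product, so \<open>a\<close> and \<open>a * \<rho>\<close> are integral and the leading term of
  \<open>q\<close> can be split off; what remains has smaller degree.\<close>

lemma int_coeffs_divide_root:
  "int_coeffs ([:-\<rho>, 1:] * q) \<Longrightarrow> int_coeffs q"
proof (induction "degree q" arbitrary: q rule: less_induct)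
  case less
  define a n where "a = lead_coeff q" and "n = degree q"
  define f where "f = [:-\<rho>, 1:] * q"
  show ?case
  proof (cases "q = 0")
    case True thus ?thesis by (simp add: int_coeffs_def)
  next
    case False
    have lf: "lead_coeff f = a" unfolding f_def a_def lead_coeff_mult by simp
    have "algebraic_int (lead_coeff f * \<rho>)"
      by (rule algebraic_int_lead_coeff_mult_root) (use less.prems in \<open>auto simp: f_def\<close>)
    hence ar: "algebraic_int (a * \<rho>)" using lf by simp
    have a: "algebraic_int a" using less.prems lf unfolding int_coeffs_def f_def by metis
    have mon: "int_coeffs (monom a n)" using a by (auto simp: int_coeffs_def)
    have lin: "int_coeffs (monom a n * [:-\<rho>, 1:])"
      using a ar by (auto simp: int_coeffs_def coeff_monom_mult coeff_pCons mult.commute[of \<rho>] split: nat.splits)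
    define q' where "q' = q - monom a n"
    have "[:-\<rho>, 1:] * q' = f - monom a n * [:-\<rho>, 1:]" by (simp add: q'_def f_def algebra_simps smult_diff_right)
    hence iq': "int_coeffs ([:-\<rho>, 1:] * q')" using int_coeffs_diff[OF less.prems lin] by (simp add: f_def)
    have "int_coeffs q'"
    proof (cases "n = 0")
      case True
      hence "q' = 0" by (auto simp: q'_def a_def n_def poly_eq_iff coeff_eq_0)
      thus ?thesis by (simp add: int_coeffs_def)
    next
      case False
      have "degree q' < n"
      proof (rule degree_lessI)
        show "q' \<noteq> 0 \<or> 0 < n" using False by simp
        show "\<forall>k\<ge>n. coeff q' k = 0" by (auto simp: q'_def a_def n_def coeff_eq_0)
      qed
      thus ?thesis using less.hyps iq' n_def by simp
    qed
    moreover have "q = q' + monom a n" by (simp add: q'_def)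
    ultimately show ?thesis using int_coeffs_add mon by metis
  qed
qed

text \<open>A root \<open>\<rho>\<close> of \<open>p\<close> is split off, leaving
  \<open>p'\<close>. Then \<open>p' * q\<close> and \<open>\<rho>\<close> times it both have
  integral coefficients, so the induction hypothesis covers the products of coefficients of
  \<open>p'\<close> and of their multiples by \<open>\<rho>\<close> with \<open>q\<close>. A
  coefficient of \<open>p\<close> is a difference of one of each kind.\<close>

theorem int_coeffs_smult_of_mult:
  "int_coeffs (p * q) \<Longrightarrow> int_coeffs (smult (coeff p i) q)"
proof (induction "degree p" arbitrary: p q i)
  case 0
  then obtain c where "p = [:c:]" by (metis degree_eq_zeroE)
  thus ?case using 0 by (cases i) (auto simp: int_coeffs_def)
next
  case (Suc n)
  have "\<not> constant (poly p)" using Suc.hyps(2) constant_degree[of p] by simp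
  then obtain \<rho> where "poly p \<rho> = 0" using fundamental_theorem_of_algebra by blast
  then obtain p' where p': "p = [:-\<rho>, 1:] * p'" by (metis dvdE poly_eq_0_iff_dvd)
  have "p' \<noteq> 0" using p' Suc.hyps(2) by auto
  hence deg: "degree p' = n" using Suc.hyps(2) p' degree_mult_eq[of "[:-\<rho>, 1:]" p'] by simp
  have 1: "int_coeffs (p' * q)"
    by (rule int_coeffs_divide_root[of \<rho>]) (use Suc.prems p' in \<open>metis mult.assoc\<close>)
  \<comment> \<open>Subtracting \<open>p * q\<close> from \<open>X\<close> times
    \<open>p' * q\<close> leaves \<open>\<rho>\<close> times \<open>p' * q\<close>.\<close>
  have "int_coeffs ([:0, 1:] * (p' * q))"
    using 1 by (auto simp: int_coeffs_def coeff_pCons split: nat.splits)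
  from int_coeffs_diff[OF this Suc.prems] have "int_coeffs (smult \<rho> (p' * q))"
    by (simp add: p' algebra_simps)
  hence 2: "int_coeffs (p' * smult \<rho> q)" by (simp add: mult.commute)
  note IH = Suc.hyps(1)[OF deg[symmetric]]
  have A: "int_coeffs (smult (coeff p' i) q)" for i using IH[OF 1] .
  have B: "int_coeffs (smult (coeff p' i * \<rho>) q)" for i using IH[OF 2, of i] by simp
  show ?case
  proof (cases i)
    case 0
    have "smult (coeff p i) q = 0 - smult (coeff p' i * \<rho>) q" using 0 by (simp add: p' mult.commute)
    thus ?thesis using int_coeffs_diff[OF _ B[of i], of 0] by (simp add: int_coeffs_def)
  next
    case (Suc j)
    have "smult (coeff p i) q = smult (coeff p' j) q - smult (coeff p' i * \<rho>) q"
      using Suc by (simp add: p' smult_diff_left[symmetric] mult.commute)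
    thus ?thesis using int_coeffs_diff[OF A[of j] B[of i]] by simp
  qed
qed

section \<open>Ring structures of the statement in terms of complex arithmetic\<close>

lemma complex_field_simps [simp]:
  "carrier (ring_of_type_algebra :: complex ring) = UNIV"
  "monoid.mult (ring_of_type_algebra :: complex ring) = (*)"
  "monoid.one (ring_of_type_algebra :: complex ring) = 1"
  "ring.zero (ring_of_type_algebra :: complex ring) = 0"
  "ring.add (ring_of_type_algebra :: complex ring) = (+)"
  by (auto simp: ring_of_type_algebra_def fun_eq_iff)

definition integers :: "complex set \<Rightarrow> complex set" where
  "integers F = {x \<in> F. algebraic_int x}"

lemma ring_of_integers_simps [simp]:
  "carrier (ring_of_integers F) = integers F"
  "monoid.mult (ring_of_integers F) = (*)"
  "monoid.one (ring_of_integers F) = 1"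
  "ring.zero (ring_of_integers F) = 0"
  "ring.add (ring_of_integers F) = (+)"
  by (auto simp: ring_of_integers_def integers_def)

subsection \<open>Products of modules of complex numbers\<close>

abbreviation iprod :: "complex set \<Rightarrow> complex set \<Rightarrow> complex set" (infixl "\<odot>" 70) where
  "I \<odot> J \<equiv> ideal_prod complex_field I J"

lemma iprod_mult: "x \<in> I \<Longrightarrow> y \<in> J \<Longrightarrow> x * y \<in> I \<odot> J"
  using ideal_prod.prod[of x I y J complex_field] by simp

lemma iprod_add: "x \<in> I \<odot> J \<Longrightarrow> y \<in> I \<odot> J \<Longrightarrow> x + y \<in> I \<odot> J"
  using ideal_prod.sum[of x complex_field I J y] by simp

lemma iprod_induct [consumes 1, case_names mult add]:
  assumes "x \<in> I \<odot> J"
    and "\<And>x y. x \<in> I \<Longrightarrow> y \<in> J \<Longrightarrow> P (x * y)"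
    and "\<And>x y. x \<in> I \<odot> J \<Longrightarrow> y \<in> I \<odot> J \<Longrightarrow> P x \<Longrightarrow> P y \<Longrightarrow> P (x + y)"
  shows "P x"
  using assms by (induction rule: ideal_prod.induct) auto

lemma iprod_subsetI:
  assumes "\<And>x y. x \<in> I \<Longrightarrow> y \<in> J \<Longrightarrow> x * y \<in> T" "\<And>x y. x \<in> T \<Longrightarrow> y \<in> T \<Longrightarrow> x + y \<in> T"
  shows "I \<odot> J \<subseteq> T"
proof
  fix x assume "x \<in> I \<odot> J"
  thus "x \<in> T" by (induction rule: iprod_induct) (use assms in auto)
qed

lemma iprod_mono: "I \<subseteq> I' \<Longrightarrow> J \<subseteq> J' \<Longrightarrow> I \<odot> J \<subseteq> I' \<odot> J'"
  by (intro iprod_subsetI) (auto intro: iprod_mult iprod_add)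

lemma iprod_comm: "I \<odot> J = J \<odot> I"
proof -
  have "I \<odot> J \<subseteq> J \<odot> I" for I J
    by (intro iprod_subsetI) (auto intro: iprod_add, metis iprod_mult mult.commute)
  thus ?thesis by blast
qed

lemma iprod_assoc: "(I \<odot> J) \<odot> L = I \<odot> (J \<odot> L)"
proof -
  have *: "(I \<odot> J) \<odot> L \<subseteq> I \<odot> (J \<odot> L)" for I J L
  proof (intro iprod_subsetI)
    fix x y assume "x \<in> I \<odot> J" "y \<in> L"
    thus "x * y \<in> I \<odot> (J \<odot> L)"
      by (induction rule: iprod_induct)
         (auto simp: mult.assoc distrib_right intro!: iprod_mult intro: iprod_add)
  qed (auto intro: iprod_add)
  have "I \<odot> (J \<odot> L) = (L \<odot> J) \<odot> I" by (simp add: iprod_comm)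
  also have "\<dots> \<subseteq> L \<odot> (J \<odot> I)" by (rule *)
  also have "\<dots> = (I \<odot> J) \<odot> L" by (simp add: iprod_comm)
  finally show ?thesis using * by blast
qed

lemma iprod_scale: "((*) c ` I) \<odot> J = (*) c ` (I \<odot> J)"
proof
  show "((*) c ` I) \<odot> J \<subseteq> (*) c ` (I \<odot> J)"
  proof (intro iprod_subsetI)
    fix x y assume "x \<in> (*) c ` I" "y \<in> J"
    then obtain x' where "x' \<in> I" "x = c * x'" by auto
    thus "x * y \<in> (*) c ` (I \<odot> J)" using iprod_mult[of x' I y J] \<open>y \<in> J\<close> by (auto simp: mult.assoc)
  next
    fix x y assume "x \<in> (*) c ` (I \<odot> J)" "y \<in> (*) c ` (I \<odot> J)"
    then obtain x' y' where "x' \<in> I \<odot> J" "x = c * x'" "y' \<in> I \<odot> J" "y = c * y'" by auto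
    thus "x + y \<in> (*) c ` (I \<odot> J)" using iprod_add[of x' I J y'] by (auto simp: distrib_left[symmetric])
  qed
  show "(*) c ` (I \<odot> J) \<subseteq> ((*) c ` I) \<odot> J"
  proof clarify
    fix x assume "x \<in> I \<odot> J"
    thus "c * x \<in> ((*) c ` I) \<odot> J"
      by (induction rule: iprod_induct)
         (auto simp: mult.assoc[symmetric] distrib_left intro!: iprod_mult intro: iprod_add)
  qed
qed

lemma ideal_prod_ring_of_integers: "ideal_prod (ring_of_integers F) I J = I \<odot> J"
proof
  show "ideal_prod (ring_of_integers F) I J \<subseteq> I \<odot> J"
  proof
    fix x assume "x \<in> ideal_prod (ring_of_integers F) I J"
    thus "x \<in> I \<odot> J" by (induction rule: ideal_prod.induct) (auto intro: iprod_mult iprod_add)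
  qed
  show "I \<odot> J \<subseteq> ideal_prod (ring_of_integers F) I J"
  proof
    fix x assume "x \<in> I \<odot> J"
    thus "x \<in> ideal_prod (ring_of_integers F) I J"
      by (induction rule: iprod_induct)
         (metis ideal_prod.prod ring_of_integers_simps(2), metis ideal_prod.sum ring_of_integers_simps(5))
  qed
qed

subsection \<open>Galois number fields inside the complex numbers\<close>

text \<open>Each member of \<open>G\<close> is a map on all complex numbers, and inverses are
  required as functions on all of them. Images and compositions then need no restriction to
  \<open>K\<close>; the intended maps are the identity outside \<open>K\<close>. The Galois property
  is \<open>fixed_Rats\<close>.\<close>

locale galois_extension =
  fixes K :: "complex set" and G :: "(complex \<Rightarrow> complex) set"
  assumes K_one: "1 \<in> K"
    and K_add: "x \<in> K \<Longrightarrow> y \<in> K \<Longrightarrow> x + y \<in> K"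
    and K_uminus: "x \<in> K \<Longrightarrow> - x \<in> K"
    and K_mult: "x \<in> K \<Longrightarrow> y \<in> K \<Longrightarrow> x * y \<in> K"
    and K_inverse: "x \<in> K \<Longrightarrow> inverse x \<in> K"
    and finite_G: "finite G"
    and id_G: "id \<in> G"
    and comp_G: "\<sigma> \<in> G \<Longrightarrow> \<tau> \<in> G \<Longrightarrow> \<sigma> \<circ> \<tau> \<in> G"
    and inverse_G: "\<sigma> \<in> G \<Longrightarrow> \<exists>\<tau>\<in>G. \<sigma> \<circ> \<tau> = id \<and> \<tau> \<circ> \<sigma> = id"
    and G_closed: "\<sigma> \<in> G \<Longrightarrow> x \<in> K \<Longrightarrow> \<sigma> x \<in> K"
    and G_add: "\<sigma> \<in> G \<Longrightarrow> x \<in> K \<Longrightarrow> y \<in> K \<Longrightarrow> \<sigma> (x + y) = \<sigma> x + \<sigma> y"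
    and G_mult: "\<sigma> \<in> G \<Longrightarrow> x \<in> K \<Longrightarrow> y \<in> K \<Longrightarrow> \<sigma> (x * y) = \<sigma> x * \<sigma> y"
    and G_one: "\<sigma> \<in> G \<Longrightarrow> \<sigma> 1 = 1"
    and fixed_Rats: "x \<in> K \<Longrightarrow> (\<And>\<sigma>. \<sigma> \<in> G \<Longrightarrow> \<sigma> x = x) \<Longrightarrow> x \<in> \<rat>"
    and K_frac: "x \<in> K \<Longrightarrow> \<exists>m::nat. m > 0 \<and> algebraic_int (of_nat m * x)"
begin

definition \<O> :: "complex set" where "\<O> = {x \<in> K. algebraic_int x}"

abbreviation R :: "complex ring" where "R \<equiv> ring_of_integers K"
abbreviation M :: "complex set ring" where "M \<equiv> ideals_set R"

lemma integers_K [simp]: "integers K = \<O>" by (simp add: integers_def \<O>_def)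

lemma O_K: "x \<in> \<O> \<Longrightarrow> x \<in> K" by (simp add: \<O>_def)

lemma K_zero [simp]: "0 \<in> K" using K_add[OF K_one K_uminus[OF K_one]] by simp
lemma K_divide: "x \<in> K \<Longrightarrow> y \<in> K \<Longrightarrow> x / y \<in> K" using K_mult K_inverse by (simp add: divide_inverse)
lemma K_power: "x \<in> K \<Longrightarrow> x ^ n \<in> K" by (induction n) (auto intro: K_mult K_one)
lemma K_of_nat [simp]: "of_nat n \<in> K" by (induction n) (auto intro: K_add K_one)
lemma K_of_int [simp]: "of_int n \<in> K" by (cases n rule: int_cases2) (auto intro: K_uminus)
lemma K_of_rat [simp]: "of_rat q \<in> K"
  by (cases q) (auto simp: of_rat_rat intro!: K_divide)
lemma K_Rats: "x \<in> \<rat> \<Longrightarrow> x \<in> K" by (auto elim!: Rats_cases)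
lemma K_sum: "(\<And>i. i \<in> I \<Longrightarrow> f i \<in> K) \<Longrightarrow> sum f I \<in> K"
  by (induction I rule: infinite_finite_induct) (auto intro: K_add)
lemma K_prod: "(\<And>i. i \<in> I \<Longrightarrow> f i \<in> K) \<Longrightarrow> prod f I \<in> K"
  by (induction I rule: infinite_finite_induct) (auto intro: K_mult K_one)

lemma G_zero: "\<sigma> \<in> G \<Longrightarrow> \<sigma> 0 = 0" using G_add[of \<sigma> 0 0] by simp
lemma G_uminus: "\<sigma> \<in> G \<Longrightarrow> x \<in> K \<Longrightarrow> \<sigma> (- x) = - \<sigma> x"
  using G_add[of \<sigma> x "- x"] K_uminus[of x] G_zero[of \<sigma>] by (metis add.right_inverse minus_unique)
lemma G_diff: "\<sigma> \<in> G \<Longrightarrow> x \<in> K \<Longrightarrow> y \<in> K \<Longrightarrow> \<sigma> (x - y) = \<sigma> x - \<sigma> y"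
  using G_add[of \<sigma> x "- y"] K_uminus G_uminus by simp
lemma G_sum: "\<sigma> \<in> G \<Longrightarrow> (\<And>i. i \<in> I \<Longrightarrow> f i \<in> K) \<Longrightarrow> \<sigma> (sum f I) = (\<Sum>i\<in>I. \<sigma> (f i))"
  by (induction I rule: infinite_finite_induct) (auto simp: G_zero G_add K_sum)
lemma G_prod: "\<sigma> \<in> G \<Longrightarrow> (\<And>i. i \<in> I \<Longrightarrow> f i \<in> K) \<Longrightarrow> \<sigma> (prod f I) = (\<Prod>i\<in>I. \<sigma> (f i))"
  by (induction I rule: infinite_finite_induct) (auto simp: G_one G_mult K_prod)
lemma G_power: "\<sigma> \<in> G \<Longrightarrow> x \<in> K \<Longrightarrow> \<sigma> (x ^ n) = \<sigma> x ^ n"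
  by (induction n) (auto simp: G_one G_mult K_power)
lemma G_of_nat: "\<sigma> \<in> G \<Longrightarrow> \<sigma> (of_nat n) = of_nat n"
  by (induction n) (auto simp: G_zero G_add G_one K_one)
lemma G_of_int: "\<sigma> \<in> G \<Longrightarrow> \<sigma> (of_int n) = of_int n"
  by (cases n rule: int_cases2) (auto simp: G_of_nat G_uminus)
lemma G_inj: "\<sigma> \<in> G \<Longrightarrow> inj \<sigma>"
  using inverse_G[of \<sigma>] by (metis inj_on_id inj_on_imageI2)
lemma G_eq_0_iff: "\<sigma> \<in> G \<Longrightarrow> \<sigma> x = 0 \<longleftrightarrow> x = 0"
  using G_inj G_zero by (metis injD)
lemma G_inverse: "\<sigma> \<in> G \<Longrightarrow> x \<in> K \<Longrightarrow> \<sigma> (inverse x) = inverse (\<sigma> x)"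
proof (cases "x = 0")
  case False
  assume "\<sigma> \<in> G" "x \<in> K"
  hence "\<sigma> x * \<sigma> (inverse x) = 1"
    using G_mult[of \<sigma> x "inverse x"] K_inverse[of x] G_one[of \<sigma>] False by simp
  thus ?thesis using inverse_unique by metis
qed (simp add: G_zero)
lemma G_divide: "\<sigma> \<in> G \<Longrightarrow> x \<in> K \<Longrightarrow> y \<in> K \<Longrightarrow> \<sigma> (x / y) = \<sigma> x / \<sigma> y"
  by (simp add: divide_inverse G_mult G_inverse K_inverse)
lemma G_Rats: "\<sigma> \<in> G \<Longrightarrow> x \<in> \<rat> \<Longrightarrow> \<sigma> x = x"
  by (elim Rats_cases') (simp add: G_divide G_of_int)

lemma G_bij: "\<tau> \<in> G \<Longrightarrow> bij_betw (\<lambda>\<sigma>. \<tau> \<circ> \<sigma>) G G"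
proof -
  assume t: "\<tau> \<in> G"
  then obtain \<rho> where r: "\<rho> \<in> G" "\<tau> \<circ> \<rho> = id" "\<rho> \<circ> \<tau> = id" using inverse_G by blast
  show ?thesis
    by (rule bij_betw_byWitness[of _ "\<lambda>\<sigma>. \<rho> \<circ> \<sigma>"]) (use t r comp_G in \<open>auto simp: comp_assoc[symmetric]\<close>)
qed

lemma G_algebraic_int:
  assumes "\<sigma> \<in> G" "x \<in> K" "algebraic_int x"
  shows "algebraic_int (\<sigma> x)"
proof -
  obtain p where p: "poly (map_poly of_int p) x = 0" "lead_coeff p = 1"
    using assms(3) unfolding algebraic_int_altdef_ipoly by blast
  have "poly (map_poly of_int p) (\<sigma> y) = \<sigma> (poly (map_poly of_int p) y)" if "y \<in> K" for y
    using assms(1) that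
    by (simp add: poly_altdef G_sum K_mult K_power G_mult G_of_int G_power)
  hence "poly (map_poly of_int p) (\<sigma> x) = 0" using p assms by (simp add: G_zero)
  thus ?thesis using p(2) unfolding algebraic_int_altdef_ipoly by blast
qed

lemma O_add: "x \<in> \<O> \<Longrightarrow> y \<in> \<O> \<Longrightarrow> x + y \<in> \<O>" by (auto simp: \<O>_def K_add algebraic_int_add)
lemma O_mult: "x \<in> \<O> \<Longrightarrow> y \<in> \<O> \<Longrightarrow> x * y \<in> \<O>" by (auto simp: \<O>_def K_mult algebraic_int_mult)
lemma O_uminus: "x \<in> \<O> \<Longrightarrow> - x \<in> \<O>" by (auto simp: \<O>_def K_uminus)
lemma O_diff: "x \<in> \<O> \<Longrightarrow> y \<in> \<O> \<Longrightarrow> x - y \<in> \<O>" using O_add[of x "- y"] O_uminus by simp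
lemma O_of_int [simp]: "of_int n \<in> \<O>" by (auto simp: \<O>_def)
lemma O_of_nat [simp]: "of_nat n \<in> \<O>" using O_of_int[of "int n"] by simp
lemma O_zero [simp]: "0 \<in> \<O>" using O_of_int[of 0] by simp
lemma O_one [simp]: "1 \<in> \<O>" using O_of_int[of 1] by simp
lemma O_sum: "(\<And>i. i \<in> I \<Longrightarrow> f i \<in> \<O>) \<Longrightarrow> sum f I \<in> \<O>"
  by (induction I rule: infinite_finite_induct) (auto intro: O_add)
lemma O_prod: "(\<And>i. i \<in> I \<Longrightarrow> f i \<in> \<O>) \<Longrightarrow> prod f I \<in> \<O>"
  by (induction I rule: infinite_finite_induct) (auto intro: O_mult)
lemma O_power: "x \<in> \<O> \<Longrightarrow> x ^ n \<in> \<O>" by (induction n) (auto intro: O_mult)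
lemma G_O: "\<sigma> \<in> G \<Longrightarrow> x \<in> \<O> \<Longrightarrow> \<sigma> x \<in> \<O>" by (auto simp: \<O>_def G_closed G_algebraic_int)
lemma G_image_O: "\<sigma> \<in> G \<Longrightarrow> \<sigma> ` \<O> = \<O>"
  using inverse_G[of \<sigma>] G_O by (auto simp: image_iff) (metis comp_apply id_apply)
lemma O_Rats: "x \<in> \<O> \<Longrightarrow> x \<in> \<rat> \<Longrightarrow> x \<in> \<int>"
  by (auto simp: \<O>_def intro: rational_algebraic_int_is_int)
lemma O_fixed: "x \<in> \<O> \<Longrightarrow> (\<And>\<sigma>. \<sigma> \<in> G \<Longrightarrow> \<sigma> x = x) \<Longrightarrow> x \<in> \<int>"
  using O_Rats fixed_Rats O_K by blast

lemma prod_G_K: "x \<in> K \<Longrightarrow> A \<subseteq> G \<Longrightarrow> (\<Prod>\<sigma>\<in>A. \<sigma> x) \<in> K"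
  using G_closed by (intro K_prod) blast

lemma prod_G_O: "x \<in> \<O> \<Longrightarrow> A \<subseteq> G \<Longrightarrow> (\<Prod>\<sigma>\<in>A. \<sigma> x) \<in> \<O>"
  using G_O by (intro O_prod) blast

definition N :: "complex \<Rightarrow> complex" where "N x = (\<Prod>\<sigma>\<in>G. \<sigma> x)"

lemma N_K: "x \<in> K \<Longrightarrow> N x \<in> \<rat>"
proof (rule fixed_Rats)
  assume x: "x \<in> K"
  show "N x \<in> K" unfolding N_def using prod_G_K[OF x] by blast
  fix \<tau> assume t: "\<tau> \<in> G"
  have "\<tau> (N x) = (\<Prod>\<sigma>\<in>G. (\<tau> \<circ> \<sigma>) x)" unfolding N_def using G_prod[OF t, of G "\<lambda>\<sigma>. \<sigma> x"] G_closed[OF _ x] by simp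
  also have "\<dots> = N x" unfolding N_def by (rule prod.reindex_bij_betw[OF G_bij[OF t]])
  finally show "\<tau> (N x) = N x" .
qed

lemma N_O: "x \<in> \<O> \<Longrightarrow> N x \<in> \<int>"
proof -
  assume x: "x \<in> \<O>"
  have "N x \<in> \<O>" unfolding N_def using prod_G_O[OF x] by blast
  thus ?thesis using N_K O_K x O_Rats by auto
qed

lemma N_eq_0_iff: "N x = 0 \<longleftrightarrow> x = 0"
  unfolding N_def using finite_G id_G G_eq_0_iff by auto

text \<open>The identity contributes the factor \<open>x\<close>; the other conjugates form the
  cofactor.\<close>

lemma N_cofactor: "x \<in> \<O> \<Longrightarrow> \<exists>y\<in>\<O>. N x = x * y"
  unfolding N_def using prod.remove[OF finite_G id_G, of "\<lambda>\<sigma>. \<sigma> x"]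
  by (intro bexI[of _ "\<Prod>\<sigma>\<in>G - {id}. \<sigma> x"]) (auto intro: prod_G_O)

lemma cring_R: "cring R"
proof (rule cringI)
  show "abelian_group R"
  proof (rule abelian_groupI)
    fix x assume "x \<in> carrier R"
    thus "\<exists>y\<in>carrier R. y \<oplus>\<^bsub>R\<^esub> x = \<zero>\<^bsub>R\<^esub>"
      using O_uminus[of x] by (intro bexI[of _ "- x"]) auto
  qed (auto simp: O_add add.assoc add.commute)
  show "comm_monoid R"
    by (rule comm_monoidI) (auto simp: O_mult mult.assoc mult.commute)
qed (auto simp: algebra_simps)

sublocale R: cring R by (rule cring_R)
sublocale M: comm_monoid M by (rule R.ideals_set_is_comm_monoid)

lemma a_inv_R: "x \<in> \<O> \<Longrightarrow> \<ominus>\<^bsub>R\<^esub> x = - x"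
  using R.minus_equality[of "- x" x] O_uminus by simp

definition isid :: "complex set \<Rightarrow> bool" where
  "isid I \<longleftrightarrow> I \<subseteq> \<O> \<and> 0 \<in> I \<and> (\<forall>x\<in>I. \<forall>y\<in>I. x + y \<in> I) \<and> (\<forall>r\<in>\<O>. \<forall>x\<in>I. r * x \<in> I)"

lemma ideal_iff: "ideal I R \<longleftrightarrow> isid I"
proof
  assume "ideal I R"
  then interpret ideal I R .
  show "isid I" unfolding isid_def
    using I_l_closed additive_subgroup.zero_closed[OF is_additive_subgroup] a_closed Icarr by auto
next
  assume I: "isid I"
  show "ideal I R"
  proof (rule idealI)
    show "ring R" by (rule R.ring_axioms)
    show "subgroup I (add_monoid R)"
    proof (rule R.add.subgroupI)
      fix a assume "a \<in> I"
      hence "- a \<in> I" using I unfolding isid_def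
        by (metis O_one O_uminus minus_mult_commute mult_1 mult_minus1)
      thus "\<ominus>\<^bsub>R\<^esub> a \<in> I" using I \<open>a \<in> I\<close> a_inv_R unfolding isid_def by auto
    qed (use I in \<open>auto simp: isid_def\<close>)
  next
    fix a x assume ax: "a \<in> I" "x \<in> carrier R"
    hence *: "x * a \<in> I" using I by (auto simp: isid_def)
    thus "x \<otimes>\<^bsub>R\<^esub> a \<in> I" by simp
    from * show "a \<otimes>\<^bsub>R\<^esub> x \<in> I" by (simp add: mult.commute)
  qed
qed

lemma carrier_M [simp]: "carrier M = {I. isid I}" by (simp add: ideals_set_def ideal_iff)
lemma mult_M [simp]: "I \<otimes>\<^bsub>M\<^esub> J = I \<odot> J" by (simp add: ideals_set_def ideal_prod_ring_of_integers)
lemma one_M [simp]: "\<one>\<^bsub>M\<^esub> = \<O>" by (simp add: ideals_set_def)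

lemma isidD:
  assumes "isid I"
  shows "x \<in> I \<Longrightarrow> x \<in> \<O>" "0 \<in> I" "x \<in> I \<Longrightarrow> y \<in> I \<Longrightarrow> x + y \<in> I"
    "r \<in> \<O> \<Longrightarrow> x \<in> I \<Longrightarrow> r * x \<in> I" "r \<in> \<O> \<Longrightarrow> x \<in> I \<Longrightarrow> x * r \<in> I"
    "x \<in> I \<Longrightarrow> - x \<in> I" "x \<in> I \<Longrightarrow> y \<in> I \<Longrightarrow> x - y \<in> I"
proof -
  note I = assms[unfolded isid_def]
  show "x \<in> I \<Longrightarrow> x \<in> \<O>" "0 \<in> I" "x \<in> I \<Longrightarrow> y \<in> I \<Longrightarrow> x + y \<in> I" "r \<in> \<O> \<Longrightarrow> x \<in> I \<Longrightarrow> r * x \<in> I"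
    "r \<in> \<O> \<Longrightarrow> x \<in> I \<Longrightarrow> x * r \<in> I"
    using I by (auto simp: mult.commute)
  show *: "x \<in> I \<Longrightarrow> - x \<in> I" for x using I O_of_int[of "-1"] by force
  show "x \<in> I \<Longrightarrow> y \<in> I \<Longrightarrow> x - y \<in> I" using *[of y] I by force
qed

lemma isid_sum: "isid I \<Longrightarrow> (\<And>i. i \<in> A \<Longrightarrow> f i \<in> I) \<Longrightarrow> sum f A \<in> I"
  by (induction A rule: infinite_finite_induct) (auto intro: isidD)

lemma isid_O [simp]: "isid \<O>" by (auto simp: isid_def O_add O_mult)

lemma isid_iprod: "isid I \<Longrightarrow> isid J \<Longrightarrow> isid (I \<odot> J)"
  using M.m_closed[of I J] by simp

lemma iprod_O: "isid I \<Longrightarrow> \<O> \<odot> I = I" using M.l_one[of I] by simp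

lemma iprod_subset: "isid I \<Longrightarrow> isid J \<Longrightarrow> I \<odot> J \<subseteq> I"
  by (intro iprod_subsetI) (auto intro: isidD)

text \<open>Meaningful for every complex \<open>a\<close>, so that it also denotes principal
  fractional ideals.\<close>

definition princ :: "complex \<Rightarrow> complex set" where "princ a = (*) a ` \<O>"

lemma princ_isid:
  assumes "a \<in> \<O>"
  shows "isid (princ a)"
proof -
  have "a * x + a * y \<in> princ a" if "x \<in> \<O>" "y \<in> \<O>" for x y
    unfolding princ_def distrib_left[symmetric] using that O_add by blast
  moreover have "r * (a * x) \<in> princ a" if "r \<in> \<O>" "x \<in> \<O>" for r x
    unfolding princ_def mult.left_commute[of r] using that O_mult by blast
  moreover have "0 \<in> princ a" unfolding princ_def using O_zero by (metis imageI mult_zero_right)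
  ultimately show ?thesis using assms O_mult unfolding isid_def princ_def by blast
qed

lemma princ_self: "a \<in> princ a" unfolding princ_def using O_one by (auto simp: image_iff intro!: bexI[of _ 1])

lemma princ_subset_iff: "isid I \<Longrightarrow> princ a \<subseteq> I \<longleftrightarrow> a \<in> I"
  using princ_self by (auto simp: princ_def intro: isidD)

lemma princ_iprod: "isid I \<Longrightarrow> princ a \<odot> I = (*) a ` I"
  unfolding princ_def iprod_scale by (simp add: iprod_O)

lemma princ_mult: "b \<in> \<O> \<Longrightarrow> princ a \<odot> princ b = princ (a * b)"
  by (subst princ_iprod[OF princ_isid]) (auto simp: princ_def image_image mult.assoc)

lemma G_iprod: "\<sigma> \<in> G \<Longrightarrow> I \<subseteq> K \<Longrightarrow> J \<subseteq> K \<Longrightarrow> \<sigma> ` (I \<odot> J) = \<sigma> ` I \<odot> \<sigma> ` J"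
proof
  assume s: "\<sigma> \<in> G" and IJ: "I \<subseteq> K" "J \<subseteq> K"
  have IJK: "I \<odot> J \<subseteq> K" using IJ by (intro iprod_subsetI) (auto intro: K_mult K_add)
  show "\<sigma> ` (I \<odot> J) \<subseteq> \<sigma> ` I \<odot> \<sigma> ` J"
  proof clarify
    fix x assume "x \<in> I \<odot> J"
    thus "\<sigma> x \<in> \<sigma> ` I \<odot> \<sigma> ` J"
    proof (induction rule: iprod_induct)
      case (mult x y)
      hence "\<sigma> (x * y) = \<sigma> x * \<sigma> y" using s IJ by (intro G_mult) auto
      thus ?case using mult by (auto intro: iprod_mult)
    next
      case (add x y)
      hence "\<sigma> (x + y) = \<sigma> x + \<sigma> y" using s IJK by (intro G_add) auto
      thus ?case using add by (auto intro: iprod_add)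
    qed
  qed
  show "\<sigma> ` I \<odot> \<sigma> ` J \<subseteq> \<sigma> ` (I \<odot> J)"
  proof (intro iprod_subsetI)
    fix x y assume "x \<in> \<sigma> ` I" "y \<in> \<sigma> ` J"
    then obtain a b where "a \<in> I" "x = \<sigma> a" "b \<in> J" "y = \<sigma> b" by auto
    thus "x * y \<in> \<sigma> ` (I \<odot> J)" using G_mult[of \<sigma> a b] s IJ iprod_mult[of a I b J]
      by (metis imageI subsetD)
  next
    fix x y assume "x \<in> \<sigma> ` (I \<odot> J)" "y \<in> \<sigma> ` (I \<odot> J)"
    then obtain a b where "a \<in> I \<odot> J" "x = \<sigma> a" "b \<in> I \<odot> J" "y = \<sigma> b" by auto
    thus "x + y \<in> \<sigma> ` (I \<odot> J)" using G_add[of \<sigma> a b] s IJK iprod_add[of a I J b]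
      by (metis imageI subsetD)
  qed
qed

lemma G_isid:
  assumes s: "\<sigma> \<in> G" and I: "isid I"
  shows "isid (\<sigma> ` I)"
proof -
  obtain \<tau> where t: "\<tau> \<in> G" "\<sigma> \<circ> \<tau> = id" using s inverse_G by blast
  have "r * \<sigma> x \<in> \<sigma> ` I" if "r \<in> \<O>" "x \<in> I" for r x
  proof -
    have "\<sigma> (\<tau> r * x) = r * \<sigma> x"
      using G_mult[OF s, of "\<tau> r" x] t that G_O O_K isidD(1)[OF I] by (metis comp_apply id_apply)
    thus ?thesis using isidD(4)[OF I, of "\<tau> r" x] that t G_O by (metis imageI)
  qed
  moreover have "\<sigma> x + \<sigma> y \<in> \<sigma> ` I" if "x \<in> I" "y \<in> I" for x y
    using G_add[OF s, of x y] that isidD(1,3)[OF I] O_K by (metis imageI)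
  ultimately show ?thesis using isidD(1,2)[OF I] G_O[OF s] G_zero[OF s]
    unfolding isid_def by (force simp: image_iff)
qed

lemma G_princ: "\<sigma> \<in> G \<Longrightarrow> a \<in> K \<Longrightarrow> \<sigma> ` princ a = princ (\<sigma> a)"
proof -
  assume s: "\<sigma> \<in> G" and a: "a \<in> K"
  have "\<sigma> ` princ a = (\<lambda>x. \<sigma> a * \<sigma> x) ` \<O>"
    unfolding princ_def image_image by (intro image_cong refl) (simp add: G_mult s a O_K)
  also have "\<dots> = (*) (\<sigma> a) ` \<sigma> ` \<O>" by (simp add: image_image)
  finally show ?thesis by (simp add: princ_def G_image_O s)
qed

text \<open>A nonzero element divides its norm, which is a nonzero rational integer.\<close>

lemma isid_contains_nat:
  assumes "isid I" "I \<noteq> {0}"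
  obtains m :: nat where "m > 0" "of_nat m \<in> I"
proof -
  obtain x where x: "x \<in> I" "x \<noteq> 0" using assms isidD(2)[OF assms(1)] by blast
  hence xO: "x \<in> \<O>" using isidD(1)[OF assms(1)] by blast
  then obtain y where y: "y \<in> \<O>" "N x = x * y" using N_cofactor by blast
  hence NI: "N x \<in> I" using x isidD(5)[OF assms(1)] by auto
  obtain n where n: "N x = of_int n" using N_O[OF xO] by (auto elim: Ints_cases)
  have "n \<noteq> 0" using n x N_eq_0_iff[of x] by auto
  moreover have "of_int \<bar>n\<bar> \<in> I" using NI n isidD(6)[OF assms(1)] by (cases "n \<ge> 0") auto
  hence "of_nat (nat \<bar>n\<bar>) \<in> I" by simp
  ultimately show ?thesis using that[of "nat \<bar>n\<bar>"] by simp
qed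

end

locale galois_field = galois_extension +
  fixes basis :: "complex list"
  assumes basis: "integral_basis K basis"
begin

subsection \<open>The relative norm of an ideal is generated by a rational integer\<close>

text \<open>The set \<open>A\<close> is a parameter because the arguments below add one automorphism
  at a time. For \<open>A = G\<close> this is the norm of \<open>I\<close>, as an ideal.\<close>

definition ideal_conj_prod :: "(complex \<Rightarrow> complex) set \<Rightarrow> complex set \<Rightarrow> complex set" where
  "ideal_conj_prod A I = finprod M (\<lambda>\<sigma>. \<sigma> ` I) A"

lemma O_coords: "x \<in> \<O> \<Longrightarrow> \<exists>!c :: int list. length c = length basis \<and> x = (\<Sum>i<length basis. of_int (c ! i) * basis ! i)"
  using basis unfolding integral_basis_def by simp

lemma basis_O: "i < length basis \<Longrightarrow> basis ! i \<in> \<O>"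
  using basis unfolding integral_basis_def by auto

text \<open>Kronecker's encoding of an ideal by a polynomial. With a positive integer
  \<open>m\<close> in \<open>I\<close>, the coordinates of members of \<open>I\<close> modulo
  \<open>m\<close> take finitely many values; \<open>m\<close> and one representative for each value
  generate \<open>I\<close>. Generation is phrased through sets \<open>T\<close> because the use
  below has a \<open>T\<close> that may reach outside the ring of integers.\<close>

lemma ideal_generating_poly:
  assumes I: "isid I" "I \<noteq> {0}"
  obtains f where "\<And>i. coeff f i \<in> I"
    "\<And>T. (\<And>x y. x \<in> T \<Longrightarrow> y \<in> T \<Longrightarrow> x + y \<in> T) \<Longrightarrow> (\<And>r x. r \<in> \<O> \<Longrightarrow> x \<in> T \<Longrightarrow> r * x \<in> T)
        \<Longrightarrow> (\<And>i. coeff f i \<in> T) \<Longrightarrow> I \<subseteq> T"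
proof -
  define n where "n = length basis"
  obtain m where m: "m > 0" "of_nat m \<in> I" using isid_contains_nat[OF I] by blast
  define co where "co x = (THE c :: int list. length c = n \<and> x = (\<Sum>i<n. of_int (c ! i) * basis ! i))" for x
  have co: "length (co x) = n" "x = (\<Sum>i<n. of_int (co x ! i) * basis ! i)" if "x \<in> \<O>" for x
    using theI'[OF O_coords[OF that]] unfolding co_def n_def by auto
  define \<phi> where "\<phi> x = map (\<lambda>k. k mod int m) (co x)" for x
  have IO: "I \<subseteq> \<O>" using isidD(1)[OF I(1)] by blast
  have "\<phi> ` I \<subseteq> {xs. set xs \<subseteq> {0..<int m} \<and> length xs = n}"
    using co(1) IO m by (auto simp: \<phi>_def)
  hence fin: "finite (\<phi> ` I)" using finite_lists_length_eq[of "{0..<int m}" n] finite_subset by auto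
  then obtain vs where vs: "set vs = \<phi> ` I" using finite_list by blast
  have "\<exists>x\<in>I. \<phi> x = w" if "w \<in> \<phi> ` I" for w using that by auto
  then obtain g where g: "\<And>w. w \<in> \<phi> ` I \<Longrightarrow> g w \<in> I \<and> \<phi> (g w) = w" by metis
  define L where "L = of_nat m # map g vs"
  have LI: "set L \<subseteq> I" using m g vs by (auto simp: L_def)
  show ?thesis
  proof (rule that[of "Poly L"])
    show "coeff (Poly L) i \<in> I" for i
      using LI isidD(2)[OF I(1)] by (cases "i < length L") (auto simp: nth_default_def)
  next
    fix T assume T: "\<And>x y. x \<in> T \<Longrightarrow> y \<in> T \<Longrightarrow> x + y \<in> T" "\<And>r x. r \<in> \<O> \<Longrightarrow> x \<in> T \<Longrightarrow> r * x \<in> T"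
      and coeffs: "\<And>i. coeff (Poly L) i \<in> T"
    have LT: "x \<in> T" if xL: "x \<in> set L" for x
    proof -
      obtain i where "i < length L" "x = L ! i" using xL by (metis in_set_conv_nth)
      thus ?thesis using coeffs[of i] by (simp add: nth_default_def del: Poly_map)
    qed
    show "I \<subseteq> T"
    proof
      fix x assume x: "x \<in> I"
      hence xO: "x \<in> \<O>" using isidD(1)[OF I(1)] by blast
      define y where "y = g (\<phi> x)"
      have y: "y \<in> I" "\<phi> y = \<phi> x" using g[of "\<phi> x"] x by (auto simp: y_def)
      have yO: "y \<in> \<O>" using isidD(1)[OF I(1)] y by blast
      \<comment> \<open>The quotient of \<open>x - y\<close> by \<open>m\<close>, computed in
        coordinates.\<close>
      define w where "w = (\<Sum>i<n. of_int ((co x ! i - co y ! i) div int m) * basis ! i)"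
      have w: "w \<in> \<O>" unfolding w_def n_def by (intro O_sum O_mult O_of_int basis_O) auto
      have "x - y = (\<Sum>i<n. of_int (co x ! i - co y ! i) * basis ! i)"
        using co(2)[OF xO] co(2)[OF yO] by (simp add: sum_subtractf algebra_simps)
      also have "\<dots> = (\<Sum>i<n. of_nat m * (of_int ((co x ! i - co y ! i) div int m) * basis ! i))"
      proof (intro sum.cong refl)
        fix i assume i: "i \<in> {..<n}"
        have "\<phi> x ! i = \<phi> y ! i" using y by simp
        hence "co x ! i mod int m = co y ! i mod int m" using i co(1)[OF xO] co(1)[OF yO] by (simp add: \<phi>_def)
        hence "int m dvd co x ! i - co y ! i" by (simp add: mod_eq_dvd_iff)
        then obtain k where "co x ! i - co y ! i = int m * k" by (elim dvdE)
        thus "of_int (co x ! i - co y ! i) * basis ! i =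
            of_nat m * (of_int ((co x ! i - co y ! i) div int m) * basis ! i)" using m by simp
      qed
      finally have "x = w * of_nat m + y" by (simp add: w_def sum_distrib_left algebra_simps)
      moreover have "of_nat m \<in> T" "y \<in> T" using LT x vs by (auto simp: L_def y_def)
      ultimately show "x \<in> T" using T w by metis
    qed
  qed
qed

lemma map_poly_G_mult:
  assumes t: "\<tau> \<in> G" and "\<And>i. coeff p i \<in> K" "\<And>i. coeff q i \<in> K"
  shows "map_poly \<tau> (p * q) = map_poly \<tau> p * map_poly \<tau> q"
proof (rule poly_eqI)
  fix i
  have "\<tau> (\<Sum>j\<le>i. coeff p j * coeff q (i - j)) = (\<Sum>j\<le>i. \<tau> (coeff p j * coeff q (i - j)))"
    using assms by (intro G_sum) (auto intro: K_mult)
  thus "coeff (map_poly \<tau> (p * q)) i = coeff (map_poly \<tau> p * map_poly \<tau> q) i"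
    using assms by (simp add: coeff_map_poly G_zero coeff_mult G_mult)
qed

lemma isid_conj_prod: "A \<subseteq> G \<Longrightarrow> isid I \<Longrightarrow> isid (ideal_conj_prod A I)"
  unfolding ideal_conj_prod_def using M.finprod_closed[of "\<lambda>\<sigma>. \<sigma> ` I" A] G_isid by auto

lemma conj_prod_insert:
  "finite A \<Longrightarrow> \<sigma> \<notin> A \<Longrightarrow> insert \<sigma> A \<subseteq> G \<Longrightarrow> isid I \<Longrightarrow>
    ideal_conj_prod (insert \<sigma> A) I = \<sigma> ` I \<odot> ideal_conj_prod A I"
  unfolding ideal_conj_prod_def using M.finprod_insert[of A \<sigma> "\<lambda>\<sigma>. \<sigma> ` I"] G_isid
  by (simp add: Pi_iff subset_iff)

lemma conj_prod_empty [simp]: "ideal_conj_prod {} I = \<O>"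
  unfolding ideal_conj_prod_def by simp

text \<open>Let \<open>F G\<close> be the product of the conjugates of the generating polynomial and
  \<open>c\<close> the least positive integer in the norm ideal. The coefficients of
  \<open>F G\<close> are integers in that ideal, so \<open>c\<close> divides them and
  \<open>F G\<close> divided by \<open>c\<close> is integral. By the Prague theorem every product of
  conjugates of coefficients is then divisible by \<open>c\<close>, and these products generate the
  norm ideal.\<close>

theorem ideal_norm_principal:
  assumes I: "isid I" "I \<noteq> {0}"
  obtains c :: nat where "c > 0" "ideal_conj_prod G I = princ (of_nat c)"
proof -
  obtain f where fI: "\<And>i. coeff f i \<in> I" and gen: "\<And>T. (\<And>x y. x \<in> T \<Longrightarrow> y \<in> T \<Longrightarrow> x + y \<in> T) \<Longrightarrow>
      (\<And>r x. r \<in> \<O> \<Longrightarrow> x \<in> T \<Longrightarrow> r * x \<in> T) \<Longrightarrow> (\<And>i. coeff f i \<in> T) \<Longrightarrow> I \<subseteq> T"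
    using ideal_generating_poly[OF I] by metis
  have fO: "coeff f i \<in> \<O>" for i using fI isidD(1)[OF I(1)] by blast
  have fK: "coeff f i \<in> K" for i using fO O_K by blast
  have coeff_conj: "coeff (map_poly \<sigma> f) i = \<sigma> (coeff f i)" if "\<sigma> \<in> G" for \<sigma> i
    using that by (simp add: coeff_map_poly G_zero)
  define F where "F A = (\<Prod>\<sigma>\<in>A. map_poly \<sigma> f)" for A :: "(complex \<Rightarrow> complex) set"
  let ?J = "\<lambda>A. ideal_conj_prod A I"
  have coeff_J: "coeff (F A) i \<in> ?J A" if "finite A" "A \<subseteq> G" for A i
    using that
  proof (induction A arbitrary: i rule: finite_induct)
    case empty thus ?case by (simp add: F_def coeff_1)
  next
    case (insert \<sigma> A)
    have "coeff (F (insert \<sigma> A)) i = (\<Sum>j\<le>i. \<sigma> (coeff f j) * coeff (F A) (i - j))"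
      using insert coeff_conj[of \<sigma>] by (simp add: F_def coeff_mult)
    also have "\<dots> \<in> ?J (insert \<sigma> A)"
    proof (rule isid_sum[OF isid_conj_prod[OF insert.prems I(1)]])
      fix j
      show "\<sigma> (coeff f j) * coeff (F A) (i - j) \<in> ?J (insert \<sigma> A)"
        unfolding conj_prod_insert[OF insert.hyps insert.prems I(1)]
        using insert fI by (intro iprod_mult) auto
    qed
    finally show ?case .
  qed
  \<comment> \<open>Induction over \<open>A\<close>: each application of the Prague theorem trades
    the factor \<open>map_poly \<sigma> f\<close> for a scalar \<open>\<sigma> (coeff f i)\<close>
    that is absorbed into \<open>z\<close>.\<close>
  have prague: "z * y \<in> \<O>" if "finite A" "A \<subseteq> G" "z \<in> K" "int_coeffs (smult z (F A))" "y \<in> ?J A" for A z y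
    using that
  proof (induction A arbitrary: z y rule: finite_induct)
    case empty
    have "coeff (smult z (F {})) 0 = z" by (simp add: F_def)
    hence "z \<in> \<O>" using empty unfolding int_coeffs_def \<O>_def by (metis (mono_tags) mem_Collect_eq)
    thus ?case using empty by (auto intro: O_mult)
  next
    case (insert \<sigma> A)
    have s: "\<sigma> \<in> G" and A: "A \<subseteq> G" using insert.prems by auto
    have JA: "isid (?J A)" using isid_conj_prod[OF A I(1)] .
    have FA: "F (insert \<sigma> A) = map_poly \<sigma> f * F A" using insert by (simp add: F_def)
    have 1: "(z * \<sigma> (coeff f i)) * y' \<in> \<O>" if y': "y' \<in> ?J A" for i y'
    proof (rule insert.IH[OF A _ _ y'])
      show "z * \<sigma> (coeff f i) \<in> K" using insert.prems(2) fK G_closed[OF s] by (auto intro: K_mult)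
      have "int_coeffs (map_poly \<sigma> f * smult z (F A))" using insert.prems(3) unfolding FA by simp
      from int_coeffs_smult_of_mult[OF this, of i]
      show "int_coeffs (smult (z * \<sigma> (coeff f i)) (F A))" using coeff_conj[OF s] by (simp add: mult.commute)
    qed
    \<comment> \<open>By the induction hypothesis \<open>T\<close> contains the coefficients of
      \<open>f\<close>, hence all of \<open>I\<close>: integrality passes from the generators to the
      whole ideal.\<close>
    define T where "T = {x \<in> K. \<forall>y'\<in>?J A. z * \<sigma> x * y' \<in> \<O>}"
    have IT: "I \<subseteq> T"
    proof (rule gen)
      show "x + y \<in> T" if "x \<in> T" "y \<in> T" for x y
      proof -
        have "z * \<sigma> (x + y) * y' \<in> \<O>" if "y' \<in> ?J A" for y'
        proof -
          have "z * \<sigma> (x + y) * y' = z * \<sigma> x * y' + z * \<sigma> y * y'"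
            using \<open>x \<in> T\<close> \<open>y \<in> T\<close> G_add[OF s, of x y] by (simp add: T_def algebra_simps)
          thus ?thesis using \<open>x \<in> T\<close> \<open>y \<in> T\<close> that by (auto simp: T_def intro: O_add)
        qed
        thus ?thesis using that by (auto simp: T_def intro: K_add)
      qed
      show "r * x \<in> T" if "r \<in> \<O>" "x \<in> T" for r x
      proof -
        have "z * \<sigma> (r * x) * y' \<in> \<O>" if "y' \<in> ?J A" for y'
        proof -
          have "z * \<sigma> (r * x) * y' = \<sigma> r * (z * \<sigma> x * y')"
            using \<open>x \<in> T\<close> \<open>r \<in> \<O>\<close> G_mult[OF s, of r x] O_K[of r] by (simp add: T_def algebra_simps)
          also have "\<dots> \<in> \<O>"
            using \<open>x \<in> T\<close> \<open>r \<in> \<O>\<close> G_O[OF s, of r] that unfolding T_def by (blast intro: O_mult)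
          finally show ?thesis .
        qed
        thus ?thesis using that by (auto simp: T_def intro: K_mult O_K)
      qed
      show "coeff f i \<in> T" for i using 1 fK by (auto simp: T_def)
    qed
    from insert.prems(4) have "y \<in> \<sigma> ` I \<odot> ?J A"
      using conj_prod_insert[OF insert.hyps insert.prems(1) I(1)] by simp
    thus ?case
    proof (induction rule: iprod_induct)
      case (mult x y)
      thus ?case using IT by (auto simp: T_def mult.assoc)
    next
      case (add x y)
      thus ?case by (auto simp: distrib_left intro: O_add)
    qed
  qed
  have map_F: "map_poly \<tau> (F A) = (\<Prod>\<sigma>\<in>A. map_poly (\<tau> \<circ> \<sigma>) f)" if t: "\<tau> \<in> G" and "finite A" "A \<subseteq> G" for \<tau> A
    using that(2,3)
  proof (induction A rule: finite_induct)
    case empty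
    show ?case using t by (simp add: F_def map_poly_1' G_one)
  next
    case (insert \<sigma> A)
    have s: "\<sigma> \<in> G" using insert by auto
    have A: "A \<subseteq> G" using insert by auto
    have "map_poly \<tau> (F (insert \<sigma> A)) = map_poly \<tau> (map_poly \<sigma> f * F A)" using insert by (simp add: F_def)
    also have "\<dots> = map_poly \<tau> (map_poly \<sigma> f) * map_poly \<tau> (F A)"
    proof (rule map_poly_G_mult[OF t])
      show "coeff (map_poly \<sigma> f) i \<in> K" for i using coeff_conj[OF s] G_closed[OF s fK] by simp
      show "coeff (F A) i \<in> K" for i
        using coeff_J[OF insert.hyps(1) A] isidD(1)[OF isid_conj_prod[OF A I(1)]] O_K by blast
    qed
    also have "map_poly \<tau> (map_poly \<sigma> f) = map_poly (\<tau> \<circ> \<sigma>) f"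
      using t s by (simp add: map_poly_map_poly G_zero)
    finally show ?case using insert by (simp add: comp_def)
  qed
  have J: "isid (?J G)" using isid_conj_prod[OF _ I(1)] by simp
  \<comment> \<open>An automorphism permutes the factors of \<open>F G\<close>, so the coefficients
    are fixed by \<open>G\<close>.\<close>
  have F_int: "coeff (F G) i \<in> \<int>" for i
  proof (rule O_fixed)
    show "coeff (F G) i \<in> \<O>" using coeff_J[OF finite_G] isidD(1)[OF J] by blast
    fix \<tau> assume t: "\<tau> \<in> G"
    have "map_poly \<tau> (F G) = F G"
      unfolding map_F[OF t finite_G order_refl] unfolding F_def
      by (rule prod.reindex_bij_betw[OF G_bij[OF t], of "\<lambda>\<sigma>. map_poly \<sigma> f"])
    thus "\<tau> (coeff (F G) i) = coeff (F G) i" using t by (metis G_zero coeff_map_poly)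
  qed
  have "f \<noteq> 0"
  proof
    assume "f = 0"
    hence "I \<subseteq> {0}" by (intro gen) auto
    thus False using I isidD(2) by auto
  qed
  hence "map_poly \<sigma> f \<noteq> 0" if "\<sigma> \<in> G" for \<sigma>
    using that coeff_conj[OF that] G_eq_0_iff[OF that] by (metis coeff_0 leading_coeff_neq_0)
  hence "F G \<noteq> 0" using finite_G by (simp add: F_def)
  hence "?J G \<noteq> {0}" using coeff_J[OF finite_G order_refl, of "degree (F G)"] by auto
  then obtain m where m: "m > 0" "of_nat m \<in> ?J G" using isid_contains_nat[OF J] by blast
  define c where "c = (LEAST c. c > 0 \<and> of_nat c \<in> ?J G)"
  have c: "c > 0" "of_nat c \<in> ?J G" using LeastI[of "\<lambda>c. c > 0 \<and> of_nat c \<in> ?J G" m] m by (auto simp: c_def)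
  have c_le: "c \<le> k" if "k > 0" "of_nat k \<in> ?J G" for k
    unfolding c_def by (rule Least_le) (use that in auto)
  \<comment> \<open>Division with remainder: the integers in the norm ideal are multiples of its
    least positive one. This applies to the coefficients of \<open>F G\<close>.\<close>
  have c_dvd: "int c dvd k" if "of_int k \<in> ?J G" for k
  proof (rule ccontr)
    assume "\<not> int c dvd k"
    hence "k mod int c \<noteq> 0" by (simp add: mod_eq_0_iff_dvd)
    moreover have "k mod int c \<ge> 0" using c by simp
    ultimately have pos: "k mod int c > 0" by linarith
    have "of_int (k mod int c) = of_int k - of_int (k div int c) * (of_nat c :: complex)"
      by (metis minus_div_mult_eq_mod of_int_diff of_int_mult of_int_of_nat_eq)
    also have "\<dots> \<in> ?J G" using that c isidD(4,7)[OF J] by auto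
    finally have "of_nat (nat (k mod int c)) \<in> ?J G" using pos by simp
    hence "c \<le> nat (k mod int c)" using c_le pos by simp
    moreover have "k mod int c < int c" using c by simp
    ultimately show False using pos by linarith
  qed
  have "int_coeffs (smult (1 / of_nat c) (F G))"
    unfolding int_coeffs_def
  proof
    fix i
    obtain k where k: "coeff (F G) i = of_int k" using F_int by (auto elim: Ints_cases)
    hence "int c dvd k" using c_dvd coeff_J[OF finite_G order_refl] by metis
    then obtain l where "k = int c * l" by (elim dvdE)
    thus "algebraic_int (coeff (smult (1 / of_nat c) (F G)) i)" using k c by simp
  qed
  hence div: "(1 / of_nat c) * y \<in> \<O>" if "y \<in> ?J G" for y
    using prague[OF finite_G order_refl K_divide[OF K_one K_of_nat] _ that] by blast
  have "?J G = princ (of_nat c)"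
  proof
    show "princ (of_nat c) \<subseteq> ?J G" using princ_subset_iff[OF J] c by simp
    show "?J G \<subseteq> princ (of_nat c)"
    proof
      fix y assume "y \<in> ?J G"
      hence "y / of_nat c \<in> \<O>" using div by simp
      thus "y \<in> princ (of_nat c)" unfolding princ_def using c by (intro image_eqI[of _ _ "y / of_nat c"]) auto
    qed
  qed
  thus ?thesis using that c by blast
qed

lemma princ_eqD:
  assumes "princ a = princ b" "b \<noteq> 0"
  shows "a / b \<in> \<O>"
proof -
  have "a \<in> princ b" using assms princ_self by auto
  thus ?thesis using assms by (auto simp: princ_def)
qed

lemma princ_of_nat_inj:
  assumes "princ (of_nat a) = princ (of_nat b)" "a > 0" "b > 0"
  shows "a = b"
proof -
  have "a \<le> b" if "princ (of_nat a) = princ (of_nat b)" "a > 0" "b > 0" for a b :: nat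
  proof -
    have "of_nat b / of_nat a \<in> \<O>" using princ_eqD[of "of_nat b" "of_nat a"] that by simp
    hence "of_nat b / of_nat a \<in> (\<int> :: complex set)" by (intro O_Rats) auto
    then obtain k where "of_nat b / of_nat a = (of_int k :: complex)" by (auto elim: Ints_cases)
    hence "(of_int (int b) :: complex) = of_int (k * int a)" using that by (simp add: field_simps)
    hence "int b = k * int a" by (simp only: of_int_eq_iff)
    hence "int a dvd int b" by simp
    thus ?thesis using that dvd_imp_le by auto
  qed
  thus ?thesis using assms by (metis order_antisym)
qed

text \<open>The positive generator of the norm ideal. It is multiplicative for formal reasons
  (\<open>nrm_iprod\<close>) and serves as the measure in the inductions on ideals, whereas
  \<open>ideal_norm\<close> counts residues.\<close>

definition nrm :: "complex set \<Rightarrow> nat" where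
  "nrm I = (THE c. c > 0 \<and> ideal_conj_prod G I = princ (of_nat c))"

lemma nrm:
  assumes "isid I" "I \<noteq> {0}"
  shows "nrm I > 0" "ideal_conj_prod G I = princ (of_nat (nrm I))"
proof -
  obtain c :: nat where c: "c > 0" "ideal_conj_prod G I = princ (of_nat c)"
    using ideal_norm_principal[OF assms] by blast
  have "nrm I = c" unfolding nrm_def
    by (rule the_equality) (use c princ_of_nat_inj in auto)
  thus "nrm I > 0" "ideal_conj_prod G I = princ (of_nat (nrm I))" using c by auto
qed

lemma nrm_eqI:
  assumes "isid I" "I \<noteq> {0}" "c > 0" "ideal_conj_prod G I = princ (of_nat c)"
  shows "nrm I = c"
  using nrm[OF assms(1,2)] assms(3,4) princ_of_nat_inj by metis

definition nzid :: "complex set \<Rightarrow> bool" where "nzid I \<longleftrightarrow> isid I \<and> I \<noteq> {0}"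

lemma nzidD: "nzid I \<Longrightarrow> isid I" by (simp add: nzid_def)

lemma nzid_nonzero: "nzid I \<Longrightarrow> \<exists>x\<in>I. x \<noteq> 0" unfolding nzid_def using isidD(2) by blast

lemma nzidI: "isid I \<Longrightarrow> x \<in> I \<Longrightarrow> x \<noteq> 0 \<Longrightarrow> nzid I" unfolding nzid_def by auto

lemma nzid_O [simp]: "nzid \<O>" by (rule nzidI[of _ 1]) auto

lemma nzid_iprod: "nzid I \<Longrightarrow> nzid J \<Longrightarrow> nzid (I \<odot> J)"
proof -
  assume IJ: "nzid I" "nzid J"
  then obtain x y where "x \<in> I" "y \<in> J" "x \<noteq> 0" "y \<noteq> 0" using nzid_nonzero by metis
  thus ?thesis using IJ by (intro nzidI[of _ "x * y"] isid_iprod) (auto simp: nzidD intro: iprod_mult)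
qed

lemma nzid_princ: "a \<in> \<O> \<Longrightarrow> a \<noteq> 0 \<Longrightarrow> nzid (princ a)"
  using nzidI[OF princ_isid princ_self] by blast

lemma nzid_G: "\<sigma> \<in> G \<Longrightarrow> nzid I \<Longrightarrow> nzid (\<sigma> ` I)"
  using nzid_nonzero[of I] G_isid[of \<sigma> I] G_eq_0_iff[of \<sigma>] by (metis imageI nzidD nzidI)

lemma nzid_superset: "nzid I \<Longrightarrow> I \<subseteq> J \<Longrightarrow> isid J \<Longrightarrow> nzid J"
  using nzid_nonzero[of I] by (auto intro: nzidI)

text \<open>Splitting the identity off the product of all conjugates leaves an ideal whose product
  with \<open>I\<close> is generated by an integer. This replaces inverses: multiplying by the
  cofactor turns cancellation and division by \<open>I\<close> into the same questions for a
  number.\<close>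

lemma cofactor:
  assumes "nzid I"
  obtains J where "nzid J" "I \<odot> J = princ (of_nat (nrm I))"
proof -
  have I: "isid I" "I \<noteq> {0}" using assms by (auto simp: nzid_def)
  have "G = insert id (G - {id})" using id_G by auto
  hence *: "ideal_conj_prod G I = I \<odot> ideal_conj_prod (G - {id}) I"
    using conj_prod_insert[of "G - {id}" id I] finite_G id_G I by auto
  have J: "isid (ideal_conj_prod (G - {id}) I)" using isid_conj_prod I by auto
  have "of_nat (nrm I) \<in> I \<odot> ideal_conj_prod (G - {id}) I" using nrm[OF I] * princ_self by metis
  moreover have "I \<odot> {0} \<subseteq> {0}" by (intro iprod_subsetI) auto
  ultimately have "ideal_conj_prod (G - {id}) I \<noteq> {0}" using nrm(1)[OF I] by auto
  thus ?thesis using that[of "ideal_conj_prod (G - {id}) I"] * nrm[OF I] J by (auto simp: nzid_def)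
qed

lemma scale_inj: "c \<noteq> 0 \<Longrightarrow> (*) c ` I = (*) c ` J \<Longrightarrow> I = (J :: complex set)"
proof -
  assume c: "c \<noteq> 0" "(*) c ` I = (*) c ` J"
  hence "(*) (inverse c) ` (*) c ` I = (*) (inverse c) ` (*) c ` J" by simp
  thus ?thesis using c(1) by (simp add: image_image mult.assoc[symmetric])
qed

lemma iprod_cancel:
  assumes "nzid I" "isid J" "isid L" "I \<odot> J = I \<odot> L"
  shows "J = L"
proof -
  obtain I' where I': "nzid I'" "I \<odot> I' = princ (of_nat (nrm I))" using cofactor[OF assms(1)] .
  have n: "nrm I > 0" using nrm assms(1) by (auto simp: nzid_def)
  have "(*) (of_nat (nrm I)) ` J = I' \<odot> (I \<odot> J)"
    using princ_iprod[OF assms(2)] I' by (simp add: iprod_assoc[symmetric] iprod_comm)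
  also have "\<dots> = I' \<odot> (I \<odot> L)" using assms by simp
  also have "\<dots> = (*) (of_nat (nrm I)) ` L"
    using princ_iprod[OF assms(3)] I' by (simp add: iprod_assoc[symmetric] iprod_comm)
  finally show ?thesis using scale_inj[of "of_nat (nrm I)" J L] n by simp
qed

lemma isid_scale:
  assumes "isid I" "(*) c ` I \<subseteq> \<O>"
  shows "isid ((*) c ` I)"
proof -
  have "c * x + c * y \<in> (*) c ` I" if "x \<in> I" "y \<in> I" for x y
    unfolding distrib_left[symmetric] using isidD(3)[OF assms(1)] that by auto
  moreover have "r * (c * x) \<in> (*) c ` I" if "r \<in> \<O>" "x \<in> I" for x r
    unfolding mult.left_commute[of r] using isidD(4)[OF assms(1)] that by auto
  moreover have "0 \<in> (*) c ` I" using isidD(2)[OF assms(1)] by force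
  ultimately show ?thesis using assms(2) unfolding isid_def by blast
qed

text \<open>To contain is to divide: the quotient is the cofactor of \<open>J\<close> times
  \<open>I\<close>, divided by \<open>nrm J\<close>. It lies in the ring because \<open>I\<close>
  lies in \<open>J\<close>.\<close>

lemma ideal_dvd:
  assumes "nzid J" "isid I" "I \<subseteq> J"
  obtains L where "isid L" "I = J \<odot> L"
proof -
  obtain J' where J': "nzid J'" "J \<odot> J' = princ (of_nat (nrm J))" using cofactor[OF assms(1)] .
  define c :: complex where "c = of_nat (nrm J)"
  have c: "c \<noteq> 0" using nrm assms(1) by (auto simp: nzid_def c_def)
  define L where "L = (*) (inverse c) ` (J' \<odot> I)"
  have "J' \<odot> I \<subseteq> princ c" using J' assms iprod_mono[of J' J' I J] by (simp add: iprod_comm c_def)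
  hence "inverse c * x \<in> \<O>" if "x \<in> J' \<odot> I" for x
    using that c by (auto simp: princ_def subset_iff image_iff field_simps)
  hence "L \<subseteq> \<O>" by (auto simp: L_def)
  hence "isid L" unfolding L_def using J' assms by (intro isid_scale isid_iprod) (auto simp: nzidD)
  moreover have "J \<odot> L = (*) (inverse c) ` (J \<odot> (J' \<odot> I))"
    unfolding L_def by (subst iprod_comm, subst iprod_scale, subst iprod_comm) simp
  hence "J \<odot> L = (*) (inverse c) ` (*) c ` I"
    using J' princ_iprod[OF assms(2)] by (simp add: iprod_assoc[symmetric] c_def)
  hence "J \<odot> L = I" using c by (simp add: image_image mult.assoc[symmetric])
  ultimately show ?thesis using that by blast
qed

lemma iprod_nzidD:
  assumes "isid I" "isid J" "nzid (I \<odot> J)"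
  shows "nzid I" "nzid J"
  using assms iprod_subset[of I J] iprod_subset[of J I] by (metis iprod_comm nzid_superset)+

lemma nrm_iprod:
  assumes "nzid I" "nzid J"
  shows "nrm (I \<odot> J) = nrm I * nrm J"
proof -
  have IJ: "isid I" "isid J" "I \<noteq> {0}" "J \<noteq> {0}" using assms by (auto simp: nzid_def)
  have sub: "I \<subseteq> K" "J \<subseteq> K" using IJ isidD(1) O_K by blast+
  have "ideal_conj_prod G (I \<odot> J) = finprod M (\<lambda>\<sigma>. \<sigma> ` I \<otimes>\<^bsub>M\<^esub> \<sigma> ` J) G"
    unfolding ideal_conj_prod_def
    by (rule M.finprod_cong') (use sub IJ in \<open>auto simp: G_iprod intro!: isid_iprod G_isid\<close>)
  also have "\<dots> = ideal_conj_prod G I \<otimes>\<^bsub>M\<^esub> ideal_conj_prod G J"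
    unfolding ideal_conj_prod_def by (rule M.finprod_multf) (use IJ in \<open>auto simp: G_isid\<close>)
  also have "\<dots> = princ (of_nat (nrm I * nrm J))"
    using nrm[of I] nrm[of J] IJ princ_mult[of "of_nat (nrm J)" "of_nat (nrm I)"] by simp
  finally show ?thesis using nrm_eqI[of "I \<odot> J"] nzid_iprod[OF assms] nrm(1)[OF IJ(1,3)] nrm(1)[OF IJ(2,4)]
    by (simp add: nzid_def)
qed

lemma nrm_eq_1_iff:
  assumes "nzid I"
  shows "nrm I = 1 \<longleftrightarrow> I = \<O>"
proof
  assume 1: "nrm I = 1"
  obtain J where J: "nzid J" "I \<odot> J = princ (of_nat (nrm I))" using cofactor[OF assms] .
  have "1 \<in> I \<odot> J" using J 1 princ_self[of 1] by simp
  hence "1 \<in> I" using iprod_subset[of I J] assms J nzidD by blast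
  thus "I = \<O>" using isidD(5)[OF nzidD[OF assms], of _ 1] isidD(1)[OF nzidD[OF assms]] by auto
next
  assume "I = \<O>"
  moreover have "nrm (\<O> \<odot> \<O>) = nrm \<O> * nrm \<O>" by (rule nrm_iprod) auto
  ultimately show "nrm I = 1" using iprod_O[OF isid_O] nrm(1)[of \<O>] nzid_O unfolding nzid_def by simp
qed

lemma nrm_of_nat: "n > 0 \<Longrightarrow> nrm (princ (of_nat n)) = n ^ card G"
proof -
  assume n: "n > 0"
  have *: "ideal_conj_prod A (princ (of_nat n)) = princ (of_nat (n ^ card A))" if "finite A" "A \<subseteq> G" for A
    using that
  proof (induction A rule: finite_induct)
    case empty
    have "princ 1 = \<O>" by (auto simp: princ_def)
    thus ?case by simp
  next
    case (insert \<sigma> A)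
    hence s: "\<sigma> \<in> G" by auto
    have "ideal_conj_prod (insert \<sigma> A) (princ (of_nat n)) = \<sigma> ` princ (of_nat n) \<odot> ideal_conj_prod A (princ (of_nat n))"
      by (rule conj_prod_insert) (use insert princ_isid in auto)
    also have "\<sigma> ` princ (of_nat n) = princ (of_nat n)" using G_princ[OF s, of "of_nat n"] G_of_nat[OF s] by simp
    finally show ?case using insert princ_mult[of "of_nat (n ^ card A)" "of_nat n"] by (simp del: of_nat_power)
  qed
  show ?thesis
    by (rule nrm_eqI) (use n nzid_princ[of "of_nat n"] *[OF finite_G] in \<open>auto simp: nzid_def\<close>)
qed

subsection \<open>Valuations\<close>

definition maxs :: "complex set set" where "maxs = {P. maximalideal P R}"

text \<open>Shows that the ideal generated by 2 is proper, which excludes \<open>{0}\<close> as a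
  maximal ideal.\<close>

lemma half_not_O: "1 / 2 \<notin> \<O>"
proof
  assume "1 / 2 \<in> \<O>"
  hence "(1 / 2 :: complex) \<in> \<int>" by (intro O_Rats) auto
  then obtain k where "1 / 2 = (of_int k :: complex)" by (auto elim: Ints_cases)
  hence "(of_int 1 :: complex) = of_int (k * 2)" by (simp add: field_simps)
  hence "1 = k * 2" by (simp only: of_int_eq_iff)
  thus False by presburger
qed

lemma maxsD:
  assumes "P \<in> maxs"
  shows "nzid P" "P \<noteq> \<O>" "isid J \<Longrightarrow> P \<subseteq> J \<Longrightarrow> J = P \<or> J = \<O>"
    "x \<in> \<O> \<Longrightarrow> y \<in> \<O> \<Longrightarrow> x * y \<in> P \<Longrightarrow> x \<in> P \<or> y \<in> P"
proof -
  interpret maximalideal P R using assms by (simp add: maxs_def)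
  have P: "isid P" using ideal_axioms ideal_iff by simp
  show "P \<noteq> \<O>" using I_notcarr by auto
  show *: "isid J \<Longrightarrow> P \<subseteq> J \<Longrightarrow> J = P \<or> J = \<O>" for J
  proof -
    assume J: "isid J" "P \<subseteq> J"
    hence "J \<subseteq> carrier R" by (simp add: isid_def)
    thus ?thesis using I_maximal[of J] ideal_iff[of J] J by simp
  qed
  have "P \<noteq> {0}"
  proof
    assume P0: "P = {0}"
    have "(2 :: complex) = of_nat 2" by simp
    hence i2: "isid (princ 2)" using princ_isid O_of_nat by metis
    have "P \<subseteq> princ 2" unfolding P0 using isidD(2)[OF i2] by blast
    hence "princ 2 = P \<or> princ 2 = \<O>" by (rule *[OF i2])
    moreover have "2 \<in> princ 2" by (rule princ_self)
    moreover have "2 \<notin> P" unfolding P0 by simp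
    ultimately have "1 \<in> princ 2" using O_one by blast
    then obtain x where "x \<in> \<O>" "1 = 2 * x" unfolding princ_def by blast
    moreover from this have "x = 1 / 2" by (simp add: field_simps)
    ultimately show False using half_not_O by simp
  qed
  thus "nzid P" using P by (simp add: nzid_def)
  have "primeideal P R" by (rule R.maximalideal_prime) (rule maximalideal_axioms)
  then interpret prime: primeideal P R .
  show "x \<in> \<O> \<Longrightarrow> y \<in> \<O> \<Longrightarrow> x * y \<in> P \<Longrightarrow> x \<in> P \<or> y \<in> P"
    using prime.I_prime[of x y] by simp
qed

lemma maxsI:
  assumes "isid P" "P \<noteq> \<O>" "\<And>J. isid J \<Longrightarrow> P \<subseteq> J \<Longrightarrow> J = P \<or> J = \<O>"
  shows "P \<in> maxs"
proof -
  have "maximalideal P R"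
  proof (rule maximalidealI)
    show "ideal P R" "carrier R \<noteq> P" using assms by (auto simp: ideal_iff)
    show "J = P \<or> J = carrier R" if "ideal J R" "P \<subseteq> J" "J \<subseteq> carrier R" for J
      using assms(3)[of J] that by (simp add: ideal_iff)
  qed
  thus ?thesis by (simp add: maxs_def)
qed

lemma maxs_isid: "P \<in> maxs \<Longrightarrow> isid P" using maxsD(1) nzidD by blast

lemma maxs_one: "P \<in> maxs \<Longrightarrow> 1 \<notin> P"
  using maxsD(2) isidD(1,5)[OF maxs_isid, of P] by (metis mult_1 subsetI subset_antisym)

lemma maxs_eqI: "P \<in> maxs \<Longrightarrow> Q \<in> maxs \<Longrightarrow> P \<subseteq> Q \<Longrightarrow> P = Q"
  using maxsD(2,3) maxs_isid by metis

lemma maxs_prime: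
  assumes P: "P \<in> maxs" and I: "isid I" and J: "isid J" and IJ: "I \<odot> J \<subseteq> P"
  shows "I \<subseteq> P \<or> J \<subseteq> P"
proof (rule ccontr)
  assume "\<not> ?thesis"
  then obtain x y where xy: "x \<in> I" "x \<notin> P" "y \<in> J" "y \<notin> P" by blast
  hence "x * y \<in> P" using IJ iprod_mult by blast
  thus False using xy maxsD(4)[OF P] isidD(1)[OF I] isidD(1)[OF J] by blast
qed

lemma maxs_G: "\<sigma> \<in> G \<Longrightarrow> P \<in> maxs \<Longrightarrow> \<sigma> ` P \<in> maxs"
proof (rule maxsI)
  assume s: "\<sigma> \<in> G" and P: "P \<in> maxs"
  obtain \<tau> where t: "\<tau> \<in> G" "\<sigma> \<circ> \<tau> = id" "\<tau> \<circ> \<sigma> = id" using s inverse_G by blast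
  have ts: "\<tau> ` \<sigma> ` J = J" "\<sigma> ` \<tau> ` J = J" for J using t by (auto simp: image_comp)
  show "isid (\<sigma> ` P)" using G_isid s maxs_isid P by blast
  show "\<sigma> ` P \<noteq> \<O>" using ts(1)[of P] maxsD(2)[OF P] G_image_O[OF t(1)] by metis
  fix J assume J: "isid J" "\<sigma> ` P \<subseteq> J"
  hence "P \<subseteq> \<tau> ` J" using ts by (metis image_mono)
  hence "\<tau> ` J = P \<or> \<tau> ` J = \<O>" using maxsD(3)[OF P] G_isid[OF t(1) J(1)] by blast
  thus "J = \<sigma> ` P \<or> J = \<O>" using ts(2)[of J] G_image_O[OF s] by metis
qed

text \<open>Among the proper ideals containing \<open>I\<close>, one of least \<open>nrm\<close> is
  maximal: a strictly larger ideal would divide it with a cofactor of norm at least 2, and so have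
  smaller norm.\<close>

lemma exists_maxs:
  assumes "nzid I" "I \<noteq> \<O>"
  obtains P where "P \<in> maxs" "I \<subseteq> P"
proof -
  define Q where "Q J \<longleftrightarrow> isid J \<and> I \<subseteq> J \<and> J \<noteq> \<O>" for J
  have "Q I" using assms by (auto simp: Q_def nzidD)
  then obtain P where P: "Q P" "\<And>J. Q J \<Longrightarrow> nrm P \<le> nrm J"
    using ex_has_least_nat[of Q I nrm] by blast
  have nzP: "nzid P" using P(1) assms nzid_superset unfolding Q_def by blast
  have "P \<in> maxs"
  proof (rule maxsI)
    show "isid P" "P \<noteq> \<O>" using P by (auto simp: Q_def)
    fix J assume J: "isid J" "P \<subseteq> J"
    show "J = P \<or> J = \<O>"
    proof (rule ccontr)
      assume n: "\<not> ?thesis"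
      hence "Q J" using J P(1) by (auto simp: Q_def)
      hence le: "nrm P \<le> nrm J" by (rule P(2))
      have nzJ: "nzid J" using nzP J nzid_superset by blast
      obtain L where L: "isid L" "P = J \<odot> L" using ideal_dvd[OF nzJ nzidD[OF nzP] J(2)] .
      have nzL: "nzid L" using iprod_nzidD L J nzP by metis
      have "nrm P = nrm J * nrm L" using nrm_iprod nzJ nzL L by simp
      moreover have "nrm L \<noteq> 1" using nrm_eq_1_iff[OF nzL] L n iprod_O[OF J(1)] iprod_comm by metis
      moreover have "nrm L > 0" "nrm J > 0" using nzL nzJ nrm by (auto simp: nzid_def)
      ultimately show False using le by (cases "nrm L") auto
    qed
  qed
  thus ?thesis using that P by (auto simp: Q_def)
qed

abbreviation pw :: "complex set \<Rightarrow> nat \<Rightarrow> complex set" where "pw I e \<equiv> I [^]\<^bsub>M\<^esub> e"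

lemma isid_pw: "isid I \<Longrightarrow> isid (pw I e)" using M.nat_pow_closed[of I e] by simp
lemma pw_add: "isid I \<Longrightarrow> pw I (a + b) = pw I a \<odot> pw I b" using M.nat_pow_mult[of I a b] by simp
lemma nzid_pw: "nzid I \<Longrightarrow> nzid (pw I e)" by (induction e) (auto intro: nzid_iprod)
lemma pw_antimono: "isid I \<Longrightarrow> a \<le> b \<Longrightarrow> pw I b \<subseteq> pw I a"
  using pw_add[of I a "b - a"] iprod_subset[of "pw I a" "pw I (b - a)"] isid_pw by auto
lemma nrm_pw: "nzid I \<Longrightarrow> nrm (pw I e) = nrm I ^ e"
  by (induction e) (auto simp: nrm_iprod nzid_pw nrm_eq_1_iff[THEN iffD2])
text \<open>The exponent of \<open>P\<close> in the factorization, read off from containment in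
  powers. The maximum exists for nonzero ideals by \<open>pw_bound\<close>.\<close>

definition v :: "complex set \<Rightarrow> complex set \<Rightarrow> nat" where
  "v P I = (GREATEST e. I \<subseteq> pw P e)"

text \<open>By multiplicativity \<open>nrm I\<close> is a multiple of \<open>nrm P ^ e\<close>,
  which is at least \<open>2 ^ e\<close>. The crude bound serves to make the maximum in
  \<open>v\<close> exist.\<close>

lemma pw_bound:
  assumes P: "P \<in> maxs" and I: "nzid I" and le: "I \<subseteq> pw P e"
  shows "e \<le> nrm I"
proof -
  have nzP: "nzid P" using maxsD(1)[OF P] .
  obtain L where L: "isid L" "I = pw P e \<odot> L" using ideal_dvd[OF nzid_pw[OF nzP] nzidD[OF I] le] .
  have nzL: "nzid L" using iprod_nzidD L I isid_pw nzP nzidD by metis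
  have "nrm I = nrm P ^ e * nrm L" using nrm_iprod nzid_pw nzP nzL nrm_pw L by metis
  moreover have "nrm L > 0" "nrm P > 0" using nzL nzP nrm by (auto simp: nzid_def)
  moreover have "nrm P \<noteq> 1" using nrm_eq_1_iff[OF nzP] maxsD(2)[OF P] by simp
  ultimately have "2 ^ e \<le> nrm I"
    using power_mono[of 2 "nrm P" e] by (metis One_nat_def Suc_1 Suc_leI le_neq_implies_less mult_le_mono mult.right_neutral zero_le)
  thus ?thesis using less_exp[of e] by linarith
qed

lemma v_iff:
  assumes P: "P \<in> maxs" and I: "nzid I"
  shows "I \<subseteq> pw P e \<longleftrightarrow> e \<le> v P I"
proof
  show "I \<subseteq> pw P e \<Longrightarrow> e \<le> v P I"
    unfolding v_def by (rule Greatest_le_nat[of _ _ "nrm I"]) (use pw_bound[OF P I] in auto)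
  have "I \<subseteq> pw P (v P I)"
    unfolding v_def
    by (rule GreatestI_nat[of "\<lambda>e. I \<subseteq> pw P e" 0 "nrm I"])
       (use pw_bound[OF P I] isidD(1)[OF nzidD[OF I]] in auto)
  thus "e \<le> v P I \<Longrightarrow> I \<subseteq> pw P e" using pw_antimono[OF maxs_isid[OF P]] by blast
qed

lemma v_pos_iff: "P \<in> maxs \<Longrightarrow> nzid I \<Longrightarrow> v P I \<ge> 1 \<longleftrightarrow> I \<subseteq> P"
  using v_iff[of P I 1] M.nat_pow_eone[of P] maxs_isid by simp

lemma v_eqI:
  assumes P: "P \<in> maxs" and J: "isid J" "\<not> J \<subseteq> P" and I: "nzid I" "I = pw P e \<odot> J"
  shows "v P I = e"
proof -
  have nzP: "nzid P" using maxsD(1)[OF P] .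
  have "I \<subseteq> pw P e" using I iprod_subset isid_pw nzidD nzP J by metis
  moreover have "\<not> I \<subseteq> pw P (Suc e)"
  proof
    assume "I \<subseteq> pw P (Suc e)"
    then obtain L where L: "isid L" "I = pw P (Suc e) \<odot> L"
      using ideal_dvd[OF nzid_pw[OF nzP] nzidD[OF I(1)]] by metis
    hence "pw P e \<odot> J = pw P e \<odot> (P \<odot> L)" using I by (simp add: iprod_assoc)
    hence "J = P \<odot> L"
      using iprod_cancel[OF nzid_pw[OF nzP] J(1) isid_iprod] nzidD[OF nzP] L by blast
    thus False using J iprod_subset nzidD[OF nzP] L by metis
  qed
  ultimately show ?thesis using v_iff[OF P I(1)] by (metis le_antisym not_less_eq_eq)
qed

lemma v_decomp:
  assumes P: "P \<in> maxs" and I: "nzid I"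
  obtains J where "nzid J" "\<not> J \<subseteq> P" "I = pw P (v P I) \<odot> J"
proof -
  have nzP: "nzid P" using maxsD(1)[OF P] .
  have "I \<subseteq> pw P (v P I)" using v_iff[OF P I] by blast
  then obtain J where J: "isid J" "I = pw P (v P I) \<odot> J"
    using ideal_dvd[OF nzid_pw[OF nzP] nzidD[OF I]] by metis
  have nzJ: "nzid J" using iprod_nzidD J I isid_pw nzidD[OF nzP] by metis
  have "\<not> J \<subseteq> P"
  proof
    assume "J \<subseteq> P"
    hence "pw P (v P I) \<odot> J \<subseteq> pw P (v P I) \<odot> P" by (intro iprod_mono order_refl)
    hence "I \<subseteq> pw P (v P I) \<odot> P" using J by metis
    hence "I \<subseteq> pw P (Suc (v P I))" by simp
    thus False using v_iff[OF P I, of "Suc (v P I)"] by simp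
  qed
  thus ?thesis using that J nzJ by blast
qed

text \<open>Split off the full power of \<open>P\<close> from both ideals. The two remaining factors
  do not lie in \<open>P\<close>, and neither does their product, since \<open>P\<close> is
  prime.\<close>

lemma v_iprod:
  assumes P: "P \<in> maxs" and I: "nzid I" and J: "nzid J"
  shows "v P (I \<odot> J) = v P I + v P J"
proof -
  obtain I' where I': "nzid I'" "\<not> I' \<subseteq> P" "I = pw P (v P I) \<odot> I'" using v_decomp[OF P I] .
  obtain J' where J': "nzid J'" "\<not> J' \<subseteq> P" "J = pw P (v P J) \<odot> J'" using v_decomp[OF P J] .
  have "I \<odot> J = (pw P (v P I) \<odot> I') \<odot> (pw P (v P J) \<odot> J')" using I'(3) J'(3) by simp
  also have "\<dots> = (pw P (v P I) \<odot> pw P (v P J)) \<odot> (I' \<odot> J')"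
    by (metis iprod_assoc iprod_comm)
  finally have "I \<odot> J = pw P (v P I + v P J) \<odot> (I' \<odot> J')"
    using pw_add[OF maxs_isid[OF P]] by simp
  moreover have "\<not> I' \<odot> J' \<subseteq> P" using maxs_prime[OF P] I' J' nzidD by blast
  ultimately show ?thesis using v_eqI[OF P] I I' J J' nzid_iprod nzidD by metis
qed

lemma v_O: "P \<in> maxs \<Longrightarrow> v P \<O> = 0"
  using v_pos_iff[of P \<O>] maxs_one[of P] O_one nzid_O by (metis less_one not_less subsetD)

lemma v_pw: "P \<in> maxs \<Longrightarrow> nzid I \<Longrightarrow> v P (pw I e) = e * v P I"
  by (induction e) (auto simp: v_O v_iprod nzid_pw)

lemma v_self: "P \<in> maxs \<Longrightarrow> Q \<in> maxs \<Longrightarrow> v P Q = (if P = Q then 1 else 0)"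
proof (cases "P = Q")
  case True
  assume P: "P \<in> maxs"
  have "v P P = 1"
  proof (rule v_eqI[OF P isid_O])
    show "\<not> \<O> \<subseteq> P" using maxs_one[OF P] O_one by blast
    show "P = pw P 1 \<odot> \<O>"
      using iprod_O[OF maxs_isid[OF P]] M.nat_pow_eone[of P] maxs_isid[OF P] by (simp add: iprod_comm)
  qed (rule maxsD(1)[OF P])
  thus ?thesis using True by simp
next
  case False
  assume "P \<in> maxs" "Q \<in> maxs"
  thus ?thesis using False v_pos_iff[of P Q] maxs_eqI[of Q P] maxsD(1)[of Q] by force
qed

text \<open>Induction on the norm of \<open>J\<close>: a prime containing \<open>J\<close> also
  contains \<open>I\<close>, and dividing both by it lowers both valuations there by one. Applied in
  both directions this is uniqueness of factorization: the valuations determine the ideal.\<close>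

lemma ideal_le_of_v_le:
  assumes "nzid I" "nzid J" "\<And>P. P \<in> maxs \<Longrightarrow> v P J \<le> v P I"
  shows "I \<subseteq> J"
  using assms
proof (induction "nrm J" arbitrary: I J rule: less_induct)
  case less
  show ?case
  proof (cases "J = \<O>")
    case True thus ?thesis using isidD(1)[OF nzidD[OF less.prems(1)]] by auto
  next
    case False
    then obtain P where P: "P \<in> maxs" "J \<subseteq> P" using exists_maxs less.prems by blast
    have nzP: "nzid P" using maxsD(1)[OF P(1)] .
    have "v P J \<ge> 1" using v_pos_iff P less.prems by blast
    hence "v P I \<ge> 1" using less.prems(3)[OF P(1)] by simp
    hence IP: "I \<subseteq> P" using v_pos_iff P less.prems by blast
    obtain I' where I': "isid I'" "I = P \<odot> I'" using ideal_dvd[OF nzP nzidD IP] less.prems by blast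
    obtain J' where J': "isid J'" "J = P \<odot> J'" using ideal_dvd[OF nzP nzidD P(2)] less.prems by blast
    have nz: "nzid I'" "nzid J'" using iprod_nzidD I' J' less.prems nzidD[OF nzP] by metis+
    have "nrm J = nrm P * nrm J'" using nrm_iprod nz nzP J' by simp
    moreover have "nrm P > 0" "nrm J' > 0" using nzP nz nrm by (auto simp: nzid_def)
    moreover have "nrm P \<noteq> 1" using nrm_eq_1_iff[OF nzP] maxsD(2)[OF P(1)] by simp
    ultimately have "nrm J' < nrm J" by (cases "nrm P") auto
    hence "I' \<subseteq> J'"
    proof (rule less.hyps)
      show "v Q J' \<le> v Q I'" if "Q \<in> maxs" for Q
        using less.prems(3)[OF that] v_iprod[OF that nzP] nz I' J' by simp
    qed (use nz in auto)
    thus ?thesis using I' J' iprod_mono[of P P I' J'] by simp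
  qed
qed

lemma ideal_eq_of_v_eq:
  "nzid I \<Longrightarrow> nzid J \<Longrightarrow> (\<And>P. P \<in> maxs \<Longrightarrow> v P I = v P J) \<Longrightarrow> I = J"
  using ideal_le_of_v_le[of I J] ideal_le_of_v_le[of J I] by fastforce

lemma v_mono: "P \<in> maxs \<Longrightarrow> nzid I \<Longrightarrow> nzid J \<Longrightarrow> I \<subseteq> J \<Longrightarrow> v P J \<le> v P I"
  using v_iff[of P I] v_iff[of P J] by blast

lemma G_pw: "\<sigma> \<in> G \<Longrightarrow> isid I \<Longrightarrow> \<sigma> ` pw I e = pw (\<sigma> ` I) e"
proof (induction e)
  case 0 thus ?case by (simp add: G_image_O)
next
  case (Suc e)
  have "I \<subseteq> K" "pw I e \<subseteq> K" using isidD(1) Suc.prems isid_pw[of I e] O_K by blast+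
  thus ?case using Suc G_iprod by simp
qed

lemma v_G:
  assumes s: "\<sigma> \<in> G" and P: "P \<in> maxs" and I: "nzid I"
  shows "v (\<sigma> ` P) (\<sigma> ` I) = v P I"
proof -
  have "\<sigma> ` I \<subseteq> pw (\<sigma> ` P) e \<longleftrightarrow> I \<subseteq> pw P e" for e
    unfolding G_pw[OF s maxs_isid[OF P], symmetric] by (rule inj_image_subset_iff[OF G_inj[OF s]])
  thus ?thesis unfolding v_def by simp
qed

lemma finprod_nzid: "finite A \<Longrightarrow> (\<And>a. a \<in> A \<Longrightarrow> nzid (f a)) \<Longrightarrow> nzid (finprod M f A)"
proof (induction A rule: finite_induct)
  case (insert x A)
  thus ?case using M.finprod_insert[of A x f] by (auto simp: nzidD Pi_iff intro: nzid_iprod)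
qed auto

lemma v_finprod:
  assumes P: "P \<in> maxs" and "finite A" "\<And>a. a \<in> A \<Longrightarrow> nzid (f a)"
  shows "v P (finprod M f A) = (\<Sum>a\<in>A. v P (f a))"
  using assms(2,3)
proof (induction A rule: finite_induct)
  case empty thus ?case by (simp add: v_O P)
next
  case (insert x A)
  thus ?case using M.finprod_insert[of A x f] finprod_nzid[of A f] v_iprod[OF P, of "f x" "finprod M f A"]
    by (auto simp: nzidD Pi_iff)
qed

subsection \<open>Primes above a rational prime\<close>

lemma primes_above_eq: "primes_above K p = {P \<in> maxs. of_nat p \<in> P}"
  by (simp add: primes_above_def maxs_def)

lemma primes_above_exists:
  assumes "Factorial_Ring.prime p"
  obtains P where "P \<in> primes_above K p"
proof -
  have "princ (of_nat p) \<noteq> \<O>"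
    using nrm_of_nat[of p] nrm_eq_1_iff[of "princ (of_nat p)"] nzid_princ[of "of_nat p"] prime_gt_1_nat[OF assms]
      finite_G id_G by (auto simp: card_gt_0_iff)
  then obtain P where "P \<in> maxs" "princ (of_nat p) \<subseteq> P"
    using exists_maxs[of "princ (of_nat p)"] nzid_princ[of "of_nat p"] prime_gt_0_nat[OF assms] by auto
  thus ?thesis using that princ_subset_iff[OF maxs_isid] by (auto simp: primes_above_eq)
qed

lemma maxs_above:
  assumes "P \<in> maxs"
  obtains p where "Factorial_Ring.prime p" "P \<in> primes_above K p"
proof -
  obtain m where m: "m > 0" "of_nat m \<in> P" using isid_contains_nat maxsD(1)[OF assms] unfolding nzid_def by blast
  have "\<exists>p. Factorial_Ring.prime p \<and> of_nat p \<in> P" if "m > 0" "of_nat m \<in> P" for m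
    using that
  proof (induction m rule: less_induct)
    case (less m)
    have "m \<noteq> 1" using less maxs_one[OF assms] by auto
    then obtain p k where p: "Factorial_Ring.prime p" "m = p * k" using prime_factor_nat[of m] by (auto elim: dvdE)
    hence "of_nat p \<in> P \<or> of_nat k \<in> P" using maxsD(4)[OF assms, of "of_nat p" "of_nat k"] less by simp
    moreover have "k < m" "k > 0" using p less prime_gt_1_nat[OF p(1)] by auto
    ultimately show ?case using less p by blast
  qed
  thus ?thesis using m that assms by (auto simp: primes_above_eq)
qed

lemma of_int_coprime_maxs:
  assumes P: "P \<in> maxs" and "of_int a \<in> P" "of_int b \<in> P" "coprime a b"
  shows False
proof -
  obtain x y where "x * a + y * b = 1" using bezout_int[of a b] assms(4) by (auto simp: coprime_iff_gcd_eq_1)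
  hence "of_int x * of_int a + of_int y * of_int b = (1 :: complex)"
    by (metis of_int_1 of_int_add of_int_mult)
  thus False using isidD(3,4)[OF maxs_isid[OF P]] assms maxs_one[OF P] O_of_int by metis
qed

lemma of_int_in_primes_above:
  assumes "Factorial_Ring.prime p" "P \<in> primes_above K p"
  shows "of_int a \<in> P \<longleftrightarrow> int p dvd a"
proof
  have P: "P \<in> maxs" "of_int (int p) \<in> P" using assms by (auto simp: primes_above_eq)
  show "of_int a \<in> P \<Longrightarrow> int p dvd a"
    using of_int_coprime_maxs[OF P(1) P(2)] prime_imp_coprime[of "int p" a] assms(1) by auto
  assume "int p dvd a"
  then obtain k where "a = int p * k" by (elim dvdE)
  thus "of_int a \<in> P" using isidD(5)[OF maxs_isid[OF P(1)], of "of_int k"] P(2) by simp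
qed

lemma primes_above_unique:
  assumes "Factorial_Ring.prime p" "Factorial_Ring.prime q" "P \<in> primes_above K p" "P \<in> primes_above K q"
  shows "p = q"
proof -
  have "of_int (int q) \<in> P" using assms by (auto simp: primes_above_eq)
  hence "int p dvd int q" using of_int_in_primes_above assms by blast
  thus ?thesis using assms primes_dvd_imp_eq by (metis of_nat_dvd_iff)
qed

text \<open>The norm of \<open>P\<close> is a power of \<open>p\<close>, so the product of the
  conjugates of \<open>P\<close> lies in \<open>Q\<close>. A prime ideal containing a product
  contains a factor, and maximality turns the inclusion into equality.\<close>

lemma primes_above_transitive:
  assumes p: "Factorial_Ring.prime p" and P: "P \<in> primes_above K p" and Q: "Q \<in> primes_above K p"
  obtains \<sigma> where "\<sigma> \<in> G" "Q = \<sigma> ` P"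
proof -
  have PM: "P \<in> maxs" "of_nat p \<in> P" and QM: "Q \<in> maxs" "of_nat p \<in> Q" using P Q by (auto simp: primes_above_eq)
  have nz: "nzid P" using maxsD(1)[OF PM(1)] .
  \<comment> \<open>\<open>p\<close> lies in every conjugate of \<open>P\<close>, so its power lies
    in their product; this makes the norm \<open>c\<close> a divisor of a power of
    \<open>p\<close>.\<close>
  have pw: "of_nat p ^ card A \<in> ideal_conj_prod A P" if "finite A" "A \<subseteq> G" for A
    using that
  proof (induction A rule: finite_induct)
    case (insert \<sigma> A)
    have "of_nat p \<in> \<sigma> ` P" using PM G_of_nat[of \<sigma> p] insert by (metis image_eqI insert_subset)
    thus ?case using insert by (auto simp: conj_prod_insert maxs_isid[OF PM(1)] intro: iprod_mult)
  qed auto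
  define c where "c = nrm P"
  have c: "c > 0" "ideal_conj_prod G P = princ (of_nat c)" using nrm[of P] nz by (auto simp: c_def nzid_def)
  have "of_nat p ^ card G \<in> princ (of_nat c)" using pw[OF finite_G] c by simp
  then obtain x where x: "x \<in> \<O>" "of_nat p ^ card G = of_nat c * x" by (auto simp: princ_def)
  hence "x = of_nat (p ^ card G) / of_nat c" using c by (simp add: field_simps)
  hence "x \<in> \<rat>" by (simp del: of_nat_power)
  hence "x \<in> \<int>" using x O_Rats by blast
  then obtain k where "x = of_int k" by (auto elim: Ints_cases)
  hence "(of_int (int (p ^ card G)) :: complex) = of_int (int c * k)" using x by simp
  hence "int (p ^ card G) = int c * k" by (simp only: of_int_eq_iff)
  hence "c dvd p ^ card G" by (metis dvd_triv_left of_nat_dvd_iff)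
  then obtain j where j: "c = p ^ j" using p by (metis divides_primepow_nat)
  have "c \<noteq> 1" using nrm_eq_1_iff[OF nz] maxsD(2)[OF PM(1)] by (simp add: c_def)
  hence "p dvd c" using j by (cases j) auto
  hence "of_int (int c) \<in> Q" using of_int_in_primes_above[OF p Q] by (metis of_nat_dvd_iff)
  hence sub: "ideal_conj_prod G P \<subseteq> Q" using c princ_subset_iff[OF maxs_isid[OF QM(1)]] by simp
  have "\<exists>\<sigma>\<in>A. \<sigma> ` P \<subseteq> Q" if "finite A" "A \<subseteq> G" "ideal_conj_prod A P \<subseteq> Q" for A
    using that
  proof (induction A rule: finite_induct)
    case empty
    thus ?case by (metis conj_prod_empty maxs_one[OF QM(1)] O_one subsetD)
  next
    case (insert \<sigma> A)
    have "\<sigma> ` P \<odot> ideal_conj_prod A P \<subseteq> Q"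
      using insert conj_prod_insert[of A \<sigma> P] maxs_isid[OF PM(1)] by simp
    hence "\<sigma> ` P \<subseteq> Q \<or> ideal_conj_prod A P \<subseteq> Q"
      using insert maxs_isid[OF PM(1)] by (intro maxs_prime[OF QM(1)] G_isid isid_conj_prod) auto
    thus ?case using insert by auto
  qed
  then obtain \<sigma> where "\<sigma> \<in> G" "\<sigma> ` P \<subseteq> Q" using finite_G sub by blast
  thus ?thesis using that maxs_eqI[OF maxs_G[OF _ PM(1)] QM(1)] by blast
qed

lemma primes_above_G: "\<sigma> \<in> G \<Longrightarrow> P \<in> primes_above K p \<Longrightarrow> \<sigma> ` P \<in> primes_above K p"
  using maxs_G G_of_nat[of \<sigma> p] by (auto simp: primes_above_eq image_iff intro!: bexI[of _ "of_nat p"])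

lemma finite_primes_above: "Factorial_Ring.prime p \<Longrightarrow> finite (primes_above K p)"
proof -
  assume p: "Factorial_Ring.prime p"
  obtain P where P: "P \<in> primes_above K p" using primes_above_exists[OF p] .
  have "primes_above K p \<subseteq> (\<lambda>\<sigma>. \<sigma> ` P) ` G" using primes_above_transitive[OF p P] by blast
  thus ?thesis using finite_G finite_subset by blast
qed

text \<open>Since to contain is to divide, divisibility in the monoid of ideals is containment in
  powers of \<open>P\<close>, and the ramification index is a valuation.\<close>

lemma ramification_index_at_eq:
  assumes "P \<in> maxs"
  shows "ramification_index_at K p P = v P (princ (of_nat p))"
proof -
  have "PIdl\<^bsub>R\<^esub> (of_nat p) = princ (of_nat p)"
    by (auto simp: cgenideal_def princ_def mult.commute)
  moreover have "pw P e divides\<^bsub>M\<^esub> princ (of_nat p) \<longleftrightarrow> princ (of_nat p) \<subseteq> pw P e" for e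
  proof
    assume "pw P e divides\<^bsub>M\<^esub> princ (of_nat p)"
    then obtain J where "isid J" "princ (of_nat p) = pw P e \<odot> J" by (auto simp: factor_def)
    thus "princ (of_nat p) \<subseteq> pw P e" using iprod_subset isid_pw maxs_isid[OF assms] by metis
  next
    assume "princ (of_nat p) \<subseteq> pw P e"
    then obtain L where "isid L" "princ (of_nat p) = pw P e \<odot> L"
      using ideal_dvd[OF nzid_pw[OF maxsD(1)[OF assms]] princ_isid[of "of_nat p"]] by auto
    thus "pw P e divides\<^bsub>M\<^esub> princ (of_nat p)" by (auto simp: factor_def)
  qed
  ultimately show ?thesis unfolding ramification_index_at_def v_def by simp
qed

definition e :: "nat \<Rightarrow> nat" where "e p = ramification_index K p"

lemma v_above_eq:
  assumes p: "Factorial_Ring.prime p" and P: "P \<in> primes_above K p" and Q: "Q \<in> primes_above K p" and I: "nzid I"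
    and inv: "\<And>\<sigma>. \<sigma> \<in> G \<Longrightarrow> \<sigma> ` I = I"
  shows "v P I = v Q I"
proof -
  obtain \<sigma> where "\<sigma> \<in> G" "Q = \<sigma> ` P" using primes_above_transitive[OF p P Q] .
  thus ?thesis using v_G[of \<sigma> P I] P I inv by (simp add: primes_above_eq)
qed

text \<open>The ideal generated by \<open>p\<close> is invariant and the primes above
  \<open>p\<close> are conjugate, so all its valuations there agree and the definite description in
  \<open>ramification_index\<close> is met.\<close>

lemma e_eq:
  assumes p: "Factorial_Ring.prime p" and P: "P \<in> primes_above K p"
  shows "v P (princ (of_nat p)) = e p"
proof -
  have nz: "nzid (princ (of_nat p))" using nzid_princ prime_gt_0_nat[OF p] by auto
  have inv: "\<sigma> ` princ (of_nat p) = princ (of_nat p)" if "\<sigma> \<in> G" for \<sigma>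
    using G_princ[OF that, of "of_nat p"] G_of_nat[OF that] by simp
  have *: "ramification_index_at K p Q = v P (princ (of_nat p))" if "Q \<in> primes_above K p" for Q
    using that v_above_eq[OF p P that nz inv] ramification_index_at_eq[of Q p] by (simp add: primes_above_eq)
  show ?thesis unfolding e_def ramification_index_def
    by (rule sym, rule the_equality) (use * P in auto)
qed

lemma v_of_nat_coprime:
  assumes "Factorial_Ring.prime p" "P \<in> primes_above K p" "\<not> p dvd n"
  shows "v P (princ (of_nat n)) = 0"
proof -
  have P: "P \<in> maxs" using assms by (auto simp: primes_above_eq)
  have n: "n > 0" using assms(3) by (cases n) auto
  have "of_int (int n) \<notin> P" using of_int_in_primes_above[OF assms(1,2), of "int n"] assms(3) by (simp add: of_nat_dvd_iff)
  thus ?thesis using v_pos_iff[OF P, of "princ (of_nat n)"] princ_subset_iff[OF maxs_isid[OF P]] nzid_princ[of "of_nat n"] n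
    by force
qed

lemma v_princ_mult:
  "P \<in> maxs \<Longrightarrow> a \<in> \<O> \<Longrightarrow> b \<in> \<O> \<Longrightarrow> a \<noteq> 0 \<Longrightarrow> b \<noteq> 0 \<Longrightarrow>
    v P (princ (a * b)) = v P (princ a) + v P (princ b)"
  using v_iprod[of P "princ a" "princ b"] princ_mult[of b a] nzid_princ by simp

lemma v_of_nat:
  assumes p: "Factorial_Ring.prime p" and P: "P \<in> primes_above K p" and n: "n > 0"
  shows "v P (princ (of_nat n)) = e p * multiplicity p n"
proof -
  have PM: "P \<in> maxs" using P by (auto simp: primes_above_eq)
  obtain k where k: "n = p ^ multiplicity p n * k" "\<not> p dvd k"
    using multiplicity_decompose'[of n p] n p by (metis not_prime_unit not_gr_zero)
  have k0: "k > 0" using k n by (cases k) auto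
  have pw: "v P (princ (of_nat (p ^ j))) = e p * j" for j
  proof (induction j)
    case 0
    have "princ 1 = \<O>" by (auto simp: princ_def)
    thus ?case using v_O[OF PM] by simp
  next
    case (Suc j)
    thus ?case
      using v_princ_mult[OF PM, of "of_nat p" "of_nat (p ^ j)"] e_eq[OF p P] prime_gt_0_nat[OF p] O_power[OF O_of_nat, of p j]
      by simp
  qed
  have "v P (princ (of_nat n)) = v P (princ (of_nat (p ^ multiplicity p n) * of_nat k))"
    by (subst k(1)) simp
  also have "\<dots> = e p * multiplicity p n + v P (princ (of_nat k))"
    by (subst v_princ_mult[OF PM]) (use k0 prime_gt_0_nat[OF p] pw in \<open>auto simp del: of_nat_power\<close>)
  also have "v P (princ (of_nat k)) = 0" using v_of_nat_coprime[OF p P k(2)] .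
  finally show ?thesis by simp
qed

lemma e_pos: "Factorial_Ring.prime p \<Longrightarrow> e p \<ge> 1"
proof -
  assume p: "Factorial_Ring.prime p"
  obtain P where P: "P \<in> primes_above K p" using primes_above_exists[OF p] .
  hence "P \<in> maxs" "princ (of_nat p) \<subseteq> P" using princ_subset_iff maxs_isid by (auto simp: primes_above_eq)
  thus ?thesis using e_eq[OF p P] v_pos_iff nzid_princ[of "of_nat p"] prime_gt_0_nat[OF p] by fastforce
qed

text \<open>The product of the primes above \<open>p\<close>. These ideals turn out to be the
  Ostrowski ideals other than the whole ring, and they generate the invariant ideals.\<close>

definition radp :: "nat \<Rightarrow> complex set" where "radp p = finprod M (\<lambda>P. P) (primes_above K p)"

lemma nzid_radp: "Factorial_Ring.prime p \<Longrightarrow> nzid (radp p)"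
  unfolding radp_def using finite_primes_above maxsD(1) by (intro finprod_nzid) (auto simp: primes_above_eq)

lemma v_radp:
  assumes p: "Factorial_Ring.prime p" and Q: "Q \<in> maxs"
  shows "v Q (radp p) = (if Q \<in> primes_above K p then 1 else 0)"
proof -
  have "v Q (radp p) = (\<Sum>P\<in>primes_above K p. v Q P)"
    unfolding radp_def using finite_primes_above[OF p] maxsD(1) by (intro v_finprod[OF Q]) (auto simp: primes_above_eq)
  also have "\<dots> = (\<Sum>P\<in>primes_above K p. if Q = P then 1 else 0)"
    by (intro sum.cong refl) (use v_self[OF Q] in \<open>auto simp: primes_above_eq\<close>)
  finally show ?thesis using finite_primes_above[OF p] by simp
qed

lemma G_radp: "Factorial_Ring.prime p \<Longrightarrow> \<sigma> \<in> G \<Longrightarrow> \<sigma> ` radp p = radp p"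
proof (rule ideal_eq_of_v_eq)
  assume p: "Factorial_Ring.prime p" and s: "\<sigma> \<in> G"
  show "nzid (\<sigma> ` radp p)" "nzid (radp p)" using nzid_radp nzid_G p s by auto
  obtain \<tau> where t: "\<tau> \<in> G" "\<sigma> \<circ> \<tau> = id" "\<tau> \<circ> \<sigma> = id" using s inverse_G by blast
  fix P assume P: "P \<in> maxs"
  have "\<sigma> ` \<tau> ` P = P" using t by (simp add: image_comp)
  hence "v P (\<sigma> ` radp p) = v (\<tau> ` P) (radp p)" "\<tau> ` P \<in> primes_above K p \<longleftrightarrow> P \<in> primes_above K p"
    using v_G[OF s maxs_G[OF t(1) P] nzid_radp[OF p]] primes_above_G[OF s, of "\<tau> ` P" p] primes_above_G[OF t(1), of P p] by auto
  thus "v P (\<sigma> ` radp p) = v P (radp p)" using v_radp[OF p P] v_radp[OF p maxs_G[OF t(1) P]] by simp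
qed

lemma radp_iff:
  assumes p: "Factorial_Ring.prime p" and I: "nzid I"
  shows "I \<subseteq> radp p \<longleftrightarrow> (\<forall>P\<in>primes_above K p. I \<subseteq> P)"
proof
  assume "I \<subseteq> radp p"
  thus "\<forall>P\<in>primes_above K p. I \<subseteq> P"
    using v_radp[OF p] v_mono[OF _ I nzid_radp[OF p]] v_pos_iff[OF _ I] by (metis (no_types, lifting) mem_Collect_eq primes_above_eq)
next
  assume *: "\<forall>P\<in>primes_above K p. I \<subseteq> P"
  show "I \<subseteq> radp p"
    by (rule ideal_le_of_v_le[OF I nzid_radp[OF p]])
       (use v_radp[OF p] v_pos_iff[OF _ I] * in auto)
qed

lemma mem_radp_iff:
  assumes p: "Factorial_Ring.prime p" and x: "x \<in> \<O>"
  shows "x \<in> radp p \<longleftrightarrow> (\<forall>P\<in>primes_above K p. x \<in> P)"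
proof (cases "x = 0")
  case True
  thus ?thesis using isidD(2) nzidD nzid_radp[OF p] maxs_isid by (auto simp: primes_above_eq)
next
  case False
  thus ?thesis using radp_iff[OF p nzid_princ[OF x False]] princ_subset_iff maxs_isid nzidD[OF nzid_radp[OF p]]
    by (auto simp: primes_above_eq)
qed

definition pprod :: "nat set \<Rightarrow> (nat \<Rightarrow> nat) \<Rightarrow> complex set" where
  "pprod S a = finprod M (\<lambda>p. pw (radp p) (a p)) S"

lemma nzid_pprod: "finite S \<Longrightarrow> (\<And>p. p \<in> S \<Longrightarrow> Factorial_Ring.prime p) \<Longrightarrow> nzid (pprod S a)"
  unfolding pprod_def by (intro finprod_nzid nzid_pw nzid_radp)

lemma v_pprod:
  assumes S: "finite S" "\<And>p. p \<in> S \<Longrightarrow> Factorial_Ring.prime p" and p: "Factorial_Ring.prime p" "P \<in> primes_above K p"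
  shows "v P (pprod S a) = (if p \<in> S then a p else 0)"
proof -
  have P: "P \<in> maxs" using p by (auto simp: primes_above_eq)
  have "v P (pprod S a) = (\<Sum>q\<in>S. v P (pw (radp q) (a q)))"
    unfolding pprod_def using S by (intro v_finprod[OF P] nzid_pw nzid_radp)
  also have "\<dots> = (\<Sum>q\<in>S. if p = q then a q else 0)"
  proof (intro sum.cong refl)
    fix q assume "q \<in> S"
    hence q: "Factorial_Ring.prime q" by (rule S)
    have "P \<in> primes_above K q \<longleftrightarrow> p = q" using primes_above_unique[OF p(1) q p(2)] p(2) by blast
    thus "v P (pw (radp q) (a q)) = (if p = q then a q else 0)"
      by (simp add: v_pw[OF P nzid_radp[OF q]] v_radp[OF q P])
  qed
  finally show ?thesis using S by simp
qed

text \<open>Invariance and the transitive action make the valuation of \<open>I\<close> the same at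
  all primes above \<open>p\<close>, so \<open>I\<close> is a product of powers of the
  \<open>radp p\<close>. Only primes dividing the norm of \<open>I\<close> can occur.\<close>

lemma invariant_ideal_pprod:
  assumes I: "nzid I" and inv: "\<And>\<sigma>. \<sigma> \<in> G \<Longrightarrow> \<sigma> ` I = I"
  obtains S a where "finite S" "\<And>p. p \<in> S \<Longrightarrow> Factorial_Ring.prime p" "I = pprod S a"
proof -
  define S where "S = prime_factors (nrm I)"
  define a where "a p = v (SOME P. P \<in> primes_above K p) I" for p
  have n: "nrm I > 0" using nrm I by (auto simp: nzid_def)
  have S: "finite S" "\<And>p. p \<in> S \<Longrightarrow> Factorial_Ring.prime p" by (auto simp: S_def)
  have "I = pprod S a"
  proof (rule ideal_eq_of_v_eq[OF I nzid_pprod[OF S]])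
    fix P assume P: "P \<in> maxs"
    then obtain p where p: "Factorial_Ring.prime p" "P \<in> primes_above K p" using maxs_above by blast
    have "a p = v P I" unfolding a_def
      by (rule v_above_eq[OF p(1) someI[of "\<lambda>P. P \<in> primes_above K p", OF p(2)] p(2) I inv])
    moreover have "v P I = 0" if "p \<notin> S"
    proof (rule ccontr)
      assume "v P I \<noteq> 0"
      hence "I \<subseteq> P" using v_pos_iff[OF P I] by simp
      moreover obtain J where "nzid J" "I \<odot> J = princ (of_nat (nrm I))" using cofactor[OF I] .
      hence "of_nat (nrm I) \<in> I" using iprod_subset[of I J] princ_self nzidD I by blast
      ultimately have "of_int (int (nrm I)) \<in> P" by auto
      hence "p dvd nrm I" using of_int_in_primes_above[OF p, of "int (nrm I)"] by simp
      thus False using that p n by (auto simp: S_def prime_factors_dvd)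
    qed
    ultimately show "v P I = v P (pprod S a)" using v_pprod[OF S p] by simp
  qed
  thus ?thesis using that S by blast
qed

end

subsection \<open>Indices of subgroups\<close>

text \<open>\<open>f\<close> and \<open>g\<close> have the same fibres on \<open>A\<close>, and each
  image counts them.\<close>

lemma card_image_cong:
  assumes "\<And>x y. x \<in> A \<Longrightarrow> y \<in> A \<Longrightarrow> f x = f y \<longleftrightarrow> g x = g y"
  shows "card (f ` A) = card (g ` A)"
proof -
  have "bij_betw (\<lambda>z. g (inv_into A f z)) (f ` A) (g ` A)"
  proof (rule bij_betwI')
    fix x y assume xy: "x \<in> f ` A" "y \<in> f ` A"
    show "g (inv_into A f x) = g (inv_into A f y) \<longleftrightarrow> x = y"
      using assms[of "inv_into A f x" "inv_into A f y"] inv_into_into[OF xy(1)] inv_into_into[OF xy(2)]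
        f_inv_into_f[OF xy(1)] f_inv_into_f[OF xy(2)] by metis
  next
    fix x assume "x \<in> f ` A"
    thus "g (inv_into A f x) \<in> g ` A" using inv_into_into by (metis imageI)
  next
    fix y assume "y \<in> g ` A"
    then obtain a where a: "a \<in> A" "y = g a" by blast
    hence "g (inv_into A f (f a)) = y"
      using assms[of "inv_into A f (f a)" a] inv_into_into[of "f a" f A] f_inv_into_f[of "f a" f A] by blast
    thus "\<exists>x\<in>f ` A. y = g (inv_into A f x)" using a by blast
  qed
  thus ?thesis by (rule bij_betw_same_card)
qed

text \<open>\<open>B\<close> need not lie in \<open>A\<close>: counted are the cosets of
  \<open>B\<close> that meet \<open>A\<close>, as for the invariant ideals modulo all principal
  ones. An infinite index is 0.\<close>

definition idx :: "('a, 'b) monoid_scheme \<Rightarrow> 'a set \<Rightarrow> 'a set \<Rightarrow> nat" where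
  "idx G A B = card ((\<lambda>a. B #>\<^bsub>G\<^esub> a) ` A)"

lemma (in group) rcos_eq_iff:
  assumes "subgroup H G" "x \<in> carrier G" "y \<in> carrier G"
  shows "H #> x = H #> y \<longleftrightarrow> x \<otimes> inv y \<in> H"
proof
  assume "H #> x = H #> y"
  hence "x \<in> H #> y" using rcos_self assms by blast
  then obtain h where "h \<in> H" "x = h \<otimes> y" unfolding r_coset_def by blast
  thus "x \<otimes> inv y \<in> H" using assms subgroup.subset[OF assms(1)] by (auto simp: m_assoc)
next
  assume h: "x \<otimes> inv y \<in> H"
  have "x = (x \<otimes> inv y) \<otimes> y" using assms by (simp add: m_assoc)
  hence "x \<in> H #> y" unfolding r_coset_def using h by blast
  thus "H #> x = H #> y" using repr_independence[of x H y] assms by simp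
qed

lemma (in group) idx_cong:
  assumes "subgroup B G" "A \<subseteq> carrier G"
    and "\<And>x y. x \<in> A \<Longrightarrow> y \<in> A \<Longrightarrow> x \<otimes> inv y \<in> B \<longleftrightarrow> g x = g y"
  shows "idx G A B = card (g ` A)"
  unfolding idx_def
proof (rule card_image_cong)
  fix x y assume xy: "x \<in> A" "y \<in> A"
  thus "(B #> x = B #> y) = (g x = g y)" using assms rcos_eq_iff[OF assms(1), of x y] by blast
qed

text \<open>Choose a representative in \<open>A\<close> for each coset of \<open>B\<close>. Sending
  \<open>a\<close> to its coset of \<open>B\<close> and to the coset of \<open>C\<close> of its
  quotient by the representative separates exactly the cosets of \<open>C\<close> and fills the
  product of the two coset sets. Cardinalities of products multiply also when infinite sets count as
  0.\<close>

lemma (in group) idx_tower: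
  assumes C: "subgroup C G" and B: "subgroup B G" and A: "subgroup A G" and CB: "C \<subseteq> B" and BA: "B \<subseteq> A"
  shows "idx G A C = idx G A B * idx G B C"
proof -
  have carr: "x \<in> carrier G" if "x \<in> A" for x using A that by (rule subgroup.mem_carrier)
  define \<rho> where "\<rho> = inv_into A (\<lambda>a. B #> a)"
  have \<rho>: "\<rho> S \<in> A" "B #> \<rho> S = S" if "S \<in> (\<lambda>a. B #> a) ` A" for S
    using inv_into_into[OF that] f_inv_into_f[OF that] by (auto simp: \<rho>_def)
  define g where "g a = (B #> a, C #> (a \<otimes> inv (\<rho> (B #> a))))" for a
  have quot: "a \<otimes> inv (\<rho> (B #> a)) \<in> B" if "a \<in> A" for a
    using rcos_eq_iff[OF B carr[OF that] carr[OF \<rho>(1)[of "B #> a"]]] \<rho>(2)[of "B #> a"] that by simp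
  have "idx G A C = card (g ` A)"
  proof (rule idx_cong[OF C])
    show "A \<subseteq> carrier G" using carr by blast
    fix x y assume xy: "x \<in> A" "y \<in> A"
    show "x \<otimes> inv y \<in> C \<longleftrightarrow> g x = g y"
    proof (cases "B #> x = B #> y")
      case True
      define r where "r = \<rho> (B #> y)"
      have r: "r \<in> carrier G" using \<rho>(1)[of "B #> y"] xy carr by (simp add: r_def)
      have "g x = g y \<longleftrightarrow> C #> (x \<otimes> inv r) = C #> (y \<otimes> inv r)" using True by (simp add: g_def r_def)
      also have "\<dots> \<longleftrightarrow> (x \<otimes> inv r) \<otimes> inv (y \<otimes> inv r) \<in> C"
        using rcos_eq_iff[OF C, of "x \<otimes> inv r" "y \<otimes> inv r"] xy carr r by simp
      also have "(x \<otimes> inv r) \<otimes> inv (y \<otimes> inv r) = x \<otimes> inv y"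
        using xy carr r by (simp add: inv_mult_group m_assoc) (simp add: m_assoc[symmetric])
      finally show ?thesis by simp
    next
      case False
      hence "x \<otimes> inv y \<notin> B" using rcos_eq_iff[OF B] xy carr by blast
      thus ?thesis using False CB by (auto simp: g_def)
    qed
  qed
  also have "g ` A = (\<lambda>a. B #> a) ` A \<times> (\<lambda>b. C #> b) ` B"
  proof
    show "g ` A \<subseteq> (\<lambda>a. B #> a) ` A \<times> (\<lambda>b. C #> b) ` B" using quot by (auto simp: g_def)
    show "(\<lambda>a. B #> a) ` A \<times> (\<lambda>b. C #> b) ` B \<subseteq> g ` A"
    proof
      fix z assume "z \<in> (\<lambda>a. B #> a) ` A \<times> (\<lambda>b. C #> b) ` B"
      then obtain S b where z: "z = (S, C #> b)" "S \<in> (\<lambda>a. B #> a) ` A" "b \<in> B" by blast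
      define a where "a = b \<otimes> \<rho> S"
      have bA: "b \<in> A" using z BA by blast
      have a: "a \<in> A" unfolding a_def using bA \<rho>(1)[OF z(2)] by (rule subgroup.m_closed[OF A])
      have "a \<otimes> inv (\<rho> S) = b" using carr[OF bA] carr[OF \<rho>(1)[OF z(2)]] by (simp add: a_def m_assoc)
      moreover from this have "B #> a = S"
        using rcos_eq_iff[OF B carr[OF a] carr[OF \<rho>(1)[OF z(2)]]] \<rho>(2)[OF z(2)] z(3) by simp
      ultimately have "g a = z" using z by (simp add: g_def)
      thus "z \<in> g ` A" using a by blast
    qed
  qed
  finally show ?thesis by (simp add: idx_def card_cartesian_product)
qed

lemma group_index_eq_idx: "group_index G H = idx G (carrier G) H"
  unfolding group_index_def idx_def RCOSETS_def by (rule arg_cong[of _ _ card]) blast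

context galois_field
begin

subsection \<open>Residue fields and Ostrowski ideals\<close>

lemma subgroup_isid: "isid I \<Longrightarrow> subgroup I (add_monoid R)"
  using ideal_iff additive_subgroup.a_subgroup ideal.axioms(1) by blast

lemma ideal_norm_eq_idx: "ideal_norm K I = idx (add_monoid R) \<O> I"
  unfolding ideal_norm_def FactRing_def A_RCOSETS_def RCOSETS_def idx_def
  by simp (rule arg_cong[of _ _ card], blast)

lemma ideal_norm_cong:
  assumes "isid I" "\<And>x y. x \<in> \<O> \<Longrightarrow> y \<in> \<O> \<Longrightarrow> x - y \<in> I \<longleftrightarrow> g x = g y"
  shows "ideal_norm K I = card (g ` \<O>)"
  unfolding ideal_norm_eq_idx
  by (rule R.add.idx_cong) (use assms subgroup_isid[OF assms(1)] a_inv_R in auto)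

text \<open>An automorphism carries the cosets of \<open>I\<close> to those of its image. With
  \<open>h\<close> naming the latter as sets, both indices count one and the same family.\<close>

lemma ideal_norm_G:
  assumes s: "\<sigma> \<in> G" and I: "isid I"
  shows "ideal_norm K (\<sigma> ` I) = ideal_norm K I"
proof -
  define h where "h x = (\<lambda>z. z + x) ` \<sigma> ` I" for x
  have h: "x - y \<in> \<sigma> ` I \<longleftrightarrow> h x = h y" if "x \<in> \<O>" "y \<in> \<O>" for x y
  proof
    assume "h x = h y"
    moreover have "x \<in> h x" unfolding h_def using isidD(2)[OF G_isid[OF s I]] by force
    ultimately show "x - y \<in> \<sigma> ` I" unfolding h_def by auto
  next
    assume xy: "x - y \<in> \<sigma> ` I"
    have "h x \<subseteq> h y" if "x - y \<in> \<sigma> ` I" for x y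
    proof
      fix z assume "z \<in> h x"
      then obtain w where w: "w \<in> \<sigma> ` I" "z = w + x" unfolding h_def by blast
      have "w + (x - y) \<in> \<sigma> ` I" by (rule isidD(3)[OF G_isid[OF s I] w(1) that])
      moreover have "z = (w + (x - y)) + y" using w(2) by simp
      ultimately show "z \<in> h y" unfolding h_def by blast
    qed
    from this[OF xy] this[of y x] show "h x = h y"
      using isidD(6)[OF G_isid[OF s I] xy] by (simp add: minus_diff_eq)
  qed
  have "ideal_norm K (\<sigma> ` I) = card (h ` \<O>)" by (rule ideal_norm_cong[OF G_isid[OF s I] h])
  also have "h ` \<O> = (\<lambda>x. h (\<sigma> x)) ` \<O>" by (simp add: G_image_O[OF s] image_image[symmetric])
  also have "card \<dots> = ideal_norm K I"
  proof (rule ideal_norm_cong[symmetric, OF I])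
    fix x y assume xy: "x \<in> \<O>" "y \<in> \<O>"
    have "\<sigma> x - \<sigma> y = \<sigma> (x - y)" using G_diff[OF s, of x y] xy O_K by simp
    thus "x - y \<in> I \<longleftrightarrow> h (\<sigma> x) = h (\<sigma> y)"
      using h[OF G_O[OF s xy(1)] G_O[OF s xy(2)]] inj_image_mem_iff[OF G_inj[OF s]] by simp
  qed
  finally show ?thesis .
qed

definition co :: "complex \<Rightarrow> int list" where
  "co x = (THE c. length c = length basis \<and> x = (\<Sum>i<length basis. of_int (c ! i) * basis ! i))"

lemma co: "x \<in> \<O> \<Longrightarrow> length (co x) = length basis"
    "x \<in> \<O> \<Longrightarrow> x = (\<Sum>i<length basis. of_int (co x ! i) * basis ! i)"
  using theI'[OF O_coords] unfolding co_def by auto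

lemma sum_basis_O: "(\<Sum>i<length basis. of_int (c i) * basis ! i) \<in> \<O>"
  by (intro O_sum O_mult O_of_int) (auto intro: basis_O)

lemma co_unique:
  assumes "length c = length basis"
  shows "co (\<Sum>i<length basis. of_int (c ! i) * basis ! i) = c"
  unfolding co_def using assms the1_equality[OF O_coords[OF sum_basis_O[of "\<lambda>i. c ! i"]]] by blast

lemma co_linear:
  assumes "x \<in> \<O>" "y \<in> \<O>" "i < length basis"
  shows "co (of_int a * x + of_int b * y) ! i = a * co x ! i + b * co y ! i"
proof -
  define c where "c = map (\<lambda>i. a * co x ! i + b * co y ! i) [0..<length basis]"
  have "of_int a * x + of_int b * y = (\<Sum>i<length basis. of_int (c ! i) * basis ! i)"
    by (subst co(2)[OF assms(1)], subst co(2)[OF assms(2)])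
       (simp add: c_def sum_distrib_left sum.distrib algebra_simps)
  thus ?thesis using co_unique[of c] assms(3) by (simp add: c_def)
qed

lemma princ_of_nat_iff:
  assumes "x \<in> \<O>" "m > 0"
  shows "x \<in> princ (of_nat m) \<longleftrightarrow> (\<forall>i<length basis. int m dvd co x ! i)"
proof
  assume "x \<in> princ (of_nat m)"
  then obtain y where y: "y \<in> \<O>" "x = of_nat m * y" by (auto simp: princ_def)
  thus "\<forall>i<length basis. int m dvd co x ! i" using co_linear[OF y(1) O_zero, of _ "int m" 0] by simp
next
  assume *: "\<forall>i<length basis. int m dvd co x ! i"
  have "x = (\<Sum>i<length basis. of_nat m * (of_int (co x ! i div int m) * basis ! i))"
  proof (subst co(2)[OF assms(1)], intro sum.cong refl)
    fix i assume "i \<in> {..<length basis}"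
    then obtain k where "co x ! i = int m * k" using * by (auto elim: dvdE)
    thus "of_int (co x ! i) * basis ! i = of_nat m * (of_int (co x ! i div int m) * basis ! i)"
      using assms by simp
  qed
  hence "x = of_nat m * (\<Sum>i<length basis. of_int (co x ! i div int m) * basis ! i)"
    by (simp add: sum_distrib_left)
  thus "x \<in> princ (of_nat m)" unfolding princ_def by (rule image_eqI[OF _ sum_basis_O])
qed

text \<open>A residue class is a list of coordinates modulo \<open>m\<close>, and all such lists
  occur.\<close>

lemma ideal_norm_of_nat:
  assumes m: "m > 0"
  shows "ideal_norm K (princ (of_nat m)) = m ^ length basis"
proof -
  let ?n = "length basis"
  define g where "g x = map (\<lambda>k. k mod int m) (co x)" for x
  have "ideal_norm K (princ (of_nat m)) = card (g ` \<O>)"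
  proof (rule ideal_norm_cong[OF princ_isid[OF O_of_nat]])
    fix x y assume xy: "x \<in> \<O>" "y \<in> \<O>"
    have "co (x - y) ! i = co x ! i - co y ! i" if "i < ?n" for i
      using co_linear[OF xy that, of 1 "-1"] by simp
    hence "x - y \<in> princ (of_nat m) \<longleftrightarrow> (\<forall>i<?n. co x ! i mod int m = co y ! i mod int m)"
      using princ_of_nat_iff[OF O_diff[OF xy] m] by (auto simp: mod_eq_dvd_iff)
    also have "\<dots> \<longleftrightarrow> g x = g y" using co(1) xy by (simp add: g_def list_eq_iff_nth_eq)
    finally show "x - y \<in> princ (of_nat m) \<longleftrightarrow> g x = g y" .
  qed
  also have "g ` \<O> = {xs. set xs \<subseteq> {0..<int m} \<and> length xs = ?n}"
  proof
    show "g ` \<O> \<subseteq> {xs. set xs \<subseteq> {0..<int m} \<and> length xs = ?n}" using co(1) m by (auto simp: g_def)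
    show "{xs. set xs \<subseteq> {0..<int m} \<and> length xs = ?n} \<subseteq> g ` \<O>"
    proof
      fix xs assume "xs \<in> {xs. set xs \<subseteq> {0..<int m} \<and> length xs = ?n}"
      hence xs: "set xs \<subseteq> {0..<int m}" "length xs = ?n" by auto
      hence "g (\<Sum>i<?n. of_int (xs ! i) * basis ! i) = map (\<lambda>k. k mod int m) xs"
        using co_unique[of xs] by (simp add: g_def)
      also have "\<dots> = xs" using xs(1) by (intro map_idI) auto
      finally show "xs \<in> g ` \<O>" using sum_basis_O by (metis imageI)
    qed
  qed
  also have "card \<dots> = m ^ ?n" by (subst card_lists_length_eq) auto
  finally show ?thesis .
qed

text \<open>By the tower, the index of \<open>P\<close> divides that of the ideal generated by
  \<open>p\<close>, which is a power of \<open>p\<close>. It is not 1 because 1 is not in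
  \<open>P\<close>.\<close>

lemma ideal_norm_maxs:
  assumes p: "Factorial_Ring.prime p" and P: "P \<in> primes_above K p"
  obtains j where "j > 0" "ideal_norm K P = p ^ j"
proof -
  have PM: "P \<in> maxs" "of_nat p \<in> P" using P by (auto simp: primes_above_eq)
  have "idx (add_monoid R) \<O> (princ (of_nat p)) = idx (add_monoid R) \<O> P * idx (add_monoid R) P (princ (of_nat p))"
    by (rule R.add.idx_tower)
       (use subgroup_isid[OF princ_isid[of "of_nat p"]] subgroup_isid[OF isid_O] subgroup_isid[OF maxs_isid[OF PM(1)]]
          princ_subset_iff[OF maxs_isid[OF PM(1)], of "of_nat p"] PM isidD(1)[OF maxs_isid[OF PM(1)]] in auto)
  hence "ideal_norm K P dvd p ^ length basis"
    using ideal_norm_of_nat[OF prime_gt_0_nat[OF p]] unfolding ideal_norm_eq_idx by (metis dvd_triv_left)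
  then obtain j where j: "ideal_norm K P = p ^ j" using p divides_primepow_nat by blast
  have "j \<noteq> 0"
  proof
    assume "j = 0"
    hence "card ((\<lambda>a. P #>\<^bsub>add_monoid R\<^esub> a) ` \<O>) = 1" using j unfolding ideal_norm_eq_idx idx_def by simp
    then obtain z where "(\<lambda>a. P #>\<^bsub>add_monoid R\<^esub> a) ` \<O> = {z}" by (rule card_1_singletonE)
    hence "P #>\<^bsub>add_monoid R\<^esub> 1 = P #>\<^bsub>add_monoid R\<^esub> 0" using O_one O_zero by blast
    thus False using R.add.rcos_eq_iff[OF subgroup_isid[OF maxs_isid[OF PM(1)]], of 1 0] maxs_one[OF PM(1)]
        a_inv_R[of 0] by simp
  qed
  thus ?thesis using that j by blast
qed

text \<open>Conjugate primes have equal norms, and a norm, being a positive power of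
  \<open>p\<close>, reveals the rational prime below. So the maximal ideals of a given norm are all
  those above a single prime, or there are none.\<close>

lemma same_norm_maxs:
  assumes p: "Factorial_Ring.prime p" and P: "P \<in> primes_above K p"
  shows "{\<mm>. maximalideal \<mm> R \<and> ideal_norm K \<mm> = ideal_norm K P} = primes_above K p"
proof
  show "primes_above K p \<subseteq> {\<mm>. maximalideal \<mm> R \<and> ideal_norm K \<mm> = ideal_norm K P}"
  proof
    fix Q assume Q: "Q \<in> primes_above K p"
    then obtain \<sigma> where "\<sigma> \<in> G" "Q = \<sigma> ` P" using primes_above_transitive[OF p P] by blast
    thus "Q \<in> {\<mm>. maximalideal \<mm> R \<and> ideal_norm K \<mm> = ideal_norm K P}"
      using ideal_norm_G maxs_isid P Q by (auto simp: primes_above_eq maxs_def)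
  qed
  show "{\<mm>. maximalideal \<mm> R \<and> ideal_norm K \<mm> = ideal_norm K P} \<subseteq> primes_above K p"
  proof clarify
    fix Q assume Q: "maximalideal Q R" "ideal_norm K Q = ideal_norm K P"
    hence "Q \<in> maxs" by (simp add: maxs_def)
    then obtain q where q: "Factorial_Ring.prime q" "Q \<in> primes_above K q" by (rule maxs_above)
    obtain i where "i > 0" "ideal_norm K Q = q ^ i" using ideal_norm_maxs[OF q] .
    moreover obtain j where "j > 0" "ideal_norm K P = p ^ j" using ideal_norm_maxs[OF p P] .
    ultimately have "q dvd p ^ j" using Q(2) by (metis dvd_power)
    hence "q dvd p" using prime_dvd_power[OF q(1)] by blast
    hence "q = p" using primes_dvd_imp_eq q(1) p by blast
    thus "Q \<in> primes_above K p" using q(2) by simp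
  qed
qed

lemma ostrowski_cases:
  "ostrowski_ideal K q = \<O> \<or> (\<exists>p. Factorial_Ring.prime p \<and> ostrowski_ideal K q = radp p)"
proof (cases "{\<mm>. maximalideal \<mm> R \<and> ideal_norm K \<mm> = q} = {}")
  case True
  hence "ostrowski_ideal K q = \<O>" unfolding ostrowski_ideal_def by (simp only: True M.finprod_empty one_M)
  thus ?thesis by blast
next
  case False
  then obtain P where P: "maximalideal P R" "ideal_norm K P = q" by blast
  hence "P \<in> maxs" by (simp add: maxs_def)
  then obtain p where p: "Factorial_Ring.prime p" "P \<in> primes_above K p" by (rule maxs_above)
  hence "ostrowski_ideal K q = radp p" unfolding ostrowski_ideal_def radp_def using same_norm_maxs[OF p] P by simp
  thus ?thesis using p by blast
qed

lemma radp_is_ostrowski: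
  assumes p: "Factorial_Ring.prime p"
  obtains q where "q > 0" "ostrowski_ideal K q = radp p"
proof -
  obtain P where P: "P \<in> primes_above K p" using primes_above_exists[OF p] .
  obtain j where "ideal_norm K P = p ^ j" using ideal_norm_maxs[OF p P] .
  thus ?thesis using that[of "p ^ j"] same_norm_maxs[OF p P] prime_gt_0_nat[OF p]
    unfolding ostrowski_ideal_def radp_def by simp
qed

end

section \<open>The multiplicative group of the complex numbers\<close>

text \<open>A common ambient group for units, generators of ideals and rational factors, so that all
  indices between them are values of \<open>idx\<close> in one group.\<close>

definition cmul :: "complex monoid" where
  "cmul = \<lparr>carrier = UNIV - {0}, monoid.mult = (*), monoid.one = 1\<rparr>"

lemma cmul_simps [simp]:
  "carrier cmul = UNIV - {0}" "monoid.mult cmul = (*)" "\<one>\<^bsub>cmul\<^esub> = 1"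
  by (auto simp: cmul_def)

interpretation cmul: comm_group cmul
proof (rule comm_groupI)
  fix x assume "x \<in> carrier cmul"
  thus "\<exists>y\<in>carrier cmul. y \<otimes>\<^bsub>cmul\<^esub> x = \<one>\<^bsub>cmul\<^esub>" by (intro bexI[of _ "inverse x"]) auto
qed (auto simp: mult.assoc mult.commute)

lemma inv_cmul: "x \<noteq> 0 \<Longrightarrow> inv\<^bsub>cmul\<^esub> x = inverse x"
  using cmul.inv_equality[of "inverse x" x] by simp

lemma subgroup_cmulI:
  assumes "0 \<notin> H" "1 \<in> H" "\<And>x y. x \<in> H \<Longrightarrow> y \<in> H \<Longrightarrow> x * y \<in> H" "\<And>x. x \<in> H \<Longrightarrow> inverse x \<in> H"
  shows "subgroup H cmul"
proof (rule cmul.subgroupI)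
  show "inv\<^bsub>cmul\<^esub> x \<in> H" if "x \<in> H" for x
    using assms(1) assms(4)[OF that] inv_cmul[of x] that by (cases "x = 0") auto
qed (use assms in auto)

context galois_field
begin

subsection \<open>Fractional ideals\<close>

definition U :: "complex set" where "U = {u \<in> \<O>. u \<noteq> 0 \<and> inverse u \<in> \<O>}"

lemma U_one [simp]: "1 \<in> U" by (auto simp: U_def)
lemma U_mult: "u \<in> U \<Longrightarrow> w \<in> U \<Longrightarrow> u * w \<in> U" by (auto simp: U_def O_mult)
lemma U_inverse: "u \<in> U \<Longrightarrow> inverse u \<in> U" by (auto simp: U_def)
lemma U_divide: "u \<in> U \<Longrightarrow> w \<in> U \<Longrightarrow> u / w \<in> U" by (simp add: divide_inverse U_mult U_inverse)
lemma U_uminus: "u \<in> U \<Longrightarrow> - u \<in> U" by (auto simp: U_def O_uminus)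
lemma U_O: "u \<in> U \<Longrightarrow> u \<in> \<O>" by (auto simp: U_def)
lemma U_K: "u \<in> U \<Longrightarrow> u \<in> K" by (auto simp: U_def O_K)
lemma U_nonzero: "u \<in> U \<Longrightarrow> u \<noteq> 0" by (auto simp: U_def)
lemma U_G: "\<sigma> \<in> G \<Longrightarrow> u \<in> U \<Longrightarrow> \<sigma> u \<in> U"
  using G_O[of \<sigma> u] G_O[of \<sigma> "inverse u"] G_inverse[of \<sigma> u] G_eq_0_iff[of \<sigma> u] by (auto simp: U_def O_K)

lemma scale_scale: "(*) c ` (*) d ` I = (*) (c * d) ` (I :: complex set)"
  by (simp add: image_image mult.assoc)

lemma iprod_scale2: "((*) c ` I) \<odot> ((*) d ` J) = (*) (c * d) ` (I \<odot> J)"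
proof -
  have "((*) c ` I) \<odot> ((*) d ` J) = (*) c ` (((*) d ` J) \<odot> I)"
    unfolding iprod_scale iprod_comm[of I] ..
  thus ?thesis unfolding iprod_scale scale_scale iprod_comm[of J] .
qed

lemma princ_mult': "princ a \<odot> princ b = princ (a * b)"
  unfolding princ_def iprod_scale2 by (simp add: iprod_O)

lemma princ_one: "princ 1 = \<O>" by (auto simp: princ_def)

lemma princ_eq_iff:
  assumes "a \<noteq> 0" "b \<noteq> 0"
  shows "princ a = princ b \<longleftrightarrow> a / b \<in> U"
proof
  assume "princ a = princ b"
  thus "a / b \<in> U" using princ_eqD[of a b] princ_eqD[of b a] assms by (auto simp: U_def)
next
  assume u: "a / b \<in> U"
  have "princ (b * u) \<subseteq> princ b" if "u \<in> \<O>" for b u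
    using that by (auto simp: princ_def mult.assoc intro!: imageI O_mult)
  from this[of "a / b" b] this[of "b / a" a] show "princ a = princ b"
    using assms u by (auto simp: U_def)
qed

abbreviation Fr :: "complex set monoid" where "Fr \<equiv> fractional_ideals K"

lemma mult_Fr [simp]: "I \<otimes>\<^bsub>Fr\<^esub> J = I \<odot> J" by (simp add: fractional_ideals_def)
lemma one_Fr [simp]: "\<one>\<^bsub>Fr\<^esub> = \<O>" by (simp add: fractional_ideals_def)

lemma nzid_scale: "y \<in> \<O> \<Longrightarrow> y \<noteq> 0 \<Longrightarrow> nzid J \<Longrightarrow> nzid ((*) y ` J)"
  using princ_iprod[OF nzidD, of J y] nzid_iprod[OF nzid_princ, of y J] by simp

text \<open>Any nonzero factor from \<open>K\<close> may replace the reciprocal of an integral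
  element, because \<open>K_frac\<close> clears its denominator by an integer.\<close>

lemma Fr_iff: "I \<in> carrier Fr \<longleftrightarrow> (\<exists>J c. nzid J \<and> c \<in> K \<and> c \<noteq> 0 \<and> I = (*) c ` J)"
proof
  assume "I \<in> carrier Fr"
  then obtain J a where J: "ideal J R" "J \<noteq> {0}" "a \<in> \<O>" "a \<noteq> 0" "I = (\<lambda>x. x / a) ` J"
    unfolding fractional_ideals_def by auto
  hence "nzid J" "I = (*) (inverse a) ` J" by (auto simp: nzid_def ideal_iff divide_inverse mult.commute)
  thus "\<exists>J c. nzid J \<and> c \<in> K \<and> c \<noteq> 0 \<and> I = (*) c ` J" using J K_inverse O_K by (metis inverse_nonzero_iff_nonzero)
next
  assume "\<exists>J c. nzid J \<and> c \<in> K \<and> c \<noteq> 0 \<and> I = (*) c ` J"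
  then obtain J c where J: "nzid J" "c \<in> K" "c \<noteq> 0" "I = (*) c ` J" by blast
  obtain m :: nat where m: "m > 0" "algebraic_int (of_nat m * c)" using K_frac J by blast
  define y where "y = of_nat m * c"
  have y: "y \<in> \<O>" "y \<noteq> 0" using m J by (auto simp: y_def \<O>_def K_mult)
  have "I = (\<lambda>x. x / of_nat m) ` (*) y ` J" using J m by (auto simp: y_def image_image)
  moreover have "nzid ((*) y ` J)" using nzid_scale y J by blast
  ultimately show "I \<in> carrier Fr" unfolding fractional_ideals_def using m
    by (auto simp: nzid_def ideal_iff intro!: exI[of _ "(*) y ` J"] exI[of _ "of_nat m"])
qed

lemma FrI: "nzid J \<Longrightarrow> c \<in> K \<Longrightarrow> c \<noteq> 0 \<Longrightarrow> (*) c ` J \<in> carrier Fr"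
  unfolding Fr_iff by blast

lemma nzid_Fr: "nzid J \<Longrightarrow> J \<in> carrier Fr"
  using FrI[of J 1] K_one by simp

lemma O_iprod_Fr: "I \<in> carrier Fr \<Longrightarrow> \<O> \<odot> I = I"
  unfolding Fr_iff using iprod_O nzidD iprod_scale by (metis iprod_comm)

lemma princ_Fr: "a \<in> K \<Longrightarrow> a \<noteq> 0 \<Longrightarrow> princ a \<in> carrier Fr"
  unfolding princ_def by (rule FrI) auto

text \<open>The inverse of \<open>J\<close> scaled by \<open>c\<close> is the cofactor of
  \<open>J\<close>, divided by \<open>c\<close> and by \<open>nrm J\<close>.\<close>

lemma comm_group_Fr: "comm_group Fr"
proof (rule comm_groupI)
  fix I J assume "I \<in> carrier Fr" "J \<in> carrier Fr"
  thus "I \<otimes>\<^bsub>Fr\<^esub> J \<in> carrier Fr"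
    unfolding Fr_iff by (auto simp: iprod_scale2) (metis K_mult mult_eq_0_iff nzid_iprod)
next
  fix I assume "I \<in> carrier Fr"
  then obtain J c where J: "nzid J" "c \<in> K" "c \<noteq> 0" "I = (*) c ` J" unfolding Fr_iff by blast
  obtain J' where J': "nzid J'" "J \<odot> J' = princ (of_nat (nrm J))" using cofactor[OF J(1)] .
  have n: "nrm J > 0" using nrm J by (auto simp: nzid_def)
  define d where "d = inverse (c * of_nat (nrm J))"
  have "(*) d ` J' \<odot> I = (*) (d * c) ` (J' \<odot> J)" unfolding J(4) iprod_scale2 by simp
  also have "\<dots> = princ (d * c * of_nat (nrm J))"
    using J'(2) by (simp add: iprod_comm princ_def scale_scale)
  also have "d * c * of_nat (nrm J) = 1" using J n by (simp add: d_def field_simps)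
  finally have "(*) d ` J' \<odot> I = \<O>" by (simp add: princ_one)
  moreover have "(*) d ` J' \<in> carrier Fr" using J J' n by (intro FrI) (auto simp: d_def intro!: K_inverse K_mult)
  ultimately show "\<exists>J\<in>carrier Fr. J \<otimes>\<^bsub>Fr\<^esub> I = \<one>\<^bsub>Fr\<^esub>" by auto
next
  show "I \<otimes>\<^bsub>Fr\<^esub> J = J \<otimes>\<^bsub>Fr\<^esub> I" for I J by (simp add: iprod_comm)
qed (simp_all add: nzid_Fr iprod_assoc O_iprod_Fr)

sublocale Fr: comm_group Fr by (rule comm_group_Fr)

lemma Fr_nat:
  assumes "I \<in> carrier Fr"
  obtains m :: nat where "m > 0" "nzid ((*) (of_nat m) ` I)"
proof -
  obtain J c where J: "nzid J" "c \<in> K" "c \<noteq> 0" "I = (*) c ` J" using assms unfolding Fr_iff by blast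
  obtain m :: nat where m: "m > 0" "algebraic_int (of_nat m * c)" using K_frac J by blast
  have "of_nat m * c \<in> \<O>" using m J by (auto simp: \<O>_def K_mult)
  hence "nzid ((*) (of_nat m * c) ` J)" using nzid_scale J m by simp
  thus ?thesis using that m J by (simp add: scale_scale)
qed

definition PP :: "complex set set" where "PP = {princ a | a. a \<in> K \<and> a \<noteq> 0}"

lemma PP_eq: "principal_fractional_ideals K = PP"
  unfolding principal_fractional_ideals_def PP_def princ_def by simp

lemma inv_princ: "a \<in> K \<Longrightarrow> a \<noteq> 0 \<Longrightarrow> inv\<^bsub>Fr\<^esub> (princ a) = princ (inverse a)"
  by (rule Fr.inv_equality) (auto simp: princ_mult' princ_one intro!: princ_Fr K_inverse)

lemma subgroup_princ:
  assumes "subgroup H cmul" "H \<subseteq> K"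
  shows "subgroup (princ ` H) Fr"
proof -
  have H0: "h \<noteq> 0" if "h \<in> H" for h using subgroup.mem_carrier[OF assms(1) that] by simp
  show ?thesis
  proof (rule Fr.subgroupI)
    show "princ ` H \<subseteq> carrier Fr" using assms H0 by (auto intro!: princ_Fr)
    show "princ ` H \<noteq> {}" using subgroup.one_closed[OF assms(1)] by auto
    show "inv\<^bsub>Fr\<^esub> I \<in> princ ` H" if I: "I \<in> princ ` H" for I
    proof -
      obtain h where h: "h \<in> H" "I = princ h" using I by blast
      have "inverse h \<in> H" using subgroup.m_inv_closed[OF assms(1) h(1)] inv_cmul H0[OF h(1)] by simp
      thus ?thesis using inv_princ[of h] h H0 assms by auto
    qed
    show "I \<otimes>\<^bsub>Fr\<^esub> J \<in> princ ` H" if IJ: "I \<in> princ ` H" "J \<in> princ ` H" for I J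
    proof -
      obtain h k where h: "h \<in> H" "I = princ h" "k \<in> H" "J = princ k" using IJ by blast
      have "h * k \<in> H" using subgroup.m_closed[OF assms(1) h(1,3)] by simp
      thus ?thesis using h by (simp add: princ_mult')
    qed
  qed
qed

lemma subgroup_K: "subgroup (K - {0}) cmul"
  by (rule subgroup_cmulI) (auto intro: K_mult K_inverse K_one)

lemma subgroup_PP: "subgroup PP Fr"
proof -
  have "PP = princ ` (K - {0})" by (auto simp: PP_def)
  thus ?thesis using subgroup_princ[OF subgroup_K] by auto
qed

definition GI :: "complex set set" where "GI = {I \<in> carrier Fr. \<forall>\<sigma>\<in>G. \<sigma> ` I = I}"

lemma Fr_K: "I \<in> carrier Fr \<Longrightarrow> I \<subseteq> K"
  unfolding Fr_iff using isidD(1)[OF nzidD] O_K K_mult by fastforce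

lemma G_scale: "\<sigma> \<in> G \<Longrightarrow> c \<in> K \<Longrightarrow> I \<subseteq> K \<Longrightarrow> \<sigma> ` (*) c ` I = (*) (\<sigma> c) ` \<sigma> ` I"
  unfolding image_image by (intro image_cong refl) (auto simp: G_mult)

lemma G_Fr: "\<sigma> \<in> G \<Longrightarrow> I \<in> carrier Fr \<Longrightarrow> \<sigma> ` I \<in> carrier Fr"
proof -
  assume s: "\<sigma> \<in> G" and I: "I \<in> carrier Fr"
  obtain J c where J: "nzid J" "c \<in> K" "c \<noteq> 0" "I = (*) c ` J" using I unfolding Fr_iff by blast
  have "J \<subseteq> K" using J(1) nzid_Fr Fr_K by blast
  hence "\<sigma> ` I = (*) (\<sigma> c) ` \<sigma> ` J" using G_scale[OF s J(2)] J(4) by simp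
  thus ?thesis using FrI[OF nzid_G[OF s J(1)] G_closed[OF s J(2)]] G_eq_0_iff[OF s] J(3) by simp
qed

lemma subgroup_GI: "subgroup GI Fr"
proof (rule Fr.subgroupI)
  show "GI \<subseteq> carrier Fr" by (auto simp: GI_def)
  have "\<O> \<in> GI" using nzid_Fr[OF nzid_O] G_image_O by (auto simp: GI_def)
  thus "GI \<noteq> {}" by blast
  show "I \<otimes>\<^bsub>Fr\<^esub> J \<in> GI" if "I \<in> GI" "J \<in> GI" for I J
    using that Fr.m_closed[of I J] G_iprod[of _ I J] Fr_K by (auto simp: GI_def)
  show "inv\<^bsub>Fr\<^esub> I \<in> GI" if "I \<in> GI" for I
  proof -
    have I: "I \<in> carrier Fr" using that by (simp add: GI_def)
    have "\<sigma> ` (inv\<^bsub>Fr\<^esub> I) = inv\<^bsub>Fr\<^esub> I" if s: "\<sigma> \<in> G" for \<sigma>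
    proof -
      have "\<sigma> ` (inv\<^bsub>Fr\<^esub> I \<odot> I) = \<sigma> ` (inv\<^bsub>Fr\<^esub> I) \<odot> \<sigma> ` I"
        using G_iprod[OF s Fr_K Fr_K, of "inv\<^bsub>Fr\<^esub> I" I] I by simp
      moreover have "inv\<^bsub>Fr\<^esub> I \<odot> I = \<O>" using Fr.l_inv[OF I] by simp
      moreover have "\<sigma> ` I = I" using \<open>I \<in> GI\<close> s by (simp add: GI_def)
      ultimately have "\<sigma> ` (inv\<^bsub>Fr\<^esub> I) \<odot> I = \<O>" using G_image_O[OF s] by simp
      thus ?thesis using Fr.inv_equality[of "\<sigma> ` (inv\<^bsub>Fr\<^esub> I)" I] I G_Fr[OF s] by simp
    qed
    thus ?thesis using I by (simp add: GI_def)
  qed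
qed

definition II :: "complex set set" where
  "II = generate Fr {radp p | p. Factorial_Ring.prime p}"

lemma radps_Fr: "{radp p | p. Factorial_Ring.prime p} \<subseteq> carrier Fr"
  using nzid_radp nzid_Fr by blast

lemma subgroup_II: "subgroup II Fr"
  unfolding II_def by (rule Fr.generate_is_subgroup[OF radps_Fr])

lemma radp_II: "Factorial_Ring.prime p \<Longrightarrow> radp p \<in> II"
  unfolding II_def by (rule generate.incl) blast

lemma pprod_II: "finite S \<Longrightarrow> (\<And>p. p \<in> S \<Longrightarrow> Factorial_Ring.prime p) \<Longrightarrow> pprod S a \<in> II"
proof (induction S rule: finite_induct)
  case empty
  show ?case using subgroup.one_closed[OF subgroup_II] by (simp add: pprod_def)
next
  case (insert p S)
  have p: "Factorial_Ring.prime p" using insert by blast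
  have pw: "pw (radp p) j \<in> II" for j
  proof (induction j)
    case 0 show ?case using subgroup.one_closed[OF subgroup_II] by simp
  next
    case (Suc j)
    thus ?case using subgroup.m_closed[OF subgroup_II Suc radp_II[OF p]] by simp
  qed
  have "pprod (insert p S) a = pw (radp p) (a p) \<odot> pprod S a"
    unfolding pprod_def using insert M.finprod_insert[of S p "\<lambda>p. pw (radp p) (a p)"] nzidD[OF nzid_pw[OF nzid_radp]]
    by (simp add: Pi_iff)
  thus ?case using subgroup.m_closed[OF subgroup_II pw insert.IH] insert.prems by simp
qed

text \<open>A positive integer moves an invariant fractional ideal into the ring and preserves
  invariance; an invariant ideal of the ring is a product of powers of the \<open>radp p\<close>.
  The integer itself generates an invariant ideal, so it can be divided out again.\<close>

lemma II_eq_GI: "II = GI"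
proof
  show "II \<subseteq> GI" unfolding II_def
    by (rule Fr.generate_subgroup_incl[OF _ subgroup_GI]) (use G_radp nzid_Fr nzid_radp in \<open>fastforce simp: GI_def\<close>)
  have inv_II: "J \<in> II" if "nzid J" "\<And>\<sigma>. \<sigma> \<in> G \<Longrightarrow> \<sigma> ` J = J" for J
    using invariant_ideal_pprod[OF that] pprod_II by metis
  show "GI \<subseteq> II"
  proof
    fix I assume I: "I \<in> GI"
    hence IFr: "I \<in> carrier Fr" by (simp add: GI_def)
    obtain m :: nat where m: "m > 0" "nzid ((*) (of_nat m) ` I)" using Fr_nat[OF IFr] .
    have "\<sigma> ` (*) (of_nat m) ` I = (*) (of_nat m) ` I" if "\<sigma> \<in> G" for \<sigma>
      using G_scale[OF that K_of_nat Fr_K[OF IFr]] G_of_nat[OF that] I that by (simp add: GI_def)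
    hence 1: "(*) (of_nat m) ` I \<in> II" using inv_II m by blast
    have "\<sigma> ` princ (of_nat m) = princ (of_nat m)" if "\<sigma> \<in> G" for \<sigma>
      using G_princ[OF that K_of_nat] G_of_nat[OF that] by simp
    hence 2: "princ (of_nat m) \<in> II" using inv_II nzid_princ m by simp
    have "princ (inverse (of_nat m)) \<in> II"
      using subgroup.m_inv_closed[OF subgroup_II 2] inv_princ[of "of_nat m"] m by simp
    from subgroup.m_closed[OF subgroup_II this 1]
    have "princ (inverse (of_nat m)) \<odot> (*) (of_nat m) ` I \<in> II" by simp
    also have "princ (inverse (of_nat m)) \<odot> (*) (of_nat m) ` I = I"
      unfolding princ_def iprod_scale2 using m O_iprod_Fr[OF IFr] by simp
    finally show "I \<in> II" .
  qed
qed

text \<open>The generators of the invariant principal fractional ideals.\<close>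

definition A0 :: "complex set" where "A0 = {a \<in> K. a \<noteq> 0 \<and> (\<forall>\<sigma>\<in>G. \<sigma> a / a \<in> U)}"

definition QU :: "complex set" where "QU = {q * u | q u. q \<in> \<rat> \<and> q \<noteq> 0 \<and> u \<in> U}"

text \<open>A generator is determined up to units, so the ideal of \<open>a\<close> is invariant
  exactly if all \<open>\<sigma> a / a\<close> are units.\<close>

lemma PP_GI: "PP \<inter> GI = princ ` A0"
proof -
  have "princ a \<in> GI \<longleftrightarrow> (\<forall>\<sigma>\<in>G. \<sigma> a / a \<in> U)" if "a \<in> K" "a \<noteq> 0" for a
    using that princ_Fr[OF that] G_princ princ_eq_iff[of _ a] G_eq_0_iff by (auto simp: GI_def)
  thus ?thesis by (auto simp: PP_def A0_def)
qed

lemma subgroup_QU: "subgroup QU cmul"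
proof (rule subgroup_cmulI)
  show "1 \<in> QU" unfolding QU_def by (auto intro!: exI[of _ 1])
  show "0 \<notin> QU" using U_nonzero by (auto simp: QU_def)
  show "x * y \<in> QU" if xy: "x \<in> QU" "y \<in> QU" for x y
  proof -
    obtain q u r w where "x = q * u" "y = r * w" "q \<in> \<rat>" "r \<in> \<rat>" "q \<noteq> 0" "r \<noteq> 0" "u \<in> U" "w \<in> U"
      using xy by (auto simp: QU_def)
    thus ?thesis unfolding QU_def
      by (intro CollectI exI[of _ "q * r"] exI[of _ "u * w"]) (auto intro: U_mult)
  qed
  show "inverse x \<in> QU" if x: "x \<in> QU" for x
  proof -
    obtain q u where "x = q * u" "q \<in> \<rat>" "q \<noteq> 0" "u \<in> U" using x by (auto simp: QU_def)
    thus ?thesis unfolding QU_def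
      by (intro CollectI exI[of _ "inverse q"] exI[of _ "inverse u"]) (auto intro: U_inverse)
  qed
qed

lemma QU_K: "QU \<subseteq> K" using K_mult K_Rats U_K by (auto simp: QU_def)

lemma A0_nonzero: "a \<in> A0 \<Longrightarrow> a \<noteq> 0" by (simp add: A0_def)
lemma A0_K: "a \<in> A0 \<Longrightarrow> a \<in> K" by (simp add: A0_def)

lemma QU_A0: "QU \<subseteq> A0"
proof
  fix x assume x: "x \<in> QU"
  then obtain q u where qu: "x = q * u" "q \<in> \<rat>" "q \<noteq> 0" "u \<in> U" by (auto simp: QU_def)
  have "\<sigma> x / x \<in> U" if "\<sigma> \<in> G" for \<sigma>
    using qu G_mult[OF that K_Rats[OF qu(2)] U_K[OF qu(4)]] G_Rats[OF that qu(2)] U_divide U_G[OF that] by simp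
  thus "x \<in> A0" using qu QU_K x U_nonzero by (auto simp: A0_def)
qed

lemma subgroup_A0: "subgroup A0 cmul"
proof (rule subgroup_cmulI)
  show "1 \<in> A0" using QU_A0 subgroup.one_closed[OF subgroup_QU] by auto
  show "0 \<notin> A0" by (simp add: A0_def)
  show "x * y \<in> A0" if "x \<in> A0" "y \<in> A0" for x y
  proof -
    have "\<sigma> (x * y) / (x * y) = (\<sigma> x / x) * (\<sigma> y / y)" if "\<sigma> \<in> G" for \<sigma>
      using G_mult[OF that A0_K[OF \<open>x \<in> A0\<close>] A0_K[OF \<open>y \<in> A0\<close>]] by simp
    hence "\<sigma> (x * y) / (x * y) \<in> U" if "\<sigma> \<in> G" for \<sigma>
      using that \<open>x \<in> A0\<close> \<open>y \<in> A0\<close> U_mult[of "\<sigma> x / x" "\<sigma> y / y"] unfolding A0_def by auto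
    thus ?thesis using that by (auto simp: A0_def K_mult)
  qed
  show "inverse x \<in> A0" if "x \<in> A0" for x
  proof -
    have "\<sigma> (inverse x) / inverse x \<in> U" if "\<sigma> \<in> G" for \<sigma>
      using G_inverse[OF that A0_K[OF \<open>x \<in> A0\<close>]] U_inverse[of "\<sigma> x / x"] \<open>x \<in> A0\<close> that
      by (auto simp: A0_def field_simps)
    thus ?thesis using that by (auto simp: A0_def intro!: K_inverse)
  qed
qed

text \<open>The Ostrowski ideals generate the group of invariant ideals, so the Polya group is the
  image of that group in the class group. Its order is the number of cosets of \<open>PP\<close>
  that meet \<open>GI\<close>.\<close>

lemma card_Polya: "card (Polya_group K) = idx Fr GI PP"
proof -
  let ?H = "Fr Mod PP"
  let ?f = "\<lambda>I. PP #>\<^bsub>Fr\<^esub> I"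
  have normal: "normal PP Fr" by (rule Fr.subgroup_imp_normal[OF subgroup_PP])
  interpret f: group_hom Fr ?H ?f
    by (intro group_hom.intro Fr.group_axioms normal.factorgroup_is_group[OF normal])
       (simp add: group_hom_axioms_def normal.r_coset_hom_Mod[OF normal])
  let ?S = "{ostrowski_ideal K q | q. 0 < q}"
  have S: "?S \<subseteq> II"
    using ostrowski_cases radp_II subgroup.one_closed[OF subgroup_II] by (auto, metis one_Fr)
  hence "?S \<subseteq> carrier Fr" using subgroup.subset[OF subgroup_II] by blast
  have "{radp p | p. Factorial_Ring.prime p} \<subseteq> ?S" using radp_is_ostrowski by (auto, metis)
  hence "II \<subseteq> generate Fr ?S" unfolding II_def by (rule Fr.mono_generate)
  moreover have "generate Fr ?S \<subseteq> II" by (rule Fr.generate_subgroup_incl[OF S subgroup_II])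
  ultimately have gen: "generate Fr ?S = GI" using II_eq_GI by blast
  have "{ideal_class K (ostrowski_ideal K q) | q. 0 < q} = ?f ` ?S"
    unfolding ideal_class_def PP_eq by blast
  hence "Polya_group K = generate ?H (?f ` ?S)" unfolding Polya_group_def class_group_def PP_eq by simp
  also have "\<dots> = ?f ` generate Fr ?S" using f.generate_img[OF \<open>?S \<subseteq> carrier Fr\<close>] by simp
  finally show ?thesis unfolding gen idx_def by simp
qed

definition QI :: "complex set set" where "QI = princ ` (\<rat> - {0})"

lemma subgroup_Rats: "subgroup (\<rat> - {0}) cmul"
  by (rule subgroup_cmulI) auto

lemma subgroup_QI: "subgroup QI Fr"
  unfolding QI_def by (rule subgroup_princ[OF subgroup_Rats]) (use K_Rats in auto)

lemma QI_PP_GI: "QI \<subseteq> PP \<inter> GI"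
proof -
  have "\<rat> - {0} \<subseteq> QU" unfolding QU_def using U_one by force
  thus ?thesis unfolding PP_GI QI_def using QU_A0 by blast
qed

text \<open>The ideal of \<open>a / b\<close> has a rational generator exactly if
  \<open>a / b\<close> is a rational number times a unit, so passing from elements to ideals
  identifies the cosets.\<close>

lemma idx_principal: "idx Fr (PP \<inter> GI) QI = idx cmul A0 QU"
proof -
  have "idx Fr (PP \<inter> GI) QI = card ((\<lambda>a. QI #>\<^bsub>Fr\<^esub> princ a) ` A0)"
    unfolding idx_def PP_GI by (simp add: image_image)
  also have "\<dots> = idx cmul A0 QU"
  proof (rule cmul.idx_cong[symmetric, OF subgroup_QU])
    show "A0 \<subseteq> carrier cmul" using A0_nonzero by auto
    fix a b assume ab: "a \<in> A0" "b \<in> A0"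
    note nz = A0_nonzero[OF ab(1)] A0_nonzero[OF ab(2)]
    have "QI #>\<^bsub>Fr\<^esub> princ a = QI #>\<^bsub>Fr\<^esub> princ b \<longleftrightarrow> princ a \<otimes>\<^bsub>Fr\<^esub> inv\<^bsub>Fr\<^esub> (princ b) \<in> QI"
      by (rule Fr.rcos_eq_iff[OF subgroup_QI princ_Fr princ_Fr]) (use ab A0_K A0_nonzero in auto)
    also have "princ a \<otimes>\<^bsub>Fr\<^esub> inv\<^bsub>Fr\<^esub> (princ b) = princ (a / b)"
      using inv_princ[of b] A0_K ab nz by (simp add: princ_mult' divide_inverse)
    also have "princ (a / b) \<in> QI \<longleftrightarrow> a / b \<in> QU"
    proof
      assume "princ (a / b) \<in> QI"
      then obtain q where q: "q \<in> \<rat>" "q \<noteq> 0" "princ (a / b) = princ q" by (auto simp: QI_def)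
      hence "a / b / q \<in> U" using princ_eq_iff[of "a / b" q] nz by simp
      thus "a / b \<in> QU" unfolding QU_def using q by (intro CollectI exI[of _ q] exI[of _ "a / b / q"]) auto
    next
      assume "a / b \<in> QU"
      then obtain q u where qu: "a / b = q * u" "q \<in> \<rat>" "q \<noteq> 0" "u \<in> U" by (auto simp: QU_def)
      moreover have "u \<noteq> 0" using U_nonzero qu by blast
      ultimately have "princ (a / b) = princ q" using princ_eq_iff[of "a / b" q] nz by simp
      thus "princ (a / b) \<in> QI" using qu by (auto simp: QI_def)
    qed
    finally show "a \<otimes>\<^bsub>cmul\<^esub> inv\<^bsub>cmul\<^esub> b \<in> QU \<longleftrightarrow> QI #>\<^bsub>Fr\<^esub> princ a = QI #>\<^bsub>Fr\<^esub> princ b"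
      using nz by (simp add: inv_cmul divide_inverse)
  qed
  finally show ?thesis .
qed

text \<open>An integer changes the valuations above \<open>p\<close> by multiples of
  \<open>e p\<close>. Under the congruences, the valuations of \<open>I\<close> and \<open>J\<close>
  can therefore be matched by integer factors composed of the primes that divide their
  norms.\<close>

lemma invariant_ratio:
  assumes I: "nzid I" "\<And>\<sigma>. \<sigma> \<in> G \<Longrightarrow> \<sigma> ` I = I" and J: "nzid J" "\<And>\<sigma>. \<sigma> \<in> G \<Longrightarrow> \<sigma> ` J = J"
    and cong: "\<And>p P. Factorial_Ring.prime p \<Longrightarrow> P \<in> primes_above K p \<Longrightarrow> v P I mod e p = v P J mod e p"
  obtains a b :: nat where "a > 0" "b > 0" "(*) (of_nat a) ` I = (*) (of_nat b) ` J"
proof -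
  define Pp where "Pp p = (SOME P. P \<in> primes_above K p)" for p
  have Pp: "Pp p \<in> primes_above K p" if "Factorial_Ring.prime p" for p
    unfolding Pp_def using primes_above_exists[OF that] by (metis someI)
  define S where "S = prime_factors (nrm I * nrm J)"
  have S: "finite S" "\<And>p. p \<in> S \<Longrightarrow> Factorial_Ring.prime p" by (auto simp: S_def)
  have nz: "nrm I > 0" "nrm J > 0" using nrm I J by (auto simp: nzid_def)
  have zero: "v P I = 0 \<and> v P J = 0" if p: "Factorial_Ring.prime p" "P \<in> primes_above K p" "p \<notin> S" for p P
  proof -
    have PM: "P \<in> maxs" using p by (auto simp: primes_above_eq)
    have "v P L = 0" if L: "nzid L" "\<not> p dvd nrm L" for L
    proof (rule ccontr)
      assume "v P L \<noteq> 0"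
      hence "L \<subseteq> P" using v_pos_iff[OF PM L(1)] by simp
      moreover obtain L' where "nzid L'" "L \<odot> L' = princ (of_nat (nrm L))" using cofactor[OF L(1)] .
      hence "of_nat (nrm L) \<in> L" using iprod_subset[of L L'] princ_self nzidD L by blast
      ultimately have "of_int (int (nrm L)) \<in> P" by auto
      thus False using of_int_in_primes_above[OF p(1,2), of "int (nrm L)"] L by simp
    qed
    moreover have "\<not> p dvd nrm I" "\<not> p dvd nrm J" using p nz by (auto simp: S_def prime_factors_dvd)
    ultimately show ?thesis using I J by blast
  qed
  \<comment> \<open>Subtraction is truncated: one of \<open>x p\<close> and \<open>y p\<close> is 0
    and the other is the distance of the two valuations divided by \<open>e p\<close>.\<close>
  define x where "x p = (v (Pp p) J - v (Pp p) I) div e p" for p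
  define y where "y p = (v (Pp p) I - v (Pp p) J) div e p" for p
  define a where "a = (\<Prod>p\<in>S. p ^ x p)"
  define b where "b = (\<Prod>p\<in>S. p ^ y p)"
  have ab: "a > 0" "b > 0" unfolding a_def b_def using S prime_gt_0_nat by (auto intro!: prod_pos)
  have mult: "multiplicity p (\<Prod>p\<in>S. p ^ f p) = (if p \<in> S then f p else 0)" if "Factorial_Ring.prime p" for p f
    using multiplicity_prod_prime_powers[OF S that] by simp
  have "(*) (of_nat a) ` I = (*) (of_nat b) ` J"
  proof (rule ideal_eq_of_v_eq)
    show "nzid ((*) (of_nat a) ` I)" "nzid ((*) (of_nat b) ` J)" using nzid_scale ab I J by simp_all
    fix P assume P: "P \<in> maxs"
    then obtain p where p: "Factorial_Ring.prime p" "P \<in> primes_above K p" using maxs_above by blast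
    have *: "v P ((*) (of_nat c) ` L) = e p * multiplicity p c + v P L" if "c > 0" "nzid L" for c L
      using that v_iprod[OF P nzid_princ, of "of_nat c" L] princ_iprod[OF nzidD, of L "of_nat c"] v_of_nat[OF p] by simp
    show "v P ((*) (of_nat a) ` I) = v P ((*) (of_nat b) ` J)"
    proof (cases "p \<in> S")
      case False
      thus ?thesis using *[OF ab(1) I(1)] *[OF ab(2) J(1)] zero[OF p] mult[OF p(1)] by (simp add: a_def b_def)
    next
      case True
      have vv: "v (Pp p) I = v P I" "v (Pp p) J = v P J"
        using v_above_eq[OF p(1) Pp[OF p(1)] p(2)] I J by blast+
      have c: "v P I mod e p = v P J mod e p" using cong[OF p] .
      have "e p dvd v P J - v P I" "e p dvd v P I - v P J"
        using c by (metis mod_eq_dvd_iff_nat dvd_0_right diff_is_0_eq nat_le_linear)+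
      hence "e p * x p = v P J - v P I" "e p * y p = v P I - v P J" by (simp_all add: x_def y_def vv)
      thus ?thesis using *[OF ab(1) I(1)] *[OF ab(2) J(1)] mult[OF p(1)] True by (simp add: a_def b_def)
    qed
  qed
  thus ?thesis using that ab by blast
qed

text \<open>An invariant fractional ideal is determined up to rational factors by its valuations
  modulo \<open>e p\<close> at the primes of \<open>Rs\<close>, and all residues occur. So the index
  of \<open>QI\<close> in \<open>GI\<close> is the product of the \<open>e p\<close>; the tower
  through the principal invariant ideals splits it into the two factors on the left.\<close>

theorem card_Polya_mult:
  assumes Rs: "finite Rs" "\<And>p. p \<in> Rs \<Longrightarrow> Factorial_Ring.prime p"
    and unram: "\<And>p. Factorial_Ring.prime p \<Longrightarrow> p \<notin> Rs \<Longrightarrow> e p = 1"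
  shows "card (Polya_group K) * idx cmul A0 QU = (\<Prod>p\<in>Rs. e p)"
proof -
  define Pp where "Pp p = (SOME P. P \<in> primes_above K p)" for p
  have Pp: "Pp p \<in> primes_above K p" if "Factorial_Ring.prime p" for p
    unfolding Pp_def using primes_above_exists[OF that] by (metis someI)
  have PpM: "Pp p \<in> maxs" if "Factorial_Ring.prime p" for p using Pp[OF that] by (auto simp: primes_above_eq)
  \<comment> \<open>Valuations are available for integral ideals, so each ideal is first multiplied
    by some positive integer. Modulo \<open>e p\<close> the choice does not matter.\<close>
  define m where "m I = (SOME m :: nat. m > 0 \<and> nzid ((*) (of_nat m) ` I))" for I
  have m: "m I > 0" "nzid ((*) (of_nat (m I)) ` I)" if "I \<in> carrier Fr" for I
    using someI_ex[of "\<lambda>m :: nat. m > 0 \<and> nzid ((*) (of_nat m) ` I)"] Fr_nat[OF that] unfolding m_def by metis+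
  define J where "J I = (*) (of_nat (m I)) ` I" for I
  have nzJ: "nzid (J I)" if "I \<in> carrier Fr" for I using m that by (simp add: J_def)
  have JG: "\<sigma> ` J I = J I" if "I \<in> GI" "\<sigma> \<in> G" for I \<sigma>
    using that G_scale[OF that(2) K_of_nat Fr_K, of I] G_of_nat[OF that(2)] by (simp add: GI_def J_def)
  have GIFr: "I \<in> carrier Fr" if "I \<in> GI" for I using that by (simp add: GI_def)
  define g where "g I = (\<lambda>p\<in>Rs. v (Pp p) (J I) mod e p)" for I
  have v_scale: "v P ((*) (of_nat c) ` L) = e p * multiplicity p c + v P L"
    if "c > 0" "nzid L" "Factorial_Ring.prime p" "P \<in> primes_above K p" for c L p P
  proof -
    have P: "P \<in> maxs" using that by (auto simp: primes_above_eq)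
    show ?thesis
      using that v_iprod[OF P nzid_princ, of "of_nat c" L] princ_iprod[OF nzidD, of L "of_nat c"] v_of_nat[OF that(3,4)] by simp
  qed
  have mod_scale: "v P L mod e p = v P L' mod e p"
    if "c > 0" "d > 0" "nzid L" "nzid L'" "Factorial_Ring.prime p" "P \<in> primes_above K p"
      "(*) (of_nat c) ` L = (*) (of_nat d) ` L'" for c d :: nat and L L' p P
  proof -
    have "e p * multiplicity p c + v P L = e p * multiplicity p d + v P L'"
      using that v_scale[of c L p P] v_scale[of d L' p P] by simp
    thus ?thesis by (metis mod_mult_self4)
  qed
  have 1: "idx Fr GI QI = card (g ` GI)"
  proof (rule Fr.idx_cong[OF subgroup_QI])
    show "GI \<subseteq> carrier Fr" using GIFr by blast
    fix I I' assume I: "I \<in> GI" "I' \<in> GI"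
    have mm: "m I > 0" "m I' > 0" using m GIFr I by auto
    have I_J: "I = (*) (inverse (of_nat (m I))) ` J I" "I' = (*) (inverse (of_nat (m I'))) ` J I'"
      using mm by (simp_all add: J_def scale_scale)
    show "I \<otimes>\<^bsub>Fr\<^esub> inv\<^bsub>Fr\<^esub> I' \<in> QI \<longleftrightarrow> g I = g I'"
    proof
      assume "I \<otimes>\<^bsub>Fr\<^esub> inv\<^bsub>Fr\<^esub> I' \<in> QI"
      then obtain q where q: "q \<in> \<rat>" "q \<noteq> 0" "I \<odot> inv\<^bsub>Fr\<^esub> I' = princ q" by (auto simp: QI_def)
      have "I = (I \<odot> inv\<^bsub>Fr\<^esub> I') \<odot> I'"
        using Fr.inv_solve_right[of "I \<odot> inv\<^bsub>Fr\<^esub> I'" I I'] Fr.m_closed[of I "inv\<^bsub>Fr\<^esub> I'"] GIFr[OF I(1)] GIFr[OF I(2)]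
          Fr.inv_closed[of I'] by (metis mult_Fr)
      hence I_q: "I = (*) q ` I'" using q O_iprod_Fr[OF GIFr[OF I(2)]] by (simp add: princ_def iprod_scale)
      \<comment> \<open>\<open>I\<close> is \<open>q\<close> times \<open>I'\<close>. Clearing the
        denominators of \<open>q\<close> and of both ideals gives an equation between integer
        multiples of \<open>J I\<close> and \<open>J I'\<close>, the sign of \<open>c\<close> being
        absorbed by \<open>neg\<close>.\<close>
      obtain c d where cd: "q = of_int c / of_int d" "d > 0" using q(1) by (auto elim: Rats_cases')
      have c0: "c \<noteq> 0" using cd q by auto
      define c' where "c' = nat \<bar>c\<bar>"
      have JK: "isid (J I')" using nzJ GIFr I nzidD by blast
      have neg: "(*) (- z) ` J I' = (*) z ` J I'" for z
      proof -
        have "(*) (- 1) ` J I' = J I'"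
        proof
          show "(*) (- 1) ` J I' \<subseteq> J I'" using isidD(6)[OF JK] by auto
          show "J I' \<subseteq> (*) (- 1) ` J I'"
          proof
            fix x assume "x \<in> J I'"
            thus "x \<in> (*) (- 1) ` J I'" using isidD(6)[OF JK, of x] by (intro image_eqI[of _ _ "- x"]) auto
          qed
        qed
        hence "(*) (- z) ` J I' = (*) z ` (*) (- 1) ` J I'" unfolding scale_scale by simp
        thus ?thesis unfolding \<open>(*) (- 1) ` J I' = J I'\<close> .
      qed
      have "(*) (of_nat (nat d * m I')) ` J I = (*) (of_int c * of_nat (m I)) ` J I'"
      proof -
        have Iz: "(*) z ` I = (*) (z * q) ` I'" for z
        proof -
          have "(*) z ` I = (*) z ` (*) q ` I'" by (rule arg_cong[of _ _ "(`) ((*) z)", OF I_q])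
          thus ?thesis unfolding scale_scale .
        qed
        have eq: "of_nat (nat d * m I') * (of_nat (m I) * q) = of_int c * of_nat (m I) * of_nat (m I')"
          using cd by (simp add: field_simps)
        show ?thesis unfolding J_def scale_scale Iz eq ..
      qed
      also have "\<dots> = (*) (of_nat (c' * m I)) ` J I'"
        using neg[of "of_int c * of_nat (m I)"] by (cases "c \<ge> 0") (auto simp: c'_def)
      finally have eq: "(*) (of_nat (nat d * m I')) ` J I = (*) (of_nat (c' * m I)) ` J I'" .
      show "g I = g I'" unfolding g_def
      proof (rule restrict_ext)
        fix p assume "p \<in> Rs"
        hence p: "Factorial_Ring.prime p" using Rs by blast
        show "v (Pp p) (J I) mod e p = v (Pp p) (J I') mod e p"
          by (rule mod_scale[OF _ _ nzJ nzJ p Pp[OF p] eq]) (use mm cd c0 GIFr I in \<open>auto simp: c'_def\<close>)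
      qed
    next
      assume gg: "g I = g I'"
      have cong: "v P (J I) mod e p = v P (J I') mod e p" if p: "Factorial_Ring.prime p" "P \<in> primes_above K p" for p P
      proof (cases "p \<in> Rs")
        case True
        hence "v (Pp p) (J I) mod e p = v (Pp p) (J I') mod e p" using fun_cong[OF gg, of p] by (simp add: g_def)
        moreover have "v P (J L) = v (Pp p) (J L)" if "L \<in> GI" for L
          by (rule v_above_eq[OF p(1) p(2) Pp[OF p(1)] nzJ[OF GIFr[OF that]] JG[OF that]])
        ultimately show ?thesis using I by simp
      next
        case False thus ?thesis using unram p by simp
      qed
      obtain a b :: nat where ab: "a > 0" "b > 0" "(*) (of_nat a) ` J I = (*) (of_nat b) ` J I'"
        using invariant_ratio[OF nzJ[OF GIFr[OF I(1)]] JG[OF I(1)] nzJ[OF GIFr[OF I(2)]] JG[OF I(2)] cong] by blast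
      define q :: complex where "q = of_nat b * of_nat (m I') / (of_nat a * of_nat (m I))"
      have "J I = (*) (inverse (of_nat a)) ` (*) (of_nat a) ` J I" unfolding scale_scale using ab by simp
      hence "J I = (*) (inverse (of_nat a) * of_nat b) ` J I'" unfolding ab(3) scale_scale .
      hence "I = (*) (inverse (of_nat (m I))) ` (*) (inverse (of_nat a) * of_nat b) ` J I'" using I_J(1) by simp
      hence "I = (*) (inverse (of_nat (m I)) * (inverse (of_nat a) * of_nat b * of_nat (m I'))) ` I'"
        unfolding J_def scale_scale by (simp add: mult.assoc)
      moreover have "inverse (of_nat (m I)) * (inverse (of_nat a) * of_nat b * of_nat (m I')) = q"
        by (simp add: q_def field_simps)
      ultimately have "I = (*) q ` I'" by simp
      hence "I \<odot> inv\<^bsub>Fr\<^esub> I' = (*) q ` (I' \<odot> inv\<^bsub>Fr\<^esub> I')" by (simp add: iprod_scale)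
      also have "I' \<odot> inv\<^bsub>Fr\<^esub> I' = \<O>" using Fr.r_inv[OF GIFr[OF I(2)]] by simp
      finally have "I \<otimes>\<^bsub>Fr\<^esub> inv\<^bsub>Fr\<^esub> I' = princ q" by (simp add: princ_def)
      moreover have "q \<in> \<rat> - {0}" using ab mm by (simp add: q_def)
      ultimately show "I \<otimes>\<^bsub>Fr\<^esub> inv\<^bsub>Fr\<^esub> I' \<in> QI" by (auto simp: QI_def)
    qed
  qed
  \<comment> \<open>Every vector of residues \<open>w\<close> is attained at the ideal
    \<open>pprod Rs w\<close>.\<close>
  have 2: "g ` GI = PiE Rs (\<lambda>p. {0..<e p})"
  proof
    have ep: "0 < e p" if "p \<in> Rs" for p using e_pos[OF Rs(2)[OF that]] by simp
    show "g ` GI \<subseteq> PiE Rs (\<lambda>p. {0..<e p})"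
      by (auto simp: g_def PiE_iff ep)
    show "PiE Rs (\<lambda>p. {0..<e p}) \<subseteq> g ` GI"
    proof
      fix w assume w: "w \<in> PiE Rs (\<lambda>p. {0..<e p})"
      define I where "I = pprod Rs w"
      have I: "I \<in> GI" using pprod_II[OF Rs] II_eq_GI by (simp add: I_def)
      have nzI: "nzid I" unfolding I_def by (rule nzid_pprod[OF Rs])
      have "g I = w"
      proof
        fix p
        show "g I p = w p"
        proof (cases "p \<in> Rs")
          case True
          hence p: "Factorial_Ring.prime p" using Rs by blast
          have "v (Pp p) (J I) = e p * multiplicity p (m I) + v (Pp p) I"
            unfolding J_def using v_scale[OF m(1)[OF GIFr[OF I]] nzI p Pp[OF p]] .
          also have "v (Pp p) I = w p" unfolding I_def using v_pprod[OF Rs p Pp[OF p]] True by simp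
          finally have "v (Pp p) (J I) mod e p = w p" using w True by (auto simp: PiE_iff)
          thus ?thesis using True by (simp add: g_def)
        next
          case False
          thus ?thesis using w by (simp add: g_def PiE_iff extensional_def)
        qed
      qed
      thus "w \<in> g ` GI" using I by blast
    qed
  qed
  \<comment> \<open>\<open>PP\<close> need not lie in \<open>GI\<close>; on \<open>GI\<close> its
    cosets are separated like those of the intersection, to which the tower applies.\<close>
  have "idx Fr GI PP = idx Fr GI (PP \<inter> GI)"
    unfolding idx_def[of Fr GI PP]
  proof (rule Fr.idx_cong[symmetric])
    show "subgroup (PP \<inter> GI) Fr" by (rule Fr.subgroups_Inter_pair[OF subgroup_PP subgroup_GI])
    show "GI \<subseteq> carrier Fr" using GIFr by blast
    fix x y assume xy: "x \<in> GI" "y \<in> GI"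
    have "x \<otimes>\<^bsub>Fr\<^esub> inv\<^bsub>Fr\<^esub> y \<in> GI" using xy subgroup_GI by (meson subgroup.m_closed subgroup.m_inv_closed)
    thus "x \<otimes>\<^bsub>Fr\<^esub> inv\<^bsub>Fr\<^esub> y \<in> PP \<inter> GI \<longleftrightarrow> PP #>\<^bsub>Fr\<^esub> x = PP #>\<^bsub>Fr\<^esub> y"
      using Fr.rcos_eq_iff[OF subgroup_PP GIFr[OF xy(1)] GIFr[OF xy(2)]] by blast
  qed
  hence "card (Polya_group K) * idx cmul A0 QU = idx Fr GI (PP \<inter> GI) * idx Fr (PP \<inter> GI) QI"
    using card_Polya idx_principal by simp
  also have "\<dots> = idx Fr GI QI"
    by (rule Fr.idx_tower[symmetric, OF subgroup_QI Fr.subgroups_Inter_pair[OF subgroup_PP subgroup_GI] subgroup_GI QI_PP_GI]) blast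
  also have "\<dots> = (\<Prod>p\<in>Rs. e p)" unfolding 1 2 using Rs by (simp add: card_PiE)
  finally show ?thesis .
qed

end

subsection \<open>The discriminant\<close>

text \<open>Links \<open>G\<close> to the embeddings over which traces are formed: restriction to
  \<open>K\<close> yields all of them, each once.\<close>

locale galois_number_field = galois_field +
  assumes embeddings: "field_embeddings K = (\<lambda>\<sigma>. restrict \<sigma> K) ` G"
    and embeddings_inj: "inj_on (\<lambda>\<sigma>. restrict \<sigma> K) G"
begin

definition Tr :: "complex \<Rightarrow> complex" where "Tr x = (\<Sum>\<sigma>\<in>G. \<sigma> x)"

lemma field_trace_eq: "x \<in> K \<Longrightarrow> field_trace K x = Tr x"
  unfolding field_trace_def Tr_def embeddings by (simp add: sum.reindex[OF embeddings_inj])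

lemma Tr_O: "x \<in> \<O> \<Longrightarrow> Tr x \<in> \<int>"
proof (rule O_fixed)
  assume x: "x \<in> \<O>"
  show "Tr x \<in> \<O>" unfolding Tr_def using G_O x by (intro O_sum) blast
  fix \<tau> assume t: "\<tau> \<in> G"
  have "\<tau> (Tr x) = (\<Sum>\<sigma>\<in>G. (\<tau> \<circ> \<sigma>) x)"
    unfolding Tr_def using G_sum[OF t, of G "\<lambda>\<sigma>. \<sigma> x"] G_closed[OF _ O_K[OF x]] by simp
  also have "\<dots> = Tr x" unfolding Tr_def by (rule sum.reindex_bij_betw[OF G_bij[OF t], of "\<lambda>\<sigma>. \<sigma> x"])
  finally show "\<tau> (Tr x) = Tr x" .
qed

definition iTr :: "complex \<Rightarrow> int" where "iTr x = \<lfloor>Re (Tr x)\<rfloor>"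

lemma iTr: "x \<in> \<O> \<Longrightarrow> of_int (iTr x) = Tr x"
  using Tr_O[of x] by (auto simp: iTr_def elim!: Ints_cases)

lemma Tr_sum_int:
  assumes "\<And>i. i \<in> I \<Longrightarrow> f i \<in> K"
  shows "Tr (\<Sum>i\<in>I. of_int (c i) * f i) = (\<Sum>i\<in>I. of_int (c i) * Tr (f i))"
proof -
  have "\<sigma> (\<Sum>i\<in>I. of_int (c i) * f i) = (\<Sum>i\<in>I. of_int (c i) * \<sigma> (f i))" if "\<sigma> \<in> G" for \<sigma>
    using G_sum[OF that, of I "\<lambda>i. of_int (c i) * f i"] assms K_mult[OF K_of_int]
    by (simp add: G_mult[OF that K_of_int] G_of_int[OF that])
  hence "Tr (\<Sum>i\<in>I. of_int (c i) * f i) = (\<Sum>\<sigma>\<in>G. \<Sum>i\<in>I. of_int (c i) * \<sigma> (f i))"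
    unfolding Tr_def by (intro sum.cong) auto
  also have "\<dots> = (\<Sum>i\<in>I. of_int (c i) * Tr (f i))"
    by (subst sum.swap) (simp add: Tr_def sum_distrib_left)
  finally show ?thesis .
qed

text \<open>The Gram matrix of the trace form, taken with integer entries so that divisibility of
  its determinant makes sense.\<close>

definition gram :: "complex list \<Rightarrow> int mat" where
  "gram b = mat (length b) (length b) (\<lambda>(i, j). iTr (b ! i * b ! j))"

lemma gram_carrier [simp]: "gram b \<in> carrier_mat (length b) (length b)" by (simp add: gram_def)

lemma det_gram:
  assumes "set b \<subseteq> \<O>"
  shows "det (mat (length b) (length b) (\<lambda>(i, j). field_trace K (b ! i * b ! j))) = of_int (det (gram b))"
proof -
  have O: "b ! i * b ! j \<in> \<O>" if "i < length b" "j < length b" for i j using that assms by (auto intro!: O_mult)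
  have "mat (length b) (length b) (\<lambda>(i, j). field_trace K (b ! i * b ! j)) = map_mat of_int (gram b)"
    by (rule eq_matI) (auto simp: gram_def iTr[OF O] field_trace_eq[OF O_K[OF O]])
  thus ?thesis by (simp add: of_int_hom.hom_det)
qed

text \<open>Bilinearity of the trace form: under the base change \<open>A\<close> the Gram matrix is
  multiplied by \<open>A\<close> on the left and by its transpose on the right.\<close>

lemma gram_transform:
  assumes b: "set b \<subseteq> \<O>" and A: "A \<in> carrier_mat (length b) (length b)" and len: "length b' = length b"
    and b': "\<And>i. i < length b \<Longrightarrow> b' ! i = (\<Sum>j<length b. of_int (A $$ (i, j)) * b ! j)"
  shows "det (gram b') = det A ^ 2 * det (gram b)"
proof -
  let ?n = "length b"
  have bO: "b ! i \<in> \<O>" if "i < ?n" for i using b that by auto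
  have b'O: "b' ! i \<in> \<O>" if "i < ?n" for i unfolding b'[OF that] using bO by (intro O_sum O_mult O_of_int) auto
  have "gram b' = A * (gram b * transpose_mat A)"
  proof (rule eq_matI)
    show "dim_row (gram b') = dim_row (A * (gram b * transpose_mat A))" "dim_col (gram b') = dim_col (A * (gram b * transpose_mat A))"
      using A len by (auto simp: gram_def)
    fix i j assume "i < dim_row (A * (gram b * transpose_mat A))" "j < dim_col (A * (gram b * transpose_mat A))"
    hence ij: "i < ?n" "j < ?n" using A by auto
    have prod: "b' ! i * b' ! j = (\<Sum>k<?n. of_int (A $$ (i, k)) * (\<Sum>l<?n. of_int (A $$ (j, l)) * (b ! k * b ! l)))"
      unfolding b'[OF ij(1)] b'[OF ij(2)] sum_product by (simp add: sum_distrib_left algebra_simps)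
    have "(of_int (iTr (b' ! i * b' ! j)) :: complex) = Tr (b' ! i * b' ! j)"
      using iTr O_mult b'O ij by blast
    also have "\<dots> = (\<Sum>k<?n. of_int (A $$ (i, k)) * Tr (\<Sum>l<?n. of_int (A $$ (j, l)) * (b ! k * b ! l)))"
      unfolding prod using bO by (intro Tr_sum_int O_K O_sum O_mult O_of_int) auto
    also have "\<dots> = (\<Sum>k<?n. of_int (A $$ (i, k)) * (\<Sum>l<?n. of_int (A $$ (j, l)) * Tr (b ! k * b ! l)))"
      by (intro sum.cong refl, subst Tr_sum_int) (auto intro!: O_K O_mult bO)
    also have "\<dots> = (\<Sum>k<?n. of_int (A $$ (i, k)) * (\<Sum>l<?n. of_int (A $$ (j, l)) * of_int (iTr (b ! k * b ! l))))"
      by (intro sum.cong refl) (simp add: iTr O_mult bO)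
    also have "\<dots> = of_int (\<Sum>k<?n. A $$ (i, k) * (\<Sum>l<?n. A $$ (j, l) * iTr (b ! k * b ! l)))" by simp
    finally have "iTr (b' ! i * b' ! j) = (\<Sum>k<?n. A $$ (i, k) * (\<Sum>l<?n. A $$ (j, l) * iTr (b ! k * b ! l)))"
      by (simp only: of_int_eq_iff)
    thus "gram b' $$ (i, j) = (A * (gram b * transpose_mat A)) $$ (i, j)"
      using ij A len by (simp add: gram_def scalar_prod_def lessThan_atLeast0 mult.commute)
  qed
  hence "det (gram b') = det A * (det (gram b) * det (transpose_mat A))"
    using det_mult[OF A mult_carrier_mat[OF gram_carrier, of "transpose_mat A" b ?n]]
      det_mult[OF gram_carrier, of "transpose_mat A" b] A by simp
  thus ?thesis using A by (simp add: det_transpose power2_eq_square)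
qed

lemma basis_subset: "set basis \<subseteq> \<O>" using basis unfolding integral_basis_def by simp

lemma gram_mult:
  assumes "i < length basis" "x \<in> \<O>"
  shows "(\<Sum>j<length basis. gram basis $$ (i, j) * co x ! j) = iTr (basis ! i * x)"
proof -
  have prod: "basis ! i * x = (\<Sum>j<length basis. of_int (co x ! j) * (basis ! i * basis ! j))"
    by (subst co(2)[OF assms(2)]) (simp add: sum_distrib_left algebra_simps)
  have "(of_int (iTr (basis ! i * x)) :: complex) = Tr (basis ! i * x)" using iTr O_mult basis_O assms by blast
  also have "\<dots> = (\<Sum>j<length basis. of_int (co x ! j) * Tr (basis ! i * basis ! j))"
    unfolding prod using basis_O assms by (intro Tr_sum_int O_K O_mult) auto
  also have "\<dots> = of_int (\<Sum>j<length basis. co x ! j * iTr (basis ! i * basis ! j))"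
    using basis_O assms by (simp add: iTr O_mult)
  finally show ?thesis using assms by (simp only: of_int_eq_iff) (simp add: gram_def mult.commute)
qed

text \<open>The trace form is nondegenerate. An \<open>x\<close> orthogonal to the basis is
  orthogonal to every integral element, in particular to its norm cofactor \<open>y\<close>; yet
  \<open>x * y\<close> is the rational number \<open>N x\<close>, with trace
  \<open>card G * N x\<close>.\<close>

lemma det_gram_nonzero: "det (gram basis) \<noteq> 0"
proof
  let ?n = "length basis"
  assume "det (gram basis) = 0"
  then obtain w where w: "w \<in> carrier_vec ?n" "w \<noteq> 0\<^sub>v ?n" "gram basis *\<^sub>v w = 0\<^sub>v ?n"
    using det_0_iff_vec_prod_zero[OF gram_carrier] by blast
  define x where "x = (\<Sum>i<?n. of_int (list_of_vec w ! i) * basis ! i)"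
  have x: "x \<in> \<O>" unfolding x_def by (rule sum_basis_O)
  have cox: "co x = list_of_vec w" unfolding x_def by (rule co_unique) (use w in auto)
  have "x \<noteq> 0"
  proof
    assume "x = 0"
    moreover have "(0 :: complex) = (\<Sum>i<?n. of_int (replicate ?n 0 ! i) * basis ! i)" by simp
    hence "co 0 = replicate ?n 0" using co_unique[of "replicate ?n 0"] by simp
    ultimately have "list_of_vec w = replicate ?n 0" using cox by simp
    hence "w = 0\<^sub>v ?n" by (intro eq_vecI) (use w in \<open>auto simp: list_of_vec_index[symmetric]\<close>)
    thus False using w by simp
  qed
  have "iTr (basis ! i * x) = 0" if "i < ?n" for i
  proof -
    have "(gram basis *\<^sub>v w) $ i = (\<Sum>j<?n. gram basis $$ (i, j) * co x ! j)"
      using that w(1) by (simp add: gram_def scalar_prod_def lessThan_atLeast0 cox list_of_vec_index)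
    moreover have "(gram basis *\<^sub>v w) $ i = 0" unfolding w(3) using that by simp
    ultimately show ?thesis using gram_mult[OF that x] by simp
  qed
  hence tr0: "Tr (basis ! i * x) = 0" if "i < ?n" for i
    using that iTr[OF O_mult[OF basis_O[OF that] x]] by simp
  obtain y where y: "y \<in> \<O>" "N x = x * y" using N_cofactor[OF x] by blast
  have "x * y = (\<Sum>i<?n. of_int (co y ! i) * (basis ! i * x))"
    by (subst co(2)[OF y(1)]) (simp add: sum_distrib_left algebra_simps)
  also have "Tr \<dots> = (\<Sum>i<?n. of_int (co y ! i) * Tr (basis ! i * x))"
    using basis_O x by (intro Tr_sum_int O_K O_mult) auto
  finally have "Tr (N x) = 0" using tr0 y by simp
  moreover have "Tr (N x) = of_nat (card G) * N x"
  proof -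
    have "Tr (N x) = (\<Sum>\<sigma>\<in>G. N x)"
      unfolding Tr_def by (rule sum.cong[OF refl]) (use G_Rats N_K[OF O_K[OF x]] in blast)
    thus ?thesis by simp
  qed
  ultimately show False using N_eq_0_iff[of x] \<open>x \<noteq> 0\<close> finite_G id_G by auto
qed

lemma galois_number_field_basis:
  assumes "integral_basis K b"
  shows "galois_number_field K G b"
  by unfold_locales
     (fact K_one K_add K_uminus K_mult K_inverse finite_G id_G comp_G inverse_G G_closed G_add G_mult G_one
        fixed_Rats K_frac assms embeddings embeddings_inj)+

text \<open>The index of the ideal generated by 2 is 2 to the length of any integral basis.\<close>

lemma length_integral_basis:
  assumes "integral_basis K b"
  shows "length b = length basis"
proof -
  interpret b: galois_number_field K G b by (rule galois_number_field_basis[OF assms])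
  have "(2 :: nat) ^ length b = 2 ^ length basis"
    using ideal_norm_of_nat[of 2] b.ideal_norm_of_nat[of 2] by simp
  thus ?thesis by simp
qed

text \<open>The transition matrices in the two directions have squared determinants whose product is
  1.\<close>

lemma det_gram_unique:
  assumes "integral_basis K b"
  shows "det (gram b) = det (gram basis)"
proof -
  interpret b: galois_number_field K G b by (rule galois_number_field_basis[OF assms])
  let ?n = "length basis"
  have len: "length b = ?n" using length_integral_basis[OF assms] .
  define A where "A = mat ?n ?n (\<lambda>(i, j). co (b ! i) ! j)"
  define B where "B = mat ?n ?n (\<lambda>(i, j). b.co (basis ! i) ! j)"
  have 1: "det (gram b) = det A ^ 2 * det (gram basis)"
  proof (rule gram_transform[OF basis_subset _ len])
    show "b ! i = (\<Sum>j<?n. of_int (A $$ (i, j)) * basis ! j)" if "i < ?n" for i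
      using co(2)[OF b.basis_O[of i]] that len by (simp add: A_def)
  qed (simp add: A_def)
  have 2: "det (gram basis) = det B ^ 2 * det (gram b)"
  proof (rule gram_transform[OF b.basis_subset])
    show "basis ! i = (\<Sum>j<length b. of_int (B $$ (i, j)) * b ! j)" if "i < length b" for i
      using b.co(2)[OF basis_O[of i]] that len by (simp add: B_def)
  qed (simp_all add: B_def len)
  have "(det A ^ 2 * det B ^ 2) * det (gram basis) = det B ^ 2 * (det A ^ 2 * det (gram basis))" by (simp only: ac_simps)
  also have "\<dots> = det (gram basis)" using 1 2 by metis
  finally have "(det A ^ 2 * det B ^ 2) * det (gram basis) = det (gram basis)" .
  hence "det A ^ 2 * det B ^ 2 = 1" using det_gram_nonzero by simp
  hence "det A ^ 2 dvd 1" by (metis dvd_triv_left)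
  hence "det A ^ 2 = 1" using zdvd1_eq[of "det A ^ 2"] by simp
  thus ?thesis using 1 by simp
qed

lemma field_discriminant_eq: "field_discriminant K = det (gram basis)"
  unfolding field_discriminant_def
proof (rule the_equality)
  show "\<exists>b. integral_basis K b \<and> of_int (det (gram basis)) =
      det (mat (length b) (length b) (\<lambda>(i, j). field_trace K (b ! i * b ! j)))"
    using basis det_gram[OF basis_subset] by auto
  fix d assume "\<exists>b. integral_basis K b \<and> of_int d = det (mat (length b) (length b) (\<lambda>(i, j). field_trace K (b ! i * b ! j)))"
  then obtain b where b: "integral_basis K b"
    "of_int d = det (mat (length b) (length b) (\<lambda>(i, j). field_trace K (b ! i * b ! j)))" by blast
  have "set b \<subseteq> \<O>" using b unfolding integral_basis_def by simp
  hence "(of_int d :: complex) = of_int (det (gram b))" using b det_gram by simp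
  thus "d = det (gram basis)" using det_gram_unique[OF b(1)] by simp
qed

text \<open>If \<open>e p\<close> is at least 2, then \<open>radp p\<close> contains some
  \<open>x\<close> that is not divisible by \<open>p\<close>. The products of \<open>x\<close> with
  the basis lie in \<open>radp p\<close>, so their traces are integers divisible by
  \<open>p\<close>. The coordinates of \<open>x\<close> thus form a nonzero kernel vector of the
  Gram matrix modulo \<open>p\<close>, and \<open>p\<close> divides the determinant.\<close>

lemma unramified_of_not_dvd_discriminant:
  assumes p: "Factorial_Ring.prime p" and nd: "\<not> int p dvd field_discriminant K"
  shows "e p = 1"
proof (rule ccontr)
  let ?n = "length basis"
  assume "e p \<noteq> 1"
  hence e2: "e p \<ge> 2" using e_pos[OF p] by simp
  have p0: "p > 0" using prime_gt_0_nat[OF p] .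
  have nzp: "nzid (princ (of_nat p))" using nzid_princ[of "of_nat p"] p0 by simp
  obtain P where P: "P \<in> primes_above K p" using primes_above_exists[OF p] .
  have PM: "P \<in> maxs" using P by (simp add: primes_above_eq)
  have "\<not> radp p \<subseteq> princ (of_nat p)"
    using v_mono[OF PM nzid_radp[OF p] nzp] e_eq[OF p P] v_radp[OF p PM] P e2 by auto
  then obtain x where x: "x \<in> radp p" "x \<notin> princ (of_nat p)" by blast
  have xO: "x \<in> \<O>" using x isidD(1) nzidD nzid_radp[OF p] by blast
  obtain i where i: "i < ?n" "\<not> int p dvd co x ! i" using princ_of_nat_iff[OF xO p0] x by blast
  define c where "c = vec ?n (\<lambda>j. co x ! j)"
  have dvd: "int p dvd iTr (basis ! j * x)" if "j < ?n" for j
  proof -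
    have yO: "basis ! j * x \<in> \<O>" using O_mult basis_O that xO by blast
    have r: "isid (radp p)" using nzidD nzid_radp[OF p] by blast
    have y: "basis ! j * x \<in> radp p" using isidD(4)[OF r basis_O[OF that] x(1)] .
    have "Tr (basis ! j * x) \<in> radp p" unfolding Tr_def
    proof (rule isid_sum[OF r])
      fix \<sigma> assume "\<sigma> \<in> G"
      thus "\<sigma> (basis ! j * x) \<in> radp p" using G_radp[OF p, of \<sigma>] y by blast
    qed
    moreover have "radp p \<subseteq> P" using radp_iff[OF p nzid_radp[OF p]] P by blast
    ultimately have "of_int (iTr (basis ! j * x)) \<in> P" using iTr[OF yO] by auto
    thus ?thesis using of_int_in_primes_above[OF p P] by blast
  qed
  have c: "c \<in> carrier_vec ?n" by (simp add: c_def)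
  have gc: "(gram basis *\<^sub>v c) $ j = iTr (basis ! j * x)" if "j < ?n" for j
    using gram_mult[OF that xO] that by (simp add: c_def gram_def scalar_prod_def lessThan_atLeast0)
  \<comment> \<open>The adjugate matrix turns the kernel vector modulo \<open>p\<close> into the
    divisibility of \<open>det (gram basis) * c $ i\<close> by \<open>p\<close>, at a coordinate not
    divisible by \<open>p\<close>.\<close>
  have adj: "adj_mat (gram basis) \<in> carrier_mat ?n ?n" "adj_mat (gram basis) * gram basis = det (gram basis) \<cdot>\<^sub>m 1\<^sub>m ?n"
    using adj_mat[OF gram_carrier] by auto
  have "adj_mat (gram basis) *\<^sub>v (gram basis *\<^sub>v c) = (det (gram basis) \<cdot>\<^sub>m 1\<^sub>m ?n) *\<^sub>v c"
    using assoc_mult_mat_vec[OF adj(1) gram_carrier c] adj(2) by simp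
  hence "(adj_mat (gram basis) *\<^sub>v (gram basis *\<^sub>v c)) $ i = det (gram basis) * c $ i"
    using i c by (simp add: scalar_prod_def if_distrib[of "\<lambda>x. x * _"] if_distrib[of "\<lambda>x. _ * x"] cong: if_cong)
  also have "(adj_mat (gram basis) *\<^sub>v (gram basis *\<^sub>v c)) $ i =
      (\<Sum>j<?n. adj_mat (gram basis) $$ (i, j) * (gram basis *\<^sub>v c) $ j)"
    using i adj(1) by (simp add: scalar_prod_def lessThan_atLeast0 gram_def)
  finally have "det (gram basis) * c $ i = (\<Sum>j<?n. adj_mat (gram basis) $$ (i, j) * iTr (basis ! j * x))"
    using gc by simp
  also have "int p dvd \<dots>" using dvd by (intro dvd_sum dvd_mult) auto
  finally have "int p dvd det (gram basis) \<or> int p dvd c $ i"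
    using p by (simp add: prime_dvd_mult_iff)
  thus False using i nd by (auto simp: c_def field_discriminant_eq)
qed

text \<open>Primes that do not divide the discriminant have ramification index 1, so the finite set
  of its prime divisors can serve as \<open>Rs\<close>.\<close>

theorem card_Polya_formula:
  "card (Polya_group K) * idx cmul A0 QU =
     (\<Prod>p \<in> {p. Factorial_Ring.prime p \<and> int p dvd field_discriminant K}. ramification_index K p)"
  unfolding e_def[symmetric]
proof (rule card_Polya_mult)
  let ?S = "{p. Factorial_Ring.prime p \<and> int p dvd field_discriminant K}"
  have d0: "nat \<bar>field_discriminant K\<bar> \<noteq> 0" using det_gram_nonzero by (simp add: field_discriminant_eq)
  have "p dvd nat \<bar>field_discriminant K\<bar>" if "int p dvd field_discriminant K" for p
    using that by (simp add: int_dvd_int_iff[symmetric])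
  hence "?S \<subseteq> {p. p dvd nat \<bar>field_discriminant K\<bar>}" by blast
  thus "finite ?S" using finite_divisors_nat[of "nat \<bar>field_discriminant K\<bar>"] d0 finite_subset by auto
qed (use unramified_of_not_dvd_discriminant in auto)

end

subsection \<open>Bases of lattices\<close>

definition zlin :: "complex list \<Rightarrow> complex set" where
  "zlin bs = {\<Sum>i<length bs. of_int (c i) * bs ! i | c :: nat \<Rightarrow> int. True}"

definition zindep :: "complex list \<Rightarrow> bool" where
  "zindep bs \<longleftrightarrow> (\<forall>c :: nat \<Rightarrow> int. (\<Sum>i<length bs. of_int (c i) * bs ! i) = 0 \<longrightarrow> (\<forall>i<length bs. c i = 0))"

lemma zlinI: "(\<Sum>i<length bs. of_int (c i) * bs ! i) \<in> zlin bs" by (auto simp: zlin_def)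

lemma zlin_Nil: "zlin [] = {0}" by (simp add: zlin_def)

lemma sum_Cons: "(\<Sum>i<length (b # bs). of_int (c i) * (b # bs) ! i) =
    of_int (c 0) * b + (\<Sum>i<length bs. of_int (c (Suc i)) * bs ! i)" for b :: complex
  by (simp only: length_Cons sum.lessThan_Suc_shift) simp

lemma zlin_Cons: "zlin (b # bs) = {of_int k * b + y | k y. y \<in> zlin bs}"
proof
  show "zlin (b # bs) \<subseteq> {of_int k * b + y | k y. y \<in> zlin bs}"
    unfolding zlin_def[of "b # bs"] sum_Cons by clarify (intro exI conjI, rule refl, rule zlinI)
  show "{of_int k * b + y | k y. y \<in> zlin bs} \<subseteq> zlin (b # bs)"
  proof clarify
    fix k :: int and y assume "y \<in> zlin bs"
    then obtain c where "y = (\<Sum>i<length bs. of_int (c i) * bs ! i)" unfolding zlin_def by blast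
    thus "of_int k * b + y \<in> zlin (b # bs)"
      using zlinI[of "\<lambda>i. case i of 0 \<Rightarrow> k | Suc j \<Rightarrow> c j" "b # bs"] unfolding sum_Cons by simp
  qed
qed

lemma zlin_diff: "x \<in> zlin bs \<Longrightarrow> y \<in> zlin bs \<Longrightarrow> x - y \<in> zlin bs"
proof -
  assume "x \<in> zlin bs" "y \<in> zlin bs"
  then obtain c e where "x = (\<Sum>i<length bs. of_int (c i) * bs ! i)" "y = (\<Sum>i<length bs. of_int (e i) * bs ! i)"
    unfolding zlin_def by blast
  hence "x - y = (\<Sum>i<length bs. of_int (c i - e i) * bs ! i)" by (simp add: sum_subtractf algebra_simps)
  thus ?thesis using zlinI by metis
qed

lemma zlin_smult: "x \<in> zlin bs \<Longrightarrow> of_int k * x \<in> zlin bs"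
proof -
  assume "x \<in> zlin bs"
  then obtain c where "x = (\<Sum>i<length bs. of_int (c i) * bs ! i)" unfolding zlin_def by blast
  hence "of_int k * x = (\<Sum>i<length bs. of_int (k * c i) * bs ! i)" by (simp add: sum_distrib_left algebra_simps)
  thus ?thesis using zlinI by metis
qed

lemma zindep_Cons:
  "zindep (b # bs) \<longleftrightarrow> zindep bs \<and> (\<forall>k y. y \<in> zlin bs \<longrightarrow> of_int k * b + y = 0 \<longrightarrow> k = 0)"
proof (intro iffI conjI allI impI)
  assume ind: "zindep (b # bs)"
  show "zindep bs" unfolding zindep_def
  proof (intro allI impI)
    fix c i assume c: "(\<Sum>i<length bs. of_int (c i) * bs ! i) = 0" "i < length bs"
    hence "(\<Sum>i<length (b # bs). of_int ((\<lambda>i. case i of 0 \<Rightarrow> 0 | Suc j \<Rightarrow> c j) i) * (b # bs) ! i) = 0"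
      unfolding sum_Cons by simp
    from ind[unfolded zindep_def, rule_format, OF this, of "Suc i"] show "c i = 0" using c by simp
  qed
  fix k :: int and y assume y: "y \<in> zlin bs" "of_int k * b + y = 0"
  then obtain c where c: "y = (\<Sum>i<length bs. of_int (c i) * bs ! i)" unfolding zlin_def by blast
  hence "(\<Sum>i<length (b # bs). of_int ((\<lambda>i. case i of 0 \<Rightarrow> k | Suc j \<Rightarrow> c j) i) * (b # bs) ! i) = 0"
    unfolding sum_Cons using y by simp
  from ind[unfolded zindep_def, rule_format, OF this, of 0] show "k = 0" by simp
next
  assume ind: "zindep bs \<and> (\<forall>k y. y \<in> zlin bs \<longrightarrow> of_int k * b + y = 0 \<longrightarrow> k = 0)"
  show "zindep (b # bs)" unfolding zindep_def
  proof (intro allI impI)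
    fix c i assume c: "(\<Sum>i<length (b # bs). of_int (c i) * (b # bs) ! i) = 0" "i < length (b # bs)"
    hence c0: "c 0 = 0" using ind zlinI[of "\<lambda>i. c (Suc i)" bs] unfolding sum_Cons by blast
    hence "(\<Sum>i<length bs. of_int (c (Suc i)) * bs ! i) = 0" using c(1) unfolding sum_Cons by simp
    from conjunct1[OF ind, unfolded zindep_def, rule_format, OF this] show "c i = 0"
      using c0 c(2) by (cases i) auto
  qed
qed

text \<open>Induction on the ambient basis. The coefficients of its first member \<open>b\<close>
  that occur in \<open>M\<close> are the multiples of some \<open>h\<close>. An element of
  \<open>M\<close> with coefficient \<open>h\<close>, put in front of a basis of the part of
  \<open>M\<close> spanned without \<open>b\<close>, gives a basis; if only the coefficient 0
  occurs, that part is all of \<open>M\<close>.\<close>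

lemma sublattice_basis:
  assumes "zindep bs" "M \<subseteq> zlin bs" "0 \<in> M" "\<And>x y. x \<in> M \<Longrightarrow> y \<in> M \<Longrightarrow> x - y \<in> M"
  obtains b where "zindep b" "zlin b = M"
proof -
  have "\<exists>b. zindep b \<and> zlin b = M" using assms
  proof (induction bs arbitrary: M)
    case Nil
    hence "M = {0}" by (auto simp: zlin_Nil)
    thus ?case by (intro exI[of _ "[]"]) (auto simp: zlin_Nil zindep_def)
  next
    case (Cons b bs)
    note indC = Cons.prems(1)[unfolded zindep_Cons]
    have neg: "- x \<in> M" if "x \<in> M" for x using Cons.prems(4)[OF Cons.prems(3) that] by simp
    have add: "x + y \<in> M" if "x \<in> M" "y \<in> M" for x y using Cons.prems(4)[OF that(1) neg[OF that(2)]] by simp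
    have nsmult: "of_nat k * x \<in> M" if "x \<in> M" for x and k :: nat
      by (induction k) (use that add Cons.prems(3) in \<open>auto simp: algebra_simps\<close>)
    have smult: "of_int k * x \<in> M" if "x \<in> M" for x and k :: int
      by (cases k rule: int_cases2) (use nsmult[OF that] neg in auto)
    define M0 where "M0 = M \<inter> zlin bs"
    have z0: "0 \<in> zlin bs" using zlinI[of "\<lambda>_. 0" bs] by simp
    have "\<exists>b. zindep b \<and> zlin b = M0"
      by (rule Cons.IH) (use indC Cons.prems z0 zlin_diff in \<open>auto simp: M0_def\<close>)
    then obtain b0 where b0: "zindep b0" "zlin b0 = M0" by blast
    define H where "H = {k :: int. \<exists>y \<in> zlin bs. of_int k * b + y \<in> M}"
    show ?case
    proof (cases "H \<subseteq> {0}")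
      case True
      have "M \<subseteq> zlin bs"
      proof
        fix x assume x: "x \<in> M"
        then obtain k y where ky: "x = of_int k * b + y" "y \<in> zlin bs" using Cons.prems(2) unfolding zlin_Cons by blast
        hence "k = 0" using x True unfolding H_def by blast
        thus "x \<in> zlin bs" using ky by simp
      qed
      hence "M0 = M" by (auto simp: M0_def)
      thus ?thesis using b0 by blast
    next
      case False
      have Hneg: "- k \<in> H" if kH: "k \<in> H" for k
      proof -
        obtain y where y: "y \<in> zlin bs" "of_int k * b + y \<in> M" using kH unfolding H_def by blast
        have "of_int (- k) * b + (0 - y) \<in> M" using neg[OF y(2)] by simp
        thus ?thesis using zlin_diff[OF z0 y(1)] unfolding H_def by blast
      qed
      obtain k0 where k0: "k0 \<in> H" "k0 \<noteq> 0" using False by blast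
      define h where "h = (LEAST n. n > 0 \<and> int n \<in> H)"
      have "\<exists>n. n > 0 \<and> int n \<in> H"
        using k0 Hneg[OF k0(1)] by (intro exI[of _ "nat \<bar>k0\<bar>"]) (cases "k0 > 0"; simp)
      hence h: "h > 0" "int h \<in> H" unfolding h_def using LeastI_ex[of "\<lambda>n. n > 0 \<and> int n \<in> H"] by auto
      have h_le: "h \<le> n" if "n > 0" "int n \<in> H" for n unfolding h_def by (rule Least_le) (use that in auto)
      obtain y0 where y0: "y0 \<in> zlin bs" "of_int (int h) * b + y0 \<in> M" using h(2) unfolding H_def by blast
      define m0 where "m0 = of_int (int h) * b + y0"
      have dvd: "int h dvd k" if kH: "k \<in> H" for k
      proof (rule ccontr)
        assume "\<not> int h dvd k"
        hence "k mod int h \<noteq> 0" by (simp add: mod_eq_0_iff_dvd)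
        moreover have "k mod int h \<ge> 0" using h by simp
        ultimately have pos: "k mod int h > 0" by linarith
        obtain y where y: "y \<in> zlin bs" "of_int k * b + y \<in> M" using kH unfolding H_def by blast
        have "of_int (k mod int h) * b + (y - of_int (k div int h) * y0) =
            (of_int k * b + y) - of_int (k div int h) * m0"
        proof -
          have "(of_int k :: complex) = of_int (k div int h) * of_int (int h) + of_int (k mod int h)"
            by (metis div_mult_mod_eq of_int_add of_int_mult)
          thus ?thesis unfolding m0_def by (simp add: algebra_simps)
        qed
        also have "\<dots> \<in> M" using Cons.prems(4)[OF y(2) smult] y0(2) m0_def by simp
        finally have "k mod int h \<in> H" unfolding H_def using zlin_diff[OF y(1) zlin_smult[OF y0(1)]] by blast
        hence "h \<le> nat (k mod int h)" using h_le pos by simp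
        moreover have "k mod int h < int h" using h by simp
        ultimately show False using pos by linarith
      qed
      have "zlin (m0 # b0) = M"
      proof
        show "zlin (m0 # b0) \<subseteq> M"
          unfolding zlin_Cons b0(2) using smult y0(2) add by (auto simp: M0_def m0_def)
        show "M \<subseteq> zlin (m0 # b0)"
        proof
          fix x assume x: "x \<in> M"
          then obtain k y where ky: "x = of_int k * b + y" "y \<in> zlin bs" using Cons.prems(2) unfolding zlin_Cons by blast
          hence "k \<in> H" using x unfolding H_def by blast
          then obtain l where l: "k = int h * l" using dvd by (blast elim: dvdE)
          have eq: "x - of_int l * m0 = y - of_int l * y0" by (simp add: ky l m0_def algebra_simps)
          have "x - of_int l * m0 \<in> M" using Cons.prems(4)[OF x smult] y0(2) m0_def by simp
          moreover have "x - of_int l * m0 \<in> zlin bs" unfolding eq using zlin_diff[OF ky(2) zlin_smult[OF y0(1)]] .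
          ultimately have "x - of_int l * m0 \<in> zlin b0" unfolding b0(2) by (simp add: M0_def)
          moreover have "x = of_int l * m0 + (x - of_int l * m0)" by simp
          ultimately show "x \<in> zlin (m0 # b0)" unfolding zlin_Cons by blast
        qed
      qed
      moreover have "zindep (m0 # b0)" unfolding zindep_Cons
      proof (intro conjI allI impI)
        show "zindep b0" by (rule b0(1))
        fix l y assume y: "y \<in> zlin b0" "of_int l * m0 + y = 0"
        have "y \<in> zlin bs" using y b0(2) by (simp add: M0_def)
        hence "0 - (of_int (- l) * y0 - y) \<in> zlin bs" using zlin_diff z0 zlin_smult[OF y0(1)] by blast
        moreover have "of_int (l * int h) * b + (0 - (of_int (- l) * y0 - y)) = 0"
          using y(2) by (simp add: m0_def algebra_simps)
        ultimately have "l * int h = 0" using indC by blast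
        thus "l = 0" using h by simp
      qed
      ultimately show ?thesis by blast
    qed
  qed
  thus ?thesis using that by blast
qed

lemma integral_basis_of_lattice:
  assumes "zindep b" "zlin b = carrier (ring_of_integers F)"
  shows "integral_basis F b"
  unfolding integral_basis_def
proof
  show "set b \<subseteq> carrier (ring_of_integers F)"
  proof
    fix x assume "x \<in> set b"
    then obtain i where i: "i < length b" "x = b ! i" by (metis in_set_conv_nth)
    have "(\<Sum>j<length b. of_int ((if j = i then 1 else 0) :: int) * b ! j) = x"
      using i by (simp add: if_distrib[of of_int] if_distrib[of "\<lambda>x. x * _"] cong: if_cong)
    thus "x \<in> carrier (ring_of_integers F)" using zlinI[of "\<lambda>j. if j = i then 1 else 0" b] assms(2) by metis
  qed
  show "\<forall>x\<in>carrier (ring_of_integers F). \<exists>!c :: int list. length c = length b \<and> x = (\<Sum>i<length b. of_int (c ! i) * b ! i)"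
  proof
    fix x assume "x \<in> carrier (ring_of_integers F)"
    then obtain c where c: "x = (\<Sum>i<length b. of_int (c i) * b ! i)" using assms(2) unfolding zlin_def by blast
    show "\<exists>!c :: int list. length c = length b \<and> x = (\<Sum>i<length b. of_int (c ! i) * b ! i)"
    proof (rule ex1I[of _ "map c [0..<length b]"])
      show "length (map c [0..<length b]) = length b \<and> x = (\<Sum>i<length b. of_int (map c [0..<length b] ! i) * b ! i)"
        using c by simp
      fix e :: "int list" assume e: "length e = length b \<and> x = (\<Sum>i<length b. of_int (e ! i) * b ! i)"
      have "(\<Sum>i<length b. of_int (e ! i - c i) * b ! i) = 0" using e c by (simp add: algebra_simps sum_subtractf)
      from assms(1)[unfolded zindep_def, rule_format, OF this]
      have "e ! i = c i" if "i < length b" for i using that by fastforce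
      thus "e = map c [0..<length b]" using e by (intro nth_equalityI) auto
    qed
  qed
qed

subsection \<open>Biquadratic fields\<close>

definition csq :: "nat \<Rightarrow> complex" where "csq n = complex_of_real (sqrt (real n))"

lemma csq_square: "csq n * csq n = of_nat n"
  by (simp add: csq_def of_real_mult[symmetric] del: of_real_mult)

lemma algebraic_int_csq: "algebraic_int (csq n)"
  by (auto simp: csq_def)

lemma squarefree_square_dvd:
  fixes n m :: nat
  assumes "squarefree n" "m\<^sup>2 dvd n"
  shows "m = 1"
  using assms unfolding squarefree_def by auto

lemma csq_not_Rats:
  assumes "squarefree n" "n > 1"
  shows "csq n \<notin> \<rat>"
proof
  assume "csq n \<in> \<rat>"
  hence "csq n \<in> \<int>" using rational_algebraic_int_is_int[OF algebraic_int_csq] by blast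
  then obtain m where m: "csq n = of_int m" by (auto elim: Ints_cases)
  have "(of_int (m * m) :: complex) = of_int (int n)" using csq_square[of n] m by simp
  hence "m * m = int n" by (simp only: of_int_eq_iff)
  hence "int ((nat \<bar>m\<bar>)\<^sup>2) = int n" by (simp add: power2_eq_square)
  hence "(nat \<bar>m\<bar>)\<^sup>2 = n" by (simp only: of_nat_eq_iff)
  hence "nat \<bar>m\<bar> = 1" using squarefree_square_dvd[OF assms(1), of "nat \<bar>m\<bar>"] by simp
  hence "n = 1" using \<open>(nat \<bar>m\<bar>)\<^sup>2 = n\<close> by simp
  thus False using assms by simp
qed

text \<open>With \<open>b\<close> in lowest terms, the square of its denominator divides
  \<open>n\<close>.\<close>

lemma Rats_int_of_squarefree:
  assumes "squarefree n" "b \<in> \<rat>" "b\<^sup>2 * of_nat n \<in> (\<int> :: complex set)"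
  shows "b \<in> \<int>"
proof -
  obtain x y where xy: "b = of_int x / of_int y" "y > 0" "coprime x y" using assms(2) by (auto elim: Rats_cases')
  obtain k where k: "b\<^sup>2 * of_nat n = of_int k" using assms(3) by (auto elim: Ints_cases)
  have "(of_int (x\<^sup>2 * int n) :: complex) = of_int (k * y\<^sup>2)" using k xy by (simp add: field_simps power2_eq_square)
  hence eq: "x\<^sup>2 * int n = k * y\<^sup>2" by (simp only: of_int_eq_iff)
  hence "y\<^sup>2 dvd x\<^sup>2 * int n" by simp
  moreover have "coprime (y\<^sup>2) (x\<^sup>2)" using xy(3) by (simp add: coprime_commute)
  ultimately have "y\<^sup>2 dvd int n" by (simp add: coprime_dvd_mult_right_iff)
  hence "(nat y)\<^sup>2 dvd n" using xy(2) by (metis int_dvd_int_iff int_nat_eq less_imp_le of_nat_power)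
  hence "nat y = 1" using squarefree_square_dvd[OF assms(1)] by blast
  hence "y = 1" using xy(2) by linarith
  thus ?thesis using xy by simp
qed

text \<open>Symmetric in the indices 1, 2, 3: \<open>r i\<close> is the rational factor between the
  \<open>i\<close>-th root and the product of the two others. By \<open>not_all_dvd\<close> a prime
  divides at most two of the \<open>d i\<close>, which is what makes each odd prime unramified in
  some quadratic subfield.\<close>

locale biquad =
  fixes d :: "nat \<Rightarrow> nat" and r :: "nat \<Rightarrow> complex"
  assumes sqf: "i \<in> {1, 2, 3} \<Longrightarrow> squarefree (d i)" and d_gt_1: "i \<in> {1, 2, 3} \<Longrightarrow> d i > 1"
    and r_Rats: "i \<in> {1, 2, 3} \<Longrightarrow> r i \<in> \<rat>" and r_nonzero: "i \<in> {1, 2, 3} \<Longrightarrow> r i \<noteq> 0"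
    and s23: "csq (d 2) * csq (d 3) = r 1 * csq (d 1)"
    and s13: "csq (d 1) * csq (d 3) = r 2 * csq (d 2)"
    and s12: "csq (d 1) * csq (d 2) = r 3 * csq (d 3)"
    and not_all_dvd: "Factorial_Ring.prime p \<Longrightarrow> \<exists>i\<in>{1, 2, 3}. \<not> p dvd d i"
begin

definition s :: "nat \<Rightarrow> complex" where "s i = csq (d i)"

lemma s_square: "s i * s i = of_nat (d i)" by (simp add: s_def csq_square)
lemma s_mult: "s 2 * s 3 = r 1 * s 1" "s 1 * s 3 = r 2 * s 2" "s 1 * s 2 = r 3 * s 3"
  using s23 s13 s12 by (simp_all add: s_def)
lemma s_irrational: "i \<in> {1, 2, 3} \<Longrightarrow> s i \<notin> \<rat>" unfolding s_def using csq_not_Rats sqf d_gt_1 by blast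
lemma s_nonzero: "i \<in> {1, 2, 3} \<Longrightarrow> s i \<noteq> 0" using s_irrational by force

definition q :: "complex \<Rightarrow> complex \<Rightarrow> complex \<Rightarrow> complex \<Rightarrow> complex" where
  "q a b c f = a + b * s 1 + c * s 2 + f * s 3"

definition KK :: "complex set" where "KK = {q a b c f | a b c f. a \<in> \<rat> \<and> b \<in> \<rat> \<and> c \<in> \<rat> \<and> f \<in> \<rat>}"

lemma KKE:
  assumes "x \<in> KK"
  obtains a b c f where "a \<in> \<rat>" "b \<in> \<rat>" "c \<in> \<rat>" "f \<in> \<rat>" "x = q a b c f"
  using assms unfolding KK_def by blast

lemma KKI: "a \<in> \<rat> \<Longrightarrow> b \<in> \<rat> \<Longrightarrow> c \<in> \<rat> \<Longrightarrow> f \<in> \<rat> \<Longrightarrow> q a b c f \<in> KK"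
  unfolding KK_def by blast

lemma lin_indep_2: "a \<in> \<rat> \<Longrightarrow> b \<in> \<rat> \<Longrightarrow> i \<in> {1, 2, 3} \<Longrightarrow> a + b * s i = 0 \<Longrightarrow> a = 0 \<and> b = 0"
proof -
  assume ab: "a \<in> \<rat>" "b \<in> \<rat>" and i: "i \<in> {1, 2, 3}" and eq: "a + b * s i = 0"
  have "b = 0"
  proof (rule ccontr)
    assume "b \<noteq> 0"
    moreover have "b * s i = - a" using eq by (simp add: add_eq_0_iff2 add.commute)
    ultimately have "s i = - a / b" by (simp add: field_simps)
    thus False using s_irrational[OF i] ab by simp
  qed
  thus ?thesis using eq by simp
qed

text \<open>With \<open>s 3\<close> rewritten through \<open>s 1 * s 2\<close>, this is a linear
  equation for \<open>s 2\<close> over the first quadratic field. If the coefficient of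
  \<open>s 2\<close> is nonzero, then \<open>s 2 = x + y * s 1\<close> with rational
  \<open>x\<close> and \<open>y\<close>, and squaring gives \<open>2 * x * y = 0\<close>. But
  \<open>y = 0\<close> makes \<open>s 2\<close> rational and \<open>x = 0\<close> makes
  \<open>s 3\<close> rational.\<close>

lemma q_eq_0_iff:
  assumes R: "a \<in> \<rat>" "b \<in> \<rat>" "c \<in> \<rat>" "f \<in> \<rat>"
  shows "q a b c f = 0 \<longleftrightarrow> a = 0 \<and> b = 0 \<and> c = 0 \<and> f = 0"
proof
  assume 0: "q a b c f = 0"
  define g where "g = f / r 3"
  have g: "g \<in> \<rat>" using R r_Rats[of 3] by (simp add: g_def)
  have r3: "r 3 \<noteq> 0" using r_nonzero[of 3] by simp
  have f: "f * s 3 = g * (s 1 * s 2)" using r3 s_mult(3) by (simp add: g_def)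
  have eq: "a + b * s 1 + (c + g * s 1) * s 2 = 0" using 0 f by (simp add: q_def algebra_simps)
  have d1: "s 1 * s 1 = of_nat (d 1)" "s 2 * s 2 = of_nat (d 2)" using s_square by auto
  have w0: "c = 0 \<and> g = 0"
  proof (rule ccontr)
    assume n: "\<not> ?thesis"
    define m where "m = c * c - g * g * of_nat (d 1)"
    have m_eq: "m = (c + g * s 1) * (c - g * s 1)" using d1 by (simp add: m_def algebra_simps)
    have "c + g * s 1 \<noteq> 0" using lin_indep_2[of c g 1] R(3) g n by blast
    moreover have "c - g * s 1 \<noteq> 0"
    proof
      assume "c - g * s 1 = 0"
      hence "c + (- g) * s 1 = 0" by (simp only: diff_conv_add_uminus mult_minus_left)
      moreover have "- g \<in> \<rat>" using g by simp
      ultimately have "c = 0 \<and> - g = 0" using lin_indep_2[of c "- g" 1] R(3) by blast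
      thus False using n by simp
    qed
    ultimately have m0: "m \<noteq> 0" unfolding m_eq by (rule no_zero_divisors)
    \<comment> \<open>Coordinates of the quotient of \<open>- (a + b * s 1)\<close> by
      \<open>c + g * s 1\<close>, computed with the conjugate \<open>c - g * s 1\<close> and the
      norm \<open>m\<close>.\<close>
    define x y where "x = - (a * c - b * g * of_nat (d 1)) / m" and "y = - (b * c - a * g) / m"
    have mQ: "m \<in> \<rat>" unfolding m_def by (intro Rats_diff Rats_mult R(3) g Rats_of_nat)
    have xy: "x \<in> \<rat>" "y \<in> \<rat>" unfolding x_def y_def
      by (simp_all only: minus_divide_left[symmetric] Rats_minus_iff)
         (intro Rats_divide Rats_diff Rats_mult R g mQ Rats_of_nat)+
    have "m * s 2 = - ((a + b * s 1) * (c - g * s 1))"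
    proof -
      have "m * s 2 = ((c + g * s 1) * s 2) * (c - g * s 1)" unfolding m_eq by simp
      also have "(c + g * s 1) * s 2 = - (a + b * s 1)" using eq by (simp add: add_eq_0_iff)
      finally show ?thesis by (simp only: mult_minus_left)
    qed
    also have "\<dots> = m * (x + y * s 1)" using m0 d1 by (simp add: x_def y_def field_simps)
    finally have s2: "s 2 = x + y * s 1" using m0 by simp
    have "of_nat (d 2) = (x + y * s 1) * (x + y * s 1)" using d1(2) unfolding s2 by (rule sym)
    also have "\<dots> = (x * x + y * y * (s 1 * s 1)) + (2 * x * y) * s 1" by (simp add: algebra_simps)
    finally have s2': "of_nat (d 2) = (x * x + y * y * of_nat (d 1)) + (2 * x * y) * s 1" unfolding d1(1) .
    have "(x * x + y * y * of_nat (d 1) - of_nat (d 2)) + (2 * x * y) * s 1 = 0"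
      unfolding s2' by (simp only: add_diff_cancel_left' diff_add_cancel diff_diff_add diff_self add_0 diff_add_eq cancel_comm_monoid_add_class.diff_cancel)
    moreover have "x * x + y * y * of_nat (d 1) - of_nat (d 2) \<in> \<rat>" "2 * x * y \<in> \<rat>"
      using xy by simp_all
    ultimately have "2 * x * y = 0" using lin_indep_2[of _ "2 * x * y" 1] by blast
    hence "x = 0 \<or> y = 0" by simp
    thus False
    proof
      assume "y = 0"
      thus False using s2 xy s_irrational[of 2] by simp
    next
      assume "x = 0"
      hence "s 1 * s 2 = y * of_nat (d 1)" using s2 d1 by (simp add: algebra_simps)
      hence "s 3 = y * of_nat (d 1) / r 3" using s_mult(3) r3 by (simp add: field_simps)
      thus False using xy r_Rats[of 3] s_irrational[of 3] by simp
    qed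
  qed
  hence "f = 0" using r3 by (simp add: g_def)
  moreover have "a + b * s 1 = 0" using eq w0 by simp
  hence "a = 0 \<and> b = 0" using lin_indep_2[of a b 1] R by blast
  ultimately show "a = 0 \<and> b = 0 \<and> c = 0 \<and> f = 0" using w0 by blast
qed (simp add: q_def)

lemma q_add: "q a b c f + q a' b' c' f' = q (a + a') (b + b') (c + c') (f + f')"
  by (simp add: q_def algebra_simps)

lemma q_uminus: "- q a b c f = q (- a) (- b) (- c) (- f)" by (simp add: q_def)

lemma q_mult: "q a b c f * q a' b' c' f' =
  q (a * a' + b * b' * of_nat (d 1) + c * c' * of_nat (d 2) + f * f' * of_nat (d 3))
    (a * b' + b * a' + (c * f' + f * c') * r 1)
    (a * c' + c * a' + (b * f' + f * b') * r 2)
    (a * f' + f * a' + (b * c' + c * b') * r 3)"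
proof -
  have "q a b c f * q a' b' c' f' = a * a' + b * b' * (s 1 * s 1) + c * c' * (s 2 * s 2) + f * f' * (s 3 * s 3) +
      (a * b' + b * a') * s 1 + (c * f' + f * c') * (s 2 * s 3) +
      (a * c' + c * a') * s 2 + (b * f' + f * b') * (s 1 * s 3) +
      (a * f' + f * a') * s 3 + (b * c' + c * b') * (s 1 * s 2)"
    by (simp add: q_def algebra_simps)
  thus ?thesis unfolding s_square s_mult by (simp add: q_def algebra_simps)
qed

lemma q_eq_iff:
  assumes "a \<in> \<rat>" "b \<in> \<rat>" "c \<in> \<rat>" "f \<in> \<rat>" "a' \<in> \<rat>" "b' \<in> \<rat>" "c' \<in> \<rat>" "f' \<in> \<rat>"
  shows "q a b c f = q a' b' c' f' \<longleftrightarrow> a = a' \<and> b = b' \<and> c = c' \<and> f = f'"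
proof -
  have "q a b c f = q a' b' c' f' \<longleftrightarrow> q (a - a') (b - b') (c - c') (f - f') = 0"
    by (auto simp: q_def algebra_simps)
  thus ?thesis using assms by (simp add: q_eq_0_iff)
qed

definition sg :: "nat \<Rightarrow> nat \<Rightarrow> complex" where "sg j i = (if i = j then 1 else - 1)"

text \<open>\<open>\<sigma> j\<close> fixes \<open>s j\<close> and negates the other two roots, so
  its fixed field is the \<open>j\<close>-th quadratic subfield. Being the identity outside
  \<open>KK\<close> makes the relations of the Klein four-group equalities of functions.\<close>

definition \<sigma> :: "nat \<Rightarrow> complex \<Rightarrow> complex" where
  "\<sigma> j x = (if x \<in> KK then (THE y. \<exists>a b c f. a \<in> \<rat> \<and> b \<in> \<rat> \<and> c \<in> \<rat> \<and> f \<in> \<rat> \<and> x = q a b c f \<and>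
      y = q a (sg j 1 * b) (sg j 2 * c) (sg j 3 * f)) else x)"

lemma \<sigma>_q:
  assumes R: "a \<in> \<rat>" "b \<in> \<rat>" "c \<in> \<rat>" "f \<in> \<rat>"
  shows "\<sigma> j (q a b c f) = q a (sg j 1 * b) (sg j 2 * c) (sg j 3 * f)"
proof -
  have "(THE y. \<exists>a' b' c' f'. a' \<in> \<rat> \<and> b' \<in> \<rat> \<and> c' \<in> \<rat> \<and> f' \<in> \<rat> \<and> q a b c f = q a' b' c' f' \<and>
      y = q a' (sg j 1 * b') (sg j 2 * c') (sg j 3 * f')) = q a (sg j 1 * b) (sg j 2 * c) (sg j 3 * f)"
  proof (rule the_equality)
    show "\<exists>a' b' c' f'. a' \<in> \<rat> \<and> b' \<in> \<rat> \<and> c' \<in> \<rat> \<and> f' \<in> \<rat> \<and> q a b c f = q a' b' c' f' \<and>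
      q a (sg j 1 * b) (sg j 2 * c) (sg j 3 * f) = q a' (sg j 1 * b') (sg j 2 * c') (sg j 3 * f')"
      using R by blast
    fix y assume "\<exists>a' b' c' f'. a' \<in> \<rat> \<and> b' \<in> \<rat> \<and> c' \<in> \<rat> \<and> f' \<in> \<rat> \<and> q a b c f = q a' b' c' f' \<and>
      y = q a' (sg j 1 * b') (sg j 2 * c') (sg j 3 * f')"
    then obtain a' b' c' f' where *: "a' \<in> \<rat>" "b' \<in> \<rat>" "c' \<in> \<rat>" "f' \<in> \<rat>" "q a b c f = q a' b' c' f'"
      "y = q a' (sg j 1 * b') (sg j 2 * c') (sg j 3 * f')" by blast
    thus "y = q a (sg j 1 * b) (sg j 2 * c) (sg j 3 * f)"
      using q_eq_iff[OF R *(1-4)] by simp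
  qed
  thus ?thesis using KKI[OF R] by (simp add: \<sigma>_def)
qed

lemma \<sigma>_outside: "x \<notin> KK \<Longrightarrow> \<sigma> j x = x" by (simp add: \<sigma>_def)

lemma sg_Rats [simp]: "sg j i \<in> \<rat>" by (simp add: sg_def)

lemma \<sigma>_KK: "x \<in> KK \<Longrightarrow> \<sigma> j x \<in> KK"
  by (erule KKE) (simp add: \<sigma>_q KKI)

definition GG :: "(complex \<Rightarrow> complex) set" where "GG = {id, \<sigma> 1, \<sigma> 2, \<sigma> 3}"

lemma \<sigma>_comp:
  "\<sigma> 1 \<circ> \<sigma> 1 = id" "\<sigma> 2 \<circ> \<sigma> 2 = id" "\<sigma> 3 \<circ> \<sigma> 3 = id"
  "\<sigma> 1 \<circ> \<sigma> 2 = \<sigma> 3" "\<sigma> 2 \<circ> \<sigma> 1 = \<sigma> 3" "\<sigma> 1 \<circ> \<sigma> 3 = \<sigma> 2"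
  "\<sigma> 3 \<circ> \<sigma> 1 = \<sigma> 2" "\<sigma> 2 \<circ> \<sigma> 3 = \<sigma> 1" "\<sigma> 3 \<circ> \<sigma> 2 = \<sigma> 1"
proof -
  have *: "\<sigma> i \<circ> \<sigma> j = h" if out: "\<And>x. x \<notin> KK \<Longrightarrow> h x = x"
    and "\<And>a b c f. a \<in> \<rat> \<Longrightarrow> b \<in> \<rat> \<Longrightarrow> c \<in> \<rat> \<Longrightarrow> f \<in> \<rat> \<Longrightarrow> \<sigma> i (\<sigma> j (q a b c f)) = h (q a b c f)" for i j h
  proof
    fix x show "(\<sigma> i \<circ> \<sigma> j) x = h x"
      by (cases "x \<in> KK") (use that in \<open>auto simp: \<sigma>_outside elim!: KKE\<close>)
  qed
  show "\<sigma> 1 \<circ> \<sigma> 1 = id" "\<sigma> 2 \<circ> \<sigma> 2 = id" "\<sigma> 3 \<circ> \<sigma> 3 = id"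
    "\<sigma> 1 \<circ> \<sigma> 2 = \<sigma> 3" "\<sigma> 2 \<circ> \<sigma> 1 = \<sigma> 3" "\<sigma> 1 \<circ> \<sigma> 3 = \<sigma> 2"
    "\<sigma> 3 \<circ> \<sigma> 1 = \<sigma> 2" "\<sigma> 2 \<circ> \<sigma> 3 = \<sigma> 1" "\<sigma> 3 \<circ> \<sigma> 2 = \<sigma> 1"
    by (rule *; simp add: \<sigma>_outside \<sigma>_q sg_def)+
qed

lemma KK_mult: "x \<in> KK \<Longrightarrow> y \<in> KK \<Longrightarrow> x * y \<in> KK"
proof (elim KKE)
  fix a b c f a' b' c' f' assume "x = q a b c f" "y = q a' b' c' f'" "a \<in> \<rat>" "b \<in> \<rat>" "c \<in> \<rat>" "f \<in> \<rat>"
    "a' \<in> \<rat>" "b' \<in> \<rat>" "c' \<in> \<rat>" "f' \<in> \<rat>"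
  thus "x * y \<in> KK" using r_Rats by (simp add: q_mult KKI)
qed

text \<open>Two conjugations in succession: \<open>x * x'\<close> lies in the first quadratic field,
  and multiplying by its conjugate \<open>z\<close> leaves the nonzero rational
  \<open>n\<close>.\<close>

lemma KK_inverse:
  assumes "x \<in> KK"
  shows "inverse x \<in> KK"
proof (cases "x = 0")
  case True thus ?thesis using assms by simp
next
  case False
  obtain a b c f where R: "a \<in> \<rat>" "b \<in> \<rat>" "c \<in> \<rat>" "f \<in> \<rat>" and x: "x = q a b c f" using assms by (rule KKE)
  define y0 y1 where "y0 = a * a + b * b * of_nat (d 1) - c * c * of_nat (d 2) - f * f * of_nat (d 3)"
    and "y1 = 2 * a * b - 2 * c * f * r 1"
  have y: "y0 \<in> \<rat>" "y1 \<in> \<rat>" using R r_Rats[of 1] by (auto simp: y0_def y1_def)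
  define x' where "x' = q a b (- c) (- f)"
  have x'K: "x' \<in> KK" using R by (auto simp: x'_def intro: KKI)
  have "x' \<noteq> 0" using False R unfolding x x'_def by (simp add: q_eq_0_iff)
  have xx': "x * x' = q y0 y1 0 0" unfolding x x'_def q_mult by (simp add: y0_def y1_def algebra_simps)
  hence "\<not> (y0 = 0 \<and> y1 = 0)" using False \<open>x' \<noteq> 0\<close> by (auto simp: q_def)
  define z where "z = q y0 (- y1) 0 0"
  have zK: "z \<in> KK" using y by (auto simp: z_def intro: KKI)
  have "z \<noteq> 0" using \<open>\<not> (y0 = 0 \<and> y1 = 0)\<close> y by (simp add: z_def q_eq_0_iff)
  define n where "n = y0 * y0 - y1 * y1 * of_nat (d 1)"
  have "x * x' * z = q n 0 0 0" unfolding xx' z_def q_mult by (simp add: n_def algebra_simps)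
  hence n: "x * (x' * z) = n" by (simp add: q_def mult.assoc)
  hence n0: "n \<noteq> 0" using False \<open>x' \<noteq> 0\<close> \<open>z \<noteq> 0\<close> by auto
  have "inverse x = x' * z * q (inverse n) 0 0 0" using n n0 False by (simp add: q_def field_simps)
  moreover have "q (inverse n) 0 0 0 \<in> KK" using y by (intro KKI) (auto simp: n_def)
  ultimately show ?thesis using x'K zK by (simp add: KK_mult)
qed

lemma KK_frac: "x \<in> KK \<Longrightarrow> \<exists>m::nat. m > 0 \<and> algebraic_int (of_nat m * x)"
proof -
  assume "x \<in> KK"
  then obtain a b c f where R: "a \<in> \<rat>" "b \<in> \<rat>" "c \<in> \<rat>" "f \<in> \<rat>" and x: "x = q a b c f" by (rule KKE)
  have den: "\<exists>m::nat. m > 0 \<and> of_nat m * a \<in> \<int>" if "a \<in> \<rat>" for a :: complex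
    using that
  proof (cases a rule: Rats_cases')
    case (1 x y)
    thus ?thesis by (intro exI[of _ "nat y"]) simp
  qed
  obtain m1 m2 m3 m4 :: nat where m: "m1 > 0" "m2 > 0" "m3 > 0" "m4 > 0" and
    Z: "of_nat m1 * a \<in> \<int>" "of_nat m2 * b \<in> \<int>" "of_nat m3 * c \<in> \<int>" "of_nat m4 * f \<in> \<int>"
    using den[OF R(1)] den[OF R(2)] den[OF R(3)] den[OF R(4)] by blast
  define m where "m = m1 * m2 * m3 * m4"
  have t: "algebraic_int (of_nat k * u * z)" if "u \<in> \<int>" "algebraic_int z" for k and u z :: complex
    using that by (intro algebraic_int_mult) (auto intro: int_imp_algebraic_int)
  have "of_nat m * x = of_nat (m2 * m3 * m4) * (of_nat m1 * a) * 1 + of_nat (m1 * m3 * m4) * (of_nat m2 * b) * s 1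
      + of_nat (m1 * m2 * m4) * (of_nat m3 * c) * s 2 + of_nat (m1 * m2 * m3) * (of_nat m4 * f) * s 3"
    by (simp add: x q_def m_def algebra_simps)
  moreover have "algebraic_int \<dots>"
    by (intro algebraic_int_add t Z) (auto simp: s_def intro: algebraic_int_csq)
  ultimately show ?thesis using m by (intro exI[of _ m]) (auto simp: m_def)
qed

lemma Rats_KK: "a \<in> \<rat> \<Longrightarrow> a \<in> KK" using KKI[of a 0 0 0] by (simp add: q_def)

lemma s_KK: "i \<in> {1, 2, 3} \<Longrightarrow> s i \<in> KK"
  using KKI[of 0 1 0 0] KKI[of 0 0 1 0] KKI[of 0 0 0 1] by (auto simp: q_def)

lemma galois_extension_KK: "galois_extension KK GG"
proof
  show "1 \<in> KK" by (rule Rats_KK) simp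
  show "x + y \<in> KK" if "x \<in> KK" "y \<in> KK" for x y using that by (elim KKE) (simp add: q_add KKI)
  show "- x \<in> KK" if "x \<in> KK" for x using that by (elim KKE) (simp add: q_uminus KKI)
  show "x * y \<in> KK" if "x \<in> KK" "y \<in> KK" for x y using that KK_mult by blast
  show "inverse x \<in> KK" if "x \<in> KK" for x using that KK_inverse by blast
  show "finite GG" "id \<in> GG" by (auto simp: GG_def)
  show "t \<circ> h \<in> GG" if "t \<in> GG" "h \<in> GG" for t h
    using that by (auto simp: GG_def \<sigma>_comp[unfolded One_nat_def])
  show "\<exists>h\<in>GG. t \<circ> h = id \<and> h \<circ> t = id" if "t \<in> GG" for t
    using that by (auto simp: GG_def \<sigma>_comp[unfolded One_nat_def])
  show "t x \<in> KK" if "t \<in> GG" "x \<in> KK" for t x using that \<sigma>_KK by (auto simp: GG_def)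
  have add: "\<sigma> j (x + y) = \<sigma> j x + \<sigma> j y" if "x \<in> KK" "y \<in> KK" for j x y
    using that by (elim KKE) (simp add: q_add \<sigma>_q distrib_left)
  show "t (x + y) = t x + t y" if "t \<in> GG" "x \<in> KK" "y \<in> KK" for t x y using that add by (auto simp: GG_def)
  have mult: "\<sigma> j (x * y) = \<sigma> j x * \<sigma> j y" if xy: "x \<in> KK" "y \<in> KK" and j: "j \<in> {1, 2, 3}" for j x y
  proof -
    obtain a b c f where R: "a \<in> \<rat>" "b \<in> \<rat>" "c \<in> \<rat>" "f \<in> \<rat>" "x = q a b c f" using xy(1) by (rule KKE)
    obtain a' b' c' f' where R': "a' \<in> \<rat>" "b' \<in> \<rat>" "c' \<in> \<rat>" "f' \<in> \<rat>" "y = q a' b' c' f'" using xy(2) by (rule KKE)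
    have "\<sigma> j (x * y) = q (a * a' + b * b' * of_nat (d 1) + c * c' * of_nat (d 2) + f * f' * of_nat (d 3))
      (sg j 1 * (a * b' + b * a' + (c * f' + f * c') * r 1))
      (sg j 2 * (a * c' + c * a' + (b * f' + f * b') * r 2))
      (sg j 3 * (a * f' + f * a' + (b * c' + c * b') * r 3))"
      unfolding R(5) R'(5) q_mult using R R' r_Rats by (intro \<sigma>_q) auto
    also have "\<dots> = \<sigma> j x * \<sigma> j y"
    proof -
      have q_cong: "q a b c f = q a' b' c' f'" if "a = a'" "b = b'" "c = c'" "f = f'" for a b c f a' b' c' f'
        using that by simp
      show ?thesis unfolding R(5) R'(5) \<sigma>_q[OF R(1-4)] \<sigma>_q[OF R'(1-4)] q_mult
        by (rule q_cong; insert j; auto simp: sg_def algebra_simps)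
    qed
    finally show ?thesis .
  qed
  show "t (x * y) = t x * t y" if "t \<in> GG" "x \<in> KK" "y \<in> KK" for t x y using that mult by (auto simp: GG_def)
  have one: "\<sigma> j 1 = 1" for j using \<sigma>_q[of 1 0 0 0 j] by (simp add: q_def)
  show "t 1 = 1" if "t \<in> GG" for t using that one by (auto simp: GG_def)
  show "x \<in> \<rat>" if x: "x \<in> KK" "\<And>t. t \<in> GG \<Longrightarrow> t x = x" for x
  proof -
    obtain a b c f where R: "a \<in> \<rat>" "b \<in> \<rat>" "c \<in> \<rat>" "f \<in> \<rat>" "x = q a b c f" using x(1) by (rule KKE)
    have "q a b (- c) (- f) = q a b c f" using x(2)[of "\<sigma> 1"] \<sigma>_q[OF R(1-4), of 1] by (simp add: GG_def R(5) sg_def)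
    moreover have "q a (- b) c (- f) = q a b c f" using x(2)[of "\<sigma> 2"] \<sigma>_q[OF R(1-4), of 2] by (simp add: GG_def R(5) sg_def)
    ultimately have "- c = c" "- f = f" "- b = b" using R by (simp_all add: q_eq_iff)
    hence "x = a" using R(5) by (simp add: q_def)
    thus ?thesis using R by simp
  qed
  show "\<exists>m::nat. m > 0 \<and> algebraic_int (of_nat m * x)" if "x \<in> KK" for x using KK_frac that by blast
qed

end

section \<open>Generated subfields, their embeddings and integral bases\<close>

interpretation cfield: cring "complex_field" by (rule cring_from_type_algebra)

lemma a_inv_complex: "\<ominus>\<^bsub>complex_field\<^esub> x = - x"
  using cfield.minus_equality[of "- x" x] by simp

lemma m_inv_complex: "x \<noteq> 0 \<Longrightarrow> inv\<^bsub>complex_field\<^esub> x = inverse x"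
  using cfield.comm_inv_char[of x "inverse x"] by simp

lemma rat_adjoin_subsetI:
  assumes "S \<subseteq> F" "1 \<in> F" "\<And>x. x \<in> F \<Longrightarrow> - x \<in> F" "\<And>x. x \<in> F \<Longrightarrow> inverse x \<in> F"
    "\<And>x y. x \<in> F \<Longrightarrow> y \<in> F \<Longrightarrow> x + y \<in> F" "\<And>x y. x \<in> F \<Longrightarrow> y \<in> F \<Longrightarrow> x * y \<in> F"
  shows "rat_adjoin S \<subseteq> F"
proof
  fix x assume "x \<in> rat_adjoin S"
  hence "x \<in> generate_field complex_field S" by (simp add: rat_adjoin_def)
  thus "x \<in> F"
  proof induction
    case (m_inv h)
    thus ?case using m_inv_complex[of h] assms(4)[of h] by simp
  qed (use assms in \<open>auto simp: a_inv_complex\<close>)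
qed

lemma rat_adjoin_base: "x \<in> S \<Longrightarrow> x \<in> rat_adjoin S"
  unfolding rat_adjoin_def by (rule generate_field.incl)

lemma rat_adjoin_closed:
  "1 \<in> rat_adjoin S" "x \<in> rat_adjoin S \<Longrightarrow> - x \<in> rat_adjoin S"
  "x \<in> rat_adjoin S \<Longrightarrow> inverse x \<in> rat_adjoin S"
  "x \<in> rat_adjoin S \<Longrightarrow> y \<in> rat_adjoin S \<Longrightarrow> x + y \<in> rat_adjoin S"
  "x \<in> rat_adjoin S \<Longrightarrow> y \<in> rat_adjoin S \<Longrightarrow> x * y \<in> rat_adjoin S"
proof -
  show "1 \<in> rat_adjoin S"
    using generate_field.one[of complex_field S] by (simp add: rat_adjoin_def)
  show neg: "x \<in> rat_adjoin S \<Longrightarrow> - x \<in> rat_adjoin S" for x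
    using generate_field.a_inv[of x complex_field S] by (simp add: rat_adjoin_def a_inv_complex)
  show add: "x \<in> rat_adjoin S \<Longrightarrow> y \<in> rat_adjoin S \<Longrightarrow> x + y \<in> rat_adjoin S" for x y
    using generate_field.eng_add[of x complex_field S y] by (simp add: rat_adjoin_def)
  show "x \<in> rat_adjoin S \<Longrightarrow> y \<in> rat_adjoin S \<Longrightarrow> x * y \<in> rat_adjoin S" for x y
    using generate_field.eng_mult[of x complex_field S y] by (simp add: rat_adjoin_def)
  show "x \<in> rat_adjoin S \<Longrightarrow> inverse x \<in> rat_adjoin S" for x
    using generate_field.m_inv[of x complex_field S] by (cases "x = 0") (auto simp: rat_adjoin_def m_inv_complex)
qed

lemma Rats_rat_adjoin: "x \<in> \<rat> \<Longrightarrow> x \<in> rat_adjoin S"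
proof -
  have 0: "0 \<in> rat_adjoin S" using rat_adjoin_closed(4)[OF rat_adjoin_closed(1) rat_adjoin_closed(2)[OF rat_adjoin_closed(1)]] by simp
  have n: "of_nat n \<in> rat_adjoin S" for n
    by (induction n) (auto simp: 0 intro: rat_adjoin_closed)
  have i: "of_int n \<in> rat_adjoin S" for n
    by (cases n rule: int_cases2) (auto intro: rat_adjoin_closed n)
  assume "x \<in> \<rat>"
  then obtain a b where "x = of_int a / of_int b" by (auto elim: Rats_cases')
  thus ?thesis using i rat_adjoin_closed(3,5) by (simp add: divide_inverse)
qed

lemma field_embeddingD:
  assumes "\<phi> \<in> field_embeddings F"
  shows "x \<in> F \<Longrightarrow> y \<in> F \<Longrightarrow> \<phi> (x + y) = \<phi> x + \<phi> y" "x \<in> F \<Longrightarrow> y \<in> F \<Longrightarrow> \<phi> (x * y) = \<phi> x * \<phi> y"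
    "\<phi> 1 = 1" "x \<notin> F \<Longrightarrow> \<phi> x = undefined"
  using assms ring_hom_add[of \<phi> "field_of F" complex_field x y] ring_hom_mult[of \<phi> "field_of F" complex_field x y]
    ring_hom_one[of \<phi> "field_of F" complex_field]
  unfolding field_embeddings_def by (auto simp: extensional_def)

lemma field_embedding_Rats:
  assumes "\<phi> \<in> field_embeddings F" "\<rat> \<subseteq> F" "x \<in> \<rat>"
  shows "\<phi> x = x"
proof -
  note h = field_embeddingD[OF assms(1)]
  have F: "y \<in> F" if "y \<in> \<rat>" for y using assms(2) that by blast
  have 0: "\<phi> 0 = 0" using h(1)[of 0 0] F by simp
  have n: "\<phi> (of_nat n) = of_nat n" for n
    by (induction n) (use 0 h(1)[of 1] h(3) F in auto)
  have neg: "\<phi> (- y) = - \<phi> y" if "y \<in> \<rat>" for y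
    using h(1)[of y "- y"] 0 F[OF that] F[of "- y"] that by (simp add: eq_neg_iff_add_eq_0 add.commute)
  have i: "\<phi> (of_int n) = of_int n" for n
    by (cases n rule: int_cases2) (use n neg in auto)
  obtain a b where ab: "x = of_int a / of_int b" "b > 0" using assms(3) by (auto elim: Rats_cases')
  have "\<phi> x * of_int b = \<phi> (x * of_int b)" using h(2)[of x "of_int b"] i F assms(3) by simp
  also have "\<dots> = x * of_int b"
  proof -
    have "x * of_int b = of_int a" using ab by simp
    thus ?thesis using i by metis
  qed
  finally have "\<phi> x * of_int b = x * of_int b" .
  moreover have "(of_int b :: complex) \<noteq> 0" using ab by simp
  ultimately show ?thesis using mult_right_cancel by blast
qed

lemma field_embeddingI:
  assumes "\<And>x y. x \<in> F \<Longrightarrow> y \<in> F \<Longrightarrow> h (x + y) = h x + h y" "\<And>x y. x \<in> F \<Longrightarrow> y \<in> F \<Longrightarrow> h (x * y) = h x * h y" "h 1 = 1"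
    "1 \<in> F" "\<And>x y. x \<in> F \<Longrightarrow> y \<in> F \<Longrightarrow> x + y \<in> F" "\<And>x y. x \<in> F \<Longrightarrow> y \<in> F \<Longrightarrow> x * y \<in> F"
  shows "restrict h F \<in> field_embeddings F"
  unfolding field_embeddings_def using assms by (auto intro!: ring_hom_memI)

context biquad
begin

sublocale galois_extension KK GG by (rule galois_extension_KK)

lemma \<sigma>_GG [simp]: "\<sigma> 1 \<in> GG" "\<sigma> 2 \<in> GG" "\<sigma> 3 \<in> GG" "\<sigma> (Suc 0) \<in> GG" by (auto simp: GG_def)
lemma \<sigma>_GG': "i \<in> {1, 2, 3} \<Longrightarrow> \<sigma> i \<in> GG" by auto

lemma \<sigma>_s: "i \<in> {1, 2, 3} \<Longrightarrow> j \<in> {1, 2, 3} \<Longrightarrow> \<sigma> j (s i) = (if i = j then s i else - s i)"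
  using \<sigma>_q[of 0 1 0 0 j] \<sigma>_q[of 0 0 1 0 j] \<sigma>_q[of 0 0 0 1 j] by (auto simp: q_def sg_def)

text \<open>The trace of \<open>q a b c f\<close> is \<open>4 * a\<close>.\<close>

lemma coeff0_int:
  assumes R: "a \<in> \<rat>" "b \<in> \<rat>" "c \<in> \<rat>" "f \<in> \<rat>" and x: "algebraic_int (q a b c f)"
  shows "4 * a \<in> \<int>"
proof -
  have K: "q a b c f \<in> KK" using KKI R by blast
  have "4 * a = q a b c f + \<sigma> 1 (q a b c f) + \<sigma> 2 (q a b c f) + \<sigma> 3 (q a b c f)"
    unfolding \<sigma>_q[OF R] by (simp add: sg_def q_def)
  moreover have "algebraic_int \<dots>"
    by (intro algebraic_int_add G_algebraic_int[OF _ K x] x) auto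
  ultimately have "algebraic_int (4 * a)" by simp
  thus ?thesis using R by (intro rational_algebraic_int_is_int) auto
qed

text \<open>The dual of 1, \<open>s 1\<close>, \<open>s 2\<close>, \<open>s 3\<close> with respect
  to the trace form. The coordinates of an integral element here are its traces against these four
  integral elements, hence integers.\<close>

definition dual_basis :: "complex list" where
  "dual_basis = [1 / 4, s 1 / of_nat (4 * d 1), s 2 / of_nat (4 * d 2), s 3 / of_nat (4 * d 3)]"

lemma sum_dual_basis:
  "(\<Sum>i<length dual_basis. of_int (c i) * dual_basis ! i) =
     q (of_int (c 0) / 4) (of_int (c 1) / of_nat (4 * d 1)) (of_int (c 2) / of_nat (4 * d 2)) (of_int (c 3) / of_nat (4 * d 3))"
  by (simp add: dual_basis_def q_def numeral_eq_Suc)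

text \<open>The ring of integers is a subgroup of the lattice with basis \<open>dual_basis\<close>,
  hence itself a lattice.\<close>

lemma exists_basis: "\<exists>b. integral_basis KK b"
proof -
  have d0: "d 1 > 0" "d 2 > 0" "d 3 > 0" using d_gt_1[of 1] d_gt_1[of 2] d_gt_1[of 3] by auto
  have "zindep dual_basis" unfolding zindep_def
  proof (intro allI impI)
    fix c :: "nat \<Rightarrow> int" and i assume c: "(\<Sum>i<length dual_basis. of_int (c i) * dual_basis ! i) = 0" "i < length dual_basis"
    have "c 0 = 0 \<and> c 1 = 0 \<and> c 2 = 0 \<and> c 3 = 0"
      using c(1) d0 unfolding sum_dual_basis by (subst (asm) q_eq_0_iff) auto
    moreover have "i = 0 \<or> i = 1 \<or> i = 2 \<or> i = 3" using c(2) by (auto simp: dual_basis_def)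
    ultimately show "c i = 0" by auto
  qed
  moreover have "\<O> \<subseteq> zlin dual_basis"
  proof
    fix x assume "x \<in> \<O>"
    hence x: "x \<in> KK" "algebraic_int x" by (auto simp: \<O>_def)
    obtain a b c f where R: "a \<in> \<rat>" "b \<in> \<rat>" "c \<in> \<rat>" "f \<in> \<rat>" "x = q a b c f" using x(1) by (rule KKE)
    have ss: "s 1 = q 0 1 0 0" "s 2 = q 0 0 1 0" "s 3 = q 0 0 0 1" by (auto simp: q_def)
    have ai: "algebraic_int (s i)" for i by (simp add: s_def algebraic_int_csq)
    have 0: "4 * a \<in> \<int>" using coeff0_int[OF R(1-4)] x(2) R(5) by simp
    \<comment> \<open>Multiplication by \<open>s i\<close> moves the coefficient of
      \<open>s i\<close>, times \<open>d i\<close>, to the rational place, where the trace sees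
      it.\<close>
    have "x * s 1 = q (b * of_nat (d 1)) a (f * r 2) (c * r 3)" unfolding R(5) ss q_mult by simp
    hence 1: "4 * (b * of_nat (d 1)) \<in> \<int>"
      using coeff0_int[of "b * of_nat (d 1)" a "f * r 2" "c * r 3"] R r_Rats algebraic_int_mult[OF x(2) ai[of 1]] by simp
    have "x * s 2 = q (c * of_nat (d 2)) (f * r 1) a (b * r 3)" unfolding R(5) ss q_mult by simp
    hence 2: "4 * (c * of_nat (d 2)) \<in> \<int>"
      using coeff0_int[of "c * of_nat (d 2)" "f * r 1" a "b * r 3"] R r_Rats algebraic_int_mult[OF x(2) ai[of 2]] by simp
    have "x * s 3 = q (f * of_nat (d 3)) (c * r 1) (b * r 2) a" unfolding R(5) ss q_mult by simp
    hence 3: "4 * (f * of_nat (d 3)) \<in> \<int>"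
      using coeff0_int[of "f * of_nat (d 3)" "c * r 1" "b * r 2" a] R r_Rats algebraic_int_mult[OF x(2) ai[of 3]] by simp
    from 0 1 2 3 obtain k0 k1 k2 k3 :: int where k: "4 * a = of_int k0" "4 * (b * of_nat (d 1)) = of_int k1"
      "4 * (c * of_nat (d 2)) = of_int k2" "4 * (f * of_nat (d 3)) = of_int k3" unfolding Ints_def by blast
    define u where "u i = (if i = 0 then k0 else if i = 1 then k1 else if i = 2 then k2 else k3)" for i :: nat
    have "x = (\<Sum>i<length dual_basis. of_int (u i) * dual_basis ! i)"
      unfolding sum_dual_basis R(5) u_def using d0 by (simp add: k[symmetric])
    thus "x \<in> zlin dual_basis" using zlinI[of u dual_basis] by simp
  qed
  ultimately obtain b where "zindep b" "zlin b = \<O>"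
    using sublattice_basis[of dual_basis \<O>] O_diff O_zero by blast
  thus ?thesis using integral_basis_of_lattice[of b KK] by auto
qed

definition bas :: "complex list" where "bas = (SOME b. integral_basis KK b)"

text \<open>An embedding fixes the rationals and sends \<open>s 1\<close> and \<open>s 2\<close> to
  themselves or their negatives; its value at \<open>s 3\<close> follows from
  \<open>s 1 * s 2 = r 3 * s 3\<close>. The four sign patterns are those of
  \<open>GG\<close>.\<close>

lemma embeddings_KK: "field_embeddings KK = (\<lambda>t. restrict t KK) ` GG"
proof
  show "(\<lambda>t. restrict t KK) ` GG \<subseteq> field_embeddings KK"
  proof clarify
    fix t assume "t \<in> GG"
    thus "restrict t KK \<in> field_embeddings KK"
      by (intro field_embeddingI G_add G_mult G_one K_one K_add K_mult)
  qed
  show "field_embeddings KK \<subseteq> (\<lambda>t. restrict t KK) ` GG"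
  proof
    fix \<phi> assume phi: "\<phi> \<in> field_embeddings KK"
    note h = field_embeddingD[OF phi]
    have Q: "\<phi> x = x" if "x \<in> \<rat>" for x using field_embedding_Rats[OF phi _ that] K_Rats by blast
    have sq: "\<phi> (s i) = s i \<or> \<phi> (s i) = - s i" if "i \<in> {1, 2, 3}" for i
    proof -
      have "\<phi> (s i) * \<phi> (s i) = s i * s i"
        using h(2)[OF s_KK[OF that] s_KK[OF that]] Q[of "of_nat (d i)"] by (simp add: s_square)
      thus ?thesis by (simp add: square_eq_iff)
    qed
    have r3: "r 3 \<in> \<rat>" "r 3 \<noteq> 0" using r_Rats[of 3] r_nonzero[of 3] by auto
    have p3: "r 3 * \<phi> (s 3) = \<phi> (s 1) * \<phi> (s 2)"
      using h(2)[of "s 1" "s 2"] h(2)[of "r 3" "s 3"] s_KK[of 1] s_KK[of 2] s_KK[of 3] K_Rats[OF r3(1)] Q[OF r3(1)] s_mult(3)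
      by simp
    have phi_q: "\<phi> (q a b c f) = a + b * \<phi> (s 1) + c * \<phi> (s 2) + f * \<phi> (s 3)"
      if "a \<in> \<rat>" "b \<in> \<rat>" "c \<in> \<rat>" "f \<in> \<rat>" for a b c f
      unfolding q_def using that h(1,2) Q K_Rats s_KK by (simp add: K_add K_mult)
    have s3: "\<phi> (s 3) = (if (\<phi> (s 1) = s 1) = (\<phi> (s 2) = s 2) then s 3 else - s 3)"
    proof -
      have "r 3 * \<phi> (s 3) = r 3 * (if (\<phi> (s 1) = s 1) = (\<phi> (s 2) = s 2) then s 3 else - s 3)"
        unfolding p3 using sq[of 1] sq[of 2] s_mult(3) s_nonzero[of 1] s_nonzero[of 2] by auto
      thus ?thesis using r3 by simp
    qed
    define t where "t = (if \<phi> (s 1) = s 1 then (if \<phi> (s 2) = s 2 then id else \<sigma> 1) else if \<phi> (s 2) = s 2 then \<sigma> 2 else \<sigma> 3)"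
    have "t \<in> GG" by (simp add: t_def GG_def)
    moreover have "\<phi> = restrict t KK"
    proof
      fix x show "\<phi> x = restrict t KK x"
      proof (cases "x \<in> KK")
        case True
        obtain a b c f where R: "a \<in> \<rat>" "b \<in> \<rat>" "c \<in> \<rat>" "f \<in> \<rat>" "x = q a b c f" using True by (rule KKE)
        have n: "\<phi> (s 1) \<noteq> s 1 \<Longrightarrow> \<phi> (s 1) = - s 1" "\<phi> (s 2) \<noteq> s 2 \<Longrightarrow> \<phi> (s 2) = - s 2" using sq by auto
        have T: "\<sigma> 1 (q a b c f) = a + b * s 1 - c * s 2 - f * s 3" "\<sigma> 2 (q a b c f) = a - b * s 1 + c * s 2 - f * s 3"
          "\<sigma> 3 (q a b c f) = a - b * s 1 - c * s 2 + f * s 3" "id (q a b c f) = a + b * s 1 + c * s 2 + f * s 3"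
          unfolding \<sigma>_q[OF R(1-4)] by (simp_all add: sg_def q_def)
        have "\<phi> x = t x"
        proof (cases "\<phi> (s 1) = s 1")
          case True
          note 1 = True
          show ?thesis
          proof (cases "\<phi> (s 2) = s 2")
            case True
            hence "t = id" "\<phi> (s 3) = s 3" using 1 s3 by (simp_all add: t_def)
            thus ?thesis unfolding R(5) phi_q[OF R(1-4)] using T True 1 by simp
          next
            case False
            hence "t = \<sigma> 1" "\<phi> (s 3) = - s 3" "\<phi> (s 2) = - s 2" using 1 s3 n by (simp_all add: t_def)
            thus ?thesis unfolding R(5) phi_q[OF R(1-4)] using T 1 by simp
          qed
        next
          case False
          note 1 = False
          show ?thesis
          proof (cases "\<phi> (s 2) = s 2")
            case True
            hence "t = \<sigma> 2" "\<phi> (s 3) = - s 3" "\<phi> (s 1) = - s 1" using 1 s3 n by (simp_all add: t_def)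
            thus ?thesis unfolding R(5) phi_q[OF R(1-4)] using T True by simp
          next
            case False
            hence "t = \<sigma> 3" "\<phi> (s 3) = s 3" "\<phi> (s 2) = - s 2" "\<phi> (s 1) = - s 1" using 1 s3 n by (simp_all add: t_def)
            thus ?thesis unfolding R(5) phi_q[OF R(1-4)] using T by simp
          qed
        qed
        thus ?thesis using True by simp
      qed (use h(4) in simp)
    qed
    ultimately show "\<phi> \<in> (\<lambda>t. restrict t KK) ` GG" by blast
  qed
qed

lemma s_neq_uminus: "i \<in> {1, 2, 3} \<Longrightarrow> s i \<noteq> - s i" using s_nonzero[of i] by simp

lemma GG_eq_iff: "t \<in> GG \<Longrightarrow> h \<in> GG \<Longrightarrow> t (s 1) = h (s 1) \<Longrightarrow> t (s 2) = h (s 2) \<Longrightarrow> t = h"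
  using \<sigma>_s[of 1 1] \<sigma>_s[of 1 2] \<sigma>_s[of 1 3] \<sigma>_s[of 2 1] \<sigma>_s[of 2 2] \<sigma>_s[of 2 3] s_neq_uminus[of 1] s_neq_uminus[of 2]
    s_neq_uminus[of 1, symmetric] s_neq_uminus[of 2, symmetric]
  unfolding GG_def by (elim insertE emptyE) simp_all

lemma embeddings_KK_inj: "inj_on (\<lambda>t. restrict t KK) GG"
proof (rule inj_onI)
  fix t h assume "t \<in> GG" "h \<in> GG" and eq: "restrict t KK = restrict h KK"
  moreover have "t (s i) = h (s i)" if "i \<in> {1, 2, 3}" for i
    using fun_cong[OF eq, of "s i"] s_KK[OF that] by simp
  ultimately show "t = h" using GG_eq_iff by simp
qed

sublocale galois_number_field KK GG bas
proof unfold_locales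
  show "integral_basis KK bas" unfolding bas_def using exists_basis by (rule someI_ex)
qed (rule embeddings_KK embeddings_KK_inj)+

definition kk :: "nat \<Rightarrow> complex set" where "kk i = {x \<in> KK. \<sigma> i x = x}"

lemma kk_KK: "x \<in> kk i \<Longrightarrow> x \<in> KK" by (simp add: kk_def)
lemma kk_fixed: "x \<in> kk i \<Longrightarrow> \<sigma> i x = x" by (simp add: kk_def)

lemma kk_eq: "i \<in> {1, 2, 3} \<Longrightarrow> kk i = {a + b * s i | a b. a \<in> \<rat> \<and> b \<in> \<rat>}"
proof -
  assume i: "i \<in> {1, 2, 3}"
  show ?thesis
  proof
    show "{a + b * s i | a b. a \<in> \<rat> \<and> b \<in> \<rat>} \<subseteq> kk i"
    proof clarify
      fix a b :: complex assume "a \<in> \<rat>" "b \<in> \<rat>"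
      thus "a + b * s i \<in> kk i"
        using i s_KK[OF i] \<sigma>_s[OF i i] G_Rats[OF \<sigma>_GG'[OF i]] K_Rats
        by (simp add: kk_def K_add K_mult G_add[OF \<sigma>_GG'[OF i]] G_mult[OF \<sigma>_GG'[OF i]])
    qed
    show "kk i \<subseteq> {a + b * s i | a b. a \<in> \<rat> \<and> b \<in> \<rat>}"
    proof
      fix x assume x: "x \<in> kk i"
      obtain a b c f where R: "a \<in> \<rat>" "b \<in> \<rat>" "c \<in> \<rat>" "f \<in> \<rat>" "x = q a b c f" using kk_KK[OF x] by (rule KKE)
      have "q a (sg i 1 * b) (sg i 2 * c) (sg i 3 * f) = q a b c f" using kk_fixed[OF x] R \<sigma>_q by simp
      hence "sg i 1 * b = b" "sg i 2 * c = c" "sg i 3 * f = f" using R by (simp_all add: q_eq_iff)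
      hence "x = a + (if i = 1 then b else if i = 2 then c else f) * s i" using i R(5) by (auto simp: sg_def q_def)
      thus "x \<in> {a + b * s i | a b. a \<in> \<rat> \<and> b \<in> \<rat>}" using R(1-4) by (auto split: if_splits)
    qed
  qed
qed

lemma Rats_kk: "i \<in> {1, 2, 3} \<Longrightarrow> x \<in> \<rat> \<Longrightarrow> x \<in> kk i"
  using G_Rats[OF \<sigma>_GG'] K_Rats by (simp add: kk_def)

lemma s_kk: "i \<in> {1, 2, 3} \<Longrightarrow> s i \<in> kk i" using s_KK \<sigma>_s by (simp add: kk_def)

lemma kk_closed:
  assumes i: "i \<in> {1, 2, 3}"
  shows "x \<in> kk i \<Longrightarrow> y \<in> kk i \<Longrightarrow> x + y \<in> kk i" "x \<in> kk i \<Longrightarrow> y \<in> kk i \<Longrightarrow> x * y \<in> kk i"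
    "x \<in> kk i \<Longrightarrow> - x \<in> kk i" "x \<in> kk i \<Longrightarrow> inverse x \<in> kk i"
  using \<sigma>_GG'[OF i] by (auto simp: kk_def K_add K_mult K_uminus K_inverse G_add G_mult G_uminus G_inverse)

lemma rat_adjoin_kk: "i \<in> {1, 2, 3} \<Longrightarrow> rat_adjoin {csq (d i)} = kk i"
proof
  assume i: "i \<in> {1, 2, 3}"
  show "rat_adjoin {csq (d i)} \<subseteq> kk i"
    by (rule rat_adjoin_subsetI) (use i s_kk[OF i] Rats_kk[OF i, of 1] kk_closed[OF i] in \<open>auto simp: s_def\<close>)
  show "kk i \<subseteq> rat_adjoin {csq (d i)}"
    unfolding kk_eq[OF i] using rat_adjoin_closed(4,5) Rats_rat_adjoin rat_adjoin_base[of "csq (d i)" "{csq (d i)}"]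
    by (auto simp: s_def)
qed

lemma rat_adjoin_KK: "rat_adjoin {csq (d 1), csq (d 2)} = KK"
proof
  show "rat_adjoin {csq (d 1), csq (d 2)} \<subseteq> KK"
    by (rule rat_adjoin_subsetI)
       (use s_KK[of 1] s_KK[of 2] in \<open>auto simp: s_def K_one K_add K_mult K_uminus K_inverse\<close>)
  let ?A = "rat_adjoin {csq (d 1), csq (d 2)}"
  have s: "s 1 \<in> ?A" "s 2 \<in> ?A" using rat_adjoin_base by (auto simp: s_def)
  have "s 3 = inverse (r 3) * (s 1 * s 2)" using s_mult(3) r_nonzero[of 3] by (simp add: field_simps)
  moreover have "inverse (r 3) \<in> ?A" using Rats_rat_adjoin r_Rats[of 3] by simp
  ultimately have "s 3 \<in> ?A" using s rat_adjoin_closed(5) by metis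
  thus "KK \<subseteq> ?A" using s rat_adjoin_closed(4,5) Rats_rat_adjoin by (auto elim!: KKE simp: q_def)
qed

text \<open>On the \<open>i\<close>-th quadratic subfield, both \<open>\<sigma> j\<close> with \<open>j \<noteq> i\<close> restrict to the nontrivial automorphism;
  \<open>nx i\<close> selects one of them.\<close>

definition nx :: "nat \<Rightarrow> nat" where "nx i = (if i = 1 then 2 else if i = 2 then 3 else 1)"

lemma nx: "i \<in> {1, 2, 3} \<Longrightarrow> nx i \<in> {1, 2, 3}" "i \<in> {1, 2, 3} \<Longrightarrow> nx i \<noteq> i" by (auto simp: nx_def)

lemma conj_kk:
  assumes i: "i \<in> {1, 2, 3}" and j: "j \<in> {1, 2, 3}" "j \<noteq> i" and R: "a \<in> \<rat>" "b \<in> \<rat>"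
  shows "\<sigma> j (a + b * s i) = a - b * s i"
  using G_add[OF \<sigma>_GG'[OF j(1)], of a "b * s i"] G_mult[OF \<sigma>_GG'[OF j(1)], of b "s i"] \<sigma>_s[OF i j(1)] j(2)
    K_Rats R s_KK[OF i] K_mult G_Rats[OF \<sigma>_GG'[OF j(1)]] by auto

lemma embeddings_kk:
  assumes i: "i \<in> {1, 2, 3}"
  shows "field_embeddings (kk i) = {restrict id (kk i), restrict (\<sigma> (nx i)) (kk i)}"
proof
  have n: "nx i \<in> {1, 2, 3}" "nx i \<noteq> i" using nx i by auto
  show "{restrict id (kk i), restrict (\<sigma> (nx i)) (kk i)} \<subseteq> field_embeddings (kk i)"
  proof -
    have "restrict t (kk i) \<in> field_embeddings (kk i)" if "t \<in> GG" for t
      by (rule field_embeddingI) (use that kk_KK kk_closed[OF i] Rats_kk[OF i] in \<open>auto simp: G_add G_mult G_one\<close>)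
    thus ?thesis using \<sigma>_GG'[OF n(1)] id_G by blast
  qed
  show "field_embeddings (kk i) \<subseteq> {restrict id (kk i), restrict (\<sigma> (nx i)) (kk i)}"
  proof
    fix \<phi> assume phi: "\<phi> \<in> field_embeddings (kk i)"
    note h = field_embeddingD[OF phi]
    have Q: "\<phi> x = x" if "x \<in> \<rat>" for x using field_embedding_Rats[OF phi _ that] Rats_kk[OF i] by blast
    have "\<phi> (s i) * \<phi> (s i) = s i * s i"
      using h(2)[OF s_kk[OF i] s_kk[OF i]] Q[of "of_nat (d i)"] by (simp add: s_square)
    hence "\<phi> (s i) = s i \<or> \<phi> (s i) = - s i" by (simp add: square_eq_iff)
    moreover have phi_ab: "\<phi> (a + b * s i) = a + b * \<phi> (s i)" if "a \<in> \<rat>" "b \<in> \<rat>" for a b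
      using that h(1)[of a "b * s i"] h(2)[of b "s i"] Q Rats_kk[OF i] s_kk[OF i] kk_closed(2)[OF i] by simp
    moreover have "\<phi> = restrict id (kk i)" if "\<phi> (s i) = s i"
    proof
      fix x show "\<phi> x = restrict id (kk i) x"
        by (cases "x \<in> kk i") (use h(4) phi_ab that in \<open>auto simp: kk_eq[OF i]\<close>)
    qed
    moreover have "\<phi> = restrict (\<sigma> (nx i)) (kk i)" if "\<phi> (s i) = - s i"
    proof
      fix x show "\<phi> x = restrict (\<sigma> (nx i)) (kk i) x"
        by (cases "x \<in> kk i") (use h(4) phi_ab that conj_kk[OF i n] in \<open>auto simp: kk_eq[OF i]\<close>)
    qed
    ultimately show "\<phi> \<in> {restrict id (kk i), restrict (\<sigma> (nx i)) (kk i)}" by blast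
  qed
qed

lemma field_norm_kk:
  assumes i: "i \<in> {1, 2, 3}" and x: "x \<in> kk i"
  shows "field_norm (kk i) x = x * \<sigma> (nx i) x"
proof -
  have "restrict id (kk i) (s i) \<noteq> restrict (\<sigma> (nx i)) (kk i) (s i)"
    using s_kk[OF i] \<sigma>_s[OF i nx(1)[OF i]] nx(2)[OF i] s_neq_uminus[OF i] by auto
  hence "restrict id (kk i) \<noteq> restrict (\<sigma> (nx i)) (kk i)" by metis
  thus ?thesis unfolding field_norm_def embeddings_kk[OF i] using x by simp
qed

lemma conj_kk_eq:
  assumes i: "i \<in> {1, 2, 3}" and j: "j \<in> {1, 2, 3}" "j \<noteq> i" and x: "x \<in> kk i"
  shows "\<sigma> j x = \<sigma> (nx i) x"
  using x conj_kk[OF i j] conj_kk[OF i nx(1)[OF i] nx(2)[OF i]] by (auto simp: kk_eq[OF i])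

lemma Rats_Reals: "a \<in> \<rat> \<Longrightarrow> a \<in> \<real>" for a :: complex
  by (elim Rats_cases') simp

lemma KK_Reals: "x \<in> KK \<Longrightarrow> x \<in> \<real>"
  by (erule KKE) (simp add: q_def s_def csq_def Rats_Reals)

lemma field_degree_KK: "field_degree KK = 4"
proof -
  have Qsub: "subfield \<rat> complex_field"
  proof (rule field.subfieldI'[OF field_from_type_algebra])
    show "subring \<rat> complex_field"
      by (rule cfield.subringI) (auto simp: a_inv_complex)
    show "inv\<^bsub>complex_field\<^esub> k \<in> \<rat>" if "k \<in> \<rat> - {\<zero>\<^bsub>complex_field\<^esub>}" for k
      using that by (simp add: m_inv_complex)
  qed
  have le: "cfield.line_extension \<rat> w E = {a * w + x | a x. a \<in> \<rat> \<and> x \<in> E}" for w E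
    unfolding cfield.line_extension_def set_add_def set_mult_def r_coset_def by auto
  define E1 where "E1 = cfield.line_extension \<rat> (s 3) {0}"
  define E2 where "E2 = cfield.line_extension \<rat> (s 2) E1"
  define E3 where "E3 = cfield.line_extension \<rat> (s 1) E2"
  define E4 where "E4 = cfield.line_extension \<rat> 1 E3"
  have E1: "E1 = {q 0 0 0 f | f. f \<in> \<rat>}" unfolding E1_def le by (auto simp: q_def)
  have E2: "E2 = {q 0 0 c f | c f. c \<in> \<rat> \<and> f \<in> \<rat>}" unfolding E2_def le E1
    by (auto simp: q_def)
  have E3: "E3 = {q 0 b c f | b c f. b \<in> \<rat> \<and> c \<in> \<rat> \<and> f \<in> \<rat>}" unfolding E3_def le E2
    by (auto simp: q_def add.assoc)
  have E4: "E4 = KK" unfolding E4_def le E3 KK_def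
    by (auto simp: q_def add.assoc) blast+
  have s2: "s 2 \<notin> E1"
  proof
    assume "s 2 \<in> E1"
    then obtain f where "f \<in> \<rat>" "s 2 = q 0 0 0 f" unfolding E1 by blast
    hence "q 0 0 1 0 = q 0 0 0 f" by (simp add: q_def)
    thus False using \<open>f \<in> \<rat>\<close> by (simp add: q_eq_iff)
  qed
  have s1: "s 1 \<notin> E2"
  proof
    assume "s 1 \<in> E2"
    then obtain c f where R: "c \<in> \<rat>" "f \<in> \<rat>" "s 1 = q 0 0 c f" unfolding E2 by blast
    hence "q 0 1 0 0 = q 0 0 c f" by (simp add: q_def)
    thus False using R by (simp add: q_eq_iff)
  qed
  have s0: "1 \<notin> E3"
  proof
    assume "1 \<in> E3"
    then obtain b c f where R: "b \<in> \<rat>" "c \<in> \<rat>" "f \<in> \<rat>" "1 = q 0 b c f" unfolding E3 by blast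
    moreover have "q 1 0 0 0 = 1" by (simp add: q_def)
    ultimately have "q 1 0 0 0 = q 0 b c f" by (simp only:)
    hence "(1 :: complex) = 0" using q_eq_iff[of 1 0 0 0 0 b c f] R(1-3) by simp
    thus False by simp
  qed
  have "cfield.dimension 0 \<rat> {0}" using cfield.zero_dim[of \<rat>] by simp
  hence "cfield.dimension (Suc 0) \<rat> E1" unfolding E1_def
    by (intro cfield.Suc_dim) (use s_nonzero[of 3] in auto)
  hence "cfield.dimension (Suc (Suc 0)) \<rat> E2" unfolding E2_def by (intro cfield.Suc_dim) (use s2 in auto)
  hence "cfield.dimension (Suc (Suc (Suc 0))) \<rat> E3" unfolding E3_def by (intro cfield.Suc_dim) (use s1 in auto)
  hence "cfield.dimension (Suc (Suc (Suc (Suc 0)))) \<rat> E4" unfolding E4_def by (intro cfield.Suc_dim) (use s0 in auto)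
  hence "cfield.dimension 4 \<rat> KK" unfolding E4 by (simp add: numeral_eq_Suc)
  thus ?thesis unfolding field_degree_def using cfield.dimI[OF Qsub] by (simp add: over_def)
qed

end

subsection \<open>Pell's equation\<close>

text \<open>Pigeonhole: the fractional parts of \<open>n + 1\<close> multiples of
  \<open>\<alpha>\<close> fall into \<open>n\<close> intervals of length \<open>1 / n\<close>, so
  two of them are close.\<close>

lemma dirichlet_approximation:
  fixes \<alpha> :: real and n :: nat
  assumes n: "n > 0"
  obtains h k :: int where "0 < k" "k \<le> int n" "\<bar>of_int k * \<alpha> - of_int h\<bar> < 1 / real n"
proof -
  define f where "f k = nat \<lfloor>real n * frac (real k * \<alpha>)\<rfloor>" for k :: nat
  have f_less: "f k < n" for k
  proof -
    have "real n * frac (real k * \<alpha>) < real n" using n frac_lt_1[of "real k * \<alpha>"] by simp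
    hence "\<lfloor>real n * frac (real k * \<alpha>)\<rfloor> < int n" by (simp add: floor_less_iff)
    thus ?thesis using n by (simp add: f_def nat_less_iff)
  qed
  have "\<not> inj_on f {..n}"
  proof
    assume "inj_on f {..n}"
    hence "card {..n} \<le> card {..<n}" using f_less by (intro card_inj_on_le[of f]) auto
    thus False by simp
  qed
  then obtain i j where ij: "i < j" "j \<le> n" "f i = f j"
    unfolding inj_on_def by (metis atMost_iff linorder_neqE_nat)
  define h where "h = \<lfloor>real j * \<alpha>\<rfloor> - \<lfloor>real i * \<alpha>\<rfloor>"
  have "\<lfloor>real n * frac (real i * \<alpha>)\<rfloor> = \<lfloor>real n * frac (real j * \<alpha>)\<rfloor>"
    using ij(3) unfolding f_def by (simp add: eq_nat_nat_iff)
  hence "\<bar>real n * frac (real j * \<alpha>) - real n * frac (real i * \<alpha>)\<bar> < 1" by linarith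
  hence "real n * \<bar>frac (real j * \<alpha>) - frac (real i * \<alpha>)\<bar> < 1"
    by (simp add: right_diff_distrib[symmetric] abs_mult)
  hence "\<bar>frac (real j * \<alpha>) - frac (real i * \<alpha>)\<bar> < 1 / real n" using n by (simp add: field_simps)
  moreover have "frac (real j * \<alpha>) - frac (real i * \<alpha>) = of_int (int j - int i) * \<alpha> - of_int h"
    by (simp add: frac_def h_def algebra_simps)
  ultimately show ?thesis using that[of "int j - int i" h] ij by simp
qed

lemma finite_positive_lower_bound:
  fixes g :: "'b \<Rightarrow> real"
  assumes "finite S" "\<And>x. x \<in> S \<Longrightarrow> g x > 0"
  shows "\<exists>n::nat. n > 0 \<and> (\<forall>x\<in>S. 1 / real n < g x)"
  using assms
proof (induction S rule: finite_induct)
  case empty thus ?case by auto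
next
  case (insert a S)
  then obtain n :: nat where n: "n > 0" "\<forall>x\<in>S. 1 / real n < g x" by auto
  obtain m :: nat where m: "m > 0" "1 / real m < g a"
    using insert.prems[of a] ex_inverse_of_nat_less[of "g a"] by (auto simp: inverse_eq_divide)
  have "1 / real (max n m) \<le> 1 / real n" "1 / real (max n m) \<le> 1 / real m"
    using n m by (simp_all add: frac_le)
  thus ?case using n m by (intro exI[of _ "max n m"]) force
qed

text \<open>Infinitely many pairs in \<open>S\<close> have norms
  \<open>h\<^sup>2 - d k\<^sup>2\<close> below a fixed bound, so two distinct ones share a nonzero
  norm \<open>c\<close> and agree modulo \<open>c\<close>. Their quotient has integral coordinates
  and norm 1, and it is not rational because the pairs differ.\<close>

theorem pell_solution:
  fixes d :: nat
  assumes irr: "sqrt (real d) \<notin> \<rat>"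
  obtains x y :: int where "y \<noteq> 0" "x\<^sup>2 - int d * y\<^sup>2 = 1"
proof -
  define \<alpha> where "\<alpha> = sqrt (real d)"
  have a2: "\<alpha>\<^sup>2 = real d" by (simp add: \<alpha>_def)
  have a0: "\<alpha> \<ge> 0" by (simp add: \<alpha>_def)
  define S where "S = {(h :: int, k :: int). k > 0 \<and> \<bar>of_int k * \<alpha> - of_int h\<bar> < 1 / of_int k}"
  have pos: "\<bar>of_int k * \<alpha> - of_int h\<bar> > 0" if "k > 0" for h k :: int
  proof -
    have "of_int k * \<alpha> - of_int h \<noteq> 0"
    proof
      assume "of_int k * \<alpha> - of_int h = 0"
      hence "\<alpha> = of_int h / of_int k" using that by (simp add: field_simps)
      thus False using irr by (simp add: \<alpha>_def)
    qed
    thus ?thesis by simp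
  qed
  \<comment> \<open>If \<open>S\<close> were finite, all its approximation errors would exceed some
    \<open>1 / n\<close>; approximation with that \<open>n\<close> yields a pair in \<open>S\<close>
    with a smaller error.\<close>
  have inf: "infinite S"
  proof
    assume "finite S"
    then obtain n :: nat where n: "n > 0" "\<forall>x\<in>S. 1 / real n < \<bar>of_int (snd x) * \<alpha> - of_int (fst x)\<bar>"
      using finite_positive_lower_bound[of S "\<lambda>x. \<bar>of_int (snd x) * \<alpha> - of_int (fst x)\<bar>"] pos by (auto simp: S_def)
    obtain h k :: int where hk: "0 < k" "k \<le> int n" "\<bar>of_int k * \<alpha> - of_int h\<bar> < 1 / real n"
      using dirichlet_approximation[OF n(1)] .
    have "1 / real n \<le> 1 / of_int k" using hk by (intro divide_left_mono) auto
    hence "(h, k) \<in> S" using hk by (auto simp: S_def)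
    thus False using n(2) hk(3) by fastforce
  qed
  \<comment> \<open>The factor \<open>h + k * \<alpha>\<close> of the norm is at most
    \<open>k * (2 * \<alpha> + 1)\<close>, and \<open>k\<close> cancels against the bound
    \<open>1 / k\<close> for the other factor.\<close>
  define B where "B = \<lceil>2 * \<alpha> + 1\<rceil>"
  have bound: "\<bar>h\<^sup>2 - int d * k\<^sup>2\<bar> \<le> B" if hk: "(h, k) \<in> S" for h k
  proof -
    have k: "k > 0" "\<bar>of_int k * \<alpha> - of_int h\<bar> < 1 / of_int k" using hk by (auto simp: S_def)
    have k1: "(1 :: real) / of_int k \<le> 1" using k by simp
    have "0 \<le> of_int k * \<alpha>" using a0 k by simp
    hence "\<bar>of_int h + of_int k * \<alpha>\<bar> \<le> \<bar>of_int k * \<alpha> - of_int h\<bar> + 2 * (of_int k * \<alpha>)" by arith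
    also have "\<dots> \<le> 1 + 2 * (of_int k * \<alpha>)" using k k1 by linarith
    also have "\<dots> \<le> of_int k * (2 * \<alpha> + 1)" using k by (simp add: algebra_simps)
    finally have 1: "\<bar>of_int h + of_int k * \<alpha>\<bar> \<le> of_int k * (2 * \<alpha> + 1)" .
    have "of_int (h\<^sup>2 - int d * k\<^sup>2) = (of_int h)\<^sup>2 - (of_int k * \<alpha>)\<^sup>2"
      by (simp add: power_mult_distrib a2 mult.commute)
    also have "\<bar>\<dots>\<bar> = \<bar>of_int k * \<alpha> - of_int h\<bar> * \<bar>of_int h + of_int k * \<alpha>\<bar>"
      unfolding abs_mult[symmetric] by (subst abs_minus_cancel[symmetric]) (simp add: power2_eq_square algebra_simps)
    also have "\<dots> \<le> (1 / of_int k) * (of_int k * (2 * \<alpha> + 1))"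
      using k 1 by (intro mult_mono) auto
    also have "\<dots> = 2 * \<alpha> + 1" using k by simp
    finally have "of_int \<bar>h\<^sup>2 - int d * k\<^sup>2\<bar> \<le> 2 * \<alpha> + 1" by simp
    thus ?thesis unfolding B_def by linarith
  qed
  define m where "m x = (fst x)\<^sup>2 - int d * (snd x)\<^sup>2" for x :: "int \<times> int"
  define F where "F x = (m x, fst x mod m x, snd x mod m x)" for x
  have m0: "m x \<noteq> 0" if "x \<in> S" for x
  proof
    assume "m x = 0"
    hence "(of_int ((fst x)\<^sup>2) :: real) = of_int (int d * (snd x)\<^sup>2)" by (simp add: m_def)
    hence "(of_int (fst x))\<^sup>2 = (of_int (snd x) * \<alpha>)\<^sup>2" by (simp add: power_mult_distrib a2 mult.commute)
    hence "\<bar>of_int (fst x)\<bar> = \<bar>of_int (snd x) * \<alpha>\<bar>" using power2_eq_iff by (metis abs_eq_iff)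
    hence "of_int (snd x) * \<alpha> - of_int \<bar>fst x\<bar> = 0" using that a0 by (auto simp: S_def)
    thus False using pos[of "snd x" "\<bar>fst x\<bar>"] that by (auto simp: S_def)
  qed
  have "F ` S \<subseteq> {- B..B} \<times> {- B..B} \<times> {- B..B}"
  proof
    fix y assume "y \<in> F ` S"
    then obtain x where x: "x \<in> S" "y = F x" by blast
    have b: "\<bar>m x\<bar> \<le> B" using bound[of "fst x" "snd x"] x(1) by (simp add: m_def)
    have "\<bar>a mod m x\<bar> \<le> \<bar>m x\<bar>" for a using abs_mod_less[OF m0[OF x(1)], of a] by simp
    from this[of "fst x"] this[of "snd x"] b show "y \<in> {- B..B} \<times> {- B..B} \<times> {- B..B}"
      by (auto simp: x(2) F_def)
  qed
  hence "finite (F ` S)" using finite_subset by blast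
  then obtain x0 where x0: "x0 \<in> S" "infinite {x \<in> S. F x = F x0}" using pigeonhole_infinite[OF inf] by blast
  obtain x1 where x1: "x1 \<in> {x \<in> S. F x = F x0}" "x1 \<noteq> x0"
    using x0(2) by (metis (no_types, lifting) finite.emptyI finite_insert finite_subset insertI1 subsetI)
  obtain h k where hk: "x0 = (h, k)" by fastforce
  obtain h' k' where hk': "x1 = (h', k')" by fastforce
  define c where "c = m x0"
  have c0: "c \<noteq> 0" using m0[OF x0(1)] by (simp add: c_def)
  have c: "h\<^sup>2 - int d * k\<^sup>2 = c" "h'\<^sup>2 - int d * k'\<^sup>2 = c" and md: "h' mod c = h mod c" "k' mod c = k mod c"
    using x1(1) by (auto simp: F_def c_def m_def hk hk')
  have kp: "k > 0" "k' > 0" using x0(1) x1(1) by (auto simp: S_def hk hk')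
  have dh: "c dvd h' - h" "c dvd k' - k" using md by (simp_all add: mod_eq_dvd_iff)
  \<comment> \<open>The two coordinates of the product of \<open>h - k * \<alpha>\<close> and
    \<open>h' + k' * \<alpha>\<close>. Both are divisible by \<open>c\<close>, and dividing by
    \<open>c\<close> leaves norm 1.\<close>
  have "h * h' - int d * k * k' = c + h * (h' - h) - int d * k * (k' - k)"
    using c(1) by (simp add: power2_eq_square algebra_simps)
  moreover have "c dvd \<dots>" by (rule dvd_diff[OF dvd_add[OF dvd_refl dvd_mult[OF dh(1)]] dvd_mult[OF dh(2)]])
  ultimately obtain x where x: "h * h' - int d * k * k' = c * x" by (metis dvdE)
  have "h * k' - h' * k = h * (k' - k) - (h' - h) * k" by (simp add: algebra_simps)
  moreover have "c dvd \<dots>" by (rule dvd_diff[OF dvd_mult[OF dh(2)] dvd_mult2[OF dh(1)]])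
  ultimately obtain y where y: "h * k' - h' * k = c * y" by (metis dvdE)
  have "(c * x)\<^sup>2 - int d * (c * y)\<^sup>2 = (h\<^sup>2 - int d * k\<^sup>2) * (h'\<^sup>2 - int d * k'\<^sup>2)"
    unfolding x[symmetric] y[symmetric] by (simp add: power2_eq_square algebra_simps)
  hence "c\<^sup>2 * (x\<^sup>2 - int d * y\<^sup>2) = c\<^sup>2 * 1" unfolding c by (simp add: power_mult_distrib power2_eq_square algebra_simps)
  hence "x\<^sup>2 - int d * y\<^sup>2 = 1" using c0 by (simp only: mult_cancel_left) simp
  moreover have "y \<noteq> 0"
  proof
    assume "y = 0"
    hence eq: "h * k' = h' * k" using y by simp
    have "c * k'\<^sup>2 = (h * k')\<^sup>2 - int d * k\<^sup>2 * k'\<^sup>2" unfolding c(1)[symmetric] by (simp add: power_mult_distrib algebra_simps)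
    also have "\<dots> = c * k\<^sup>2" unfolding eq c(2)[symmetric] by (simp add: power_mult_distrib algebra_simps)
    finally have "k'\<^sup>2 = k\<^sup>2" using c0 by simp
    hence kk: "k' = k" using kp by (simp add: power2_eq_iff)
    hence "h = h'" using eq kp by simp
    thus False using x1(2) hk hk' kk by simp
  qed
  ultimately show ?thesis using that by blast
qed

context biquad
begin

subsection \<open>Fundamental units of the quadratic subfields\<close>

lemma KK_re: "x \<in> KK \<Longrightarrow> of_real (Re x) = x"
  using KK_Reals[of x] by (simp add: complex_is_Real_iff complex_eq_iff)

definition Ui :: "nat \<Rightarrow> complex set" where "Ui i = {u \<in> U. \<sigma> i u = u}"

lemma Ui_U: "u \<in> Ui i \<Longrightarrow> u \<in> U" by (simp add: Ui_def)
lemma Ui_kk: "u \<in> Ui i \<Longrightarrow> u \<in> kk i" using U_K by (simp add: Ui_def kk_def)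
lemma Ui_KK: "u \<in> Ui i \<Longrightarrow> u \<in> KK" using U_K by (simp add: Ui_def)
lemma UiI: "u \<in> U \<Longrightarrow> u \<in> kk i \<Longrightarrow> u \<in> Ui i" by (simp add: Ui_def kk_def)

lemma Ui_closed:
  assumes i: "i \<in> {1, 2, 3}"
  shows "1 \<in> Ui i" "u \<in> Ui i \<Longrightarrow> w \<in> Ui i \<Longrightarrow> u * w \<in> Ui i" "u \<in> Ui i \<Longrightarrow> inverse u \<in> Ui i" "u \<in> Ui i \<Longrightarrow> - u \<in> Ui i"
  using kk_closed(2)[OF i, of u w] kk_closed(3)[OF i, of u] kk_closed(4)[OF i, of u] Rats_kk[OF i, of 1] Ui_kk Ui_U U_mult[of u w] U_inverse[of u] U_uminus[of u]
  by (auto intro!: UiI)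

lemma Ui_power: "i \<in> {1, 2, 3} \<Longrightarrow> u \<in> Ui i \<Longrightarrow> u ^ n \<in> Ui i"
  by (induction n) (auto simp: Ui_closed)

lemma Ui_powi: "i \<in> {1, 2, 3} \<Longrightarrow> u \<in> Ui i \<Longrightarrow> u powi n \<in> Ui i"
proof -
  assume i: "i \<in> {1, 2, 3}" and u: "u \<in> Ui i"
  show ?thesis using Ui_power[OF i u] Ui_power[OF i Ui_closed(3)[OF i u]] by (simp add: power_int_def)
qed

lemma Rats_unit: "u \<in> U \<Longrightarrow> u \<in> \<rat> \<Longrightarrow> u = 1 \<or> u = - 1"
proof -
  assume u: "u \<in> U" "u \<in> \<rat>"
  have "u \<in> \<int>" "inverse u \<in> \<int>" using u O_Rats by (auto simp: U_def)
  then obtain a b where ab: "u = of_int a" "inverse u = of_int b" unfolding Ints_def by blast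
  have "u * inverse u = 1" using U_nonzero[OF u(1)] by simp
  hence "(of_int (a * b) :: complex) = of_int 1" using ab by simp
  hence "a * b = 1" by (simp only: of_int_eq_iff)
  hence "a = 1 \<or> a = - 1" by (metis zmult_eq_1_iff)
  thus ?thesis using ab by auto
qed

definition nm :: "nat \<Rightarrow> complex \<Rightarrow> complex" where "nm i x = x * \<sigma> (nx i) x"

lemma kk_trace_norm:
  assumes i: "i \<in> {1, 2, 3}" and x: "x \<in> kk i"
  shows "x + \<sigma> (nx i) x \<in> \<rat>" "nm i x \<in> \<rat>" "\<sigma> (nx i) x \<in> kk i"
proof -
  obtain a b where ab: "a \<in> \<rat>" "b \<in> \<rat>" "x = a + b * s i" using x unfolding kk_eq[OF i] by blast
  have c: "\<sigma> (nx i) x = a - b * s i" using conj_kk[OF i nx(1)[OF i] nx(2)[OF i] ab(1,2)] ab(3) by simp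
  have "x + \<sigma> (nx i) x = 2 * a" unfolding c using ab(3) by simp
  moreover have "2 * a \<in> \<rat>" using ab(1) by simp
  ultimately show "x + \<sigma> (nx i) x \<in> \<rat>" by (simp only:)
  have "nm i x = (a + b * s i) * (a - b * s i)" unfolding nm_def c using ab(3) by simp
  hence "nm i x = a * a - b * b * (s i * s i)" by (simp add: algebra_simps)
  thus "nm i x \<in> \<rat>" using ab by (simp add: s_square)
  have "a + (- b) * s i \<in> kk i" unfolding kk_eq[OF i] using ab by (intro CollectI exI[of _ a] exI[of _ "- b"]) auto
  thus "\<sigma> (nx i) x \<in> kk i" unfolding c by simp
qed

lemma nm_unit:
  assumes i: "i \<in> {1, 2, 3}" and u: "u \<in> Ui i"
  shows "nm i u = 1 \<or> nm i u = - 1"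
  using kk_trace_norm(2)[OF i Ui_kk[OF u]] U_mult[OF Ui_U[OF u] U_G[OF \<sigma>_GG'[OF nx(1)[OF i]] Ui_U[OF u]]] Rats_unit
  by (simp add: nm_def)

text \<open>A unit is a root of a quadratic polynomial with integer trace \<open>t\<close> and
  constant term 1 or -1. If it exceeds 1, it is the larger root and its conjugate has absolute value
  below 1, so a bound on the unit bounds \<open>t\<close>.\<close>

lemma finite_units_between:
  assumes i: "i \<in> {1, 2, 3}"
  shows "finite {u \<in> Ui i. 1 < Re u \<and> Re u \<le> b}"
proof -
  define f :: "int \<times> int \<Rightarrow> complex" where
    "f x = of_real ((of_int (fst x) + sqrt ((of_int (fst x))\<^sup>2 - 4 * of_int (snd x))) / 2)" for x
  have "{u \<in> Ui i. 1 < Re u \<and> Re u \<le> b} \<subseteq> f ` ({- \<lceil>b\<rceil> - 1..\<lceil>b\<rceil> + 1} \<times> {-1, 1})"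
  proof
    fix u assume "u \<in> {u \<in> Ui i. 1 < Re u \<and> Re u \<le> b}"
    hence u: "u \<in> Ui i" "1 < Re u" "Re u \<le> b" by auto
    define u' where "u' = \<sigma> (nx i) u"
    have uO: "u \<in> \<O>" "u' \<in> \<O>" using U_O Ui_U[OF u(1)] G_O[OF \<sigma>_GG'[OF nx(1)[OF i]]] by (auto simp: u'_def)
    have uK: "u \<in> KK" "u' \<in> KK" using uO O_K by auto
    have "u + u' \<in> \<int>" using kk_trace_norm(1)[OF i Ui_kk[OF u(1)]] O_Rats[OF O_add[OF uO]] by (simp add: u'_def)
    then obtain t where t: "u + u' = of_int t" by (auto elim: Ints_cases)
    have "\<exists>n :: int. u * u' = of_int n \<and> n \<in> {-1, 1}"
      using nm_unit[OF i u(1)]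
    proof
      assume "nm i u = 1"
      thus ?thesis by (intro exI[of _ 1]) (simp add: nm_def u'_def)
    next
      assume "nm i u = - 1"
      thus ?thesis by (intro exI[of _ "-1"]) (simp add: nm_def u'_def)
    qed
    then obtain n :: int where n: "u * u' = of_int n" "n \<in> {-1, 1}" by blast
    define x y where "x = Re u" and "y = Re u'"
    have uxy: "u = of_real x" "u' = of_real y" using KK_re uK by (auto simp: x_def y_def)
    have sum: "x + y = of_int t" using arg_cong[OF t, of Re] by (simp add: x_def y_def)
    have prod: "x * y = of_int n" using arg_cong[OF n(1), of Re] unfolding uxy by simp
    have x1: "x > 1" using u by (simp add: x_def)
    have "\<bar>x * y\<bar> = 1" using prod n(2) by auto
    hence "x * \<bar>y\<bar> = 1" using x1 by (simp add: abs_mult)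
    hence "\<bar>y\<bar> = 1 / x" using x1 by (simp add: field_simps)
    hence y1: "\<bar>y\<bar> < 1" using x1 by simp
    have "(of_int t :: real)\<^sup>2 - 4 * of_int n = (x - y)\<^sup>2"
      unfolding sum[symmetric] prod[symmetric] by (simp add: power2_eq_square algebra_simps)
    hence "sqrt ((of_int t)\<^sup>2 - 4 * of_int n) = x - y" using x1 y1 by simp
    hence "f (t, n) = of_real x" unfolding f_def using sum[symmetric] by simp
    moreover have "real_of_int t \<le> b + 1" "real_of_int t \<ge> - b - 1" using sum y1 x1 u(3) by (auto simp: x_def)
    hence "t \<le> \<lceil>b\<rceil> + 1" "- \<lceil>b\<rceil> - 1 \<le> t" by linarith+
    hence "t \<in> {- \<lceil>b\<rceil> - 1..\<lceil>b\<rceil> + 1}" by simp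
    ultimately show "u \<in> f ` ({- \<lceil>b\<rceil> - 1..\<lceil>b\<rceil> + 1} \<times> {-1, 1})"
      using uxy n(2) by (intro image_eqI[of _ _ "(t, n)"]) auto
  qed
  thus ?thesis by (rule finite_subset) simp
qed

text \<open>Pell's equation gives a unit other than 1 and -1; among it, its inverse and their
  negatives, one exceeds 1.\<close>

lemma exists_unit_gt_1:
  assumes i: "i \<in> {1, 2, 3}"
  shows "\<exists>u\<in>Ui i. 1 < Re u"
proof -
  have "sqrt (real (d i)) \<notin> \<rat>"
  proof
    assume "sqrt (real (d i)) \<in> \<rat>"
    hence "s i \<in> \<rat>" unfolding s_def csq_def by (elim Rats_cases') (simp add: Rats_divide)
    thus False using s_irrational[OF i] by simp
  qed
  then obtain x y :: int where xy: "y \<noteq> 0" "x\<^sup>2 - int (d i) * y\<^sup>2 = 1" by (rule pell_solution)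
  define u u' where "u = of_int x + of_int y * s i" and "u' = of_int x - of_int y * s i"
  have "u * u' = of_int x * of_int x - of_int y * of_int y * (s i * s i)" by (simp add: u_def u'_def algebra_simps)
  also have "\<dots> = of_int (x\<^sup>2 - int (d i) * y\<^sup>2)" by (simp add: s_square power2_eq_square)
  finally have uu: "u * u' = 1" using xy by simp
  have sO: "s i \<in> \<O>" using s_KK[OF i] algebraic_int_csq by (simp add: \<O>_def s_def)
  have "u \<in> \<O>" "u' \<in> \<O>" unfolding u_def u'_def using sO by (auto intro!: O_add O_diff O_mult)
  moreover have "u \<noteq> 0" using uu by auto
  moreover have "inverse u = u'" using uu by (rule inverse_unique)
  ultimately have "u \<in> U" by (simp add: U_def)
  moreover have "u \<in> kk i" unfolding kk_eq[OF i] u_def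
    by (intro CollectI exI[of _ "of_int x"] exI[of _ "of_int y"]) simp
  ultimately have uU: "u \<in> Ui i" by (rule UiI)
  have "u \<noteq> 1 \<and> u \<noteq> - 1"
  proof -
    have "u \<notin> \<rat>"
    proof
      assume "u \<in> \<rat>"
      hence "(u - of_int x) / of_int y \<in> \<rat>" by simp
      thus False using s_irrational[OF i] xy(1) by (simp add: u_def)
    qed
    thus ?thesis by auto
  qed
  define z where "z = Re u"
  have uz: "u = of_real z" using KK_re[OF Ui_KK[OF uU]] by (simp add: z_def)
  have z: "z \<noteq> 0" "z \<noteq> 1" "z \<noteq> - 1" using uz \<open>u \<noteq> 0\<close> \<open>u \<noteq> 1 \<and> u \<noteq> - 1\<close> by auto
  consider "z > 1" | "0 < z" "z < 1" | "- 1 < z" "z < 0" | "z < - 1" using z by linarith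
  thus ?thesis
  proof cases
    case 1 thus ?thesis using uU by (auto simp: z_def)
  next
    case 2
    hence "Re (inverse u) > 1" using one_less_inverse[of z] unfolding uz by (simp flip: of_real_inverse)
    thus ?thesis using Ui_closed(3)[OF i uU] by blast
  next
    case 3
    hence "Re (- inverse u) > 1" using one_less_inverse[of "- z"] unfolding uz by (simp flip: of_real_inverse)
    thus ?thesis using Ui_closed(3,4)[OF i] uU by blast
  next
    case 4
    thus ?thesis using Ui_closed(4)[OF i uU] by (intro bexI[of _ "- u"]) (auto simp: z_def)
  qed
qed

definition is_fund :: "nat \<Rightarrow> complex \<Rightarrow> bool" where
  "is_fund i u \<longleftrightarrow> u \<in> Ui i \<and> 1 < Re u \<and> (\<forall>v\<in>Ui i. \<exists>n :: int. v = u powi n \<or> v = - (u powi n))"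

text \<open>By finiteness there is a least unit \<open>w\<close> above 1. A positive unit divided by
  the largest power of \<open>w\<close> not exceeding it is a unit that is at least 1 and below
  \<open>w\<close>, hence 1. For another fundamental unit \<open>x\<close>, \<open>w\<close> is a
  positive power of \<open>x\<close>, so \<open>x\<close> is at most \<open>w\<close> and equal to
  it.\<close>

lemma exists_fund:
  assumes i: "i \<in> {1, 2, 3}"
  shows "\<exists>!u. is_fund i u"
proof -
  obtain u0 where u0: "u0 \<in> Ui i" "1 < Re u0" using exists_unit_gt_1[OF i] by blast
  define T where "T = {u \<in> Ui i. 1 < Re u \<and> Re u \<le> Re u0}"
  have "finite T" "T \<noteq> {}" using finite_units_between[OF i] u0 by (auto simp: T_def)
  then obtain w where w: "w \<in> T" "\<forall>u\<in>T. Re w \<le> Re u"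
    by (meson ex_min_if_finite arg_min_least arg_min_if_finite(1))
  have wU: "w \<in> Ui i" and w1: "1 < Re w" using w by (auto simp: T_def)
  have least: "Re w \<le> Re u" if "u \<in> Ui i" "1 < Re u" for u
    using w that u0 by (cases "Re u \<le> Re u0") (auto simp: T_def)
  have wr: "w = of_real (Re w)" using KK_re[OF Ui_KK[OF wU]] by simp
  have pos_case: "\<exists>n. u = w powi n" if u: "u \<in> Ui i" "Re u > 0" for u
  proof -
    have ur: "u = of_real (Re u)" using KK_re[OF Ui_KK[OF u(1)]] by simp
    define n where "n = \<lfloor>ln (Re u) / ln (Re w)\<rfloor>"
    have lw: "ln (Re w) > 0" using w1 by simp
    have exp: "Re w powi m = exp (of_int m * ln (Re w))" for m
      using w1 by (simp add: powr_real_of_int'[symmetric] powr_def)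
    have "of_int n \<le> ln (Re u) / ln (Re w)" "ln (Re u) / ln (Re w) < of_int n + 1" unfolding n_def by linarith+
    hence "of_int n * ln (Re w) \<le> ln (Re u)" "ln (Re u) < of_int (n + 1) * ln (Re w)"
      using lw by (simp_all add: pos_le_divide_eq pos_divide_less_eq)
    hence "exp (of_int n * ln (Re w)) \<le> exp (ln (Re u))" "exp (ln (Re u)) < exp (of_int (n + 1) * ln (Re w))"
      by (simp_all only: exp_le_cancel_iff exp_less_cancel_iff)
    hence "exp (of_int n * ln (Re w)) \<le> Re u" "Re u < exp (of_int (n + 1) * ln (Re w))"
      using u(2) by simp_all
    hence b: "Re w powi n \<le> Re u" "Re u < Re w powi (n + 1)" unfolding exp by auto
    have wn: "Re w powi n > 0" using w1 by simp
    define y where "y = u * inverse (w powi n)"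
    have yU: "y \<in> Ui i" unfolding y_def by (intro Ui_closed(2,3)[OF i] u(1) Ui_powi[OF i wU])
    have yr: "Re y = Re u / (Re w powi n)"
    proof -
      have "y = of_real (Re u / Re w powi n)"
        unfolding y_def by (subst ur, subst wr) (simp add: divide_inverse flip: of_real_power_int of_real_inverse of_real_mult)
      hence "Re y = Re (of_real (Re u / Re w powi n))" by (rule arg_cong)
      thus ?thesis by (simp only: Re_complex_of_real)
    qed
    have "1 \<le> Re y" "Re y < Re w" using b wn w1 by (auto simp: yr field_simps power_int_add)
    hence "Re y = 1" using least[OF yU] by force
    hence "y = 1" using KK_re[OF Ui_KK[OF yU]] by (metis of_real_1)
    moreover have "w powi n \<noteq> 0" using U_nonzero[OF Ui_U[OF wU]] by simp
    ultimately have "u = w powi n" unfolding y_def by (simp add: field_simps)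
    thus ?thesis by blast
  qed
  have "is_fund i w" unfolding is_fund_def
  proof (intro conjI ballI)
    fix u assume u: "u \<in> Ui i"
    have "Re u \<noteq> 0" using KK_re[OF Ui_KK[OF u]] U_nonzero[OF Ui_U[OF u]] by auto
    then consider "Re u > 0" | "Re (- u) > 0" by force
    thus "\<exists>n. u = w powi n \<or> u = - (w powi n)"
    proof cases
      case 1 thus ?thesis using pos_case[OF u] by blast
    next
      case 2
      then obtain n where "- u = w powi n" using pos_case[OF Ui_closed(4)[OF i u]] by blast
      hence "u = - (w powi n)" by (metis minus_minus)
      thus ?thesis by blast
    qed
  qed (use wU w1 in auto)
  moreover have "x = w" if x: "is_fund i x" for x
  proof -
    have xU: "x \<in> Ui i" and x1: "1 < Re x" using x by (auto simp: is_fund_def)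
    have xr: "x = of_real (Re x)" using KK_re[OF Ui_KK[OF xU]] by simp
    obtain n where n: "w = x powi n \<or> w = - (x powi n)" using x wU unfolding is_fund_def by blast
    have Rex: "Re (x powi n) = Re x powi n" by (subst xr) (simp flip: of_real_power_int)
    have "Re x powi n > 0" using x1 by simp
    hence w_eq: "Re w = Re x powi n" using n Rex w1 by auto
    have "n \<ge> 1"
    proof (rule ccontr)
      assume "\<not> n \<ge> 1"
      hence "Re x powi n \<le> Re x powi 0" using x1 by (intro power_int_increasing) auto
      thus False using w1 w_eq by simp
    qed
    hence "Re x powi 1 \<le> Re x powi n" using x1 by (intro power_int_increasing) auto
    hence "Re x \<le> Re w" using w_eq by simp
    hence "Re x = Re w" using least[OF xU x1] by simp
    thus ?thesis using xr wr by simp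
  qed
  ultimately show ?thesis by blast
qed

definition eps :: "nat \<Rightarrow> complex" where "eps i = (THE u. is_fund i u)"

lemma eps: "i \<in> {1, 2, 3} \<Longrightarrow> is_fund i (eps i)"
  unfolding eps_def using theI'[OF exists_fund] .

lemma Units_ring_of_integers_kk:
  assumes i: "i \<in> {1, 2, 3}"
  shows "Units (ring_of_integers (kk i)) = Ui i"
proof -
  have O: "integers (kk i) = {x \<in> \<O>. \<sigma> i x = x}" by (auto simp: integers_def \<O>_def kk_def)
  show ?thesis
  proof
    show "Units (ring_of_integers (kk i)) \<subseteq> Ui i"
    proof
      fix x assume "x \<in> Units (ring_of_integers (kk i))"
      then obtain y where "x \<in> \<O>" "\<sigma> i x = x" "y \<in> \<O>" "x * y = 1" unfolding Units_def by (auto simp: O)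
      moreover from this have "inverse x = y" "x \<noteq> 0" using inverse_unique by auto
      ultimately show "x \<in> Ui i" by (simp add: Ui_def U_def)
    qed
    show "Ui i \<subseteq> Units (ring_of_integers (kk i))"
    proof
      fix x assume x: "x \<in> Ui i"
      have "inverse x \<in> Ui i" using Ui_closed(3)[OF i x] .
      hence "x \<in> \<O>" "\<sigma> i x = x" "inverse x \<in> \<O>" "\<sigma> i (inverse x) = inverse x" "x \<noteq> 0"
        using x by (auto simp: Ui_def U_def)
      thus "x \<in> Units (ring_of_integers (kk i))"
        unfolding Units_def by (auto simp: O intro!: bexI[of _ "inverse x"])
    qed
  qed
qed

lemma fundamental_unit_eq: "i \<in> {1, 2, 3} \<Longrightarrow> fundamental_unit (kk i) = eps i"
proof -
  assume i: "i \<in> {1, 2, 3}"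
  have "u \<in> Ui i \<and> (\<exists>r>1. u = complex_of_real r) \<and> (\<forall>v\<in>Ui i. \<exists>n::int. v = u powi n \<or> v = - (u powi n)) \<longleftrightarrow> is_fund i u" for u
    unfolding is_fund_def using KK_re[OF Ui_KK, of u i] by (metis Re_complex_of_real)
  thus ?thesis unfolding fundamental_unit_def eps_def Units_ring_of_integers_kk[OF i] by simp
qed

subsection \<open>Unit indices\<close>

lemma G3: "t \<in> GG \<longleftrightarrow> t = id \<or> (\<exists>i\<in>{1, 2, 3}. t = \<sigma> i)" by (auto simp: GG_def)

lemma \<sigma>_\<sigma>:
  "i \<in> {1, 2, 3} \<Longrightarrow> \<sigma> i (\<sigma> i x) = x"
  "{i, j, k} = {1, 2, 3} \<Longrightarrow> \<sigma> i (\<sigma> j x) = \<sigma> k x"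
proof -
  note c = \<sigma>_comp[THEN fun_cong, of x, unfolded comp_def id_def]
  show "i \<in> {1, 2, 3} \<Longrightarrow> \<sigma> i (\<sigma> i x) = x" using c by (elim insertE emptyE) simp_all
  assume eq: "{i, j, k} = {1, 2, 3}"
  have m: "i \<in> {1, 2, 3}" "j \<in> {1, 2, 3}" "k \<in> {1, 2, 3}" unfolding eq[symmetric] by simp_all
  have n: "1 \<in> {i, j, k}" "2 \<in> {i, j, k}" "3 \<in> {i, j, k}" unfolding eq by simp_all
  have "(i = 1 \<and> j = 2 \<and> k = 3) \<or> (i = 1 \<and> j = 3 \<and> k = 2) \<or> (i = 2 \<and> j = 1 \<and> k = 3) \<or>
    (i = 2 \<and> j = 3 \<and> k = 1) \<or> (i = 3 \<and> j = 1 \<and> k = 2) \<or> (i = 3 \<and> j = 2 \<and> k = 1)"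
    using m by (elim insertE emptyE) (insert n, simp_all)
  thus "\<sigma> i (\<sigma> j x) = \<sigma> k x" using c by (elim disjE conjE) simp_all
qed

lemma \<sigma>_K: "i \<in> {1, 2, 3} \<Longrightarrow> x \<in> KK \<Longrightarrow> \<sigma> i x \<in> KK" by (rule \<sigma>_KK)
lemma \<sigma>_mult: "i \<in> {1, 2, 3} \<Longrightarrow> x \<in> KK \<Longrightarrow> y \<in> KK \<Longrightarrow> \<sigma> i (x * y) = \<sigma> i x * \<sigma> i y" by (rule G_mult[OF \<sigma>_GG'])
lemma \<sigma>_divide: "i \<in> {1, 2, 3} \<Longrightarrow> x \<in> KK \<Longrightarrow> y \<in> KK \<Longrightarrow> \<sigma> i (x / y) = \<sigma> i x / \<sigma> i y" by (rule G_divide[OF \<sigma>_GG'])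
lemma \<sigma>_nz: "i \<in> {1, 2, 3} \<Longrightarrow> x \<noteq> 0 \<Longrightarrow> \<sigma> i x \<noteq> 0" using G_eq_0_iff[OF \<sigma>_GG'] by blast
lemma \<sigma>_U: "i \<in> {1, 2, 3} \<Longrightarrow> u \<in> U \<Longrightarrow> \<sigma> i u \<in> U" by (rule U_G[OF \<sigma>_GG'])
lemma \<sigma>_Rats: "i \<in> {1, 2, 3} \<Longrightarrow> x \<in> \<rat> \<Longrightarrow> \<sigma> i x = x" by (rule G_Rats[OF \<sigma>_GG'])

lemma KK_Re_mult: "x \<in> KK \<Longrightarrow> y \<in> KK \<Longrightarrow> Re (x * y) = Re x * Re y"
  using KK_re[of x] KK_re[of y] by (metis Re_complex_of_real of_real_mult)

lemma KK_Re_inverse: "x \<in> KK \<Longrightarrow> Re (inverse x) = inverse (Re x)"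
  using KK_re[of x] by (metis Re_complex_of_real of_real_inverse)

lemma KK_Re_eq_0: "x \<in> KK \<Longrightarrow> Re x = 0 \<longleftrightarrow> x = 0"
  using KK_re[of x] by (metis of_real_0 zero_complex.sel(1))

lemma KK_Re_square: "x \<in> KK \<Longrightarrow> x \<noteq> 0 \<Longrightarrow> Re (x * x) > 0"
  using KK_Re_eq_0[of x] by (simp only: KK_Re_mult) (simp add: zero_less_mult_iff linorder_neq_iff disj_commute)

text \<open>Since multiplication is commutative, the products of one unit from each subfield already
  form the subgroup generated by the three unit groups.\<close>

definition W :: "complex set" where
  "W = {u1 * u2 * u3 | u1 u2 u3. u1 \<in> Ui 1 \<and> u2 \<in> Ui 2 \<and> u3 \<in> Ui 3}"

lemma subgroup_U: "subgroup U cmul"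
  by (rule subgroup_cmulI) (auto intro: U_mult U_inverse dest: U_nonzero)

lemma WE:
  assumes "x \<in> W"
  obtains u1 u2 u3 where "u1 \<in> Ui 1" "u2 \<in> Ui 2" "u3 \<in> Ui 3" "x = u1 * u2 * u3"
  using assms unfolding W_def by blast

lemma WI: "u1 \<in> Ui 1 \<Longrightarrow> u2 \<in> Ui 2 \<Longrightarrow> u3 \<in> Ui 3 \<Longrightarrow> u1 * u2 * u3 \<in> W"
  unfolding W_def by blast

lemma W_U: "W \<subseteq> U" using Ui_U U_mult by (auto elim!: WE)

lemma subgroup_W: "subgroup W cmul"
proof (rule subgroup_cmulI)
  show "0 \<notin> W" using W_U U_nonzero by blast
  show "1 \<in> W" using WI[OF Ui_closed(1)[of 1] Ui_closed(1)[of 2] Ui_closed(1)[of 3]] by simp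
  show "x * y \<in> W" if xy: "x \<in> W" "y \<in> W" for x y
  proof -
    obtain u1 u2 u3 where u: "u1 \<in> Ui 1" "u2 \<in> Ui 2" "u3 \<in> Ui 3" "x = u1 * u2 * u3" using xy(1) by (rule WE)
    obtain w1 w2 w3 where w: "w1 \<in> Ui 1" "w2 \<in> Ui 2" "w3 \<in> Ui 3" "y = w1 * w2 * w3" using xy(2) by (rule WE)
    have "(u1 * w1) * (u2 * w2) * (u3 * w3) \<in> W"
      by (intro WI Ui_closed(2)) (use u w in auto)
    thus ?thesis using u(4) w(4) by (simp add: mult_ac)
  qed
  show "inverse x \<in> W" if xy: "x \<in> W" for x
  proof -
    obtain u1 u2 u3 where u: "u1 \<in> Ui 1" "u2 \<in> Ui 2" "u3 \<in> Ui 3" "x = u1 * u2 * u3" using xy by (rule WE)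
    have "inverse u1 * inverse u2 * inverse u3 \<in> W" by (intro WI Ui_closed(3)) (use u in auto)
    thus ?thesis using u(4) by simp
  qed
qed

lemma Ui_W: "i \<in> {1, 2, 3} \<Longrightarrow> Ui i \<subseteq> W"
proof
  fix u assume i: "i \<in> {1, 2, 3}" and u: "u \<in> Ui i"
  show "u \<in> W" using i u WI[of u 1 1] WI[of 1 u 1] WI[of 1 1 u] Ui_closed(1)[of 1] Ui_closed(1)[of 2] Ui_closed(1)[of 3]
    by (elim insertE emptyE) simp_all
qed

lemma W_uminus: "x \<in> W \<Longrightarrow> - x \<in> W"
proof -
  assume x: "x \<in> W"
  have "- 1 \<in> W" using Ui_W[of 1] Ui_closed(4)[of 1 1] Ui_closed(1)[of 1] by auto
  from subgroup.m_closed[OF subgroup_W this x] show ?thesis by simp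
qed

lemma Units_R: "Units R = U"
proof
  show "Units R \<subseteq> U"
  proof
    fix x assume "x \<in> Units R"
    then obtain y where "x \<in> \<O>" "y \<in> \<O>" "x * y = 1" unfolding Units_def by auto
    moreover from this have "inverse x = y" "x \<noteq> 0" using inverse_unique by auto
    ultimately show "x \<in> U" by (simp add: U_def)
  qed
  show "U \<subseteq> Units R" unfolding Units_def U_def by (auto intro!: bexI[of _ "inverse _"])
qed

lemma hasse_index_eq:
  "group_index (unit_group KK) (generate (unit_group KK) (\<Union>i\<in>{1, 2, 3}. carrier (unit_group (kk i)))) = idx cmul U W"
proof -
  let ?G = "unit_group KK"
  interpret uG: group ?G by (rule R.units_group)
  have simps: "carrier ?G = U" "\<And>x y. x \<otimes>\<^bsub>?G\<^esub> y = x * y" "\<one>\<^bsub>?G\<^esub> = 1"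
    by (simp_all add: units_of_def Units_R)
  have inv: "inv\<^bsub>?G\<^esub> x = inverse x" if "x \<in> U" for x
    using uG.inv_equality[of "inverse x" x] that U_inverse U_nonzero simps by simp
  have S: "(\<Union>i\<in>{1, 2, 3}. carrier (unit_group (kk i))) = Ui 1 \<union> Ui 2 \<union> Ui 3"
    using Units_ring_of_integers_kk[of 1] Units_ring_of_integers_kk[of 2] Units_ring_of_integers_kk[of 3]
    by (simp add: units_of_def Un_assoc)
  have "subgroup W ?G"
  proof (rule uG.subgroupI)
    show "W \<subseteq> carrier ?G" "W \<noteq> {}" using W_U subgroup.one_closed[OF subgroup_W] simps by auto
    show "inv\<^bsub>?G\<^esub> x \<in> W" if "x \<in> W" for x
    proof -
      have x: "x \<in> U" using that W_U by blast
      hence "inverse x \<in> W" using subgroup.m_inv_closed[OF subgroup_W that] inv_cmul[OF U_nonzero] by simp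
      thus ?thesis using inv[OF x] by simp
    qed
    show "x \<otimes>\<^bsub>?G\<^esub> y \<in> W" if "x \<in> W" "y \<in> W" for x y
      using subgroup.m_closed[OF subgroup_W that] simps by simp
  qed
  hence "generate ?G (Ui 1 \<union> Ui 2 \<union> Ui 3) \<subseteq> W"
    using Ui_W[of 1] Ui_W[of 2] Ui_W[of 3] by (intro uG.generate_subgroup_incl) auto
  moreover have "W \<subseteq> generate ?G (Ui 1 \<union> Ui 2 \<union> Ui 3)"
  proof
    fix x assume "x \<in> W"
    then obtain u1 u2 u3 where u: "u1 \<in> Ui 1" "u2 \<in> Ui 2" "u3 \<in> Ui 3" "x = u1 * u2 * u3" by (rule WE)
    have "u1 \<otimes>\<^bsub>?G\<^esub> u2 \<otimes>\<^bsub>?G\<^esub> u3 \<in> generate ?G (Ui 1 \<union> Ui 2 \<union> Ui 3)"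
      by (intro generate.eng generate.incl) (use u in auto)
    thus "x \<in> generate ?G (Ui 1 \<union> Ui 2 \<union> Ui 3)" using u(4) simps by simp
  qed
  ultimately have gen: "generate ?G (Ui 1 \<union> Ui 2 \<union> Ui 3) = W" by blast
  show ?thesis unfolding S gen group_index_eq_idx idx_def simps(1) r_coset_def using simps(2) by simp
qed

definition sqs :: "complex set \<Rightarrow> complex set" where "sqs H = (\<lambda>x. x * x) ` H"

lemma subgroup_sqs: "subgroup H cmul \<Longrightarrow> subgroup (sqs H) cmul"
proof (rule subgroup_cmulI)
  assume H: "subgroup H cmul"
  show "0 \<notin> sqs H" using subgroup.mem_carrier[OF H] by (force simp: sqs_def)
  show "1 \<in> sqs H" using subgroup.one_closed[OF H] by (force simp: sqs_def)
  show "x * y \<in> sqs H" if xy: "x \<in> sqs H" "y \<in> sqs H" for x y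
  proof -
    obtain a b where "a \<in> H" "b \<in> H" "x = a * a" "y = b * b" using xy by (auto simp: sqs_def)
    thus ?thesis using subgroup.m_closed[OF H, of a b] by (auto simp: sqs_def intro!: image_eqI[of _ _ "a * b"])
  qed
  show "inverse x \<in> sqs H" if xy: "x \<in> sqs H" for x
  proof -
    obtain a where a: "a \<in> H" "x = a * a" using xy by (auto simp: sqs_def)
    have "inverse a \<in> H" using subgroup.m_inv_closed[OF H a(1)] inv_cmul subgroup.mem_carrier[OF H a(1)] by simp
    thus ?thesis using a by (auto simp: sqs_def intro!: image_eqI[of _ _ "inverse a"])
  qed
qed

text \<open>The kernel of squaring consists of 1 and -1 and lies in \<open>W\<close>, so squaring
  preserves the index.\<close>

lemma idx_sqs: "idx cmul (sqs U) (sqs W) = idx cmul U W"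
proof -
  have "idx cmul U W = card ((\<lambda>u. sqs W #>\<^bsub>cmul\<^esub> (u * u)) ` U)"
  proof (rule cmul.idx_cong[OF subgroup_W])
    show "U \<subseteq> carrier cmul" using U_nonzero by auto
    fix x y assume xy: "x \<in> U" "y \<in> U"
    hence nz: "x \<noteq> 0" "y \<noteq> 0" using U_nonzero by auto
    have "sqs W #>\<^bsub>cmul\<^esub> (x * x) = sqs W #>\<^bsub>cmul\<^esub> (y * y) \<longleftrightarrow> (x * x) * inverse (y * y) \<in> sqs W"
      using cmul.rcos_eq_iff[OF subgroup_sqs[OF subgroup_W], of "x * x" "y * y"] nz inv_cmul by simp
    also have "(x * x) * inverse (y * y) = (x * inverse y) * (x * inverse y)" by simp
    also have "\<dots> \<in> sqs W \<longleftrightarrow> x * inverse y \<in> W"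
    proof
      assume "(x * inverse y) * (x * inverse y) \<in> sqs W"
      then obtain w where w: "w \<in> W" "(x * inverse y) * (x * inverse y) = w * w" by (auto simp: sqs_def)
      hence "x * inverse y = w \<or> x * inverse y = - w" by (simp only: square_eq_iff)
      thus "x * inverse y \<in> W" using w(1) W_uminus by auto
    qed (auto simp: sqs_def)
    finally show "x \<otimes>\<^bsub>cmul\<^esub> inv\<^bsub>cmul\<^esub> y \<in> W \<longleftrightarrow> sqs W #>\<^bsub>cmul\<^esub> (x * x) = sqs W #>\<^bsub>cmul\<^esub> (y * y)"
      using nz inv_cmul by simp
  qed
  moreover have "idx cmul (sqs U) (sqs W) = card ((\<lambda>u. sqs W #>\<^bsub>cmul\<^esub> (u * u)) ` U)"
    by (simp only: idx_def sqs_def[of U] image_image)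
  ultimately show ?thesis by simp
qed

text \<open>The units that become positive rationals after multiplication by a nonzero square of the
  field. Positivity of all conjugates is a consequence (\<open>V_positive\<close>); this form is
  what the correspondence with \<open>A2\<close> uses.\<close>

definition V :: "complex set" where
  "V = {u \<in> U. \<exists>a\<in>KK. a \<noteq> 0 \<and> (\<exists>qq\<in>\<rat>. Re qq > 0 \<and> a * a * u = qq)}"

text \<open>As -1 is a unit the sign can always be arranged, so the condition amounts to
  \<open>a * a\<close> lying in \<open>QU\<close>. Asking for a positive rational makes the unit
  unique.\<close>

definition A2 :: "complex set" where
  "A2 = {a \<in> KK. a \<noteq> 0 \<and> (\<exists>u\<in>U. \<exists>qq\<in>\<rat>. Re qq > 0 \<and> a * a * u = qq)}"

lemma Re_Rats_mult: "x \<in> \<rat> \<Longrightarrow> y \<in> \<rat> \<Longrightarrow> Re x > 0 \<Longrightarrow> Re y > 0 \<Longrightarrow> Re (x * y) > 0"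
  using mult_pos_pos[of "Re x" "Re y"] KK_Re_mult[OF K_Rats K_Rats, of x y] by metis

lemma Re_Rats_inverse: "p \<in> \<rat> \<Longrightarrow> Re p > 0 \<Longrightarrow> Re (inverse p) > 0"
  using KK_Re_inverse[OF K_Rats] by simp

lemma subgroup_V: "subgroup V cmul"
proof (rule subgroup_cmulI)
  show "0 \<notin> V" using U_nonzero by (auto simp: V_def)
  show "1 \<in> V" unfolding V_def using K_one by (auto intro!: bexI[of _ 1])
  show "x * y \<in> V" if xy: "x \<in> V" "y \<in> V" for x y
  proof -
    obtain a p where a: "a \<in> KK" "a \<noteq> 0" "p \<in> \<rat>" "Re p > 0" "a * a * x = p" using xy by (auto simp: V_def)
    obtain b qq where b: "b \<in> KK" "b \<noteq> 0" "qq \<in> \<rat>" "Re qq > 0" "b * b * y = qq" using xy by (auto simp: V_def)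
    have "(a * b) * (a * b) * (x * y) = p * qq" unfolding a(5)[symmetric] b(5)[symmetric] by (simp add: mult_ac)
    moreover have "p * qq \<in> \<rat>" "Re (p * qq) > 0" "a * b \<in> KK" "a * b \<noteq> 0"
      using a b Re_Rats_mult K_mult by auto
    moreover have "x * y \<in> U" using xy U_mult by (auto simp: V_def)
    ultimately show ?thesis unfolding V_def by blast
  qed
  show "inverse x \<in> V" if x: "x \<in> V" for x
  proof -
    obtain a p where a: "a \<in> KK" "a \<noteq> 0" "p \<in> \<rat>" "Re p > 0" "a * a * x = p" using x by (auto simp: V_def)
    have "inverse a * inverse a * inverse x = inverse p" unfolding a(5)[symmetric] by (simp add: mult_ac)
    moreover have "inverse p \<in> \<rat>" "Re (inverse p) > 0" "inverse a \<in> KK" "inverse a \<noteq> 0"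
      using a Re_Rats_inverse K_inverse by auto
    moreover have "inverse x \<in> U" using x U_inverse by (auto simp: V_def)
    ultimately show ?thesis unfolding V_def by blast
  qed
qed

lemma sqs_U_V: "sqs U \<subseteq> V"
proof
  fix x assume "x \<in> sqs U"
  then obtain w where w: "w \<in> U" "x = w * w" by (auto simp: sqs_def)
  have "inverse w * inverse w * x = 1" using w(2) U_nonzero[OF w(1)] by (simp add: field_simps)
  moreover have "inverse w \<in> KK" "inverse w \<noteq> 0" "x \<in> U" using w U_K U_inverse U_nonzero U_mult by auto
  moreover have "Re 1 > 0" by simp
  ultimately show "x \<in> V" unfolding V_def using Rats_1 by blast
qed

lemma sqs_W_U: "sqs W \<subseteq> sqs U" using W_U by (auto simp: sqs_def)

definition uu :: "complex \<Rightarrow> complex" where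
  "uu a = (THE u. u \<in> U \<and> (\<exists>qq\<in>\<rat>. Re qq > 0 \<and> a * a * u = qq))"

text \<open>Two admissible units differ by a factor that is a positive rational unit, hence
  1.\<close>

lemma uu:
  assumes "a \<in> A2"
  shows "uu a \<in> U" "a * a * uu a \<in> \<rat>" "Re (a * a * uu a) > 0"
    "\<And>u. u \<in> U \<Longrightarrow> a * a * u \<in> \<rat> \<Longrightarrow> Re (a * a * u) > 0 \<Longrightarrow> uu a = u"
proof -
  have a0: "a \<noteq> 0" using assms by (simp add: A2_def)
  obtain u qq where u: "u \<in> U" "qq \<in> \<rat>" "Re qq > 0" "a * a * u = qq" using assms by (auto simp: A2_def)
  have uniq: "u = w" if w: "w \<in> U" "a * a * w \<in> \<rat>" "Re (a * a * w) > 0" for w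
  proof -
    define p where "p = a * a * w"
    have p: "p \<in> \<rat>" "Re p > 0" using w by (simp_all add: p_def)
    have eq: "qq * inverse p = u * inverse w" using a0 U_nonzero[OF w(1)] unfolding u(4)[symmetric] p_def by (simp add: field_simps)
    have "qq * inverse p \<in> \<rat>" "Re (qq * inverse p) > 0"
      using Rats_mult[OF u(2) Rats_inverse[OF p(1)]] Re_Rats_mult[OF u(2) Rats_inverse[OF p(1)] u(3) Re_Rats_inverse[OF p]]
      by (simp_all only:)
    moreover have "Re (- 1) < 0" by simp
    ultimately have "u * inverse w = 1"
      using Rats_unit[OF U_mult[OF u(1) U_inverse[OF w(1)]]] unfolding eq by (metis less_asym)
    thus ?thesis using U_nonzero[OF w(1)] by (simp add: field_simps)
  qed
  have e: "uu a = u" unfolding uu_def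
  proof (rule the_equality)
    show "u \<in> U \<and> (\<exists>qq\<in>\<rat>. Re qq > 0 \<and> a * a * u = qq)" using u by blast
    show "w = u" if "w \<in> U \<and> (\<exists>qq\<in>\<rat>. Re qq > 0 \<and> a * a * w = qq)" for w
      using uniq[of w] that by blast
  qed
  show "uu a \<in> U" unfolding e by (rule u(1))
  show "a * a * uu a \<in> \<rat>" unfolding e u(4) by (rule u(2))
  show "Re (a * a * uu a) > 0" unfolding e u(4) by (rule u(3))
  show "\<And>w. w \<in> U \<Longrightarrow> a * a * w \<in> \<rat> \<Longrightarrow> Re (a * a * w) > 0 \<Longrightarrow> uu a = w"
    unfolding e using uniq by blast
qed

lemma A2I: "a \<in> KK \<Longrightarrow> a \<noteq> 0 \<Longrightarrow> u \<in> U \<Longrightarrow> a * a * u \<in> \<rat> \<Longrightarrow> Re (a * a * u) > 0 \<Longrightarrow> a \<in> A2"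
  unfolding A2_def by blast

lemma A2_K: "a \<in> A2 \<Longrightarrow> a \<in> KK" and A2_nz: "a \<in> A2 \<Longrightarrow> a \<noteq> 0" by (auto simp: A2_def)

lemma uu_mult:
  assumes "a \<in> A2" "b \<in> A2"
  shows "a * b \<in> A2" "uu (a * b) = uu a * uu b"
proof -
  have eq: "(a * b) * (a * b) * (uu a * uu b) = (a * a * uu a) * (b * b * uu b)" by (simp add: mult_ac)
  have R: "(a * b) * (a * b) * (uu a * uu b) \<in> \<rat>" "Re ((a * b) * (a * b) * (uu a * uu b)) > 0"
    unfolding eq using uu(2,3)[OF assms(1)] uu(2,3)[OF assms(2)] by (simp_all only: Rats_mult Re_Rats_mult)
  have UU: "uu a * uu b \<in> U" using uu(1) assms U_mult by blast
  show ab: "a * b \<in> A2"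
    by (rule A2I[OF _ _ UU R]) (use assms A2_K A2_nz K_mult in auto)
  show "uu (a * b) = uu a * uu b" by (rule uu(4)[OF ab UU R])
qed

lemma uu_inverse:
  assumes "a \<in> A2"
  shows "inverse a \<in> A2" "uu (inverse a) = inverse (uu a)"
proof -
  have eq: "inverse a * inverse a * inverse (uu a) = inverse (a * a * uu a)" by (simp add: mult_ac)
  have R: "inverse a * inverse a * inverse (uu a) \<in> \<rat>" "Re (inverse a * inverse a * inverse (uu a)) > 0"
    unfolding eq using uu(2,3)[OF assms] by (simp_all only: Rats_inverse Re_Rats_inverse)
  have UU: "inverse (uu a) \<in> U" using uu(1) assms U_inverse by blast
  show ia: "inverse a \<in> A2"
    by (rule A2I[OF _ _ UU R]) (use assms A2_K A2_nz K_inverse in auto)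
  show "uu (inverse a) = inverse (uu a)" by (rule uu(4)[OF ia UU R])
qed

lemma QU_A2: "x \<in> QU \<Longrightarrow> x \<in> A2 \<and> uu x \<in> sqs U"
proof -
  assume x: "x \<in> QU"
  then obtain qq u where qu: "x = qq * u" "qq \<in> \<rat>" "qq \<noteq> 0" "u \<in> U" by (auto simp: QU_def)
  have eq: "x * x * (inverse u * inverse u) = qq * qq" using qu(1) U_nonzero[OF qu(4)] by (simp add: field_simps)
  have R: "x * x * (inverse u * inverse u) \<in> \<rat>" "Re (x * x * (inverse u * inverse u)) > 0"
    unfolding eq using qu KK_Re_square[OF K_Rats] by auto
  have uU: "inverse u * inverse u \<in> U" using qu U_inverse U_mult by blast
  have A: "x \<in> A2" by (rule A2I[OF _ _ uU R]) (use qu QU_K x U_nonzero in auto)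
  have "uu x = inverse u * inverse u" by (rule uu(4)[OF A uU R])
  thus ?thesis using A qu U_inverse by (auto simp: sqs_def)
qed

lemma subgroup_A2: "subgroup A2 cmul"
  by (rule subgroup_cmulI)
     (use uu_mult(1) uu_inverse(1) A2_nz QU_A2[of 1] subgroup.one_closed[OF subgroup_QU] in auto)

text \<open>The kernel of \<open>uu\<close> taken modulo squares of units.\<close>

definition A3 :: "complex set" where "A3 = {a \<in> A2. uu a \<in> sqs U}"

lemma subgroup_A3: "subgroup A3 cmul"
proof (rule subgroup_cmulI)
  note S = subgroup_sqs[OF subgroup_U]
  show "0 \<notin> A3" using A2_nz by (auto simp: A3_def)
  show "1 \<in> A3" using QU_A2[of 1] subgroup.one_closed[OF subgroup_QU] by (simp add: A3_def)
  show "x * y \<in> A3" if "x \<in> A3" "y \<in> A3" for x y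
    using that uu_mult subgroup.m_closed[OF S] by (simp add: A3_def)
  show "inverse x \<in> A3" if "x \<in> A3" for x
    using that uu_inverse subgroup.m_inv_closed[OF S] inv_cmul U_nonzero[OF uu(1)] by (force simp: A3_def)
qed

lemma uu_image: "uu ` A2 = V"
proof
  show "uu ` A2 \<subseteq> V" unfolding V_def using uu A2_K A2_nz by blast
  show "V \<subseteq> uu ` A2"
  proof
    fix u assume "u \<in> V"
    then obtain a qq where a: "u \<in> U" "a \<in> KK" "a \<noteq> 0" "qq \<in> \<rat>" "Re qq > 0" "a * a * u = qq" by (auto simp: V_def)
    hence A: "a \<in> A2" by (auto simp: A2_def)
    have "uu a = u" by (rule uu(4)[OF A a(1)]) (use a in auto)
    thus "u \<in> uu ` A2" using A by blast
  qed
qed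

lemma idx_A2_A3: "idx cmul A2 A3 = idx cmul V (sqs U)"
proof -
  have "idx cmul A2 A3 = card ((\<lambda>a. sqs U #>\<^bsub>cmul\<^esub> uu a) ` A2)"
  proof (rule cmul.idx_cong[OF subgroup_A3])
    show "A2 \<subseteq> carrier cmul" using A2_nz by auto
    fix x y assume xy: "x \<in> A2" "y \<in> A2"
    have "sqs U #>\<^bsub>cmul\<^esub> uu x = sqs U #>\<^bsub>cmul\<^esub> uu y \<longleftrightarrow> uu x * inverse (uu y) \<in> sqs U"
      using cmul.rcos_eq_iff[OF subgroup_sqs[OF subgroup_U], of "uu x" "uu y"] U_nonzero[OF uu(1)] xy inv_cmul by simp
    also have "\<dots> \<longleftrightarrow> x * inverse y \<in> A3"
      using uu_mult[OF xy(1) uu_inverse(1)[OF xy(2)]] uu_inverse(2)[OF xy(2)] by (simp add: A3_def)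
    finally show "x \<otimes>\<^bsub>cmul\<^esub> inv\<^bsub>cmul\<^esub> y \<in> A3 \<longleftrightarrow> sqs U #>\<^bsub>cmul\<^esub> uu x = sqs U #>\<^bsub>cmul\<^esub> uu y"
      using A2_nz[OF xy(2)] inv_cmul by simp
  qed
  moreover have "idx cmul V (sqs U) = card ((\<lambda>a. sqs U #>\<^bsub>cmul\<^esub> uu a) ` A2)"
    by (simp only: idx_def uu_image[symmetric] image_image)
  ultimately show ?thesis by simp
qed

text \<open>Representatives of the four classes of \<open>A3\<close> modulo \<open>QU\<close>; the
  index 0 stands for the class of 1.\<close>

definition s' :: "nat \<Rightarrow> complex" where "s' i = (if i = 0 then 1 else s i)"

text \<open>Otherwise the unit would have a positive rational square, which is a unit and therefore
  1, and \<open>s i\<close> would be rational.\<close>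

lemma s_not_QU: "i \<in> {1, 2, 3} \<Longrightarrow> s i \<notin> QU"
proof
  assume i: "i \<in> {1, 2, 3}" and "s i \<in> QU"
  then obtain qq u where qu: "s i = qq * u" "qq \<in> \<rat>" "qq \<noteq> 0" "u \<in> U" by (auto simp: QU_def)
  have "u * u = (s i * s i) / (qq * qq)" using qu by simp
  moreover have "(s i * s i) / (qq * qq) \<in> \<rat>" using qu(2) by (simp add: s_square)
  ultimately have "u * u \<in> \<rat>" by (simp only:)
  moreover have "Re (u * u) > 0" using KK_Re_square U_K U_nonzero qu by blast
  moreover have "Re (- 1) < 0" by simp
  ultimately have "u * u = 1" using Rats_unit[of "u * u"] U_mult[OF qu(4) qu(4)] by (metis less_asym)
  hence "u = 1 \<or> u = - 1" by (simp add: square_eq_1_iff)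
  thus False using qu s_irrational[OF i] by auto
qed

text \<open>Each automorphism sends \<open>y\<close> to \<open>y\<close> or \<open>- y\<close>,
  which leaves at most one nonzero coordinate.\<close>

lemma square_Rats:
  assumes y: "y \<in> KK" "y * y \<in> \<rat>"
  obtains i p where "i \<in> {0, 1, 2, 3}" "p \<in> \<rat>" "y = p * s' i"
proof -
  have sgn: "\<sigma> j y = y \<or> \<sigma> j y = - y" if j: "j \<in> {1, 2, 3}" for j
  proof -
    have "\<sigma> j y * \<sigma> j y = y * y" using \<sigma>_mult[OF j y(1) y(1)] \<sigma>_Rats[OF j y(2)] by simp
    thus ?thesis by (simp add: square_eq_iff)
  qed
  obtain a b c f where R: "a \<in> \<rat>" "b \<in> \<rat>" "c \<in> \<rat>" "f \<in> \<rat>" "y = q a b c f" using y(1) by (rule KKE)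
  have 1: "(c = 0 \<and> f = 0) \<or> (a = 0 \<and> b = 0)"
  proof -
    have "q a b (- c) (- f) = q a b c f \<or> q a b (- c) (- f) = q (- a) (- b) (- c) (- f)"
      using sgn[of 1] \<sigma>_q[OF R(1-4), of 1] unfolding R(5) q_uminus by (simp add: sg_def)
    thus ?thesis using R by (auto simp: q_eq_iff)
  qed
  have 2: "(b = 0 \<and> f = 0) \<or> (a = 0 \<and> c = 0)"
  proof -
    have "q a (- b) c (- f) = q a b c f \<or> q a (- b) c (- f) = q (- a) (- b) (- c) (- f)"
      using sgn[of 2] \<sigma>_q[OF R(1-4), of 2] unfolding R(5) q_uminus by (simp add: sg_def)
    thus ?thesis using R by (auto simp: q_eq_iff)
  qed
  from 1 2 consider "b = 0" "c = 0" "f = 0" | "a = 0" "c = 0" "f = 0" | "a = 0" "b = 0" "f = 0" | "a = 0" "b = 0" "c = 0" by blast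
  thus ?thesis
  proof cases
    case 1 thus ?thesis using that[of 0 a] R by (simp add: s'_def q_def)
  next
    case 2 thus ?thesis using that[of 1 b] R by (simp add: s'_def q_def)
  next
    case 3 thus ?thesis using that[of 2 c] R by (simp add: s'_def q_def)
  next
    case 4 thus ?thesis using that[of 3 f] R by (simp add: s'_def q_def)
  qed
qed

lemma s'_ratio_not_QU:
  assumes "i \<in> {0, 1, 2, 3}" "j \<in> {0, 1, 2, 3}" "i \<noteq> j"
  shows "s' i * inverse (s' j) \<notin> QU"
proof
  assume Q: "s' i * inverse (s' j) \<in> QU"
  have s'0: "s' i \<noteq> 0" "s' j \<noteq> 0" using s_nonzero[of i] s_nonzero[of j] assms by (auto simp: s'_def)
  have jj: "s' j * s' j \<in> \<rat>" by (simp add: s'_def s_square)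
  have Qq: "x * y \<in> QU" if "x \<in> \<rat>" "x \<noteq> 0" "y \<in> QU" for x y
  proof -
    have "x \<in> QU" unfolding QU_def using that by (intro CollectI exI[of _ x] exI[of _ 1]) auto
    from subgroup.m_closed[OF subgroup_QU this that(3)] show ?thesis by simp
  qed
  have "(s' j * s' j) * (s' i * inverse (s' j)) = s' i * s' j" using s'0 by (simp add: field_simps)
  moreover have "(s' j * s' j) * (s' i * inverse (s' j)) \<in> QU" by (rule Qq[OF jj _ Q]) (use s'0 in simp)
  ultimately have ij: "s' i * s' j \<in> QU" by (simp only:)
  have "\<exists>l\<in>{1, 2, 3}. \<exists>p\<in>\<rat>. p \<noteq> 0 \<and> s' i * s' j = p * s l"
  proof -
    have rr: "r 1 \<in> \<rat>" "r 2 \<in> \<rat>" "r 3 \<in> \<rat>" "r 1 \<noteq> 0" "r 2 \<noteq> 0" "r 3 \<noteq> 0"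
      using r_Rats[of 1] r_Rats[of 2] r_Rats[of 3] r_nonzero[of 1] r_nonzero[of 2] r_nonzero[of 3] by auto
    have m: "s 2 * s 3 = r 1 * s 1" "s 1 * s 3 = r 2 * s 2" "s 1 * s 2 = r 3 * s 3"
      "s 3 * s 2 = r 1 * s 1" "s 3 * s 1 = r 2 * s 2" "s 2 * s 1 = r 3 * s 3"
      using s_mult by (simp_all add: mult.commute)
    consider "i = 0" "j \<in> {1, 2, 3}" | "j = 0" "i \<in> {1, 2, 3}" | "{i, j} = {1, 2}" | "{i, j} = {1, 3}" | "{i, j} = {2, 3}"
      using assms by auto
    thus ?thesis
    proof cases
      case 1
      hence "s' i * s' j = 1 * s j" by (auto simp: s'_def)
      thus ?thesis using 1 by (intro bexI[of _ j] bexI[of _ 1]) auto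
    next
      case 2
      hence "s' i * s' j = 1 * s i" by (auto simp: s'_def)
      thus ?thesis using 2 by (intro bexI[of _ i] bexI[of _ 1]) auto
    next
      case 3
      hence "s' i * s' j = r 3 * s 3" using m by (auto simp: s'_def doubleton_eq_iff)
      thus ?thesis using rr by (intro bexI[of _ 3] bexI[of _ "r 3"]) auto
    next
      case 4
      hence "s' i * s' j = r 2 * s 2" using m by (auto simp: s'_def doubleton_eq_iff)
      thus ?thesis using rr by (intro bexI[of _ 2] bexI[of _ "r 2"]) auto
    next
      case 5
      hence "s' i * s' j = r 1 * s 1" using m by (auto simp: s'_def doubleton_eq_iff)
      thus ?thesis using rr by (intro bexI[of _ 1] bexI[of _ "r 1"]) auto
    qed
  qed
  then obtain l p where lp: "l \<in> {1, 2, 3}" "p \<in> \<rat>" "p \<noteq> 0" "s' i * s' j = p * s l" by blast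
  have "inverse p * (s' i * s' j) \<in> QU" by (rule Qq[OF _ _ ij]) (use lp in auto)
  moreover have "inverse p * (s' i * s' j) = s l" using lp by simp
  ultimately show False using s_not_QU[OF lp(1)] by simp
qed

lemma QU_A3: "QU \<subseteq> A3" using QU_A2 by (auto simp: A3_def)
lemma A3_A2: "A3 \<subseteq> A2" by (auto simp: A3_def)

text \<open>If \<open>uu a = w * w\<close>, then \<open>a * w\<close> has a rational square and is a
  rational multiple of some \<open>s' i\<close>, so \<open>a\<close> lies in the class of
  \<open>s' i\<close>. These four classes are distinct.\<close>

lemma idx_A3_QU: "idx cmul A3 QU = 4"
proof -
  let ?c = "\<lambda>a. QU #>\<^bsub>cmul\<^esub> a"
  have s'nz: "s' i \<noteq> 0" if "i \<in> {0, 1, 2, 3}" for i using s_nonzero[of i] that by (auto simp: s'_def)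
  have s'K: "s' i \<in> KK" if "i \<in> {0, 1, 2, 3}" for i using s_KK[of i] that K_one by (auto simp: s'_def)
  have eq: "?c a = ?c b \<longleftrightarrow> a * inverse b \<in> QU" if "a \<noteq> 0" "b \<noteq> 0" for a b
    using cmul.rcos_eq_iff[OF subgroup_QU, of a b] that inv_cmul by simp
  have "?c ` A3 = ?c ` s' ` {0, 1, 2, 3}"
  proof
    show "?c ` s' ` {0, 1, 2, 3} \<subseteq> ?c ` A3"
    proof -
      have "s' i \<in> A3" if i: "i \<in> {0, 1, 2, 3}" for i
      proof -
        have R: "s' i * s' i * 1 \<in> \<rat>" "Re (s' i * s' i * 1) > 0"
          using KK_Re_square[OF s'K[OF i] s'nz[OF i]] by (auto simp: s'_def s_square)
        have A: "s' i \<in> A2" by (rule A2I[OF s'K[OF i] s'nz[OF i] U_one R])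
        have "uu (s' i) = 1" by (rule uu(4)[OF A U_one R])
        moreover have "1 \<in> sqs U" using subgroup.one_closed[OF subgroup_sqs[OF subgroup_U]] by simp
        ultimately show ?thesis using A by (simp add: A3_def)
      qed
      thus ?thesis by blast
    qed
    show "?c ` A3 \<subseteq> ?c ` s' ` {0, 1, 2, 3}"
    proof
      fix z assume "z \<in> ?c ` A3"
      then obtain a where a: "a \<in> A2" "uu a \<in> sqs U" "z = ?c a" by (auto simp: A3_def)
      then obtain w where w: "w \<in> U" "uu a = w * w" by (auto simp: sqs_def)
      have "(a * w) * (a * w) \<in> \<rat>" using uu(2)[OF a(1)] w(2) by (simp add: mult_ac)
      moreover have "a * w \<in> KK" using A2_K[OF a(1)] U_K[OF w(1)] K_mult by blast
      ultimately obtain i p where ip: "i \<in> {0, 1, 2, 3}" "p \<in> \<rat>" "a * w = p * s' i" using square_Rats by blast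
      have nz: "a \<noteq> 0" "w \<noteq> 0" using A2_nz a U_nonzero w by auto
      hence "p \<noteq> 0" using ip by auto
      have "a = p * inverse w * s' i" using ip(3) nz by (simp add: field_simps)
      hence "a * inverse (s' i) = p * inverse w" using s'nz[OF ip(1)] by simp
      moreover have "p * inverse w \<in> QU" unfolding QU_def using ip \<open>p \<noteq> 0\<close> U_inverse[OF w(1)] by blast
      ultimately have "?c a = ?c (s' i)" using eq[OF nz(1) s'nz[OF ip(1)]] by simp
      thus "z \<in> ?c ` s' ` {0, 1, 2, 3}" using a(3) ip(1) by blast
    qed
  qed
  moreover have "inj_on (\<lambda>i. ?c (s' i)) {0, 1, 2, 3}"
  proof (rule inj_onI, rule ccontr)
    fix i j :: nat assume ij: "i \<in> {0, 1, 2, 3}" "j \<in> {0, 1, 2, 3}" "?c (s' i) = ?c (s' j)" "i \<noteq> j"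
    show False using s'_ratio_not_QU[OF ij(1,2,4)] eq[OF s'nz[OF ij(1)] s'nz[OF ij(2)]] ij(3) by simp
  qed
  hence "card ((\<lambda>i. ?c (s' i)) ` {0, 1, 2, 3}) = 4" by (simp add: card_image)
  ultimately show ?thesis by (simp add: idx_def image_image)
qed

text \<open>The square of \<open>t a / a\<close> is the unit \<open>uu a / t (uu a)\<close>, and an
  element of the field whose square is a unit is a unit.\<close>

lemma A2_A0: "A2 \<subseteq> A0"
proof
  fix a assume a: "a \<in> A2"
  note h = uu[OF a]
  have aK: "a \<in> KK" "a \<noteq> 0" using A2_K A2_nz a by auto
  have "t a / a \<in> U" if t: "t \<in> GG" for t
  proof -
    have "t a * t a * t (uu a) = a * a * uu a"
      using G_Rats[OF t h(2)] aK(1) U_K[OF h(1)] by (simp add: G_mult[OF t] K_mult)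
    hence eq: "(t a / a) ^ 2 = uu a / t (uu a)"
      using aK U_nonzero[OF U_G[OF t h(1)]] by (simp add: field_simps power2_eq_square)
    have inU: "uu a / t (uu a) \<in> U" using U_divide h(1) U_G[OF t h(1)] by blast
    have K: "t a / a \<in> KK" using K_divide G_closed[OF t aK(1)] aK by blast
    have root: "algebraic_int x" if "algebraic_int (x ^ 2)" for x :: complex
      by (rule algebraic_int_of_monic_relation[of 2 x "\<lambda>i. if i = 0 then x ^ 2 else 0"]) (use that in \<open>auto simp: numeral_2_eq_2\<close>)
    have "t a / a \<in> \<O>" using root[of "t a / a"] inU K U_O by (auto simp: eq \<O>_def)
    moreover have "inverse (t a / a) \<in> \<O>"
    proof -
      have "inverse (t a / a) ^ 2 = inverse ((t a / a) ^ 2)" by (rule power_inverse)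
      hence "inverse (t a / a) ^ 2 = inverse (uu a / t (uu a))" unfolding eq .
      hence "algebraic_int (inverse (t a / a) ^ 2)" using U_O[OF U_inverse[OF inU]] by (simp add: \<O>_def)
      thus ?thesis using root K_inverse[OF K] by (simp add: \<O>_def)
    qed
    moreover have "t a / a \<noteq> 0" using aK G_eq_0_iff[OF t] by simp
    ultimately show ?thesis by (simp add: U_def)
  qed
  thus "a \<in> A0" using aK by (simp add: A0_def)
qed

lemma A2_iff: "a \<in> A0 \<Longrightarrow> a \<in> A2 \<longleftrightarrow> a * a \<in> QU"
proof
  assume a: "a \<in> A0"
  have aK: "a \<in> KK" "a \<noteq> 0" using A0_K A0_nonzero a by auto
  show "a * a \<in> QU" if "a \<in> A2"
  proof -
    note h = uu[OF that]
    have "a * a = (a * a * uu a) * inverse (uu a)" using U_nonzero[OF h(1)] by simp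
    moreover have "a * a * uu a \<noteq> 0" using h(3) by auto
    ultimately show ?thesis unfolding QU_def using h(2) U_inverse[OF h(1)] by blast
  qed
  show "a \<in> A2" if "a * a \<in> QU"
  proof -
    obtain qq u where qu: "a * a = qq * u" "qq \<in> \<rat>" "qq \<noteq> 0" "u \<in> U" using \<open>a * a \<in> QU\<close> by (auto simp: QU_def)
    have "Re qq \<noteq> 0" using KK_Re_eq_0[OF K_Rats[OF qu(2)]] qu(3) by simp
    hence "Re qq > 0 \<or> Re (- qq) > 0" by auto
    thus ?thesis
    proof
      assume "Re qq > 0"
      moreover have "a * a * inverse u = qq" using qu U_nonzero by simp
      ultimately show ?thesis using A2I[OF aK U_inverse[OF qu(4)]] qu(2) by simp
    next
      assume "Re (- qq) > 0"
      moreover have "a * a * - inverse u = - qq" using qu U_nonzero by simp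
      ultimately show ?thesis using A2I[OF aK U_uminus[OF U_inverse[OF qu(4)]]] qu(2) by simp
    qed
  qed
qed

text \<open>\<open>[A2 : QU]\<close> is \<open>4 * [V : U\<^sup>2]\<close> through
  \<open>A3\<close>, and \<open>[V : W\<^sup>2]\<close> is \<open>[V : U\<^sup>2] * [U : W]\<close>
  by the tower and \<open>idx_sqs\<close>. Eliminating \<open>[V : U\<^sup>2]\<close> leaves the
  formula.\<close>

lemma index_formula:
  "idx cmul A2 QU * idx cmul U W = 4 * idx cmul V (sqs W)"
proof -
  have "idx cmul A2 QU = idx cmul V (sqs U) * 4"
    using cmul.idx_tower[OF subgroup_QU subgroup_A3 subgroup_A2 QU_A3 A3_A2] idx_A2_A3 idx_A3_QU by simp
  moreover have "idx cmul V (sqs W) = idx cmul V (sqs U) * idx cmul U W"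
    using cmul.idx_tower[OF subgroup_sqs[OF subgroup_W] subgroup_sqs[OF subgroup_U] subgroup_V sqs_W_U sqs_U_V] idx_sqs by simp
  ultimately show ?thesis by simp
qed

end

section \<open>Hilbert's theorem 90 and the exponents of units in \<open>V\<close>\<close>

text \<open>An automorphism that fixes \<open>x\<close> and sends \<open>y\<close> and
  \<open>z\<close> to \<open>n / y\<close> and \<open>n / z\<close> multiplies the resolvent by
  \<open>y * z / n\<close> and leaves \<open>a * a * (x * y * z)\<close> unchanged. The three
  automorphisms are the three choices of the distinguished variable.\<close>

lemma resolvent_factor:
  fixes n x y z a :: complex
  assumes nz: "x \<noteq> 0" "y \<noteq> 0" "z \<noteq> 0" "n \<noteq> 0"
  shows "1 + n / ((n / y) * (n / z)) + n / (x * (n / z)) + n / (x * (n / y)) =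
      (1 + n / (y * z) + n / (x * z) + n / (x * y)) * (y * z / n)"
    and "(a * (y * z / n)) * (a * (y * z / n)) * (x * (n / y) * (n / z)) = a * a * (x * y * z)"
proof -
  have "n / ((n / y) * (n / z)) = y * z / n" "n / (x * (n / z)) = z / x" "n / (x * (n / y)) = y / x"
    using nz by simp_all
  moreover have "n / (y * z) * (y * z / n) = 1" "n / (x * z) * (y * z / n) = y / x" "n / (x * y) * (y * z / n) = z / x"
    using nz by simp_all
  ultimately show "1 + n / ((n / y) * (n / z)) + n / (x * (n / z)) + n / (x * (n / y)) =
      (1 + n / (y * z) + n / (x * z) + n / (x * y)) * (y * z / n)"
    by (simp only: distrib_right) simp
  show "(a * (y * z / n)) * (a * (y * z / n)) * (x * (n / y) * (n / z)) = a * a * (x * y * z)"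
    using nz by simp
qed

context biquad
begin

lemma conj_other:
  assumes "i \<in> {1, 2, 3}" "j \<in> {1, 2, 3}" "j \<noteq> i" "x \<in> kk i"
  shows "x * \<sigma> j x = nm i x"
  unfolding nm_def using conj_kk_eq[OF assms] by simp

text \<open>Explicit form of Hilbert's theorem 90 for the cocycle \<open>\<sigma> 1 \<mapsto> n / (x 2 * x 3)\<close>, \<dots>:
  its Lagrange resolvent splits it, and some choice of the signs of the \<open>x i\<close> makes the resolvent nonzero.\<close>

lemma resolvent:
  assumes y: "y1 \<in> kk 1" "y2 \<in> kk 2" "y3 \<in> kk 3" and n: "n \<in> \<rat>" "n \<noteq> 0"
    and nm: "nm 1 y1 = n" "nm 2 y2 = n" "nm 3 y3 = n"
    and a: "a = 1 + n / (y2 * y3) + n / (y1 * y3) + n / (y1 * y2)"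
  shows "a \<in> KK" "\<sigma> 1 a = a * (y2 * y3 / n)" "\<sigma> 2 a = a * (y1 * y3 / n)" "\<sigma> 3 a = a * (y1 * y2 / n)"
    "a * a * (y1 * y2 * y3) \<in> \<rat>"
proof -
  have K: "y1 \<in> KK" "y2 \<in> KK" "y3 \<in> KK" "n \<in> KK" using kk_KK y K_Rats[OF n(1)] by blast+
  have nz: "y1 \<noteq> 0" "y2 \<noteq> 0" "y3 \<noteq> 0" using nm n(2) unfolding nm_def by auto
  have c: "\<sigma> 1 y1 = y1" "\<sigma> 2 y2 = y2" "\<sigma> 3 y3 = y3" using kk_fixed y by blast+
  have c1: "\<sigma> 2 y1 = n / y1" "\<sigma> 3 y1 = n / y1"
    using conj_other[of 1 2 y1] conj_other[of 1 3 y1] y nm nz by (auto simp: field_simps)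
  have c2: "\<sigma> 1 y2 = n / y2" "\<sigma> 3 y2 = n / y2"
    using conj_other[of 2 1 y2] conj_other[of 2 3 y2] y nm nz by (auto simp: field_simps)
  have c3: "\<sigma> 1 y3 = n / y3" "\<sigma> 2 y3 = n / y3"
    using conj_other[of 3 1 y3] conj_other[of 3 2 y3] y nm nz by (auto simp: field_simps)
  have sn: "\<sigma> i n = n" if "i \<in> {1, 2, 3}" for i using \<sigma>_Rats[OF that n(1)] .
  show aK: "a \<in> KK" unfolding a by (intro K_add K_divide K_mult K K_one)
  have s: "\<sigma> i a = 1 + n / (\<sigma> i y2 * \<sigma> i y3) + n / (\<sigma> i y1 * \<sigma> i y3) + n / (\<sigma> i y1 * \<sigma> i y2)" if i: "i \<in> {1, 2, 3}" for i
  proof -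
    note h = G_add[OF \<sigma>_GG'[OF i]] G_divide[OF \<sigma>_GG'[OF i]] G_mult[OF \<sigma>_GG'[OF i]] G_one[OF \<sigma>_GG'[OF i]]
    show ?thesis unfolding a by (simp only: h K K_one K_add K_mult K_divide sn[OF i])
  qed
  note f1 = resolvent_factor[OF nz n(2)]
    and f2 = resolvent_factor[OF nz(2,1,3) n(2)]
    and f3 = resolvent_factor[OF nz(3,1,2) n(2)]
  have a': "a = 1 + n / (y1 * y3) + n / (y2 * y3) + n / (y2 * y1)" "a = 1 + n / (y1 * y2) + n / (y3 * y2) + n / (y3 * y1)"
    unfolding a by (simp_all only: add_ac mult_ac)
  have s1: "\<sigma> 1 a = 1 + n / ((n / y2) * (n / y3)) + n / (y1 * (n / y3)) + n / (y1 * (n / y2))"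
    using s[of 1] unfolding c c2 c3 by blast
  show 1: "\<sigma> 1 a = a * (y2 * y3 / n)" unfolding s1 f1(1) a[symmetric] ..
  have "\<sigma> 2 a = 1 + n / (y2 * (n / y3)) + n / ((n / y1) * (n / y3)) + n / ((n / y1) * y2)"
    using s[of 2] unfolding c c1 c3 by blast
  hence s2: "\<sigma> 2 a = 1 + n / ((n / y1) * (n / y3)) + n / (y2 * (n / y3)) + n / (y2 * (n / y1))"
    by (simp only: add_ac mult_ac)
  show 2: "\<sigma> 2 a = a * (y1 * y3 / n)" unfolding s2 f2(1) a'(1)[symmetric] ..
  have "\<sigma> 3 a = 1 + n / ((n / y2) * y3) + n / ((n / y1) * y3) + n / ((n / y1) * (n / y2))"
    using s[of 3] unfolding c c1 c2 by blast
  hence s3: "\<sigma> 3 a = 1 + n / ((n / y1) * (n / y2)) + n / (y3 * (n / y2)) + n / (y3 * (n / y1))"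
    by (simp only: add_ac mult_ac)
  show 3: "\<sigma> 3 a = a * (y1 * y2 / n)" unfolding s3 f3(1) a'(2)[symmetric] ..
  define z where "z = a * a * (y1 * y2 * y3)"
  have sz: "\<sigma> i z = \<sigma> i a * \<sigma> i a * (\<sigma> i y1 * \<sigma> i y2 * \<sigma> i y3)" if i: "i \<in> {1, 2, 3}" for i
    unfolding z_def using aK K by (simp only: G_mult[OF \<sigma>_GG'[OF i]] K_mult)
  have z1: "\<sigma> 1 z = z"
    using sz[of 1] f1(2)[of a] unfolding 1 c c2 c3 z_def by simp
  have "\<sigma> 2 z = (a * (y1 * y3 / n)) * (a * (y1 * y3 / n)) * (y2 * (n / y1) * (n / y3))"
    using sz[of 2] unfolding 2 c c1 c3 by (simp only: mult_ac insert_iff simp_thms)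
  hence z2: "\<sigma> 2 z = z" unfolding f2(2) z_def by (simp only: mult_ac)
  have "\<sigma> 3 z = (a * (y1 * y2 / n)) * (a * (y1 * y2 / n)) * (y3 * (n / y1) * (n / y2))"
    using sz[of 3] unfolding 3 c c1 c2 by (simp only: mult_ac insert_iff simp_thms)
  hence z3: "\<sigma> 3 z = z" unfolding f3(2) z_def by (simp only: mult_ac)
  have "t z = z" if "t \<in> GG" for t using that z1 z2 z3 unfolding G3 by auto
  moreover have "z \<in> KK" unfolding z_def using aK K by (intro K_mult)
  ultimately show "a * a * (y1 * y2 * y3) \<in> \<rat>" using fixed_Rats z_def by blast
qed

lemma nm_uminus: "i \<in> {1, 2, 3} \<Longrightarrow> x \<in> kk i \<Longrightarrow> nm i (- x) = nm i x"
  using G_uminus[OF \<sigma>_GG'[OF nx(1)]] kk_KK by (simp add: nm_def)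

lemma hilbert_90:
  assumes x: "x1 \<in> kk 1" "x2 \<in> kk 2" "x3 \<in> kk 3" and n: "n \<in> \<rat>" "n \<noteq> 0"
    and nm: "nm 1 x1 = n" "nm 2 x2 = n" "nm 3 x3 = n"
  obtains a y1 y2 y3 where "a \<in> KK" "a \<noteq> 0" "y1 \<in> {x1, - x1}" "y2 \<in> {x2, - x2}" "y3 \<in> {x3, - x3}"
    "\<sigma> 1 a = a * (y2 * y3 / n)" "\<sigma> 2 a = a * (y1 * y3 / n)" "\<sigma> 3 a = a * (y1 * y2 / n)"
    "a * a * (x1 * x2 * x3) \<in> \<rat>"
proof -
  define f where "f y1 y2 y3 = 1 + n / (y2 * y3) + n / (y1 * y3) + n / (y1 * y2)" for y1 y2 y3
  \<comment> \<open>All terms but the constant ones cancel in this sum of four resolvents, so one of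
    the four is nonzero.\<close>
  have "f x1 x2 x3 + f (- x1) x2 x3 + f x1 (- x2) x3 + f x1 x2 (- x3) = 4"
    unfolding f_def by simp
  hence "\<exists>y1\<in>{x1, - x1}. \<exists>y2\<in>{x2, - x2}. \<exists>y3\<in>{x3, - x3}. f y1 y2 y3 \<noteq> 0" by fastforce
  then obtain y1 y2 y3 where y: "y1 \<in> {x1, - x1}" "y2 \<in> {x2, - x2}" "y3 \<in> {x3, - x3}" "f y1 y2 y3 \<noteq> 0" by blast
  have yk: "y1 \<in> kk 1" "y2 \<in> kk 2" "y3 \<in> kk 3"
    using y x kk_closed(3)[of 1 x1] kk_closed(3)[of 2 x2] kk_closed(3)[of 3 x3] by auto
  have yn: "nm 1 y1 = n" "nm 2 y2 = n" "nm 3 y3 = n"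
    using y x nm nm_uminus[of 1 x1] nm_uminus[of 2 x2] nm_uminus[of 3 x3] by auto
  note h = resolvent[OF yk n yn f_def]
  have "a * a * (x1 * x2 * x3) \<in> \<rat>" if "a * a * (y1 * y2 * y3) \<in> \<rat>" for a
  proof -
    have "a * a * (x1 * x2 * x3) = a * a * (y1 * y2 * y3) \<or> a * a * (x1 * x2 * x3) = - (a * a * (y1 * y2 * y3))"
      using y by auto
    thus ?thesis using that by auto
  qed
  thus ?thesis using that[OF h(1) y(4) y(1-3) h(2-4)] h(5) by blast
qed

text \<open>Integral closure, applied to \<open>x\<close> and to \<open>inverse x\<close>.\<close>

lemma root_U:
  assumes "x \<in> KK" "x * x \<in> U"
  shows "x \<in> U"
proof -
  have root: "algebraic_int x" if "algebraic_int (x * x)" for x :: complex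
    by (rule algebraic_int_of_monic_relation[of 2 x "\<lambda>i. if i = 0 then x * x else 0"])
       (use that in \<open>auto simp: numeral_2_eq_2\<close>)
  have "x \<in> \<O>" using root[of x] assms U_O by (auto simp: \<O>_def)
  moreover have "inverse x * inverse x \<in> \<O>" using U_O[OF U_inverse[OF assms(2)]] by simp
  hence "inverse x \<in> \<O>" using root[of "inverse x"] K_inverse[OF assms(1)] by (auto simp: \<O>_def)
  moreover have "x \<noteq> 0" using U_nonzero[OF assms(2)] by auto
  ultimately show ?thesis by (simp add: U_def)
qed

lemma V_U: "u \<in> V \<Longrightarrow> u \<in> U" by (simp add: V_def)

lemma V_positive:
  assumes "u \<in> V" "t \<in> GG"
  shows "Re (t u) > 0"
proof -
  obtain a p where a: "a \<in> KK" "a \<noteq> 0" "p \<in> \<rat>" "Re p > 0" "a * a * u = p" using assms(1) by (auto simp: V_def)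
  have uK: "u \<in> KK" using V_U[OF assms(1)] U_K by blast
  have tK: "t a \<in> KK" "t u \<in> KK" using G_closed[OF assms(2)] a uK by auto
  have "t a * t a * t u = p"
    using G_Rats[OF assms(2) a(3)] unfolding a(5)[symmetric] using a(1) uK by (simp only: G_mult[OF assms(2)] K_mult)
  hence "Re (t a * t a) * Re (t u) > 0" using a(4) KK_Re_mult[OF K_mult[OF tK(1) tK(1)] tK(2)] by simp
  moreover have "Re (t a * t a) > 0" using KK_Re_square[OF tK(1)] G_eq_0_iff[OF assms(2)] a(2) by blast
  ultimately show ?thesis by (metis zero_less_mult_pos)
qed

text \<open>With \<open>a * a * u = p\<close>, the element
  \<open>w i = p / (a * \<sigma> i a)\<close> is fixed by \<open>\<sigma> i\<close> and has square
  \<open>u * \<sigma> i u\<close>, so it is a unit of the \<open>i\<close>-th subfield. Comparing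
  squares expresses \<open>u\<close>, up to sign, by \<open>w 1\<close>, \<open>w 2\<close> and a
  conjugate of \<open>w 3\<close>.\<close>

lemma V_W: "V \<subseteq> W"
proof
  fix u assume u: "u \<in> V"
  obtain a p where a: "a \<in> KK" "a \<noteq> 0" "p \<in> \<rat>" "Re p > 0" "a * a * u = p" using u by (auto simp: V_def)
  have uU: "u \<in> U" using V_U[OF u] .
  have uK: "u \<in> KK" "u \<noteq> 0" using uU U_K U_nonzero by auto
  have p0: "p \<noteq> 0" using a(4) by auto
  define w where "w i = p / (a * \<sigma> i a)" for i
  have w: "w i \<in> Ui i \<and> w i * w i = u * \<sigma> i u" if i: "i \<in> {1, 2, 3}" for i
  proof -
    have sa: "\<sigma> i a \<in> KK" "\<sigma> i a \<noteq> 0" using \<sigma>_K[OF i a(1)] \<sigma>_nz[OF i a(2)] by auto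
    have "\<sigma> i a * \<sigma> i a * \<sigma> i u = p"
      using \<sigma>_Rats[OF i a(3)] unfolding a(5)[symmetric] using a(1) uK by (simp only: \<sigma>_mult[OF i] K_mult)
    hence u': "u = p / (a * a)" "\<sigma> i u = p / (\<sigma> i a * \<sigma> i a)" using a sa by (auto simp: field_simps)
    have sq: "w i * w i = u * \<sigma> i u"
    proof -
      have "w i * w i = p / (a * a) * (p / (\<sigma> i a * \<sigma> i a))" unfolding w_def by simp
      thus ?thesis by (simp only: u'[symmetric])
    qed
    have wK: "w i \<in> KK" unfolding w_def by (intro K_divide K_mult K_Rats a sa)
    have "\<sigma> i (w i) = p / (\<sigma> i a * a)"
      unfolding w_def using K_Rats[OF a(3)] a(1) sa \<sigma>_Rats[OF i a(3)] \<sigma>_\<sigma>(1)[OF i, of a]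
      by (simp only: \<sigma>_divide[OF i] \<sigma>_mult[OF i] K_mult)
    hence "\<sigma> i (w i) = w i" by (simp add: w_def mult.commute)
    moreover have "w i \<in> U" by (rule root_U[OF wK]) (use sq U_mult[OF uU \<sigma>_U[OF i uU]] in simp)
    ultimately show ?thesis using sq by (simp add: Ui_def)
  qed
  \<comment> \<open>The conjugate of \<open>w 3\<close> has square
    \<open>\<sigma> 1 u * \<sigma> 2 u\<close>, which is what remains of the square of
    \<open>w 1 * w 2\<close> after removing \<open>u * u\<close>.\<close>
  define w' where "w' = \<sigma> 1 (w 3)"
  have w3: "w 3 \<in> Ui 3" "w 3 * w 3 = u * \<sigma> 3 u" using w[of 3] by auto
  have w'U: "w' \<in> U" unfolding w'_def using \<sigma>_U[of 1] Ui_U[OF w3(1)] by simp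
  have "w' \<in> kk 3" using kk_trace_norm(3)[of 3 "w 3"] Ui_kk[OF w3(1)] by (simp add: w'_def nx_def)
  hence w'3: "w' \<in> Ui 3" using UiI w'U by blast
  have su: "\<sigma> i u \<in> KK" "\<sigma> i u \<noteq> 0" if "i \<in> {1, 2, 3}" for i using \<sigma>_K[OF that uK(1)] \<sigma>_nz[OF that uK(2)] by auto
  have "w' * w' = \<sigma> 1 u * \<sigma> 1 (\<sigma> 3 u)"
    unfolding w'_def using \<sigma>_mult[of 1 "w 3" "w 3"] \<sigma>_mult[of 1 u "\<sigma> 3 u"] w3 Ui_KK[OF w3(1)] uK su(1)[of 3] by simp
  hence w'sq: "w' * w' = \<sigma> 1 u * \<sigma> 2 u" using \<sigma>_\<sigma>(2)[of 1 3 2 u] by (simp add: insert_commute)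
  have w'0: "w' \<noteq> 0" using U_nonzero[OF w'U] .
  have w12: "w 1 * w 1 = u * \<sigma> 1 u" "w 2 * w 2 = u * \<sigma> 2 u" using w[of 1] w[of 2] by auto
  have "(u * w') * (u * w') = u * u * (w' * w')" by (simp only: mult_ac)
  also have "\<dots> = (w 1 * w 1) * (w 2 * w 2)" unfolding w'sq w12 by (simp only: mult_ac)
  also have "\<dots> = (w 1 * w 2) * (w 1 * w 2)" by (simp only: mult_ac)
  finally have "u * w' = w 1 * w 2 \<or> u * w' = - (w 1 * w 2)" by (simp only: square_eq_iff)
  hence "u = w 1 * w 2 * inverse w' \<or> u = - (w 1 * w 2 * inverse w')" using w'0 by (auto simp: field_simps)
  moreover have "w 1 * w 2 * inverse w' \<in> W" by (rule WI) (use w[of 1] w[of 2] Ui_closed(3)[OF _ w'3] in auto)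
  ultimately show "u \<in> W" using W_uminus by auto
qed

lemma eps_props:
  assumes i: "i \<in> {1, 2, 3}"
  shows "eps i \<in> Ui i" "Re (eps i) > 1" "w \<in> Ui i \<Longrightarrow> \<exists>n :: int. w = eps i powi n \<or> w = - (eps i powi n)"
  using eps[OF i] unfolding is_fund_def by auto

lemma eps_nz: "i \<in> {1, 2, 3} \<Longrightarrow> eps i \<noteq> 0" using eps_props(2)[of i] by auto

definition mono :: "int \<Rightarrow> int \<Rightarrow> int \<Rightarrow> complex" where
  "mono a b c = eps 1 powi a * eps 2 powi b * eps 3 powi c"

lemma powi_Ui: "i \<in> {1, 2, 3} \<Longrightarrow> eps i powi n \<in> Ui i" using Ui_powi eps_props(1) by blast

lemma mono_W: "mono a b c \<in> W" unfolding mono_def by (intro WI powi_Ui) auto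

lemma mono_mult: "mono a b c * mono a' b' c' = mono (a + a') (b + b') (c + c')"
  unfolding mono_def using eps_nz[of 1] eps_nz[of 2] eps_nz[of 3] by (simp add: power_int_add mult_ac)

lemma mono_inverse: "inverse (mono a b c) = mono (- a) (- b) (- c)"
  unfolding mono_def by (simp add: power_int_minus)

lemma Re_eps_powi: "i \<in> {1, 2, 3} \<Longrightarrow> eps i powi n = of_real (Re (eps i) powi n)"
  using KK_re[OF Ui_KK[OF eps_props(1)], of i] by (metis of_real_power_int)

lemma mono_Re_pos: "Re (mono a b c) > 0"
proof -
  have "mono a b c = of_real (Re (eps 1) powi a * Re (eps 2) powi b * Re (eps 3) powi c)"
    unfolding mono_def using Re_eps_powi[of 1 a] Re_eps_powi[of 2 b] Re_eps_powi[of 3 c] by simp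
  hence "Re (mono a b c) = Re (eps 1) powi a * Re (eps 2) powi b * Re (eps 3) powi c"
    by (simp only: Re_complex_of_real)
  moreover have "Re (eps i) powi k > 0" if "i \<in> {1, 2, 3}" for i k using eps_props(2)[OF that] by simp
  ultimately show ?thesis by simp
qed

lemma W_mono:
  assumes "u \<in> W"
  obtains a b c where "u = mono a b c \<or> u = - mono a b c"
proof -
  obtain u1 u2 u3 where u: "u1 \<in> Ui 1" "u2 \<in> Ui 2" "u3 \<in> Ui 3" "u = u1 * u2 * u3" using assms by (rule WE)
  obtain a where "u1 = eps 1 powi a \<or> u1 = - (eps 1 powi a)" using eps_props(3)[of 1 u1] u by auto
  moreover obtain b where "u2 = eps 2 powi b \<or> u2 = - (eps 2 powi b)" using eps_props(3)[of 2 u2] u by auto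
  moreover obtain c where "u3 = eps 3 powi c \<or> u3 = - (eps 3 powi c)" using eps_props(3)[of 3 u3] u by auto
  ultimately show ?thesis using that[of a b c] u(4) unfolding mono_def by auto
qed

lemma W_mono_pos:
  assumes "u \<in> W" "Re u > 0"
  obtains a b c where "u = mono a b c"
proof -
  obtain a b c where m: "u = mono a b c \<or> u = - mono a b c" using W_mono[OF assms(1)] .
  moreover have "u \<noteq> - mono a b c"
  proof
    assume "u = - mono a b c"
    hence "Re u = - Re (mono a b c)" by simp
    thus False using assms(2) mono_Re_pos[of a b c] by linarith
  qed
  ultimately show ?thesis using that by blast
qed

definition n' :: "nat \<Rightarrow> complex" where "n' i = nm i (eps i)"

lemma n'_cases: "i \<in> {1, 2, 3} \<Longrightarrow> n' i = 1 \<or> n' i = - 1"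
  unfolding n'_def by (rule nm_unit[OF _ eps_props(1)])

lemma \<sigma>_powi: "i \<in> {1, 2, 3} \<Longrightarrow> x \<in> KK \<Longrightarrow> \<sigma> i (x powi n) = \<sigma> i x powi n"
  using G_power[OF \<sigma>_GG'] G_inverse[OF \<sigma>_GG'] K_inverse by (simp add: power_int_def)

lemma \<sigma>_eps:
  assumes i: "i \<in> {1, 2, 3}" and j: "j \<in> {1, 2, 3}"
  shows "\<sigma> j (eps i powi n) = (if i = j then eps i powi n else n' i powi n * eps i powi (- n))"
proof -
  have k: "eps i \<in> kk i" "eps i \<in> KK" using Ui_kk Ui_KK eps_props(1)[OF i] by auto
  show ?thesis
  proof (cases "i = j")
    case True
    thus ?thesis using \<sigma>_powi[OF j k(2)] kk_fixed[OF k(1)] by simp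
  next
    case False
    have "eps i * \<sigma> j (eps i) = n' i" using conj_other[OF i j _ k(1)] False by (simp add: n'_def)
    hence "\<sigma> j (eps i) = n' i / eps i" using eps_nz[OF i] by (simp add: field_simps)
    thus ?thesis using False \<sigma>_powi[OF j k(2)] by (simp add: power_int_divide_distrib power_int_minus divide_inverse power_int_mult_distrib power_int_inverse)
  qed
qed

text \<open>The fundamental units of the other two subfields are conjugated, that is, inverted up to
  their norms.\<close>

lemma \<sigma>_mono:
  "\<sigma> 1 (mono a b c) = (n' 2 powi b * n' 3 powi c) * mono a (- b) (- c)"
  "\<sigma> 2 (mono a b c) = (n' 1 powi a * n' 3 powi c) * mono (- a) b (- c)"
  "\<sigma> 3 (mono a b c) = (n' 1 powi a * n' 2 powi b) * mono (- a) (- b) c"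
proof -
  have K: "eps i powi n \<in> KK" if "i \<in> {1, 2, 3}" for i n using powi_Ui[OF that] Ui_KK by blast
  have m: "\<sigma> j (mono a b c) = \<sigma> j (eps 1 powi a) * \<sigma> j (eps 2 powi b) * \<sigma> j (eps 3 powi c)" if j: "j \<in> {1, 2, 3}" for j
    unfolding mono_def using K[of 1 a] K[of 2 b] K[of 3 c] by (simp add: \<sigma>_mult[OF j] K_mult)
  have e: "\<sigma> 1 (eps 1 powi a) = eps 1 powi a" "\<sigma> 1 (eps 2 powi b) = n' 2 powi b * eps 2 powi (- b)"
    "\<sigma> 1 (eps 3 powi c) = n' 3 powi c * eps 3 powi (- c)"
    "\<sigma> 2 (eps 1 powi a) = n' 1 powi a * eps 1 powi (- a)" "\<sigma> 2 (eps 2 powi b) = eps 2 powi b"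
    "\<sigma> 2 (eps 3 powi c) = n' 3 powi c * eps 3 powi (- c)"
    "\<sigma> 3 (eps 1 powi a) = n' 1 powi a * eps 1 powi (- a)" "\<sigma> 3 (eps 2 powi b) = n' 2 powi b * eps 2 powi (- b)"
    "\<sigma> 3 (eps 3 powi c) = eps 3 powi c"
    using \<sigma>_eps[of 1 1 a] \<sigma>_eps[of 2 1 b] \<sigma>_eps[of 3 1 c] \<sigma>_eps[of 1 2 a] \<sigma>_eps[of 2 2 b] \<sigma>_eps[of 3 2 c]
      \<sigma>_eps[of 1 3 a] \<sigma>_eps[of 2 3 b] \<sigma>_eps[of 3 3 c] by simp_all
  have j: "(1::nat) \<in> {1, 2, 3}" "(2::nat) \<in> {1, 2, 3}" "(3::nat) \<in> {1, 2, 3}" by simp_all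
  show "\<sigma> 1 (mono a b c) = (n' 2 powi b * n' 3 powi c) * mono a (- b) (- c)"
    unfolding m[OF j(1)] e by (simp only: mono_def mult_ac)
  show "\<sigma> 2 (mono a b c) = (n' 1 powi a * n' 3 powi c) * mono (- a) b (- c)"
    unfolding m[OF j(2)] e by (simp only: mono_def mult_ac)
  show "\<sigma> 3 (mono a b c) = (n' 1 powi a * n' 2 powi b) * mono (- a) (- b) c"
    unfolding m[OF j(3)] e by (simp only: mono_def mult_ac)
qed

lemma n'_powi: "i \<in> {1, 2, 3} \<Longrightarrow> n' i powi a = (if even a then 1 else n' i)"
proof -
  assume "i \<in> {1, 2, 3}"
  have "(- 1 :: complex) powi a = (if even a then 1 else - 1)"
    by (auto simp: power_int_def even_nat_iff minus_one_power_iff)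
  thus ?thesis using n'_cases[OF \<open>i \<in> {1, 2, 3}\<close>] by (elim disjE) simp_all
qed

lemma eps_powi_eq_1:
  assumes i: "i \<in> {1, 2, 3}" and "eps i powi a = 1 \<or> eps i powi a = - 1"
  shows "a = 0"
proof -
  have g: "Re (eps i) > 1" using eps_props(2)[OF i] .
  have "Re (eps i) powi a = 1"
  proof -
    have "Re (eps i powi a) = Re (eps i) powi a" using arg_cong[OF Re_eps_powi[OF i, of a], of Re] by (simp only: Re_complex_of_real)
    moreover have "Re (eps i) powi a > 0" using g by simp
    ultimately show ?thesis using assms(2) by auto
  qed
  thus "a = 0"
  proof -
    assume 1: "Re (eps i) powi a = 1"
    show ?thesis
    proof (rule ccontr)
      assume "a \<noteq> 0"
      then consider "a > 0" | "a < 0" by linarith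
      thus False
      proof cases
        case 1
        hence "Re (eps i) powi 0 < Re (eps i) powi a" using g by (intro power_int_strict_increasing) auto
        thus False using \<open>Re (eps i) powi a = 1\<close> by simp
      next
        case 2
        hence "Re (eps i) powi a < Re (eps i) powi 0" using g by (intro power_int_strict_increasing) auto
        thus False using \<open>Re (eps i) powi a = 1\<close> by simp
      qed
    qed
  qed
qed

text \<open>Multiplying the product by its conjugate under \<open>\<sigma> i\<close> cancels the
  other two fundamental units up to sign and leaves an even power of \<open>eps i\<close> equal to 1
  or -1. As \<open>eps i\<close> exceeds 1, the exponent is 0.\<close>

lemma mono_eq_1:
  assumes "mono a b c = 1"
  shows "a = 0" "b = 0" "c = 0"
proof -
  have p: "n' i powi m = 1 \<or> n' i powi m = - 1" if "i \<in> {1, 2, 3}" for i m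
    using n'_powi[OF that, of m] n'_cases[OF that] by auto
  have one: "\<sigma> i 1 = 1" if "i \<in> {1, 2, 3}" for i using G_one[OF \<sigma>_GG'[OF that]] .
  have 1: "1 = (n' 2 powi b * n' 3 powi c) * mono a (- b) (- c)" using \<sigma>_mono(1)[of a b c] one[of 1] assms by simp
  have 2: "1 = (n' 1 powi a * n' 3 powi c) * mono (- a) b (- c)" using \<sigma>_mono(2)[of a b c] one[of 2] assms by simp
  have 3: "1 = (n' 1 powi a * n' 2 powi b) * mono (- a) (- b) c" using \<sigma>_mono(3)[of a b c] one[of 3] assms by simp
  have "(n' 2 powi b * n' 3 powi c) * mono (a + a) 0 0 = 1"
    using 1 mono_mult[of a "- b" "- c" a b c] assms by simp
  hence "eps 1 powi (a + a) = 1 \<or> eps 1 powi (a + a) = - 1"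
    using p[of 2 b] p[of 3 c] by (auto simp: mono_def minus_equation_iff)
  thus "a = 0" using eps_powi_eq_1[of 1 "a + a"] by simp
  have "(n' 1 powi a * n' 3 powi c) * mono 0 (b + b) 0 = 1"
    using 2 mono_mult[of "- a" b "- c" a b c] assms by simp
  hence "eps 2 powi (b + b) = 1 \<or> eps 2 powi (b + b) = - 1"
    using p[of 1 a] p[of 3 c] by (auto simp: mono_def minus_equation_iff)
  thus "b = 0" using eps_powi_eq_1[of 2 "b + b"] by simp
  have "(n' 1 powi a * n' 2 powi b) * mono 0 0 (c + c) = 1"
    using 3 mono_mult[of "- a" "- b" c a b c] assms by simp
  hence "eps 3 powi (c + c) = 1 \<or> eps 3 powi (c + c) = - 1"
    using p[of 1 a] p[of 2 b] by (auto simp: mono_def minus_equation_iff)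
  thus "c = 0" using eps_powi_eq_1[of 3 "c + c"] by simp
qed

lemma mono_inj: "mono a b c = mono a' b' c' \<Longrightarrow> a = a' \<and> b = b' \<and> c = c'"
proof -
  assume eq: "mono a b c = mono a' b' c'"
  have "mono 0 0 0 = 1" by (simp add: mono_def)
  hence "mono (a - a') (b - b') (c - c') = 1"
    using mono_mult[of a b c "- a'" "- b'" "- c'"] mono_mult[of a' b' c' "- a'" "- b'" "- c'"] eq by simp
  thus ?thesis using mono_eq_1[of "a - a'" "b - b'" "c - c'"] by simp
qed

text \<open>Hilbert's theorem 90 for a unit of norm 1: the square of \<open>1 + eps i\<close>,
  divided by \<open>eps i\<close>, is 2 plus the trace of \<open>eps i\<close>, a positive rational.
  Since \<open>V\<close> asks for \<open>a * a\<close> times the unit, \<open>a\<close> is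
  \<open>1 + eps i\<close> divided by the unit.\<close>

lemma eps_V:
  assumes i: "i \<in> {1, 2, 3}" and n1: "n' i = 1"
  shows "eps i \<in> V"
proof -
  have k: "eps i \<in> kk i" "eps i \<in> KK" "eps i \<in> U" using Ui_kk Ui_KK Ui_U eps_props(1)[OF i] by auto
  have g: "Re (eps i) > 1" using eps_props(2)[OF i] .
  define z where "z = Re (eps i)"
  have z: "eps i = of_real z" using KK_re[OF k(2)] by (simp add: z_def)
  have nz: "eps i \<noteq> 0" using eps_nz[OF i] .
  have "\<sigma> (nx i) (eps i) = inverse (eps i)"
    using n1 nz unfolding n'_def nm_def by (metis inverse_unique)
  hence Q: "2 + (eps i + inverse (eps i)) \<in> \<rat>" using kk_trace_norm(1)[OF i k(1)] by simp
  define a where "a = (1 + eps i) / eps i"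
  have a: "a * a * eps i = 2 + (eps i + inverse (eps i))" 
  proof -
    have "a * a * eps i = (1 + eps i) * (1 + eps i) / eps i" unfolding a_def using nz by simp
    also have "\<dots> = (1 + 2 * eps i + eps i * eps i) / eps i" by (simp add: distrib_left distrib_right)
    also have "\<dots> = 2 + (eps i + inverse (eps i))" using nz by (simp add: add_divide_distrib inverse_eq_divide)
    finally show ?thesis .
  qed
  have "2 + (eps i + inverse (eps i)) = of_real (2 + (z + inverse z))" unfolding z by simp
  hence "Re (2 + (eps i + inverse (eps i))) = 2 + (z + inverse z)" by (metis Re_complex_of_real)
  moreover have "2 + (z + inverse z) > 0" using g by (intro add_pos_pos) (simp_all add: z_def)
  ultimately have pos: "Re (2 + (eps i + inverse (eps i))) > 0" by (simp only:)
  have "1 + eps i \<noteq> 0"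
  proof
    assume "1 + eps i = 0"
    hence "of_real (1 + z) = (0 :: complex)" using z by simp
    hence "1 + z = 0" by (simp only: of_real_eq_0_iff)
    thus False using g by (simp add: z_def)
  qed
  hence "a \<noteq> 0" using nz by (simp add: a_def)
  moreover have "a \<in> KK" unfolding a_def by (intro K_divide K_add K_one k)
  ultimately show ?thesis unfolding V_def using k(3) a Q pos by blast
qed

text \<open>Hilbert's theorem 90 with the common norm -1. The rational number that it yields is
  positive because \<open>mono 1 1 1\<close> is.\<close>

lemma mono_V_all:
  assumes "n' 1 = - 1" "n' 2 = - 1" "n' 3 = - 1"
  shows "mono 1 1 1 \<in> V"
proof -
  have k: "eps i \<in> kk i" "eps i \<in> KK" "eps i \<in> U" if "i \<in> {1, 2, 3}" for i
    using Ui_kk Ui_KK Ui_U eps_props(1)[OF that] by auto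
  have m: "mono 1 1 1 = eps 1 * eps 2 * eps 3" by (simp add: mono_def)
  have "- 1 \<in> (\<rat> :: complex set)" "- 1 \<noteq> (0 :: complex)" by auto
  then obtain a where a: "a \<in> KK" "a \<noteq> 0" "a * a * (eps 1 * eps 2 * eps 3) \<in> \<rat>"
    using hilbert_90[OF k(1)[of 1] k(1)[of 2] k(1)[of 3] _ _ assms[unfolded n'_def], of thesis for thesis]
    by (metis insert_iff)
  have mK: "mono 1 1 1 \<in> KK" using mono_W W_U U_K by blast
  have "Re (a * a * mono 1 1 1) = Re (a * a) * Re (mono 1 1 1)" by (rule KK_Re_mult[OF K_mult[OF a(1) a(1)] mK])
  moreover have "Re (a * a) > 0" by (rule KK_Re_square[OF a(1,2)])
  ultimately have "Re (a * a * mono 1 1 1) > 0" using mono_Re_pos[of 1 1 1] by (metis mult_pos_pos)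
  moreover have "mono 1 1 1 \<in> U" using mono_W W_U by blast
  moreover have "a * a * mono 1 1 1 \<in> \<rat>" using a(3) m by simp
  ultimately show ?thesis unfolding V_def using a(1,2) by blast
qed

text \<open>The parities of the exponents of the products of fundamental units that lie in \<open>V\<close>;
  \<open>True\<close> stands for an even exponent.\<close>

definition E :: "(bool \<times> bool \<times> bool) set" where
  "E = {(x, y, z). (x \<or> n' 1 = 1) = (y \<or> n' 2 = 1) \<and> (y \<or> n' 2 = 1) = (z \<or> n' 3 = 1)}"

text \<open>Members of \<open>V\<close> are positive, hence products of powers of the fundamental
  units without a sign, and their classes modulo \<open>sqs W\<close> are the parities of the
  exponents. Positive conjugates force the conditions of \<open>E\<close>; conversely, each triple
  in \<open>E\<close> is realized with exponents 0 and 1.\<close>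

lemma idx_V_sqs_W: "idx cmul V (sqs W) = card E"
proof -
  define ex where "ex u = (SOME x. u = mono (fst x) (fst (snd x)) (snd (snd x)))" for u
  have ex: "u = mono (fst (ex u)) (fst (snd (ex u))) (snd (snd (ex u)))" if "u \<in> V" for u
  proof -
    have "Re u > 0" using V_positive[OF that id_G] by simp
    moreover have "u \<in> W" using V_W that by blast
    ultimately obtain a b c where "u = mono a b c" using W_mono_pos[of u] by blast
    hence "\<exists>x. u = mono (fst x) (fst (snd x)) (snd (snd x))" by (intro exI[of _ "(a, b, c)"]) simp
    thus ?thesis unfolding ex_def by (rule someI_ex)
  qed
  define g where "g u = (even (fst (ex u)), even (fst (snd (ex u))), even (snd (snd (ex u))))" for u
  have g_mono: "g (mono a b c) = (even a, even b, even c)" if "mono a b c \<in> V" for a b c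
    using mono_inj[OF ex[OF that]] by (simp add: g_def)
  have mono_ex: "\<exists>a b c. u = mono a b c" if "u \<in> V" for u using ex[OF that] by blast
  have 1: "idx cmul V (sqs W) = card (g ` V)"
  proof (rule cmul.idx_cong[OF subgroup_sqs[OF subgroup_W]])
    show "V \<subseteq> carrier cmul" using V_U U_nonzero by auto
    fix x y assume xy: "x \<in> V" "y \<in> V"
    obtain a b c where x: "x = mono a b c" using mono_ex[OF xy(1)] by blast
    obtain a' b' c' where y: "y = mono a' b' c'" using mono_ex[OF xy(2)] by blast
    have y0: "y \<noteq> 0" using V_U[OF xy(2)] U_nonzero by blast
    have quot: "x * inverse y = mono (a - a') (b - b') (c - c')" unfolding x y mono_inverse mono_mult by simp
    have "x * inverse y \<in> sqs W \<longleftrightarrow> even (a - a') \<and> even (b - b') \<and> even (c - c')"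
    proof
      assume "x * inverse y \<in> sqs W"
      then obtain w where w: "w \<in> W" "x * inverse y = w * w" by (auto simp: sqs_def)
      obtain k l m where "w = mono k l m \<or> w = - mono k l m" using W_mono[OF w(1)] .
      hence "w * w = mono (k + k) (l + l) (m + m)" using mono_mult[of k l m k l m] by auto
      hence "a - a' = k + k \<and> b - b' = l + l \<and> c - c' = m + m" using w(2) quot mono_inj by metis
      thus "even (a - a') \<and> even (b - b') \<and> even (c - c')" by simp
    next
      assume "even (a - a') \<and> even (b - b') \<and> even (c - c')"
      then obtain k l m where "a - a' = 2 * k" "b - b' = 2 * l" "c - c' = 2 * m" unfolding dvd_def by blast
      hence "x * inverse y = mono k l m * mono k l m" unfolding quot mono_mult by simp
      thus "x * inverse y \<in> sqs W" unfolding sqs_def using mono_W by blast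
    qed
    also have "\<dots> \<longleftrightarrow> g x = g y" using g_mono xy unfolding x y by auto
    finally show "x \<otimes>\<^bsub>cmul\<^esub> inv\<^bsub>cmul\<^esub> y \<in> sqs W \<longleftrightarrow> g x = g y" using y0 inv_cmul by simp
  qed
  have j: "(1::nat) \<in> {1, 2, 3}" "(2::nat) \<in> {1, 2, 3}" "(3::nat) \<in> {1, 2, 3}" by simp_all
  \<comment> \<open>The sign of a conjugate is a product of two powers of norms; positivity means
    that both powers are 1 or both are -1.\<close>
  have sgn: "(even x \<or> n' i = 1) = (even y \<or> n' j = 1)"
    if i: "i \<in> {1, 2, 3}" and jj: "j \<in> {1, 2, 3}" and pos: "Re ((n' i powi x * n' j powi y) * mono k l m) > 0" for i j x y k l m
  proof (rule ccontr)
    assume "\<not> ?thesis"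
    hence "n' i powi x * n' j powi y = - 1"
      using n'_powi[OF i, of x] n'_powi[OF jj, of y] n'_cases[OF i] n'_cases[OF jj] by auto
    hence "Re (- mono k l m) > 0" using pos by simp
    thus False using mono_Re_pos[of k l m] by simp
  qed
  have 2: "g ` V = E"
  proof
    show "g ` V \<subseteq> E"
    proof
      fix z assume "z \<in> g ` V"
      then obtain u where u: "u \<in> V" "z = g u" by blast
      obtain a b c where m: "u = mono a b c" using mono_ex[OF u(1)] by blast
      have "(even b \<or> n' 2 = 1) = (even c \<or> n' 3 = 1)"
        using sgn[OF j(2,3)] V_positive[OF u(1), of "\<sigma> 1"] unfolding m \<sigma>_mono by simp
      moreover have "(even a \<or> n' 1 = 1) = (even b \<or> n' 2 = 1)"
        using sgn[OF j(1,2)] V_positive[OF u(1), of "\<sigma> 3"] unfolding m \<sigma>_mono by simp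
      ultimately show "z \<in> E" using u m g_mono by (simp add: E_def)
    qed
    show "E \<subseteq> g ` V"
    proof
      fix z assume z: "z \<in> E"
      obtain x1 x2 x3 where zx: "z = (x1, x2, x3)" by (metis prod_cases3)
      define h where "h x = (if x then 0 else 1 :: int)" for x
      \<comment> \<open>By the conditions of \<open>E\<close>, either every factor is 1 or a
        fundamental unit of norm 1, or all three exponents are odd and all three norms are
        -1.\<close>
      have "mono (h x1) (h x2) (h x3) \<in> V"
      proof (cases "x1 \<or> n' 1 = 1")
        case True
        have h2: "x2 \<or> n' 2 = 1" "x3 \<or> n' 3 = 1" using True z by (auto simp: E_def zx)
        have one: "1 \<in> V" using subgroup.one_closed[OF subgroup_V] by simp
        have "eps 1 powi (h x1) \<in> V" "eps 2 powi (h x2) \<in> V" "eps 3 powi (h x3) \<in> V"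
          using True h2 eps_V[OF j(1)] eps_V[OF j(2)] eps_V[OF j(3)] one by (auto simp: h_def)
        thus ?thesis unfolding mono_def using subgroup.m_closed[OF subgroup_V] by simp
      next
        case False
        hence "\<not> (x2 \<or> n' 2 = 1)" "\<not> (x3 \<or> n' 3 = 1)" using z by (auto simp: E_def zx)
        hence "h x1 = 1" "h x2 = 1" "h x3 = 1" "n' 1 = - 1" "n' 2 = - 1" "n' 3 = - 1"
          using False n'_cases[OF j(1)] n'_cases[OF j(2)] n'_cases[OF j(3)] by (auto simp: h_def)
        thus ?thesis using mono_V_all by simp
      qed
      moreover from this have "g (mono (h x1) (h x2) (h x3)) = z" using g_mono by (simp add: zx h_def)
      ultimately show "z \<in> g ` V" by blast
    qed
  qed
  show ?thesis using 1 2 by simp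
qed

text \<open>Each conjugate imposes one sign condition on the parities, and the product of the three
  conditions is trivial, so at most two are independent. With 0, 1, 2 or 3 negative norms there are
  0, 1, 2 and again 2 independent conditions on three parities. This is why two and three negative
  norms give the same count.\<close>

lemma card_E:
  "card E = (case card {i \<in> {1, 2, 3}. n' i = - 1} of 0 \<Rightarrow> 8 | Suc 0 \<Rightarrow> 4 | _ \<Rightarrow> 2)"
proof -
  define L where "L = [(x, y, z). x \<leftarrow> [True, False], y \<leftarrow> [True, False], z \<leftarrow> [True, False]]"
  define P where "P m1 m2 m3 = (\<lambda>(x, y, z). (x \<or> m1) = (y \<or> m2) \<and> (y \<or> m2) = (z \<or> m3))" for m1 m2 m3
  have L: "distinct L" "set L = UNIV" by (auto simp: L_def)
  have "E = set (filter (P (n' 1 = 1) (n' 2 = 1) (n' 3 = 1)) L)" using L(2) by (auto simp: E_def P_def)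
  moreover have "card (set (filter Q L)) = length (filter Q L)" for Q
    by (rule distinct_card) (rule distinct_filter[OF L(1)])
  ultimately have E: "card E = length (filter (P (n' 1 = 1) (n' 2 = 1) (n' 3 = 1)) L)" by (simp only:)
  have neg: "n' i = - 1 \<longleftrightarrow> n' i \<noteq> 1" if "i \<in> {1, 2, 3}" for i using n'_cases[OF that] by auto
  have S: "{i \<in> {1, 2, 3}. n' i = - 1} = set (filter (\<lambda>i. n' i \<noteq> 1) [1, 2, 3])" using neg by auto
  have T: "card {i \<in> {1, 2, 3}. n' i = - 1} = length (filter (\<lambda>i. n' i \<noteq> 1) [1, 2, 3])"
    unfolding S by (rule distinct_card) simp
  show ?thesis unfolding E T
    by (cases "n' 1 = 1"; cases "n' 2 = 1"; cases "n' 3 = 1") (simp_all add: L_def P_def)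
qed

end

section \<open>Uniformizers, divisibility by \<open>p\<close> and totally ramified primes\<close>

context galois_field
begin

lemma princ_antimono: "x \<in> \<O> \<Longrightarrow> y \<in> princ x \<Longrightarrow> princ y \<subseteq> princ x"
  using princ_subset_iff[OF princ_isid] by blast

lemma radp_O: "Factorial_Ring.prime p \<Longrightarrow> x \<in> radp p \<Longrightarrow> x \<in> \<O>"
  using isidD(1)[OF nzidD[OF nzid_radp]] by blast

lemma of_int_in_radp:
  assumes "Factorial_Ring.prime p"
  shows "of_int a \<in> radp p \<longleftrightarrow> int p dvd a"
proof -
  obtain P where P: "P \<in> primes_above K p" using primes_above_exists[OF assms] .
  show ?thesis using mem_radp_iff[OF assms O_of_int] of_int_in_primes_above[OF assms] P by blast
qed

lemma of_int_in_princ: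
  assumes "int p dvd a"
  shows "of_int a \<in> princ (of_nat p)"
proof -
  obtain m where "a = int p * m" using assms by (elim dvdE)
  hence "of_int a = of_nat p * (of_int m :: complex)" by simp
  thus ?thesis unfolding princ_def by (intro image_eqI[of _ _ "of_int m"]) auto
qed

text \<open>\<open>radp p\<close> has valuation 1 at \<open>P\<close>, so it contains an element
  outside the square of \<open>P\<close>. Membership in the invariant ideal \<open>radp p\<close> is
  kept by conjugates, and so by relative traces and norms.\<close>

lemma uniformizer:
  assumes p: "Factorial_Ring.prime p" and P: "P \<in> primes_above K p"
  obtains x where "x \<in> radp p" "x \<in> \<O>" "x \<noteq> 0" "v P (princ x) = 1"
proof -
  have Pm: "P \<in> maxs" using P primes_above_eq by blast
  have vr: "v P (radp p) = 1" using v_radp[OF p Pm] P by simp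
  have "\<not> radp p \<subseteq> pw P 2" using v_iff[OF Pm nzid_radp[OF p], of 2] vr by simp
  then obtain x where x: "x \<in> radp p" "x \<notin> pw P 2" by blast
  have xO: "x \<in> \<O>" using radp_O[OF p x(1)] .
  have x0: "x \<noteq> 0" using x(2) isidD(2)[OF isid_pw[OF maxs_isid[OF Pm], of 2]] by metis
  have nz: "nzid (princ x)" using nzid_princ[OF xO x0] .
  have "princ x \<subseteq> radp p" using princ_subset_iff[OF nzidD[OF nzid_radp[OF p]]] x(1) by blast
  hence "v P (princ x) \<ge> 1" using v_mono[OF Pm nz nzid_radp[OF p]] vr by simp
  moreover have "\<not> princ x \<subseteq> pw P 2" using x(2) princ_self by blast
  hence "\<not> 2 \<le> v P (princ x)" using v_iff[OF Pm nz] by blast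
  ultimately have "v P (princ x) = 1" by linarith
  thus ?thesis using that x(1) xO x0 by blast
qed

lemma e_le:
  assumes p: "Factorial_Ring.prime p" and P: "P \<in> primes_above K p"
    and x: "x \<in> \<O>" "x \<noteq> 0" "x \<in> princ (of_nat p)"
  shows "e p \<le> v P (princ x)"
proof -
  have Pm: "P \<in> maxs" using P primes_above_eq by blast
  have p0: "p \<noteq> 0" using p by auto
  have "nzid (princ (of_nat p))" using nzid_princ[OF O_of_nat] p0 by simp
  thus ?thesis
    using v_mono[OF Pm nzid_princ[OF x(1,2)] _ princ_antimono[OF O_of_nat x(3)]] e_eq[OF p P] by simp
qed

lemma v_G_invariant:
  assumes "P \<in> maxs" "\<sigma> \<in> G" "\<sigma> ` P = P" "x \<in> \<O>" "x \<noteq> 0"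
  shows "v P (princ (\<sigma> x)) = v P (princ x)"
  using v_G[OF assms(2,1) nzid_princ[OF assms(4,5)]] assms(3) G_princ[OF assms(2) O_K[OF assms(4)]] by simp

text \<open>If \<open>e p = card G\<close>, the power of \<open>radp p\<close> with this exponent is
  the ideal generated by \<open>p\<close>, and comparing norms gives
  \<open>nrm (radp p) = p\<close>. A prime norm leaves no room for a cofactor of
  \<open>P\<close>.\<close>

lemma totally_ramified_prime:
  assumes p: "Factorial_Ring.prime p" and e: "e p = card G" and P: "P \<in> primes_above K p"
  shows "radp p = P"
proof -
  have Pm: "P \<in> maxs" using P primes_above_eq by blast
  have p0: "p > 0" using p prime_gt_0_nat by blast
  have nr: "nzid (radp p)" using nzid_radp[OF p] .
  have "pw (radp p) (e p) = princ (of_nat p)"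
  proof (rule ideal_eq_of_v_eq)
    show "nzid (pw (radp p) (e p))" using nzid_pw[OF nr] .
    show np: "nzid (princ (of_nat p))" using nzid_princ[OF O_of_nat] p0 by simp
    fix Q assume Q: "Q \<in> maxs"
    obtain l where l: "Factorial_Ring.prime l" "Q \<in> primes_above K l" using maxs_above[OF Q] .
    show "v Q (pw (radp p) (e p)) = v Q (princ (of_nat p))"
    proof (cases "Q \<in> primes_above K p")
      case True
      thus ?thesis using v_pw[OF Q nr] v_radp[OF p Q] e_eq[OF p True] by simp
    next
      case False
      hence "l \<noteq> p" using l by blast
      hence "\<not> l dvd p" using primes_dvd_imp_eq[OF l(1) p] by blast
      thus ?thesis using v_pw[OF Q nr] v_radp[OF p Q] False v_of_nat_coprime[OF l] by simp
    qed
  qed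
  hence "nrm (radp p) ^ card G = p ^ card G" using nrm_pw[OF nr, of "e p"] nrm_of_nat[OF p0] e by simp
  moreover have "card G > 0" using finite_G id_G card_gt_0_iff by blast
  ultimately have nrp: "nrm (radp p) = p" using power_eq_iff_eq_base[of "card G" "nrm (radp p)" p] by simp
  have "radp p \<subseteq> P" using radp_iff[OF p nr] P by blast
  then obtain L where L: "isid L" "radp p = P \<odot> L" using ideal_dvd[OF maxsD(1)[OF Pm] nzidD[OF nr]] by blast
  have L0: "nzid L" 
  proof -
    have "L \<noteq> {0}"
    proof
      assume "L = {0}"
      hence "radp p \<subseteq> {0}" using L(2) iprod_subset[OF L(1) maxs_isid[OF Pm]] iprod_comm by metis
      thus False using nzid_nonzero[OF nr] by blast
    qed
    thus ?thesis using L(1) by (simp add: nzid_def)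
  qed
  have "nrm P * nrm L = p" using nrp nrm_iprod[OF maxsD(1)[OF Pm] L0] L(2) by simp
  moreover have "nrm P \<noteq> 1" using nrm_eq_1_iff[OF maxsD(1)[OF Pm]] maxsD(2)[OF Pm] by blast
  ultimately have "nrm L = 1" using prime_product[of "nrm P" "nrm L"] p by simp
  hence "L = \<O>" using nrm_eq_1_iff[OF L0] by blast
  thus ?thesis using L(2) iprod_O[OF maxs_isid[OF Pm]] iprod_comm by metis
qed

end

context biquad
begin

subsection \<open>Ramification in the biquadratic field\<close>

lemma s_O: "i \<in> {1, 2, 3} \<Longrightarrow> s i \<in> \<O>"
  using kk_KK[OF s_kk] algebraic_int_csq by (simp add: \<O>_def s_def)

lemma kk_O_trace_norm:
  assumes i: "i \<in> {1, 2, 3}" and w: "w \<in> \<O>" "\<sigma> i w = w"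
  shows "w \<in> kk i" "w + \<sigma> (nx i) w \<in> \<int>" "nm i w \<in> \<int>"
proof -
  show k: "w \<in> kk i" using w O_K by (simp add: kk_def)
  have "\<sigma> (nx i) w \<in> \<O>" using G_O[OF \<sigma>_GG'[OF nx(1)[OF i]] w(1)] .
  thus "w + \<sigma> (nx i) w \<in> \<int>" "nm i w \<in> \<int>"
    using O_Rats O_add[OF w(1)] O_mult[OF w(1)] kk_trace_norm[OF i k] unfolding nm_def by blast+
qed

lemma conj_trace_norm:
  assumes p: "Factorial_Ring.prime p" and i: "i \<in> {1, 2, 3}" and x: "x \<in> radp p"
  shows "x + \<sigma> i x \<in> radp p" "x * \<sigma> i x \<in> radp p"
    "\<sigma> i (x + \<sigma> i x) = x + \<sigma> i x" "\<sigma> i (x * \<sigma> i x) = x * \<sigma> i x"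
proof -
  have xO: "x \<in> \<O>" "x \<in> KK" using radp_O[OF p x] O_K by auto
  have sx: "\<sigma> i x \<in> radp p" using G_radp[OF p \<sigma>_GG'[OF i]] x by blast
  have sK: "\<sigma> i x \<in> KK" "\<sigma> i x \<in> \<O>" using radp_O[OF p sx] O_K by auto
  have I: "isid (radp p)" using nzidD[OF nzid_radp[OF p]] .
  show "x + \<sigma> i x \<in> radp p" using isidD(3)[OF I x sx] .
  show "x * \<sigma> i x \<in> radp p" using isidD(4)[OF I xO(1) sx] .
  show "\<sigma> i (x + \<sigma> i x) = x + \<sigma> i x"
    using G_add[OF \<sigma>_GG'[OF i] xO(2) sK(1)] \<sigma>_\<sigma>(1)[OF i] by (simp only: add.commute)
  show "\<sigma> i (x * \<sigma> i x) = x * \<sigma> i x"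
    using \<sigma>_mult[OF i xO(2) sK(1)] \<sigma>_\<sigma>(1)[OF i] by (simp only: mult.commute)
qed

text \<open>The condition expresses that \<open>p\<close> is unramified in the \<open>i\<close>-th
  subfield. A uniformizer \<open>x\<close> satisfies \<open>x * x = x * a - b\<close> with its
  relative trace \<open>a\<close> and norm \<open>b\<close>, which the condition makes divisible by
  \<open>p\<close>. So \<open>p\<close> divides an element of valuation 2.\<close>

lemma e_le_2:
  assumes p: "Factorial_Ring.prime p" and i: "i \<in> {1, 2, 3}"
    and cond: "\<And>w. w \<in> radp p \<Longrightarrow> \<sigma> i w = w \<Longrightarrow> w \<in> princ (of_nat p)"
  shows "e p \<le> 2"
proof -
  obtain P where P: "P \<in> primes_above KK p" using primes_above_exists[OF p] .
  have Pm: "P \<in> maxs" using P primes_above_eq by blast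
  obtain x where x: "x \<in> radp p" "x \<in> \<O>" "x \<noteq> 0" "v P (princ x) = 1" using uniformizer[OF p P] .
  have I: "isid (princ (of_nat p))" using princ_isid[OF O_of_nat] .
  define a where "a = x + \<sigma> i x"
  define b where "b = x * \<sigma> i x"
  have ab: "a \<in> princ (of_nat p)" "b \<in> princ (of_nat p)"
    using cond conj_trace_norm[OF p i x(1)] unfolding a_def b_def by blast+
  have "x * x = x * a - b" unfolding a_def b_def by (simp add: distrib_left)
  hence "x * x \<in> princ (of_nat p)" using isidD(7)[OF I isidD(4)[OF I x(2) ab(1)] ab(2)] by simp
  hence "e p \<le> v P (princ (x * x))" using e_le[OF p P O_mult[OF x(2,2)]] x(3) by simp
  thus ?thesis using v_princ_mult[OF Pm x(2,2,3,3)] x(4) by simp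
qed

text \<open>Some \<open>d i\<close> is prime to \<open>p\<close>. An integral element
  \<open>w\<close> of that subfield satisfies \<open>2 * w = t + m * s i\<close> with integers
  \<open>t\<close> and \<open>m\<close>; if it lies in \<open>radp p\<close>, then \<open>p\<close>
  divides \<open>t\<close> and \<open>m\<close>, hence \<open>2 * w\<close>, and as \<open>p\<close>
  is odd also \<open>w\<close>.\<close>

lemma e_odd_le_2:
  assumes p: "Factorial_Ring.prime p" "p \<noteq> 2"
  shows "e p \<le> 2"
proof -
  obtain i where i: "i \<in> {1, 2, 3}" "\<not> p dvd d i" using not_all_dvd[OF p(1)] by blast
  have odd: "odd p" using p prime_odd_nat prime_gt_1_nat primes_dvd_imp_eq two_is_prime_nat by metis
  have pi: "Factorial_Ring.prime (int p)" using p(1) by simp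
  show ?thesis
  proof (rule e_le_2[OF p(1) i(1)])
    fix w assume w: "w \<in> radp p" "\<sigma> i w = w"
    have wO: "w \<in> \<O>" using radp_O[OF p(1) w(1)] .
    have I: "isid (radp p)" using nzidD[OF nzid_radp[OF p(1)]] .
    have J: "isid (princ (of_nat p))" using princ_isid[OF O_of_nat] .
    have sw: "\<sigma> (nx i) w \<in> radp p" using G_radp[OF p(1) \<sigma>_GG'[OF nx(1)[OF i(1)]]] w(1) by blast
    obtain a b where ab: "w = a + b * s i" "a \<in> \<rat>" "b \<in> \<rat>"
      using kk_O_trace_norm(1)[OF i(1) wO w(2)] kk_eq[OF i(1)] by blast
    have sw': "\<sigma> (nx i) w = a - b * s i" unfolding ab(1) by (rule conj_kk[OF i(1) nx(1,2)[OF i(1)] ab(2,3)])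
    have "w + \<sigma> (nx i) w \<in> \<int>" using kk_O_trace_norm(2)[OF i(1) wO w(2)] .
    then obtain t where t: "w + \<sigma> (nx i) w = of_int t" unfolding Ints_def by blast
    have "of_int t \<in> radp p" using isidD(3)[OF I w(1) sw] t by simp
    hence tJ: "of_int t \<in> princ (of_nat p)" using of_int_in_radp[OF p(1)] of_int_in_princ by blast
    have y: "w - \<sigma> (nx i) w \<in> radp p" using isidD(7)[OF I w(1) sw] .
    have ys: "w - \<sigma> (nx i) w = 2 * b * s i" unfolding sw' by (simp add: ab(1))
    hence yb: "2 * b * s i \<in> radp p" using y by simp
    \<comment> \<open>The square of the difference of \<open>w\<close> and its conjugate is
      \<open>(2 * b)\<^sup>2 * d i\<close>, a rational integer, and since \<open>d i\<close> is
      squarefree \<open>2 * b\<close> is an integer.\<close>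
    have y2: "(2 * b * s i) * (2 * b * s i) \<in> radp p" using isidD(4)[OF I radp_O[OF p(1) yb] yb] .
    have eq: "(2 * b * s i) * (2 * b * s i) = (2 * b)\<^sup>2 * of_nat (d i)"
      unfolding s_square[of i, symmetric] by (simp only: power2_eq_square mult_ac)
    have "(2 * b)\<^sup>2 * of_nat (d i) \<in> \<O>" using radp_O[OF p(1) y2] eq by simp
    moreover have "(2 * b)\<^sup>2 * of_nat (d i) \<in> \<rat>" using ab(3) by (intro Rats_mult Rats_power) auto
    ultimately have "(2 * b)\<^sup>2 * of_nat (d i) \<in> \<int>" by (rule O_Rats)
    moreover have "2 * b \<in> \<rat>" using ab(3) by (intro Rats_mult) auto
    ultimately have "2 * b \<in> \<int>" using Rats_int_of_squarefree[OF sqf[OF i(1)]] by blast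
    then obtain m where m: "2 * b = of_int m" unfolding Ints_def by blast
    have "of_int (m\<^sup>2 * int (d i)) \<in> radp p" using y2[unfolded eq] unfolding m by simp
    hence "int p dvd m\<^sup>2 * int (d i)" using of_int_in_radp[OF p(1)] by blast
    hence "int p dvd m" using prime_dvd_mult_iff[OF pi] prime_dvd_power[OF pi] i(2) by auto
    hence "of_int m \<in> princ (of_nat p)" by (rule of_int_in_princ)
    hence "of_int m * s i \<in> princ (of_nat p)" using isidD(5)[OF J s_O[OF i(1)]] by blast
    hence 2: "of_int t + of_int m * s i \<in> princ (of_nat p)" using isidD(3)[OF J tJ] by blast
    have 3: "of_int t + of_int m * s i = 2 * w" unfolding t[symmetric] m[symmetric] ys[symmetric] by simp
    \<comment> \<open>This inverts 2 modulo \<open>p\<close>: \<open>w\<close> is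
      \<open>p * w\<close> minus \<open>h\<close> times \<open>2 * w\<close>.\<close>
    obtain h where h: "p = 2 * h + 1" using odd by (auto elim: oddE)
    have "w = of_nat p * w - of_nat h * (2 * w)" unfolding h by (simp add: algebra_simps)
    moreover have "of_nat p * w \<in> princ (of_nat p)" using wO by (auto simp: princ_def)
    moreover have "of_nat h * (2 * w) \<in> princ (of_nat p)" using isidD(4)[OF J O_of_nat] 2 3 by simp
    ultimately show "w \<in> princ (of_nat p)" using isidD(7)[OF J] by metis
  qed
qed

text \<open>Two quadratic steps. An element of \<open>radp 2\<close> in the first subfield has its
  square divisible by 2; the relative trace and norm of a uniformizer \<open>x\<close> are such
  elements, so the fourth power of \<open>x\<close> is divisible by 2.\<close>

lemma e_two_le_4: "e 2 \<le> 4"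
proof -
  have p: "Factorial_Ring.prime (2::nat)" by (rule two_is_prime_nat)
  have i: "(1::nat) \<in> {1, 2, 3}" by simp
  obtain P where P: "P \<in> primes_above KK 2" using primes_above_exists[OF p] .
  have Pm: "P \<in> maxs" using P primes_above_eq by blast
  obtain x where x: "x \<in> radp 2" "x \<in> \<O>" "x \<noteq> 0" "v P (princ x) = 1" using uniformizer[OF p P] .
  have I: "isid (radp 2)" using nzidD[OF nzid_radp[OF p]] .
  have J: "isid (princ (of_nat 2))" using princ_isid[OF O_of_nat] .
  have sq: "w * w \<in> princ (of_nat 2)" if w: "w \<in> radp 2" "\<sigma> 1 w = w" for w
  proof -
    have wO: "w \<in> \<O>" using radp_O[OF p w(1)] .
    have sw: "\<sigma> (nx 1) w \<in> radp 2" using G_radp[OF p \<sigma>_GG'[OF nx(1)[OF i]]] w(1) by blast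
    obtain t m where tm: "w + \<sigma> (nx 1) w = of_int t" "w * \<sigma> (nx 1) w = of_int m"
      using kk_O_trace_norm(2,3)[OF i wO w(2)] unfolding nm_def Ints_def by blast
    have "of_int t \<in> radp 2" "of_int m \<in> radp 2"
      using isidD(3)[OF I w(1) sw] isidD(4)[OF I wO sw] tm by simp_all
    hence h: "of_int t \<in> princ (of_nat 2)" "of_int m \<in> princ (of_nat 2)"
      using of_int_in_radp[OF p] of_int_in_princ by blast+
    have "w * w = w * of_int t - of_int m" unfolding tm[symmetric] by (simp add: distrib_left)
    thus ?thesis using isidD(7)[OF J isidD(4)[OF J wO h(1)] h(2)] by simp
  qed
  define a where "a = x + \<sigma> 1 x"
  define b where "b = x * \<sigma> 1 x"
  note ct = conj_trace_norm[OF p i x(1), folded a_def b_def]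
  have aO: "a \<in> \<O>" "b \<in> \<O>" using ct radp_O[OF p] by blast+
  have xx: "x * x = x * a - b" unfolding a_def b_def by (simp add: distrib_left)
  \<comment> \<open>In the square of \<open>x * a - b\<close> the cross term carries a factor 2, and
    the squares of \<open>a\<close> and \<open>b\<close> are covered by \<open>sq\<close>.\<close>
  have "(x * x) * (x * x) = (x * x) * (a * a) - (x * a * b) * of_nat 2 + b * b"
  proof -
    have "(x * a - b) * (x * a - b) = (x * x) * (a * a) - (x * a * b) * of_nat 2 + b * b" by (simp add: algebra_simps)
    moreover have "(x * x) * (x * x) = (x * a - b) * (x * a - b)" by (simp only: xx)
    ultimately show ?thesis by (simp only:)
  qed
  moreover have "(x * x) * (a * a) \<in> princ (of_nat 2)"
    using isidD(4)[OF J O_mult[OF x(2,2)] sq[OF ct(1,3)]] .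
  moreover have "(x * a * b) * of_nat 2 \<in> princ (of_nat 2)"
    using isidD(4)[OF J O_mult[OF O_mult[OF x(2) aO(1)] aO(2)] princ_self] .
  ultimately have "(x * x) * (x * x) \<in> princ (of_nat 2)"
    using isidD(3)[OF J isidD(7)[OF J] sq[OF ct(2,4)]] by simp
  hence "e 2 \<le> v P (princ ((x * x) * (x * x)))"
    using e_le[OF p P O_mult[OF O_mult[OF x(2,2)] O_mult[OF x(2,2)]]] x(3) by simp
  thus ?thesis using v_princ_mult[OF Pm O_mult[OF x(2,2)] O_mult[OF x(2,2)]] v_princ_mult[OF Pm x(2,2,3,3)] x(3,4) by simp
qed

lemma distinct_GG: "distinct [id, \<sigma> 1, \<sigma> 2, \<sigma> 3]"
proof -
  have 0: "s i \<noteq> - s i" if "i \<in> {1, 2, 3}" for i using s_nonzero[OF that] by simp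
  have "\<sigma> i \<noteq> \<sigma> j" if "i \<in> {1, 2, 3}" "j \<in> {1, 2, 3}" "i \<noteq> j" for i j
    using \<sigma>_s[OF that(1,1)] \<sigma>_s[OF that(1,2)] that(3) 0[OF that(1)] by metis
  hence "\<sigma> 1 \<noteq> \<sigma> 2" "\<sigma> 1 \<noteq> \<sigma> 3" "\<sigma> 2 \<noteq> \<sigma> 3" by simp_all
  moreover have "\<sigma> j \<noteq> id" if "j \<in> {1, 2, 3}" for j
    using \<sigma>_s[OF nx(1)[OF that] that] nx(2)[OF that] 0[OF nx(1)[OF that]] by (metis id_apply)
  hence "\<sigma> 1 \<noteq> id" "\<sigma> 2 \<noteq> id" "\<sigma> 3 \<noteq> id" by simp_all
  ultimately show ?thesis by auto
qed

lemma GG_set: "GG = set [id, \<sigma> 1, \<sigma> 2, \<sigma> 3]" unfolding GG_def by simp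

lemma card_GG: "card GG = 4" unfolding GG_set distinct_card[OF distinct_GG] by simp

lemma N_expand: "N x = x * \<sigma> 1 x * \<sigma> 2 x * \<sigma> 3 x"
  unfolding N_def
  unfolding GG_set prod.distinct_set_conv_list[OF distinct_GG] by (simp add: mult.assoc)

lemma totally_ramified_iff: "totally_ramified KK 2 \<longleftrightarrow> e 2 = 4"
proof -
  have p: "Factorial_Ring.prime (2::nat)" by (rule two_is_prime_nat)
  obtain P where P: "P \<in> primes_above KK 2" using primes_above_exists[OF p] .
  have "ramification_index_at KK 2 Q = e 2" if "Q \<in> primes_above KK 2" for Q
    using that ramification_index_at_eq[of Q 2] e_eq[OF p that] primes_above_eq by simp
  thus ?thesis unfolding totally_ramified_def field_degree_KK using P by metis
qed

subsection \<open>Invariant principal ideals whose square is not rational\<close>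

lemma A0_princ: "a \<in> A0 \<Longrightarrow> t \<in> GG \<Longrightarrow> princ (t a) = princ a"
  using princ_eq_iff[of "t a" a] G_eq_0_iff[of t a] by (simp add: A0_def)

lemma A0_invariant: "a \<in> A0 \<Longrightarrow> t \<in> GG \<Longrightarrow> t ` princ a = princ a"
  using A0_princ G_princ A0_K by simp

lemma v_prod_A0:
  assumes a: "a \<in> A0" "a \<in> \<O>" and P: "P \<in> maxs"
  shows "finite A \<Longrightarrow> A \<subseteq> GG \<Longrightarrow>
    (\<Prod>t\<in>A. t a) \<in> \<O> \<and> (\<Prod>t\<in>A. t a) \<noteq> 0 \<and> v P (princ (\<Prod>t\<in>A. t a)) = card A * v P (princ a)"
proof (induction A rule: finite_induct)
  case empty
  show ?case using v_O[OF P] princ_one by simp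
next
  case (insert t A)
  have t: "t \<in> GG" using insert by blast
  have ta: "t a \<in> \<O>" "t a \<noteq> 0" using G_O[OF t a(2)] G_eq_0_iff[OF t] A0_nonzero[OF a(1)] by auto
  have eq: "(\<Prod>t\<in>insert t A. t a) = t a * (\<Prod>t\<in>A. t a)" using insert(1,2) by simp
  have IH: "(\<Prod>t\<in>A. t a) \<in> \<O>" "(\<Prod>t\<in>A. t a) \<noteq> 0" "v P (princ (\<Prod>t\<in>A. t a)) = card A * v P (princ a)"
    using insert by blast+
  show ?case unfolding eq
    using v_princ_mult[OF P ta(1) IH(1) ta(2) IH(2)] IH O_mult[OF ta(1) IH(1)] ta A0_princ[OF a(1) t] insert(1,2) by simp
qed

lemma princ_of_int: "princ (of_int z) = princ (of_nat (nat \<bar>z\<bar>))"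
proof (cases "z = 0")
  case False
  have "(of_nat (nat \<bar>z\<bar>) :: complex) = of_int \<bar>z\<bar>" by simp
  hence "(of_nat (nat \<bar>z\<bar>) :: complex) = of_int z \<or> (of_nat (nat \<bar>z\<bar>) :: complex) = - of_int z"
    by (cases "z \<ge> 0") simp_all
  hence "of_int z / of_nat (nat \<bar>z\<bar>) = (1 :: complex) \<or> of_int z / of_nat (nat \<bar>z\<bar>) = (- 1 :: complex)"
    using False by auto
  hence "of_int z / of_nat (nat \<bar>z\<bar>) \<in> U" using U_one U_uminus[OF U_one] by metis
  moreover have "(of_int z :: complex) \<noteq> 0" "(of_nat (nat \<bar>z\<bar>) :: complex) \<noteq> 0" using False by simp_all
  ultimately show ?thesis using princ_eq_iff by blast
qed simp

text \<open>The four conjugates of \<open>a\<close> generate the same ideal, so the norm of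
  \<open>a\<close> has four times its valuation. The norm is a rational integer, whose valuations
  above \<open>p\<close> are multiples of \<open>e p\<close>.\<close>

lemma e_dvd_v:
  assumes a: "a \<in> A0" "a \<in> \<O>" and p: "Factorial_Ring.prime p" and P: "P \<in> primes_above KK p"
  shows "e p dvd 4 * v P (princ a)"
proof -
  have Pm: "P \<in> maxs" using P primes_above_eq by blast
  have f: "finite GG" by (simp add: GG_def)
  note h = v_prod_A0[OF a Pm f order_refl, folded N_def, unfolded card_GG]
  obtain z where z: "N a = of_int z" using N_O[OF a(2)] unfolding Ints_def by blast
  have "z \<noteq> 0" using h z by auto
  hence "v P (princ (N a)) = e p * multiplicity p (nat \<bar>z\<bar>)" 
    unfolding z princ_of_int by (intro v_of_nat[OF p P]) simp
  thus ?thesis using h by (metis dvd_triv_left)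
qed

lemma e_cases: "Factorial_Ring.prime p \<Longrightarrow> p \<noteq> 2 \<Longrightarrow> e p = 1 \<or> e p = 2"
  using e_pos[of p] e_odd_le_2[of p] by linarith

lemma e_two_cases: "e 2 = 1 \<or> e 2 = 2 \<or> e 2 = 3 \<or> e 2 = 4"
  using e_pos[OF two_is_prime_nat] e_two_le_4 by linarith

text \<open>If the claims fail, \<open>2 * v Q (princ a)\<close> is a multiple of the ramification
  index at every prime \<open>Q\<close>, since indices at odd primes are at most 2. Then
  \<open>a * a\<close> generates an ideal with a rational generator, so it lies in \<open>QU\<close>
  and \<open>a\<close> lies in \<open>A2\<close>.\<close>

lemma A0_not_A2:
  assumes a: "a \<in> A0" "a \<in> \<O>" "a \<notin> A2" and P: "P \<in> primes_above KK 2"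
  shows "e 2 = 4" "odd (v P (princ a))"
proof -
  have a0: "a \<noteq> 0" "a \<in> KK" using A0_nonzero A0_K a(1) by auto
  have na: "nzid (princ a)" using nzid_princ[OF a(2) a0(1)] .
  have "e 2 = 4 \<and> odd (v P (princ a))"
  proof (rule ccontr)
    assume neg: "\<not> ?thesis"
    have e2: "e 2 dvd 2 * v P (princ a)"
    proof -
      have d4: "e 2 dvd 4 * v P (princ a)" by (rule e_dvd_v[OF a(1,2) two_is_prime_nat P])
      \<comment> \<open>If \<open>e 2 = 3\<close>, it divides the valuation, being prime to 4; if
        \<open>e 2 = 4\<close>, the assumption makes the valuation even.\<close>
      consider "e 2 = 1" | "e 2 = 2" | "e 2 = 3" | "e 2 = 4" using e_two_cases by blast
      thus ?thesis
      proof cases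
        case 3
        hence "3 dvd 4 * v P (princ a)" using d4 by simp
        moreover have "3 dvd 4 * j \<Longrightarrow> 3 dvd 2 * j" for j :: nat by presburger
        ultimately have "3 dvd 2 * v P (princ a)" by blast
        thus ?thesis using 3 by simp
      next
        case 4
        hence "even (v P (princ a))" using neg by simp
        moreover have "even j \<Longrightarrow> 4 dvd 2 * j" for j :: nat by presburger
        ultimately have "4 dvd 2 * v P (princ a)" by blast
        thus ?thesis using 4 by simp
      qed simp_all
    qed
    have dv: "e p dvd 2 * v Q (princ a)" if p: "Factorial_Ring.prime p" and Q: "Q \<in> primes_above KK p" for p Q
    proof (cases "p = 2")
      case True
      have "v Q (princ a) = v P (princ a)"
        by (rule v_above_eq[OF p Q _ na A0_invariant[OF a(1)]]) (use P True in simp_all)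
      thus ?thesis using e2 True by simp
    next
      case False
      thus ?thesis using e_cases[OF p] by auto
    qed
    have vaa: "v Q (princ (a * a)) = 2 * v Q (princ a)" if "Q \<in> maxs" for Q
      using v_princ_mult[OF that a(2,2) a0(1,1)] by simp
    have naa: "nzid (princ (a * a))" using nzid_princ[OF O_mult[OF a(2,2)]] a0 by simp
    have inv: "t ` princ (a * a) = princ (a * a)" if "t \<in> GG" for t
      using A0_invariant[OF subgroup.m_closed[OF subgroup_A0 a(1,1)] that] by simp
    obtain m n :: nat where mn: "m > 0" "n > 0" "(*) (of_nat m) ` princ (a * a) = (*) (of_nat n) ` \<O>"
    proof (rule invariant_ratio[OF naa inv nzid_O G_image_O])
      fix p Q assume p: "Factorial_Ring.prime p" "Q \<in> primes_above KK p"
      have Qm: "Q \<in> maxs" using p primes_above_eq by blast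
      show "v Q (princ (a * a)) mod e p = v Q \<O> mod e p" using dv[OF p] vaa[OF Qm] v_O[OF Qm] by simp
    qed auto
    have "princ (of_nat m * (a * a)) = princ (of_nat n)" using mn(3) unfolding princ_def scale_scale by simp
    hence u: "of_nat m * (a * a) / of_nat n \<in> U" using princ_eq_iff[of "of_nat m * (a * a)" "of_nat n"] mn a0 by simp
    have "a * a = (of_nat n / of_nat m) * (of_nat m * (a * a) / of_nat n)" using mn by simp
    moreover have "(of_nat n / of_nat m :: complex) \<in> \<rat>" "(of_nat n / of_nat m :: complex) \<noteq> 0" using mn by simp_all
    ultimately have "a * a \<in> QU" unfolding QU_def using u by blast
    thus False using A2_iff[OF a(1)] a(3) by blast
  qed
  thus "e 2 = 4" "odd (v P (princ a))" by auto
qed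

definition hyp :: bool where
  "hyp \<longleftrightarrow> totally_ramified KK 2 \<and>
     ((\<forall>i \<in> {1, 2, 3}. \<exists>x \<in> carrier (ring_of_integers (kk i)). field_norm (kk i) x = 2) \<or>
      (\<forall>i \<in> {1, 2, 3}. \<exists>x \<in> carrier (ring_of_integers (kk i)). field_norm (kk i) x = -2))"

lemma integers_kk: "x \<in> carrier (ring_of_integers (kk i)) \<longleftrightarrow> x \<in> \<O> \<and> \<sigma> i x = x"
  by (auto simp: integers_def \<O>_def kk_def)

lemma hyp_iff:
  "hyp \<longleftrightarrow> e 2 = 4 \<and> (\<exists>n. (n = 2 \<or> n = - 2) \<and> (\<forall>i\<in>{1, 2, 3}. \<exists>x. x \<in> \<O> \<and> \<sigma> i x = x \<and> nm i x = n))"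
proof -
  have "(\<exists>x\<in>carrier (ring_of_integers (kk i)). field_norm (kk i) x = n) \<longleftrightarrow> (\<exists>x. x \<in> \<O> \<and> \<sigma> i x = x \<and> nm i x = n)"
    if i: "i \<in> {1, 2, 3}" for i n
  proof -
    have "field_norm (kk i) x = nm i x" if "x \<in> carrier (ring_of_integers (kk i))" for x
      using field_norm_kk[OF i] that by (simp add: integers_def nm_def)
    thus ?thesis using integers_kk by metis
  qed
  hence "(\<forall>i\<in>{1, 2, 3}. \<exists>x\<in>carrier (ring_of_integers (kk i)). field_norm (kk i) x = n) \<longleftrightarrow>
      (\<forall>i\<in>{1, 2, 3}. \<exists>x. x \<in> \<O> \<and> \<sigma> i x = x \<and> nm i x = n)" for n by (intro ball_cong refl)
  note * = this
  show ?thesis unfolding hyp_def totally_ramified_iff * by blast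
qed

text \<open>The odd valuation of \<open>a\<close> above 2 makes the valuations of
  \<open>a * a\<close> and of \<open>J\<close> congruent modulo every \<open>e p\<close>, so a
  rational \<open>c\<close> turns \<open>a * a\<close> into a generator of \<open>J\<close>. As
  \<open>\<sigma> i a / a\<close> is a unit, \<open>c * (a * \<sigma> i a)\<close> generates
  \<open>J\<close> as well, and it is fixed by \<open>\<sigma> i\<close>.\<close>

lemma A0_not_A2_hyp:
  assumes a: "a \<in> A0" "a \<in> \<O>" "a \<notin> A2"
  shows hyp
proof -
  have two: "Factorial_Ring.prime (2::nat)" by (rule two_is_prime_nat)
  obtain P0 where P0: "P0 \<in> primes_above KK 2" using primes_above_exists[OF two] .
  have e2: "e 2 = 4" using A0_not_A2(1)[OF a P0] .
  have a0: "a \<noteq> 0" "a \<in> KK" using A0_nonzero A0_K a(1) by auto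
  have nr: "nzid (radp 2)" using nzid_radp[OF two] .
  define J where "J = radp 2 \<odot> radp 2"
  have nJ: "nzid J" unfolding J_def using nzid_iprod[OF nr nr] .
  have vJ: "v Q J = (if Q \<in> primes_above KK 2 then 2 else 0)" if "Q \<in> maxs" for Q
    unfolding J_def v_iprod[OF that nr nr] using v_radp[OF two that] by simp
  have rK: "radp 2 \<subseteq> KK" using radp_O[OF two] O_K by blast
  have invJ: "t ` J = J" if "t \<in> GG" for t unfolding J_def G_iprod[OF that rK rK] G_radp[OF two that] ..
  have vaa: "v Q (princ (a * a)) = 2 * v Q (princ a)" if "Q \<in> maxs" for Q
    using v_princ_mult[OF that a(2,2) a0(1,1)] by simp
  have naa: "nzid (princ (a * a))" using nzid_princ[OF O_mult[OF a(2,2)]] a0 by simp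
  have inv: "t ` princ (a * a) = princ (a * a)" if "t \<in> GG" for t
    using A0_invariant[OF subgroup.m_closed[OF subgroup_A0 a(1,1)] that] by simp
  obtain m n :: nat where mn: "m > 0" "n > 0" "(*) (of_nat m) ` princ (a * a) = (*) (of_nat n) ` J"
  proof (rule invariant_ratio[OF naa inv nJ invJ])
    fix p Q assume p: "Factorial_Ring.prime p" "Q \<in> primes_above KK p"
    have Qm: "Q \<in> maxs" using p primes_above_eq by blast
    show "v Q (princ (a * a)) mod e p = v Q J mod e p"
    proof (cases "p = 2")
      case True
      hence Q: "Q \<in> primes_above KK 2" using p by simp
      have "odd (v Q (princ a))" using A0_not_A2(2)[OF a Q] .
      moreover have "odd j \<Longrightarrow> 2 * j mod 4 = 2" for j :: nat by presburger
      ultimately have "2 * v Q (princ a) mod 4 = 2" by blast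
      thus ?thesis using vaa[OF Qm] vJ[OF Qm] Q True e2 by simp
    next
      case False
      hence "Q \<notin> primes_above KK 2" using primes_above_unique[OF p(1) two p(2)] by blast
      thus ?thesis using vaa[OF Qm] vJ[OF Qm] e_cases[OF p(1) False] by auto
    qed
  qed auto
  define c where "c = (of_nat m / of_nat n :: complex)"
  have c: "c \<in> \<rat>" "c \<noteq> 0" using mn by (simp_all add: c_def)
  have "(*) (inverse (of_nat n)) ` (*) (of_nat n) ` J = (*) (inverse (of_nat n)) ` (*) (of_nat m) ` princ (a * a)"
    using mn(3) by simp
  hence "J = (*) (inverse (of_nat n) * of_nat m) ` princ (a * a)" using mn(2) unfolding scale_scale by simp
  hence J: "J = princ (c * (a * a))" unfolding princ_def scale_scale c_def by (simp add: divide_inverse mult_ac)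
  define x where "x i = c * (a * \<sigma> i a)" for i
  have sa: "\<sigma> i a \<in> KK" "\<sigma> i a \<noteq> 0" if "i \<in> {1, 2, 3}" for i using \<sigma>_K[OF that a0(2)] \<sigma>_nz[OF that a0(1)] by auto
  have px: "princ (x i) = J" if i: "i \<in> {1, 2, 3}" for i
  proof -
    have "x i / (c * (a * a)) = \<sigma> i a / a" unfolding x_def using c(2) a0(1) by simp
    moreover have "\<sigma> i a / a \<in> U" using a(1) \<sigma>_GG'[OF i] by (simp add: A0_def)
    moreover have "x i \<noteq> 0" "c * (a * a) \<noteq> 0" unfolding x_def using c(2) a0(1) sa[OF i] by simp_all
    ultimately show ?thesis unfolding J using princ_eq_iff[of "x i" "c * (a * a)"] by simp
  qed
  have xO: "x i \<in> \<O>" if i: "i \<in> {1, 2, 3}" for i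
    using px[OF i] princ_self[of "x i"] isidD(1)[OF nzidD[OF nJ]] by blast
  have sx: "\<sigma> j (x i) = c * (\<sigma> j a * \<sigma> j (\<sigma> i a))" if i: "i \<in> {1, 2, 3}" and j: "j \<in> {1, 2, 3}" for i j
    unfolding x_def \<sigma>_mult[OF j K_Rats[OF c(1)] K_mult[OF a0(2) sa(1)[OF i]]] \<sigma>_mult[OF j a0(2) sa(1)[OF i]] \<sigma>_Rats[OF j c(1)] ..
  have fx: "\<sigma> i (x i) = x i" if i: "i \<in> {1, 2, 3}" for i
    unfolding sx[OF i i] \<sigma>_\<sigma>(1)[OF i] unfolding x_def by (simp only: mult_ac)
  \<comment> \<open>The common norm of the \<open>x i\<close>: each of the four conjugates of
    \<open>a\<close> occurs once in it. It generates \<open>J \<odot> J\<close>, which has the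
    valuations of 2, and a rational unit is 1 or -1.\<close>
  define z where "z = c * c * N a"
  have nmx: "nm i (x i) = z" if i: "i \<in> {1, 2, 3}" for i
  proof -
    have 1: "nm i (x i) = c * (a * \<sigma> i a) * (c * (\<sigma> (nx i) a * \<sigma> (nx i) (\<sigma> i a)))"
      unfolding nm_def sx[OF i nx(1)[OF i]] by (simp only: x_def)
    have 2: "\<sigma> 2 (\<sigma> 1 a) = \<sigma> 3 a" "\<sigma> 3 (\<sigma> 2 a) = \<sigma> 1 a" "\<sigma> 1 (\<sigma> 3 a) = \<sigma> 2 a"
      by (rule \<sigma>_\<sigma>(2); force)+
    have n: "nx 1 = 2" "nx 2 = 3" "nx 3 = 1" by (simp_all add: nx_def)
    consider "i = 1" | "i = 2" | "i = 3" using i by blast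
    thus ?thesis
    proof cases
      case 1 show ?thesis using \<open>nm i (x i) = _\<close> unfolding 1 n 2 z_def N_expand by (simp only: mult_ac)
    next
      case 2 show ?thesis using \<open>nm i (x i) = _\<close> unfolding \<open>i = 2\<close> n \<open>\<sigma> 3 (\<sigma> 2 a) = \<sigma> 1 a\<close> z_def N_expand by (simp only: mult_ac)
    next
      case 3 show ?thesis using \<open>nm i (x i) = _\<close> unfolding 3 n 2 z_def N_expand by (simp only: mult_ac)
    qed
  qed
  have i1: "(1::nat) \<in> {1, 2, 3}" by simp
  have zx: "z = x 1 * \<sigma> (nx 1) (x 1)" using nmx[OF i1] by (simp add: nm_def)
  have "princ (\<sigma> (nx 1) (x 1)) = J"
    using G_princ[OF \<sigma>_GG'[OF nx(1)[OF i1]] O_K[OF xO[OF i1]]] px[OF i1] invJ[OF \<sigma>_GG'[OF nx(1)[OF i1]]] by simp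
  hence pz: "princ z = J \<odot> J" unfolding zx princ_mult'[symmetric] px[OF i1] by simp
  have z0: "z \<noteq> 0" unfolding z_def using c(2) N_eq_0_iff a0(1) by simp
  have "princ z = princ (of_nat 2)"
  proof (rule ideal_eq_of_v_eq)
    show "nzid (princ z)" unfolding pz using nzid_iprod[OF nJ nJ] .
    show "nzid (princ (of_nat 2))" by (rule nzid_princ[OF O_of_nat]) simp
    fix Q assume Q: "Q \<in> maxs"
    obtain l where l: "Factorial_Ring.prime l" "Q \<in> primes_above KK l" using maxs_above[OF Q] .
    show "v Q (princ z) = v Q (princ (of_nat 2))"
    proof (cases "Q \<in> primes_above KK 2")
      case True
      thus ?thesis unfolding pz v_iprod[OF Q nJ nJ] vJ[OF Q] using e_eq[OF two True] e2 by simp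
    next
      case False
      hence "l \<noteq> 2" using l by blast
      hence "\<not> l dvd 2" using primes_dvd_imp_eq[OF l(1) two] by blast
      thus ?thesis unfolding pz v_iprod[OF Q nJ nJ] vJ[OF Q] using v_of_nat_coprime[OF l \<open>\<not> l dvd 2\<close>] False by simp
    qed
  qed
  hence "z / of_nat 2 \<in> U" using princ_eq_iff[OF z0, of "of_nat 2"] by simp
  moreover have "z \<in> \<rat>" unfolding z_def using c N_K[OF a0(2)] by (intro Rats_mult)
  hence "z / of_nat 2 \<in> \<rat>" by (intro Rats_divide) simp_all
  ultimately have "z / of_nat 2 = 1 \<or> z / of_nat 2 = - 1" by (rule Rats_unit)
  hence "z = 2 \<or> z = - 2" by auto
  moreover have "\<forall>i\<in>{1, 2, 3}. \<exists>y. y \<in> \<O> \<and> \<sigma> i y = y \<and> nm i y = z"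
  proof
    fix i :: nat assume i: "i \<in> {1, 2, 3}"
    show "\<exists>y. y \<in> \<O> \<and> \<sigma> i y = y \<and> nm i y = z"
      by (rule exI[of _ "x i"]) (intro conjI xO[OF i] fx[OF i] nmx[OF i])
  qed
  ultimately show hyp unfolding hyp_iff using e2 by (intro conjI exI[of _ z])
qed

text \<open>Each \<open>x i\<close> has valuation 2 at the only prime above 2 and 0 elsewhere, so
  the factors \<open>x i * x k / n\<close> coming from Hilbert's theorem 90 are units and
  \<open>a\<close> lies in \<open>A0\<close>. If \<open>a\<close> were in \<open>A2\<close>, the
  product of the three \<open>x i\<close> would be a rational integer times a unit, but its
  valuation 6 is not a multiple of 4.\<close>

lemma hyp_A0_not_A2:
  assumes hyp
  obtains a where "a \<in> A0" "a \<notin> A2"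
proof -
  have two: "Factorial_Ring.prime (2::nat)" by (rule two_is_prime_nat)
  obtain n where e2: "e 2 = 4" and n2: "n = 2 \<or> n = - 2"
    and ex: "\<forall>i\<in>{1, 2, 3}. \<exists>x. x \<in> \<O> \<and> \<sigma> i x = x \<and> nm i x = n" using assms unfolding hyp_iff by blast
  then obtain x where x: "\<And>i. i \<in> {1, 2, 3} \<Longrightarrow> x i \<in> \<O> \<and> \<sigma> i (x i) = x i \<and> nm i (x i) = n" by metis
  have n0: "n \<noteq> 0" "n \<in> \<rat>" using n2 by auto
  have pn: "princ n = princ (of_nat 2)"
  proof -
    have "n / of_nat 2 = 1 \<or> n / of_nat 2 = - 1" using n2 by auto
    hence "n / of_nat 2 \<in> U" using U_one U_uminus[OF U_one] by metis
    thus ?thesis using princ_eq_iff[OF n0(1), of "of_nat 2"] by simp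
  qed
  obtain P where P: "P \<in> primes_above KK 2" using primes_above_exists[OF two] .
  have Pm: "P \<in> maxs" using P primes_above_eq by blast
  have uniq: "Q = P" if "Q \<in> primes_above KK 2" for Q
    using totally_ramified_prime[OF two _ P] totally_ramified_prime[OF two _ that] e2 card_GG by simp
  have fixP: "t ` P = P" if "t \<in> GG" for t using uniq[OF primes_above_G[OF that P]] .
  have x0: "x i \<noteq> 0" if "i \<in> {1, 2, 3}" for i using x[OF that] n0(1) by (auto simp: nm_def)
  have sxO: "\<sigma> (nx i) (x i) \<in> \<O>" "\<sigma> (nx i) (x i) \<noteq> 0" if i: "i \<in> {1, 2, 3}" for i
    using G_O[OF \<sigma>_GG'[OF nx(1)[OF i]]] x[OF i] \<sigma>_nz[OF nx(1)[OF i] x0[OF i]] by blast+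
  have vn: "v Q (princ (x i)) + v Q (princ (\<sigma> (nx i) (x i))) = v Q (princ (of_nat 2))"
    if i: "i \<in> {1, 2, 3}" and Q: "Q \<in> maxs" for i Q
    using v_princ_mult[OF Q _ sxO(1)[OF i] x0[OF i] sxO(2)[OF i]] x[OF i] pn by (simp add: nm_def)
  \<comment> \<open>Every automorphism fixes \<open>P\<close>, so \<open>x i\<close> and its
    conjugate share equally in the valuation 4 of their product, which is 2 up to sign.\<close>
  have vx: "v Q (princ (x i)) = (if Q = P then 2 else 0)" if i: "i \<in> {1, 2, 3}" and Q: "Q \<in> maxs" for i Q
  proof (cases "Q = P")
    case True
    have "v P (princ (\<sigma> (nx i) (x i))) = v P (princ (x i))"
      using v_G_invariant[OF Pm \<sigma>_GG'[OF nx(1)[OF i]] fixP[OF \<sigma>_GG'[OF nx(1)[OF i]]]] x[OF i] x0[OF i] by blast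
    thus ?thesis using vn[OF i Pm] e_eq[OF two P] e2 True by simp
  next
    case False
    obtain l where l: "Factorial_Ring.prime l" "Q \<in> primes_above KK l" using maxs_above[OF Q] .
    have "l \<noteq> 2" using l uniq False by blast
    hence "\<not> l dvd 2" using primes_dvd_imp_eq[OF l(1) two] by blast
    thus ?thesis using vn[OF i Q] v_of_nat_coprime[OF l \<open>\<not> l dvd 2\<close>] False by simp
  qed
  have j: "(1::nat) \<in> {1, 2, 3}" "(2::nat) \<in> {1, 2, 3}" "(3::nat) \<in> {1, 2, 3}" by simp_all
  have kx: "x i \<in> kk i" if "i \<in> {1, 2, 3}" for i using x[OF that] O_K by (simp add: kk_def)
  have nmx: "nm i (x i) = n" if "i \<in> {1, 2, 3}" for i using x[OF that] by blast
  obtain a y1 y2 y3 where a: "a \<in> KK" "a \<noteq> 0" and y: "y1 \<in> {x 1, - x 1}" "y2 \<in> {x 2, - x 2}" "y3 \<in> {x 3, - x 3}"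
    and sa: "\<sigma> 1 a = a * (y2 * y3 / n)" "\<sigma> 2 a = a * (y1 * y3 / n)" "\<sigma> 3 a = a * (y1 * y2 / n)"
    and aR: "a * a * (x 1 * x 2 * x 3) \<in> \<rat>"
    using hilbert_90[OF kx[OF j(1)] kx[OF j(2)] kx[OF j(3)] n0(2,1) nmx[OF j(1)] nmx[OF j(2)] nmx[OF j(3)]] by metis
  have xu: "x i * x k / n \<in> U" if i: "i \<in> {1, 2, 3}" and k: "k \<in> {1, 2, 3}" for i k
  proof -
    have xx: "x i * x k \<in> \<O>" "x i * x k \<noteq> 0" using x[OF i] x[OF k] O_mult x0[OF i] x0[OF k] by simp_all
    have "princ (x i * x k) = princ (of_nat 2)"
    proof (rule ideal_eq_of_v_eq[OF nzid_princ[OF xx] nzid_princ[OF O_of_nat]])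
      show "of_nat 2 \<noteq> (0 :: complex)" by simp
      fix Q assume Q: "Q \<in> maxs"
      have "v Q (princ (x i * x k)) = v Q (princ (x i)) + v Q (princ (x i))"
        using v_princ_mult[OF Q _ _ x0[OF i] x0[OF k]] x[OF i] x[OF k] vx[OF i Q] vx[OF k Q] by simp
      moreover have "v Q (princ (\<sigma> (nx i) (x i))) = v Q (princ (x i))"
      proof (cases "Q = P")
        case True
        thus ?thesis using v_G_invariant[OF Pm \<sigma>_GG'[OF nx(1)[OF i]] fixP[OF \<sigma>_GG'[OF nx(1)[OF i]]]] x[OF i] x0[OF i] by blast
      next
        case False
        obtain l where l: "Factorial_Ring.prime l" "Q \<in> primes_above KK l" using maxs_above[OF Q] .
        have "l \<noteq> 2" using l uniq False by blast
        hence "\<not> l dvd 2" using primes_dvd_imp_eq[OF l(1) two] by blast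
        thus ?thesis using vn[OF i Q] v_of_nat_coprime[OF l \<open>\<not> l dvd 2\<close>] by simp
      qed
      ultimately show "v Q (princ (x i * x k)) = v Q (princ (of_nat 2))" using vn[OF i Q] by simp
    qed
    hence "princ (x i * x k) = princ n" using pn by simp
    thus ?thesis using princ_eq_iff[OF xx(2) n0(1)] by blast
  qed
  have yu: "y * y' / n \<in> U" if "y \<in> {x i, - x i}" "y' \<in> {x k, - x k}" "i \<in> {1, 2, 3}" "k \<in> {1, 2, 3}" for i k y y'
  proof -
    have "y * y' / n = x i * x k / n \<or> y * y' / n = - (x i * x k / n)" using that(1,2) by auto
    thus ?thesis using xu[OF that(3,4)] U_uminus[OF xu[OF that(3,4)]] by metis
  qed
  have q: "\<sigma> 1 a / a \<in> U" "\<sigma> 2 a / a \<in> U" "\<sigma> 3 a / a \<in> U"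
    using sa a(2) yu[OF y(2,3) j(2,3)] yu[OF y(1,3) j(1,3)] yu[OF y(1,2) j(1,2)] by simp_all
  have "t a / a \<in> U" if "t \<in> GG" for t using that q a(2) unfolding GG_def by auto
  hence aA: "a \<in> A0" using a by (simp add: A0_def)
  have "a \<notin> A2"
  proof
    assume "a \<in> A2"
    then obtain u qq where u: "u \<in> U" "qq \<in> \<rat>" "a * a * u = qq" unfolding A2_def by blast
    define w where "w = x 1 * x 2 * x 3"
    have wO: "w \<in> \<O>" "w \<noteq> 0" unfolding w_def using x[OF j(1)] x[OF j(2)] x[OF j(3)] x0[OF j(1)] x0[OF j(2)] x0[OF j(3)] O_mult by simp_all
    \<comment> \<open>A quotient of two rational numbers that is also integral, so \<open>w\<close>
      is a rational integer times the unit \<open>u\<close>.\<close>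
    have "w / u = (a * a * w) / (a * a * u)" using a(2) by simp
    hence "w / u \<in> \<rat>" using aR u(2,3) unfolding w_def by (metis Rats_divide)
    moreover have "w / u \<in> \<O>" using O_mult[OF wO(1) U_O[OF U_inverse[OF u(1)]]] by (simp add: divide_inverse)
    ultimately have "w / u \<in> \<int>" using O_Rats by blast
    then obtain m where m: "w / u = of_int m" unfolding Ints_def by blast
    have u0: "u \<noteq> 0" using U_nonzero[OF u(1)] .
    have "m \<noteq> 0" using m wO(2) u0 by auto
    have "w / (w / u) = u" using wO(2) by simp
    hence "princ w = princ (w / u)" using princ_eq_iff[OF wO(2), of "w / u"] wO(2) u0 u(1) by simp
    hence w: "princ w = princ (of_nat (nat \<bar>m\<bar>))" unfolding m princ_of_int .
    have "nat \<bar>m\<bar> > 0" using \<open>m \<noteq> 0\<close> by simp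
    hence "v P (princ w) = 4 * multiplicity 2 (nat \<bar>m\<bar>)" unfolding w e2[symmetric] by (rule v_of_nat[OF two P])
    moreover have "v P (princ w) = 6"
    proof -
      have "x 1 * x 2 \<in> \<O>" "x 1 * x 2 \<noteq> 0" using x[OF j(1)] x[OF j(2)] x0[OF j(1)] x0[OF j(2)] O_mult by simp_all
      hence "v P (princ w) = v P (princ (x 1 * x 2)) + v P (princ (x 3))"
        unfolding w_def using v_princ_mult[OF Pm _ _ _ x0[OF j(3)]] x[OF j(3)] by blast
      moreover have "v P (princ (x 1 * x 2)) = v P (princ (x 1)) + v P (princ (x 2))"
        using v_princ_mult[OF Pm _ _ x0[OF j(1)] x0[OF j(2)]] x[OF j(1)] x[OF j(2)] by blast
      ultimately show ?thesis using vx[OF j(1) Pm] vx[OF j(2) Pm] vx[OF j(3) Pm] by simp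
    qed
    ultimately have "4 * multiplicity 2 (nat \<bar>m\<bar>) = 6" by simp
    moreover have "4 * j \<noteq> 6" for j :: nat by presburger
    ultimately show False by blast
  qed
  thus ?thesis using that aA by blast
qed

text \<open>A positive integer makes \<open>a\<close> integral; belonging to both groups, it leaves
  membership in \<open>A0\<close> and \<open>A2\<close> unchanged.\<close>

lemma A0_not_A2_scale:
  assumes a: "a \<in> A0" "a \<notin> A2"
  obtains n :: nat where "n > 0" "of_nat n * a \<in> A0" "of_nat n * a \<in> \<O>" "of_nat n * a \<notin> A2" "(of_nat n :: complex) \<in> A2"
proof -
  obtain n :: nat where n: "n > 0" "algebraic_int (of_nat n * a)" using K_frac[OF A0_K[OF a(1)]] by blast
  have n0: "(of_nat n :: complex) \<noteq> 0" using n(1) by simp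
  have "(of_nat n :: complex) = of_nat n * 1" by simp
  hence "(of_nat n :: complex) \<in> QU" unfolding QU_def using n0 U_one Rats_of_nat by blast
  hence nA: "(of_nat n :: complex) \<in> A2" "(of_nat n :: complex) \<in> A0" using QU_A2 QU_A0 by blast+
  have "of_nat n * a \<notin> A2"
  proof
    assume h: "of_nat n * a \<in> A2"
    have "inverse (of_nat n) \<in> A2" using subgroup.m_inv_closed[OF subgroup_A2 nA(1)] inv_cmul[OF n0] by simp
    hence "inverse (of_nat n) * (of_nat n * a) \<in> A2" using subgroup.m_closed[OF subgroup_A2 _ h] by simp
    thus False using a(2) n0 by (simp add: mult.assoc[symmetric])
  qed
  moreover have "of_nat n * a \<in> A0" using subgroup.m_closed[OF subgroup_A0 nA(2) a(1)] by simp
  moreover have "of_nat n * a \<in> \<O>" using n(2) K_mult[OF K_of_nat A0_K[OF a(1)]] by (simp add: \<O>_def)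
  ultimately show ?thesis using that n(1) nA(1) by blast
qed

text \<open>After scaling to integral elements, the valuation above 2 is odd outside
  \<open>A2\<close>, while the product of two such elements has an even one.\<close>

lemma A0_not_A2_mult:
  assumes a: "a \<in> A0" "a \<notin> A2" and b: "b \<in> A0" "b \<notin> A2"
  shows "a * b \<in> A2"
proof (rule ccontr)
  assume neg: "a * b \<notin> A2"
  obtain P where P: "P \<in> primes_above KK 2" using primes_above_exists[OF two_is_prime_nat] .
  have Pm: "P \<in> maxs" using P primes_above_eq by blast
  obtain n :: nat where n: "n > 0" "of_nat n * a \<in> A0" "of_nat n * a \<in> \<O>" "of_nat n * a \<notin> A2" "(of_nat n :: complex) \<in> A2"
    using A0_not_A2_scale[OF a] .
  obtain m :: nat where m: "m > 0" "of_nat m * b \<in> A0" "of_nat m * b \<in> \<O>" "of_nat m * b \<notin> A2" "(of_nat m :: complex) \<in> A2"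
    using A0_not_A2_scale[OF b] .
  define c where "c = (of_nat n * a) * (of_nat m * b)"
  have c: "c \<in> A0" "c \<in> \<O>" unfolding c_def using subgroup.m_closed[OF subgroup_A0 n(2) m(2)] O_mult[OF n(3) m(3)] by simp_all
  have k: "(of_nat n * of_nat m :: complex) \<in> A2" using subgroup.m_closed[OF subgroup_A2 n(5) m(5)] by simp
  have k0: "(of_nat n * of_nat m :: complex) \<noteq> 0" using n(1) m(1) by simp
  have "c \<notin> A2"
  proof
    assume h: "c \<in> A2"
    have "inverse (of_nat n * of_nat m) \<in> A2" using subgroup.m_inv_closed[OF subgroup_A2 k] inv_cmul[OF k0] by simp
    hence "inverse (of_nat n * of_nat m) * c \<in> A2" using subgroup.m_closed[OF subgroup_A2 _ h] by simp
    moreover have "inverse (of_nat n * of_nat m) * c = a * b"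
    proof -
      have "c = (of_nat n * of_nat m) * (a * b)" unfolding c_def by (simp only: mult_ac)
      thus ?thesis using k0 by (metis left_inverse mult.assoc mult_1_left)
    qed
    ultimately show False using neg by simp
  qed
  hence "odd (v P (princ c))" using A0_not_A2(2)[OF c _ P] by blast
  moreover have "odd (v P (princ (of_nat n * a)))" "odd (v P (princ (of_nat m * b)))"
    using A0_not_A2(2)[OF n(2-4) P] A0_not_A2(2)[OF m(2-4) P] by blast+
  moreover have "v P (princ c) = v P (princ (of_nat n * a)) + v P (princ (of_nat m * b))"
    unfolding c_def using v_princ_mult[OF Pm n(3) m(3) A0_nonzero[OF n(2)] A0_nonzero[OF m(2)]] .
  ultimately show False by simp
qed

text \<open>A product of two elements outside \<open>A2\<close> falls into \<open>A2\<close>, so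
  membership in \<open>A2\<close> separates the cosets: there are two of them if \<open>A0\<close>
  has an element outside \<open>A2\<close>, and one otherwise.\<close>

lemma idx_A0_A2: "idx cmul A0 A2 = (if hyp then 2 else 1)"
proof -
  have one: "1 \<in> A2" "1 \<in> A0" using subgroup.one_closed[OF subgroup_A2] subgroup.one_closed[OF subgroup_A0] by simp_all
  have "idx cmul A0 A2 = card ((\<lambda>x. x \<in> A2) ` A0)"
  proof (rule cmul.idx_cong[OF subgroup_A2])
    show "A0 \<subseteq> carrier cmul" using A0_nonzero by auto
    fix x y assume x: "x \<in> A0" and y: "y \<in> A0"
    have y0: "y \<noteq> 0" using A0_nonzero[OF y] .
    have inv: "inv\<^bsub>cmul\<^esub> y = inverse y" using inv_cmul[OF y0] .
    have yA: "inverse y \<in> A0" using subgroup.m_inv_closed[OF subgroup_A0 y] inv by simp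
    have yiff: "inverse y \<in> A2 \<longleftrightarrow> y \<in> A2"
      using subgroup.m_inv_closed[OF subgroup_A2, of y] subgroup.m_inv_closed[OF subgroup_A2, of "inverse y"]
        inv inv_cmul[of "inverse y"] y0 by auto
    show "x \<otimes>\<^bsub>cmul\<^esub> inv\<^bsub>cmul\<^esub> y \<in> A2 \<longleftrightarrow> (x \<in> A2) = (y \<in> A2)"
    proof (cases "y \<in> A2")
      case True
      have "x * inverse y \<in> A2 \<longleftrightarrow> x \<in> A2"
      proof
        assume "x * inverse y \<in> A2"
        hence "(x * inverse y) * y \<in> A2" using subgroup.m_closed[OF subgroup_A2 _ True] by simp
        moreover have "(x * inverse y) * y = x" using y0 by simp
        ultimately show "x \<in> A2" by (simp only:)
      next
        assume "x \<in> A2"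
        thus "x * inverse y \<in> A2" using subgroup.m_closed[OF subgroup_A2, of x "inverse y"] True yiff by simp
      qed
      thus ?thesis using inv True by simp
    next
      case False
      hence yn: "inverse y \<notin> A2" using yiff by blast
      have "x * inverse y \<in> A2 \<longleftrightarrow> x \<notin> A2"
      proof
        assume h: "x * inverse y \<in> A2"
        show "x \<notin> A2"
        proof
          assume "x \<in> A2"
          hence "inverse x \<in> A2" "x \<noteq> 0"
            using subgroup.m_inv_closed[OF subgroup_A2, of x] inv_cmul[of x] A0_nonzero[OF x] by auto
          moreover from this have "inverse x * (x * inverse y) \<in> A2" using subgroup.m_closed[OF subgroup_A2 _ h] by simp
          ultimately have "inverse y \<in> A2" by (simp add: mult.assoc[symmetric])
          thus False using yn by blast
        qed
      next
        assume "x \<notin> A2"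
        thus "x * inverse y \<in> A2" using A0_not_A2_mult[OF x _ yA yn] by blast
      qed
      thus ?thesis using inv False by simp
    qed
  qed
  also have "(\<lambda>x. x \<in> A2) ` A0 = (if hyp then {True, False} else {True})"
  proof (cases hyp)
    case True
    then obtain a where "a \<in> A0" "a \<notin> A2" using hyp_A0_not_A2 by blast
    hence "True \<in> (\<lambda>x. x \<in> A2) ` A0" "False \<in> (\<lambda>x. x \<in> A2) ` A0" using one by auto
    thus ?thesis using True by (auto simp: UNIV_bool[symmetric])
  next
    case False
    have "a \<in> A2" if a: "a \<in> A0" for a
    proof (rule ccontr)
      assume "a \<notin> A2"
      then obtain n :: nat where "of_nat n * a \<in> A0" "of_nat n * a \<in> \<O>" "of_nat n * a \<notin> A2"
        using A0_not_A2_scale[OF a] by metis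
      thus False using A0_not_A2_hyp False by blast
    qed
    thus ?thesis using False one by auto
  qed
  finally show ?thesis by (cases hyp) simp_all
qed

end

section \<open>From the hypotheses of the theorem to the biquadratic setting\<close>

lemma squarefree_pos: "squarefree (n :: nat) \<Longrightarrow> n > 0"
  by (rule ccontr) simp

lemma squarefree_multiplicity_le_1:
  fixes n :: nat
  assumes "squarefree n" "Factorial_Ring.prime p"
  shows "multiplicity p n \<le> 1"
  using squarefree_factorial_semiring''[of n] squarefree_pos[OF assms(1)] assms by blast

text \<open>If \<open>c\<close> is squarefree too, this says that every prime divides an even number
  of \<open>a\<close>, \<open>b\<close>, \<open>c\<close>.\<close>

lemma multiplicity_squarefree_product:
  fixes a b :: nat
  assumes a: "squarefree a" and b: "squarefree b" and h: "a * b = c * h\<^sup>2" and p: "Factorial_Ring.prime p"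
  shows "multiplicity p a + multiplicity p b = multiplicity p c + 2 * multiplicity p h"
proof -
  have ab: "a \<noteq> 0" "b \<noteq> 0" using squarefree_pos[OF a] squarefree_pos[OF b] by simp_all
  hence "c * h\<^sup>2 \<noteq> 0" unfolding h[symmetric] by simp
  hence nz: "a \<noteq> 0" "b \<noteq> 0" "c \<noteq> 0" "h \<noteq> 0" using ab by simp_all
  have pe: "prime_elem p" using p by simp
  have "multiplicity p (a * b) = multiplicity p (c * h\<^sup>2)" using h by simp
  thus ?thesis using nz prime_elem_multiplicity_mult_distrib[OF pe] prime_elem_multiplicity_power_distrib[OF pe] by simp
qed

text \<open>A prime divides an even number of \<open>d 1\<close>, \<open>d 2\<close>,
  \<open>d 3\<close>. So \<open>d 3 = 1\<close> would force \<open>d 1 = d 2\<close>, and no prime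
  divides all three.\<close>

lemma biquad_of_squarefree:
  fixes d :: "nat \<Rightarrow> nat"
  assumes d1: "squarefree (d 1)" "d 1 \<noteq> 1" and d2: "squarefree (d 2)" "d 2 \<noteq> 1"
    and neq: "d 1 \<noteq> d 2" and d3: "d 3 = squarefree_part (d 1 * d 2)"
  obtains r where "biquad d r"
proof -
  define h where "h = square_part (d 1 * d 2)"
  have h: "d 1 * d 2 = d 3 * h\<^sup>2" unfolding d3 h_def using squarefree_decompose[of "d 1 * d 2"] by simp
  have pos: "d 1 > 0" "d 2 > 0" using squarefree_pos d1 d2 by auto
  hence "d 1 * d 2 \<noteq> 0" by simp
  hence h0: "h > 0" "d 3 > 0" using h by (auto intro!: Nat.gr0I)
  have d3s: "squarefree (d 3)" unfolding d3 by (rule squarefree_squarefree_part)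
  have m: "multiplicity p (d 1) + multiplicity p (d 2) = multiplicity p (d 3) + 2 * multiplicity p h"
    if "Factorial_Ring.prime p" for p by (rule multiplicity_squarefree_product[OF d1(1) d2(1) h that])
  have le: "multiplicity p (d 1) \<le> 1" "multiplicity p (d 2) \<le> 1" if "Factorial_Ring.prime p" for p
    using squarefree_multiplicity_le_1 d1 d2 that by auto
  have d31: "d 3 \<noteq> 1"
  proof
    assume one: "d 3 = 1"
    have "multiplicity p (d 1) = multiplicity p (d 2)" if "Factorial_Ring.prime p" for p
    proof -
      have "multiplicity p (d 1) + multiplicity p (d 2) = 2 * multiplicity p h" using m[OF that] one by simp
      thus ?thesis using le[OF that] by presburger
    qed
    hence "d 1 = d 2" using multiplicity_eq_nat[OF pos] by blast
    thus False using neq by blast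
  qed
  have rr: "csq (d 1) * csq (d 2) = of_nat h * csq (d 3)"
  proof -
    have "sqrt (real (d 1)) * sqrt (real (d 2)) = sqrt (real (d 1 * d 2))" by (simp add: real_sqrt_mult)
    also have "\<dots> = real h * sqrt (real (d 3))" unfolding h by (simp add: real_sqrt_mult)
    finally have "of_real (sqrt (real (d 1)) * sqrt (real (d 2))) = (of_real (real h * sqrt (real (d 3))) :: complex)" by (rule arg_cong)
    thus ?thesis unfolding csq_def by simp
  qed
  \<comment> \<open>From \<open>\<surd>d1 \<surd>d2 = h \<surd>d3\<close>: multiplying by one of the
    roots on the left and dividing by \<open>h\<close> gives the other two factors.\<close>
  define r where "r = (\<lambda>i :: nat. if i = 1 then of_nat (d 2) / of_nat h else if i = 2 then of_nat (d 1) / of_nat h else of_nat h :: complex)"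
  have hz: "(of_nat h :: complex) \<noteq> 0" using h0 by simp
  have c3: "csq (d 3) = csq (d 1) * csq (d 2) / of_nat h" using rr hz by (simp add: field_simps)
  have "biquad d r"
  proof
    show "squarefree (d i)" if "i \<in> {1, 2, 3}" for i using that d1 d2 d3s by auto
    show "d i > 1" if "i \<in> {1, 2, 3}" for i using that d1(2) d2(2) d31 pos h0(2) by auto
    show "r i \<in> \<rat>" if "i \<in> {1, 2, 3}" for i unfolding r_def by simp
    show "r i \<noteq> 0" if "i \<in> {1, 2, 3}" for i unfolding r_def using h0 pos by simp
    have "csq (d 2) * csq (d 3) = (csq (d 2) * csq (d 2)) / of_nat h * csq (d 1)" unfolding c3 by simp
    thus "csq (d 2) * csq (d 3) = r 1 * csq (d 1)" unfolding csq_square r_def by simp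
    have "csq (d 1) * csq (d 3) = (csq (d 1) * csq (d 1)) / of_nat h * csq (d 2)" unfolding c3 by simp
    thus "csq (d 1) * csq (d 3) = r 2 * csq (d 2)" unfolding csq_square r_def by simp
    show "csq (d 1) * csq (d 2) = r 3 * csq (d 3)" unfolding rr r_def by simp
    fix p :: nat assume p: "Factorial_Ring.prime p"
    show "\<exists>i\<in>{1, 2, 3}. \<not> p dvd d i"
    proof (rule ccontr)
      assume "\<not> ?thesis"
      hence dv: "p dvd d 1" "p dvd d 2" "p dvd d 3" by auto
      have "multiplicity p n \<ge> 1" if "p dvd n" "n > 0" for n
        using that p multiplicity_geI[of p n 1] by (simp add: not_prime_unit prime_multiplicity_gt_zero_iff Suc_le_eq)
      hence "multiplicity p (d 1) \<ge> 1" "multiplicity p (d 2) \<ge> 1" "multiplicity p (d 3) \<ge> 1" using dv pos h0 by auto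
      moreover have "multiplicity p (d 3) \<le> 1" by (rule squarefree_multiplicity_le_1[OF d3s p])
      ultimately have "multiplicity p (d 1) = 1" "multiplicity p (d 2) = 1" "multiplicity p (d 3) = 1" using le[OF p] by linarith+
      hence "1 + 1 = 1 + 2 * multiplicity p h" using m[OF p] by simp
      thus False by presburger
    qed
  qed
  thus ?thesis using that by blast
qed

context biquad
begin

text \<open>The order formula is multiplied by the unit index; through the tower over
  \<open>A2\<close>, the index formula then turns the unknown index of \<open>QU\<close> in
  \<open>A2\<close> into \<open>4 * card E\<close>.\<close>

lemma Polya_count:
  "card (Polya_group KK) * ((if hyp then 2 else 1) * (4 * card E)) = idx cmul U W *
     (\<Prod>p \<in> {p. Factorial_Ring.prime p \<and> int p dvd field_discriminant KK}. ramification_index KK p)"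
proof -
  have "QU \<subseteq> A2" using QU_A2 by blast
  hence t: "idx cmul A0 QU = idx cmul A0 A2 * idx cmul A2 QU"
    using cmul.idx_tower[OF subgroup_QU subgroup_A2 subgroup_A0 _ A2_A0] by blast
  have i: "idx cmul A2 QU * idx cmul U W = 4 * card E" using index_formula idx_V_sqs_W by simp
  have "card (Polya_group KK) * ((if hyp then 2 else 1) * (4 * card E)) =
      card (Polya_group KK) * (idx cmul A0 A2 * (idx cmul A2 QU * idx cmul U W))"
    unfolding idx_A0_A2 i ..
  also have "\<dots> = idx cmul U W * (card (Polya_group KK) * idx cmul A0 QU)" unfolding t by (simp only: mult_ac)
  finally show ?thesis unfolding card_Polya_formula .
qed

lemma n'_field_norm: "i \<in> {1, 2, 3} \<Longrightarrow> field_norm (kk i) (fundamental_unit (kk i)) = n' i"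
  using fundamental_unit_eq[of i] field_norm_kk[of i "eps i"] Ui_kk[OF eps_props(1)[of i]] by (simp add: n'_def nm_def)

end

theorem theorem2p2:
  fixes d :: "nat \<Rightarrow> nat" and K :: "complex set" and k :: "nat \<Rightarrow> complex set"
    and t hasse_index ram_prod :: nat and hyp_i :: bool
  assumes "0 < d 1" "squarefree (d 1)" "d 1 \<noteq> 1"
    and "0 < d 2" "squarefree (d 2)" "d 2 \<noteq> 1"
    and "d 1 \<noteq> d 2"
    and "d 3 = squarefree_part (d 1 * d 2)"
    and K: "K = rat_adjoin {complex_of_real (sqrt (real (d 1))), complex_of_real (sqrt (real (d 2)))}"
    and k: "\<And>i. k i = rat_adjoin {complex_of_real (sqrt (real (d i)))}"
    and t: "t = card {i \<in> {1, 2, 3}. field_norm (k i) (fundamental_unit (k i)) = -1}"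
    and hasse_index: "hasse_index = group_index (unit_group K)
          (generate (unit_group K)
             (\<Union>i \<in> {1, 2, 3}. carrier (unit_group (k i))))"
    and ram_prod: "ram_prod =
          (\<Prod>p \<in> {p. Factorial_Ring.prime p \<and> int p dvd field_discriminant K}. ramification_index K p)"
    and hyp_i: "hyp_i \<longleftrightarrow> totally_ramified K 2 \<and>
          ((\<forall>i \<in> {1, 2, 3}. \<exists>x \<in> carrier (ring_of_integers (k i)). field_norm (k i) x = 2) \<or>
           (\<forall>i \<in> {1, 2, 3}. \<exists>x \<in> carrier (ring_of_integers (k i)). field_norm (k i) x = -2))"
  shows "(hyp_i \<longrightarrow>
            (t \<in> {0, 1} \<longrightarrow>
               real (card (Polya_group K)) = real hasse_index * real ram_prod / 2 ^ (6 - t)) \<and>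
            (t \<in> {2, 3} \<longrightarrow>
               real (card (Polya_group K)) = real hasse_index * real ram_prod / 2 ^ 4)) \<and>
         (\<not> hyp_i \<longrightarrow>
            (t \<in> {0, 1} \<longrightarrow>
               real (card (Polya_group K)) = real hasse_index * real ram_prod / 2 ^ (5 - t)) \<and>
            (t \<in> {2, 3} \<longrightarrow>
               real (card (Polya_group K)) = real hasse_index * real ram_prod / 2 ^ 3))"
proof -
  obtain r where "biquad d r" using biquad_of_squarefree[OF assms(2,3,5,6,7,8)] .
  then interpret biquad d r .
  have K: "K = KK" unfolding K rat_adjoin_KK[symmetric] csq_def ..
  have k: "k i = kk i" if "i \<in> {1, 2, 3}" for i unfolding k rat_adjoin_kk[OF that, symmetric] csq_def ..
  have "{i \<in> {1, 2, 3}. field_norm (k i) (fundamental_unit (k i)) = - 1} = {i \<in> {1, 2, 3}. n' i = - 1}"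
    using k n'_field_norm by auto
  hence t: "t = card {i \<in> {1, 2, 3}. n' i = - 1}" using t by simp
  have "(\<Union>i\<in>{1, 2, 3}. carrier (unit_group (k i))) = (\<Union>i\<in>{1, 2, 3}. carrier (unit_group (kk i)))" using k by simp
  hence hasse: "hasse_index = idx cmul U W" unfolding hasse_index K using hasse_index_eq by simp
  have hyp: "hyp_i \<longleftrightarrow> hyp" unfolding hyp_i hyp_def K using k by simp
  have "real (card (Polya_group K) * ((if hyp_i then 2 else 1) * (4 * card E))) = real (hasse_index * ram_prod)"
    unfolding hyp hasse ram_prod K Polya_count ..
  hence main: "real (card (Polya_group K)) * ((if hyp_i then 2 else 1) * (4 * real (card E))) = real hasse_index * real ram_prod"
    by (cases hyp_i) simp_all
  \<comment> \<open>Thus \<open>4 * card E\<close> is 32, 16 or 8, that is,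
    \<open>2 ^ (5 - t)\<close> for \<open>t\<close> up to 1 and \<open>2 ^ 3\<close> beyond. Under
    \<open>hyp_i\<close> the index of \<open>A2\<close> in \<open>A0\<close> contributes one more
    factor 2.\<close>
  have E0: "t = 0 \<Longrightarrow> card E = 8" and E1: "t = 1 \<Longrightarrow> card E = 4" and E2: "t \<in> {2, 3} \<Longrightarrow> card E = 2"
    unfolding card_E t[symmetric] by (auto split: nat.split)
  show ?thesis
  proof (intro conjI impI)
    assume h: "hyp_i" "t \<in> {0, 1}"
    thus "real (card (Polya_group K)) = real hasse_index * real ram_prod / 2 ^ (6 - t)"
      using main E0 E1 by (auto simp: field_simps)
  next
    assume h: "hyp_i" "t \<in> {2, 3}"
    show "real (card (Polya_group K)) = real hasse_index * real ram_prod / 2 ^ 4"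
      using main E2[OF h(2)] h(1) by simp
  next
    assume h: "\<not> hyp_i" "t \<in> {0, 1}"
    thus "real (card (Polya_group K)) = real hasse_index * real ram_prod / 2 ^ (5 - t)"
      using main E0 E1 by (auto simp: field_simps)
  next
    assume h: "\<not> hyp_i" "t \<in> {2, 3}"
    show "real (card (Polya_group K)) = real hasse_index * real ram_prod / 2 ^ 3"
      using main E2[OF h(2)] h(1) by simp
  qed
qed

end
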